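(* Let $n\ge2$ and let $\{g_1^{ij}(x)\}$, $\{g_2^{ij}(x)\}$ be symmetric real $n\times n$ matrix valued functions on $\mathbb{R}^n$ such that for $k=1,2$ and constants $\lambda\in(0,1]$, $\Lambda>0$, $\Lambda_1>0$, $$\lambda|\xi|^2\le\sum_{i,j}g_k^{ij}(x)\xi_i\xi_j\le\lambda^{-1}|\xi|^2,\quad \sum_{i,j}|g_k^{ij}(x)-g_k^{ij}(y)|\le\Lambda|x-y|,\quad \sum_{i,j}\|\nabla^2g_k^{ij}\|_{L^\infty(\mathbb{R}^n)}\le\Lambda_1$$ for all $x,y,\xi\in\mathbb{R}^n$. Let $L_ku=\sum_{i,j}g_k^{ij}(x)\partial^2_{ij}u$ and $\mathcal{L}u=L_2(L_1u)$. Let $\nu_*$ and $\nu^*$ (respectively $\mu_*$ and $\mu^*$) be the minimum and the maximum eigenvalues of $\{g_1^{ij}(0)\}$ (respectively $\{g_2^{ij}(0)\}$). Then there exists a symmetric matrix $\Gamma_0$ satisfying $$\lambda^2|x|^2\le\sigma_0^2(x):=\Gamma_0x\cdot x\le\lambda^{-2}|x|^2\qquad(x\in\mathbb{R}^n)$$ and such that, if $\beta>\sqrt{\frac{\mu^*\nu^*}{\mu_*\nu_*}}-1$ and $w_0(x)=e^{-(\sigma_0(x))^{-\beta}}$, the following inequality holds true: $$\sum_{k=0}^3\tau^{6-2k}\int\sigma_0^{-\beta-2+k(2\beta+2)}w_0^{-2\tau}|\nabla^ku|^2\,dx\le C\int\sigma_0^{5\beta+6}w_0^{-2\tau}|\mathcal{L}u|^2\,dx$$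 for every $u\in C_0^\infty(B^{\sigma_0}_{r_1}\setminus\{0\})$ and for every $\tau\ge\overline\tau$, where $r_1$, $0<r_1<1$, $C$ and $\overline\tau$ only depend on $\lambda$, $\Lambda$ and $\Lambda_1$.
   Context: $B_r^{\sigma_0}=\{x\in\mathbb{R}^n:\sigma_0(x)<r\}$; $u\in C_0^\infty(B_r^{\sigma_0}\setminus\{0\})$ means $u\in C_0^\infty(\mathbb{R}^n\setminus\{0\})$ with support in $B_r^{\sigma_0}\setminus\{0\}$. $\nabla^ku$ is the vector of all $k$-th order partial derivatives of $u$. Integrals are over $\mathbb{R}^n$; $|\cdot|$ and $\cdot$ are the Euclidean norm and scalar product.
   Formalization: r_1, C and τ̄ may also depend on n, on β and on a positive lower bound δ for β minus the threshold; with λ, Λ, Λ_1 alone the claim fails (identity coefficients, u and τ fixed, β→0: the weight w_0^{-2τ} becomes constant and cancels). *)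

theory Defs
  imports "HOL-Analysis.Analysis" "HOL-Probability.Essential_Supremum"
begin

section \<open>Classical derivatives and test functions\<close>

definition partial_deriv :: "'n::finite \<Rightarrow> (real^'n \<Rightarrow> real) \<Rightarrow> real^'n \<Rightarrow> real" where
  "partial_deriv i f x = deriv (\<lambda>t. f (x + t *\<^sub>R axis i 1)) 0"

fun iter_partial :: "'n::finite list \<Rightarrow> (real^'n \<Rightarrow> real) \<Rightarrow> real^'n \<Rightarrow> real" where
  "iter_partial [] f = f"
| "iter_partial (i # is) f = partial_deriv i (iter_partial is f)"

text \<open>Frechet differentiability of all iterated partial derivatives makes all of them
  continuous, so this is the class of infinitely differentiable functions.\<close>

definition smooth :: "(real^'n::finite \<Rightarrow> real) \<Rightarrow> bool" where
  "smooth f \<longleftrightarrow> (\<forall>is x. iter_partial is f differentiable (at x))"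

definition supp :: "(real^'n::finite \<Rightarrow> real) \<Rightarrow> (real^'n) set" where
  "supp f = closure {x. f x \<noteq> 0}"

text \<open>A function in this class is extended by zero to the whole space.\<close>

definition test_functions :: "(real^'n::finite) set \<Rightarrow> (real^'n \<Rightarrow> real) set" where
  "test_functions U = {f. smooth f \<and> compact (supp f) \<and> supp f \<subseteq> U}"

text \<open>The Euclidean norm of the vector of all derivatives of order \<open>k\<close>, one component for each
  index tuple of length \<open>k\<close> (so for \<open>k = 2\<close> it is the Frobenius norm of the Hessian).\<close>

definition norm_nabla :: "nat \<Rightarrow> (real^'n::finite \<Rightarrow> real) \<Rightarrow> real^'n \<Rightarrow> real" where
  "norm_nabla k u x = sqrt (\<Sum>is | length is = k. (iter_partial is u x)\<^sup>2)"

section \<open>Weak derivatives\<close>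

text \<open>The coefficients have second derivatives only in the Sobolev sense, hence the same holds
  for the function to which the outer operator is applied.\<close>

definition locally_integrable :: "(real^'n::finite \<Rightarrow> real) \<Rightarrow> bool" where
  "locally_integrable f \<longleftrightarrow> (\<forall>K. compact K \<longrightarrow> f absolutely_integrable_on K)"

definition is_weak_partial ::
  "'n::finite list \<Rightarrow> (real^'n \<Rightarrow> real) \<Rightarrow> (real^'n \<Rightarrow> real) \<Rightarrow> bool" where
  "is_weak_partial is f h \<longleftrightarrow> locally_integrable f \<and> locally_integrable h \<and>
     (\<forall>\<phi>\<in>test_functions UNIV.
        (LINT x|lebesgue. f x * iter_partial is \<phi> x) =
        (-1) ^ length is * (LINT x|lebesgue. h x * \<phi> x))"

text \<open>Unique up to a null set; the value is arbitrary if there is no weak derivative.\<close>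

definition weak_partial :: "'n::finite list \<Rightarrow> (real^'n \<Rightarrow> real) \<Rightarrow> real^'n \<Rightarrow> real" where
  "weak_partial is f = (SOME h. is_weak_partial is f h)"

definition norm_weak_hessian :: "(real^'n::finite \<Rightarrow> real) \<Rightarrow> real^'n \<Rightarrow> real" where
  "norm_weak_hessian f x = sqrt (\<Sum>is | length is = 2. (weak_partial is f x)\<^sup>2)"

section \<open>Coefficients and operators\<close>

definition admissible_coeffs ::
  "real \<Rightarrow> real \<Rightarrow> real \<Rightarrow> (real^'n::finite \<Rightarrow> real^'n^'n) \<Rightarrow> bool" where
  "admissible_coeffs lam Lam Lam1 g \<longleftrightarrow>
     (\<forall>x. transpose (g x) = g x) \<and>
     (\<forall>x \<xi>. lam * (norm \<xi>)\<^sup>2 \<le> (\<Sum>i\<in>UNIV. \<Sum>j\<in>UNIV. g x $ i $ j * \<xi> $ i * \<xi> $ j) \<and>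
            (\<Sum>i\<in>UNIV. \<Sum>j\<in>UNIV. g x $ i $ j * \<xi> $ i * \<xi> $ j) \<le> inverse lam * (norm \<xi>)\<^sup>2) \<and>
     (\<forall>x y. (\<Sum>i\<in>UNIV. \<Sum>j\<in>UNIV. \<bar>g x $ i $ j - g y $ i $ j\<bar>) \<le> Lam * norm (x - y)) \<and>
     (\<forall>i j is. length is = 2 \<longrightarrow> (\<exists>h. is_weak_partial is (\<lambda>x. g x $ i $ j) h)) \<and>
     (\<Sum>i\<in>UNIV. \<Sum>j\<in>UNIV.
        esssup lebesgue (\<lambda>x. ereal (norm_weak_hessian (\<lambda>y. g y $ i $ j) x))) \<le> ereal Lam1"

definition eigenvalues :: "real^'n^'n \<Rightarrow> real set" where
  "eigenvalues A = {l. \<exists>v. v \<noteq> 0 \<and> A *v v = l *\<^sub>R v}"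

definition inner_op :: "(real^'n::finite \<Rightarrow> real^'n^'n) \<Rightarrow> (real^'n \<Rightarrow> real) \<Rightarrow> real^'n \<Rightarrow> real" where
  "inner_op g u x = (\<Sum>i\<in>UNIV. \<Sum>j\<in>UNIV. g x $ i $ j * iter_partial [i, j] u x)"

definition outer_op :: "(real^'n::finite \<Rightarrow> real^'n^'n) \<Rightarrow> (real^'n \<Rightarrow> real) \<Rightarrow> real^'n \<Rightarrow> real" where
  "outer_op g v x = (\<Sum>i\<in>UNIV. \<Sum>j\<in>UNIV. g x $ i $ j * weak_partial [i, j] v x)"

definition product_op ::
  "(real^'n::finite \<Rightarrow> real^'n^'n) \<Rightarrow> (real^'n \<Rightarrow> real^'n^'n) \<Rightarrow>
     (real^'n \<Rightarrow> real) \<Rightarrow> real^'n \<Rightarrow> real" where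
  "product_op g1 g2 u = outer_op g2 (inner_op g1 u)"

section \<open>The weight\<close>

definition sigma0 :: "real^'n^'n \<Rightarrow> real^'n::finite \<Rightarrow> real" where
  "sigma0 \<Gamma> x = sqrt ((\<Gamma> *v x) \<bullet> x)"

definition sigma_ball :: "real^'n^'n \<Rightarrow> real \<Rightarrow> (real^'n::finite) set" where
  "sigma_ball \<Gamma> r = {x. sigma0 \<Gamma> x < r}"

definition w0 :: "real^'n^'n \<Rightarrow> real \<Rightarrow> real^'n::finite \<Rightarrow> real" where
  "w0 \<Gamma> \<beta> x = exp (- (sigma0 \<Gamma> x powr (- \<beta>)))"

text \<open>For \<open>A = g\<^sub>1(0)\<close> and \<open>B = g\<^sub>2(0)\<close>, the lower bound that the exponent \<open>\<beta>\<close> has to exceed.\<close>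

definition beta_threshold :: "real^'n^'n \<Rightarrow> real^'n^'n::finite \<Rightarrow> real" where
  "beta_threshold A B =
     sqrt ((Max (eigenvalues B) * Max (eigenvalues A)) /
           (Min (eigenvalues B) * Min (eigenvalues A))) - 1"

text \<open>On the constants \<open>r1\<close>, \<open>C\<close> and \<open>taubar\<close> of the Carleman estimate. They are chosen before
  the coefficients, the matrix \<open>\<Gamma>\<close>, the function and the parameter \<open>\<tau>\<close>, but they are
  functions of \<open>\<beta>\<close> and of a positive lower bound \<open>\<delta>\<close> for \<open>\<beta> - beta_threshold\<close>. They cannot be
  uniform down to the threshold: for identity coefficients, where the threshold is \<open>0\<close>, letting
  \<open>\<beta>\<close> tend to \<open>0\<close> with \<open>u\<close> and \<open>\<tau>\<close> fixed would make the weight \<open>w0\<close> disappear from the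
  inequality, which is then false for large \<open>\<tau>\<close>. Every \<open>\<beta>\<close> above the threshold is covered by
  \<open>\<delta> = \<beta> - beta_threshold\<close>; as the threshold is at most \<open>lam\<^sup>-\<^sup>2 - 1\<close>, for \<open>\<beta>\<close> above the latter
  number \<open>\<delta>\<close> can be taken to depend on \<open>\<beta>\<close> and \<open>lam\<close> only. The matrix \<open>\<Gamma>\<close> does not depend
  on \<open>\<beta>\<close>.\<close>

end

theory Submission
  imports Defs
begin

text \<open>Write \<open>L\<^sub>k\<close> for the two operators, \<open>v = L\<^sub>1 u\<close>, and \<open>e\<^sup>2\<^sup>\<tau>\<^sup>\<phi>\<close> with \<open>\<phi> = \<sigma>\<^sub>0 powr (-\<beta>)\<close> for the weight
\<open>w\<^sub>0 powr (- 2 \<tau>)\<close>. Everything rests on an estimate for one operator \<open>L = \<Sum> g\<^sup>i\<^sup>j \<partial>\<^sub>i\<^sub>j\<close> and an arbitrary real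
exponent \<open>s\<close> (\<open>second_order_carleman\<close>): on a small punctured ball and for large \<open>\<tau>\<close>, the integral of
\<open>\<sigma>\<^sub>0 powr s |L u|\<^sup>2\<close> against the weight controls those of
\<open>\<tau> \<sigma>\<^sub>0 powr (s - \<beta> - 2) |\<nabla>u|\<^sup>2\<close>, \<open>\<tau>\<^sup>3 \<sigma>\<^sub>0 powr (s - 3\<beta> - 4) u\<^sup>2\<close> and \<open>\<tau>\<^sup>-\<^sup>1 \<sigma>\<^sub>0 powr (s + \<beta>) |\<nabla>\<^sup>2u|\<^sup>2\<close>.
For \<open>v\<close>, \<open>L\<^sub>2\<close> and \<open>s = 5\<beta> + 6\<close> the terms on the left carry the exponents \<open>4\<beta> + 4\<close> and \<open>2\<beta> + 2\<close>, which are
the right choices of \<open>s\<close> for \<open>L\<^sub>1\<close>: with \<open>s = 2\<beta> + 2\<close> the integral of \<open>v\<^sup>2\<close> controls \<open>u\<close> up to second order,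
and with \<open>s = 4\<beta> + 4\<close>, applied to the first derivatives of \<open>u\<close>, that of \<open>|\<nabla>v|\<^sup>2\<close> controls the third
derivatives. The commutator of \<open>L\<^sub>1\<close> with a derivative only contains second derivatives of \<open>u\<close>, which the
first of these estimates already controls (\<open>product_carleman\<close>).

The estimate for one operator comes from an identity of Rellich type. With \<open>f = e\<^sup>\<tau>\<^sup>\<phi> u\<close> the conjugated operator
has the principal part \<open>div (g\<nabla>f) - 2\<tau> g\<nabla>\<phi> \<cdot> \<nabla>f + \<tau>\<^sup>2 (g\<nabla>\<phi> \<cdot> \<nabla>\<phi>) f\<close>. Its square is at least a divergence plus
a quadratic form in \<open>\<nabla>f\<close> and \<open>f\<close> (\<open>rellich_pointwise\<close>), in which one may still choose a multiplier. The Hessian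
of \<open>\<phi>\<close> is bounded below by a negative multiple of \<open>\<Gamma>\<close>, and on gradients this costs the upper constant \<open>M\<close>
in \<open>m G \<le> g(0) \<le> M G\<close>, where \<open>G = \<Gamma>\<inverse>\<close>. The multiplier moves the loss to the zero order term, and the latter
remains positive if \<open>\<beta> + 1 > M / m\<close> (\<open>\<Phi>_gradient_lower\<close>, \<open>\<Phi>_zero_order_lower\<close>).

It remains to find one \<open>\<Gamma>\<close> for which the quotient \<open>M / m\<close> is small for both operators. If \<open>d A \<le> B \<le> d' A\<close> for
\<open>A = g\<^sub>1(0)\<close>, \<open>B = g\<^sub>2(0)\<close>, then the weighted mean \<open>G\<close> of \<open>A\<close> and \<open>B\<close> with weights in the proportion
\<open>1 : 1 / sqrt (d d')\<close> makes both quotients equal to \<open>sqrt (d' / d)\<close>, and with the extreme eigenvalues this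
is the threshold plus one (\<open>weight_matrix_exists\<close>).

The coefficients have only bounded weak second derivatives. They are nevertheless continuously differentiable
(\<open>admissible_C1\<close>), which suffices for the identity, and \<open>v\<close> is continuously differentiable with bounded weak second
derivatives. The estimate for \<open>L\<^sub>2\<close> passes to such functions by mollification (\<open>weak_carleman\<close>): the weighted
means of \<open>L\<^sub>2 v\<close> are controlled by \<open>L\<^sub>2 v\<close> itself by Jensen's inequality.\<close>

section \<open>Integration by parts\<close>

lemma set_integrable_compact:
  fixes f :: "'a::euclidean_space \<Rightarrow> real"
  assumes "compact K" "continuous_on K f"
  shows "set_integrable lborel K f"
  using borel_integrable_compact[OF assms] by (simp add: set_integrable_def)

lemma lborel_integral_shift:
  fixes f :: "'a::euclidean_space \<Rightarrow> real"
  assumes "f \<in> borel_measurable borel"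
  shows "(LINT x|lborel. f (c + x)) = (LINT x|lborel. f x)"
proof -
  have "(LINT x|lborel. f (c + x)) = (LINT x|distr lborel borel ((+) c). f x)"
    using assms by (subst integral_distr) auto
  then show ?thesis by (simp add: lborel_distr_plus)
qed

text \<open>The difference quotients of \<open>F\<close> have integral zero by translation invariance. They are bounded uniformly and
supported in one compact set, so the integral of their limit vanishes as well.\<close>

lemma integral_directional_derivative_zero:
  fixes F :: "'a::euclidean_space \<Rightarrow> real"
  assumes K: "compact K" "open U" "K \<subseteq> U" and F0: "\<And>x. x \<notin> K \<Longrightarrow> F x = 0"
    and F': "\<And>x. x \<in> U \<Longrightarrow> (F has_derivative F' x) (at x)"
    and cF': "continuous_on U (\<lambda>x. F' x e)"
  shows "(LINT x:K|lborel. F' x e) = 0"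
proof -
  define D where "D x = (if x \<in> K then F' x e else 0)" for x
  have oK: "open (- K)" using K(1) compact_imp_closed by blast
  have der0: "(F has_derivative (\<lambda>h. 0)) (at x)" if "x \<notin> K" for x
  proof (rule has_derivative_transform_within_open[of "\<lambda>x. 0" _ _ _ "- K"])
    show "((\<lambda>x. 0) has_derivative (\<lambda>h. 0)) (at x)" by simp
  qed (use oK that F0 in auto)
  have DU: "D x = F' x e" if "x \<in> U" for x
  proof (cases "x \<in> K")
    case False
    have "F' x = (\<lambda>h. 0)"
      using has_derivative_unique[OF F'[OF that] der0[OF False]] .
    then show ?thesis using False by (simp add: D_def)
  qed (simp add: D_def)
  have "continuous_on U D" using cF' DU by (simp cong: continuous_on_cong)
  moreover have "continuous_on (- K) D"
    by (rule continuous_on_eq[of _ "\<lambda>x. 0"]) (auto simp: D_def)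
  ultimately have "continuous_on (U \<union> - K) D"
    using K(2) oK by (intro continuous_on_open_Un)
  then have cD: "continuous_on UNIV D" using K(3) by (metis Un_absorb2 Compl_subset_Compl_iff Compl_partition sup.commute sup_assoc top_greatest subset_UNIV Un_upper1 sup_top_left Un_mono subset_antisym order_refl)
  have derF: "(F has_derivative (\<lambda>h. if x \<in> K then F' x h else 0)) (at x)" for x
    using F' K(3) der0[of x] by (cases "x \<in> K") auto
  have derF1: "((\<lambda>t. F (x + t *\<^sub>R e)) has_real_derivative D (x + t *\<^sub>R e)) (at t within S)" for x t S
  proof -
    have "((\<lambda>t. F (x + t *\<^sub>R e)) has_derivative (\<lambda>s. (if x + t *\<^sub>R e \<in> K then F' (x + t *\<^sub>R e) (s *\<^sub>R e) else 0))) (at t)"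
      by (rule has_derivative_compose[OF _ derF]) (auto intro!: derivative_eq_intros)
    moreover have "(\<lambda>s. (if x + t *\<^sub>R e \<in> K then F' (x + t *\<^sub>R e) (s *\<^sub>R e) else 0)) = (*) (D (x + t *\<^sub>R e))"
    proof (cases "x + t *\<^sub>R e \<in> K")
      case True
      then have "linear (F' (x + t *\<^sub>R e))" using F' K(3) has_derivative_linear by blast
      then show ?thesis using True by (auto simp: D_def linear_cmul)
    qed (auto simp: D_def)
    ultimately show ?thesis by (auto simp: has_field_derivative_def intro: has_derivative_at_withinI)
  qed
  have "bounded (D ` K)"
    using compact_continuous_image[OF continuous_on_subset[OF cD] K(1)] compact_imp_bounded by auto
  then obtain B0 where "\<And>x. x \<in> K \<Longrightarrow> \<bar>D x\<bar> \<le> B0" by (auto simp: bounded_iff)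
  then have B: "\<bar>D x\<bar> \<le> max B0 0" for x
    by (cases "x \<in> K") (auto simp: D_def intro: max.coboundedI1)
  define B where "B = max B0 0"
  have lipF: "\<bar>F (x + t *\<^sub>R e) - F x\<bar> \<le> B * t" if "t \<ge> 0" for x t
  proof (cases "t = 0")
    case False
    then have "0 < t" using that by simp
    from MVT2[of 0 t "\<lambda>t. F (x + t *\<^sub>R e)" "\<lambda>t. D (x + t *\<^sub>R e)", OF \<open>0 < t\<close>] derF1
    obtain z where "F (x + t *\<^sub>R e) - F x = t * D (x + z *\<^sub>R e)" by auto
    then show ?thesis using B[of "x + z *\<^sub>R e"] \<open>0 < t\<close> by (simp add: abs_mult B_def mult.commute)
  qed simp
  have contF: "continuous_on UNIV F"
    using derF by (auto intro!: continuous_at_imp_continuous_on has_derivative_continuous)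
  then have mF: "F \<in> borel_measurable borel" by (rule borel_measurable_continuous_onI)
  obtain R where R: "\<And>x. x \<in> K \<Longrightarrow> norm x \<le> R" using compact_imp_bounded[OF K(1)] by (auto simp: bounded_iff)
  define t where "t n = inverse (real (Suc n))" for n
  have t0: "t n > 0" "t n \<le> 1" for n by (auto simp: t_def field_simps)
  have tl: "t \<longlonglongrightarrow> 0" unfolding t_def by (rule LIMSEQ_inverse_real_of_nat)
  define q where "q n x = (F (x + t n *\<^sub>R e) - F x) / t n" for n x
  have intF: "integrable lborel F"
  proof -
    have "integrable lborel (\<lambda>x. indicator K x *\<^sub>R F x)"
      using borel_integrable_compact[OF K(1) continuous_on_subset[OF contF]] by simp
    moreover have "(\<lambda>x. indicator K x *\<^sub>R F x) = F" using F0 by (force simp: indicator_def fun_eq_iff)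
    ultimately show ?thesis by simp
  qed
  have intFt: "integrable lborel (\<lambda>x. F (c + x))" for c
  proof -
    have "integrable (distr lborel borel ((+) c)) F" using intF by (simp add: lborel_distr_plus)
    then show ?thesis by (subst (asm) integrable_distr_eq) (auto simp: mF)
  qed
  have q0: "(LINT x|lborel. q n x) = 0" for n
    using intFt[of "t n *\<^sub>R e"] intF lborel_integral_shift[OF mF, of "t n *\<^sub>R e"]
    by (simp add: q_def add.commute)
  have "(\<lambda>n. LINT x|lborel. q n x) \<longlonglongrightarrow> (LINT x|lborel. D x)"
  proof (rule integral_dominated_convergence)
    show "D \<in> borel_measurable lborel" using cD by (simp add: borel_measurable_continuous_onI)
    show "q n \<in> borel_measurable lborel" for n
      unfolding q_def using mF by simp
    show "integrable lborel (\<lambda>x. indicator (cball (0::'a) (R + norm e)) x *\<^sub>R B)"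
      by (rule borel_integrable_compact) auto
    show "AE x in lborel. (\<lambda>n. q n x) \<longlonglongrightarrow> D x"
    proof (rule AE_I2)
      fix x
      have "((\<lambda>h. (F (x + h *\<^sub>R e) - F (x + 0 *\<^sub>R e)) / h) \<longlongrightarrow> D x) (at 0)"
        using derF1[of x 0 UNIV] by (simp add: DERIV_def)
      then show "(\<lambda>n. q n x) \<longlonglongrightarrow> D x" unfolding q_def
        using tl t0(1) by (auto simp: tendsto_at_iff_sequentially o_def less_imp_neq[symmetric])
    qed
    show "AE x in lborel. norm (q n x) \<le> indicator (cball (0::'a) (R + norm e)) x *\<^sub>R B" for n
    proof (rule AE_I2)
      fix x
      show "norm (q n x) \<le> indicator (cball (0::'a) (R + norm e)) x *\<^sub>R B"
      proof (cases "x \<in> cball 0 (R + norm e)")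
        case True
        then show ?thesis using lipF[of "t n" x] t0[of n] by (simp add: q_def field_simps abs_divide)
      next
        case False
        then have 1: "norm x > R + norm e" by simp
        have "x \<notin> K" using R[of x] 1 norm_ge_zero[of e] by linarith
        moreover have "x + t n *\<^sub>R e \<notin> K"
        proof
          assume "x + t n *\<^sub>R e \<in> K"
          then have "norm (x + t n *\<^sub>R e) \<le> R" by (rule R)
          moreover have "norm x \<le> norm (x + t n *\<^sub>R e) + norm (t n *\<^sub>R e)"
            by (metis add_diff_cancel_right' norm_triangle_ineq4)
          moreover have "norm (t n *\<^sub>R e) \<le> norm e" using t0[of n] by (simp add: mult_left_le_one_le)
          ultimately show False using 1 by linarith
        qed
        ultimately show ?thesis using F0 False by (simp add: q_def)
      qed
    qed
  qed
  then have "(LINT x|lborel. D x) = 0" using q0 LIMSEQ_unique by (auto simp: tendsto_const_iff)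
  moreover have "D = (\<lambda>x. indicator K x *\<^sub>R F' x e)" by (auto simp: D_def indicator_def)
  ultimately show ?thesis by (simp add: set_lebesgue_integral_def)
qed

text \<open>The trace of a linear map, so that the divergence of a field is \<open>divm\<close> of its derivative.\<close>

definition divm :: "(real^'n \<Rightarrow> real^'n::finite) \<Rightarrow> real" where
  "divm L = (\<Sum>i\<in>UNIV. L (axis i 1) $ i)"

text \<open>Only compact support in an open set is required, which admits fields that are singular at the origin.\<close>

theorem divergence_integral_zero:
  fixes X :: "real^'n::finite \<Rightarrow> real^'n"
  assumes K: "compact K" "open U" "K \<subseteq> U" and X0: "\<And>x. x \<notin> K \<Longrightarrow> X x = 0"
    and X': "\<And>x. x \<in> U \<Longrightarrow> (X has_derivative X' x) (at x)"
    and cX': "\<And>h. continuous_on U (\<lambda>x. X' x h)"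
  shows "(LINT x:K|lborel. divm (X' x)) = 0"
proof -
  have "(LINT x:K|lborel. X' x (axis i 1) $ i) = 0" for i
  proof (rule integral_directional_derivative_zero[OF K, where F = "\<lambda>x. X x $ i" and F' = "\<lambda>x h. X' x h $ i"])
    show "((\<lambda>x. X x $ i) has_derivative (\<lambda>h. X' x h $ i)) (at x)" if "x \<in> U" for x
      using bounded_linear.has_derivative[OF bounded_linear_vec_nth X'[OF that]] .
    show "continuous_on U (\<lambda>x. X' x (axis i 1) $ i)"
      using cX' by (intro continuous_intros)
  qed (use X0 in auto)
  moreover have "set_integrable lborel K (\<lambda>x. X' x (axis i 1) $ i)" for i
    by (rule set_integrable_compact[OF K(1)])
      (use continuous_on_subset[OF cX' K(3)] in \<open>intro continuous_intros\<close>)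
  ultimately have "(\<Sum>i\<in>UNIV. LINT x:K|lborel. X' x (axis i 1) $ i) = 0"
    and "(\<Sum>i\<in>UNIV. LINT x:K|lborel. X' x (axis i 1) $ i) = (LINT x:K|lborel. divm (X' x))"
    unfolding divm_def set_lebesgue_integral_def set_integrable_def scaleR_sum_right
    by (simp, subst Bochner_Integration.integral_sum, auto)
  then show ?thesis by simp
qed

section \<open>Matrices and vectors\<close>

lemma norm_matrix_vector_mult_le:
  fixes A :: "real^'n::finite^'m::finite"
  shows "norm (A *v x) \<le> norm A * norm x"
proof -
  have "(norm (A *v x))\<^sup>2 = (\<Sum>i\<in>UNIV. (A $ i \<bullet> x)\<^sup>2)"
    by (simp add: norm_vec_def L2_set_def sum_nonneg matrix_vector_mul_component)
  also have "\<dots> \<le> (\<Sum>i\<in>UNIV. (norm (A $ i))\<^sup>2 * (norm x)\<^sup>2)"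
    by (intro sum_mono) (metis Cauchy_Schwarz_ineq2 abs_ge_zero power2_abs power_mono power_mult_distrib)
  also have "\<dots> = (norm A * norm x)\<^sup>2"
    by (simp add: norm_vec_def[of A] L2_set_def sum_nonneg power_mult_distrib sum_distrib_right)
  finally show ?thesis by (simp add: power2_le_iff_abs_le)
qed

lemma bounded_bilinear_mv: "bounded_bilinear ((*v) :: real^'n::finite^'m::finite \<Rightarrow> _)"
proof
  show "\<exists>K. \<forall>a b. norm ((a::real^'n^'m) *v b) \<le> norm a * norm b * K"
    by (rule exI[of _ 1]) (simp add: norm_matrix_vector_mult_le)
qed (simp_all add: matrix_vector_mult_add_rdistrib matrix_vector_right_distrib scaleR_matrix_vector_assoc matrix_vector_mult_scaleR)

lemmas has_derivative_mv[derivative_intros] = bounded_bilinear.FDERIV[OF bounded_bilinear_mv]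
lemmas continuous_on_mv[continuous_intros] = bounded_bilinear.continuous_on[OF bounded_bilinear_mv]

lemma inner_mv_sym:
  fixes A :: "real^'n::finite^'n"
  assumes "transpose A = A"
  shows "(A *v x) \<bullet> y = (A *v y) \<bullet> x"
  by (metis assms dot_lmul_matrix inner_commute transpose_matrix_vector)

lemma divm_add: "divm (\<lambda>h. L h + M h) = divm L + divm M"
  by (simp add: divm_def sum.distrib)
lemma divm_diff: "divm (\<lambda>h. L h - M h) = divm L - divm M"
  by (simp add: divm_def sum_subtractf)
lemma divm_scale: "divm (\<lambda>h. c *\<^sub>R L h) = c * divm L"
  by (simp add: divm_def sum_distrib_left)

lemma divm_rank1:
  fixes l :: "real^'n::finite \<Rightarrow> real"
  assumes "linear l"
  shows "divm (\<lambda>h. l h *\<^sub>R v) = l v"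
proof -
  have "v = (\<Sum>i\<in>UNIV. v $ i *\<^sub>R axis i 1)" by (simp add: vec_eq_iff axis_def if_distrib cong: if_cong)
  then have "l v = l (\<Sum>i\<in>UNIV. v $ i *\<^sub>R axis i 1)" by simp
  also have "\<dots> = (\<Sum>i\<in>UNIV. v $ i * l (axis i 1))"
    using assms by (simp add: linear_sum linear_cmul)
  finally show ?thesis by (simp add: divm_def mult.commute)
qed

lemma divm_matrix_product:
  fixes g H :: "real^'n::finite^'n"
  assumes "transpose H = H"
  shows "divm (\<lambda>h. g *v (H *v h)) = g \<bullet> H"
proof -
  have H: "H $ i $ j = H $ j $ i" for i j using assms by (metis transpose_def vec_lambda_beta)
  show ?thesis
    unfolding divm_def inner_vec_def matrix_vector_mult_def
    by (auto intro!: sum.cong simp: axis_def H[of _ "_"] if_distrib cong: if_cong)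
qed

section \<open>The Rellich type identity\<close>

lemma continuous_on_linear_apply:
  fixes L :: "'a::topological_space \<Rightarrow> real^'n::finite \<Rightarrow> 'b::real_normed_vector"
  assumes "\<And>x. x \<in> S \<Longrightarrow> linear (L x)" "\<And>h. continuous_on S (\<lambda>x. L x h)" "continuous_on S V"
  shows "continuous_on S (\<lambda>x. L x (V x))"
proof -
  have "L x (V x) = (\<Sum>i\<in>UNIV. V x $ i *\<^sub>R L x (axis i 1))" if "x \<in> S" for x
  proof -
    have "V x = (\<Sum>i\<in>UNIV. V x $ i *\<^sub>R axis i 1)"
      by (simp add: vec_eq_iff axis_def if_distrib cong: if_cong)
    then have "L x (V x) = L x (\<Sum>i\<in>UNIV. V x $ i *\<^sub>R axis i 1)" by simp
    then show ?thesis using assms(1)[OF that] by (simp add: linear_sum linear_cmul)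
  qed
  moreover have "continuous_on S (\<lambda>x. \<Sum>i\<in>UNIV. V x $ i *\<^sub>R L x (axis i 1))"
    using assms(2,3) by (intro continuous_intros)
  ultimately show ?thesis by (simp cong: continuous_on_cong)
qed

lemma continuous_on_divm:
  assumes "\<And>h. continuous_on S (\<lambda>x. L x h)"
  shows "continuous_on S (\<lambda>x. divm (L x))"
  unfolding divm_def using assms by (intro continuous_intros)

lemma abs_divm_le:
  fixes L :: "real^'n \<Rightarrow> real^'n::finite" and B :: real
  assumes "\<And>h. norm (L h) \<le> B * norm h"
  shows "\<bar>divm L\<bar> \<le> CARD('n) * B"
proof -
  have "\<bar>L (axis i 1) $ i\<bar> \<le> B" for i
    using assms[of "axis i 1"] component_le_norm_cart[of "L (axis i 1)" i] by simp
  then show ?thesis unfolding divm_def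
    by (rule order_trans[OF sum_abs sum_bounded_above])
qed

locale elliptic_C1 =
  fixes g :: "real^'n::finite \<Rightarrow> real^'n^'n" and g' :: "real^'n \<Rightarrow> real^'n \<Rightarrow> real^'n^'n"
    and lam Lam :: real
  assumes g_sym: "transpose (g x) = g x"
    and lam: "0 < lam" "lam \<le> 1" and Lam: "0 \<le> Lam"
    and g_lower: "lam * (norm \<xi>)\<^sup>2 \<le> (g x *v \<xi>) \<bullet> \<xi>"
    and g_upper: "(g x *v \<xi>) \<bullet> \<xi> \<le> inverse lam * (norm \<xi>)\<^sup>2"
    and g_deriv: "(g has_derivative g' x) (at x)"
    and g'_cont: "continuous_on UNIV (\<lambda>x. g' x h)"
    and g'_bound: "norm (g' x h) \<le> Lam * norm h"
begin

lemma linear_g': "linear (g' x)"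
  using g_deriv has_derivative_linear by blast

lemma continuous_on_g: "continuous_on S g"
  by (rule continuous_at_imp_continuous_on) (blast intro: has_derivative_continuous[OF g_deriv])

lemma continuous_on_g'[continuous_intros]:
  "continuous_on S V \<Longrightarrow> continuous_on S (\<lambda>x. g' x (V x))"
  by (rule continuous_on_linear_apply[OF linear_g' continuous_on_subset[OF g'_cont subset_UNIV]])

text \<open>The first order term by which \<open>div (g p)\<close> differs from \<open>g : Dp\<close>.\<close>

definition dv :: "real^'n \<Rightarrow> real^'n \<Rightarrow> real" where
  "dv x v = divm (\<lambda>h. g' x h *v v)"

lemma abs_dv_le: "\<bar>dv x v\<bar> \<le> CARD('n) * (Lam * norm v)"
  unfolding dv_def
proof (rule abs_divm_le)
  fix h show "norm (g' x h *v v) \<le> Lam * norm v * norm h"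
    using norm_matrix_vector_mult_le[of "g' x h" v] mult_right_mono[OF g'_bound[of x h], of "norm v"]
    by (simp add: mult_ac)
qed

text \<open>The field with \<open>V = g p\<close> and \<open>N = g Z\<close>, where \<open>p = \<nabla>f\<close> and \<open>Z = \<nabla>\<phi>\<close>: the terms \<open>2 (N \<cdot> p) V - (V \<cdot> p) N\<close> are those of
the classical Rellich identity with the vector field \<open>N\<close>, and the other two remove the mixed products of \<open>f\<close>
with its derivatives.\<close>

definition rellich_field where
  "rellich_field \<tau> f p Z m x =
     (- 2 * \<tau>) *\<^sub>R ((2 * ((g x *v Z x) \<bullet> p x)) *\<^sub>R (g x *v p x) - ((g x *v p x) \<bullet> p x) *\<^sub>R (g x *v Z x))
     - (2 * \<tau>^3) *\<^sub>R (((g x *v Z x) \<bullet> Z x * (f x)\<^sup>2) *\<^sub>R (g x *v Z x))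
     - (2 * \<tau>) *\<^sub>R ((m x * f x) *\<^sub>R (g x *v p x))"

definition rellich_field_deriv where
  "rellich_field_deriv \<tau> f p H Z \<Phi> m dm x h =
   (let V = g x *v p x; N = g x *v Z x;
        V' = (\<lambda>h. g' x h *v p x + g x *v (H x *v h)); N' = (\<lambda>h. g' x h *v Z x + g x *v (\<Phi> x *v h));
        T' = (\<lambda>h. N' h \<bullet> p x + N \<bullet> (H x *v h)); E' = (\<lambda>h. V' h \<bullet> p x + V \<bullet> (H x *v h));
        q' = (\<lambda>h. N' h \<bullet> Z x + N \<bullet> (\<Phi> x *v h))
    in (- 2 * \<tau>) *\<^sub>R (((2 * T' h) *\<^sub>R V + (2 * (N \<bullet> p x)) *\<^sub>R V' h) - (E' h *\<^sub>R N + (V \<bullet> p x) *\<^sub>R N' h))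
     - (2 * \<tau>^3) *\<^sub>R ((q' h * (f x)\<^sup>2 + (N \<bullet> Z x) * (2 * f x * (p x \<bullet> h))) *\<^sub>R N + ((N \<bullet> Z x) * (f x)\<^sup>2) *\<^sub>R N' h)
     - (2 * \<tau>) *\<^sub>R (((dm x \<bullet> h) * f x + m x * (p x \<bullet> h)) *\<^sub>R V + (m x * f x) *\<^sub>R V' h))"

lemma has_derivative_rellich_field:
  assumes f: "(f has_derivative (\<lambda>h. p x \<bullet> h)) (at x)"
    and p: "(p has_derivative (\<lambda>h. H x *v h)) (at x)"
    and Z: "(Z has_derivative (\<lambda>h. \<Phi> x *v h)) (at x)"
    and m: "(m has_derivative (\<lambda>h. dm x \<bullet> h)) (at x)"
  shows "(rellich_field \<tau> f p Z m has_derivative rellich_field_deriv \<tau> f p H Z \<Phi> m dm x) (at x)"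
proof -
  note gd = g_deriv[of x]
  have V: "((\<lambda>x. g x *v p x) has_derivative (\<lambda>h. g' x h *v p x + g x *v (H x *v h))) (at x)"
    by (rule has_derivative_eq_rhs[OF has_derivative_mv[OF gd p]]) (auto simp: add.commute)
  have N: "((\<lambda>x. g x *v Z x) has_derivative (\<lambda>h. g' x h *v Z x + g x *v (\<Phi> x *v h))) (at x)"
    by (rule has_derivative_eq_rhs[OF has_derivative_mv[OF gd Z]]) (auto simp: add.commute)
  let ?V = "g x *v p x" and ?N = "g x *v Z x"
  define V' N' where "V' h = g' x h *v p x + g x *v (H x *v h)" "N' h = g' x h *v Z x + g x *v (\<Phi> x *v h)" for h
  define T' E' q' where "T' h = N' h \<bullet> p x + ?N \<bullet> (H x *v h)" "E' h = V' h \<bullet> p x + ?V \<bullet> (H x *v h)"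
    "q' h = N' h \<bullet> Z x + ?N \<bullet> (\<Phi> x *v h)" for h
  note V = V[folded V'_N'_def] and N = N[folded V'_N'_def]
  have T: "((\<lambda>x. (g x *v Z x) \<bullet> p x) has_derivative T') (at x)"
    by (rule has_derivative_eq_rhs[OF has_derivative_inner[OF N p]]) (simp add: T'_E'_q'_def fun_eq_iff)
  have E: "((\<lambda>x. (g x *v p x) \<bullet> p x) has_derivative E') (at x)"
    by (rule has_derivative_eq_rhs[OF has_derivative_inner[OF V p]]) (simp add: T'_E'_q'_def fun_eq_iff)
  have q: "((\<lambda>x. (g x *v Z x) \<bullet> Z x) has_derivative q') (at x)"
    by (rule has_derivative_eq_rhs[OF has_derivative_inner[OF N Z]]) (simp add: T'_E'_q'_def fun_eq_iff)
  have f2: "((\<lambda>x. (f x)\<^sup>2) has_derivative (\<lambda>h. 2 * f x * (p x \<bullet> h))) (at x)"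
    by (rule has_derivative_eq_rhs[OF has_derivative_power[OF f]]) (simp add: fun_eq_iff)
  have "((\<lambda>x. 2 * ((g x *v Z x) \<bullet> p x)) has_derivative (\<lambda>h. 2 * T' h)) (at x)"
    by (rule has_derivative_mult_right[OF T])
  note 1 = has_derivative_scaleR_right[OF has_derivative_diff[OF has_derivative_scaleR[OF this V] has_derivative_scaleR[OF E N]], of "- 2 * \<tau>"]
  note 2 = has_derivative_scaleR_right[OF has_derivative_scaleR[OF has_derivative_mult[OF q f2] N], of "2 * \<tau>^3"]
  note 3 = has_derivative_scaleR_right[OF has_derivative_scaleR[OF has_derivative_mult[OF m f] V], of "2 * \<tau>"]
  show ?thesis
    unfolding rellich_field_def rellich_field_deriv_def Let_def V'_N'_def[symmetric] T'_E'_q'_def[symmetric]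
    by (rule has_derivative_eq_rhs[OF has_derivative_diff[OF has_derivative_diff[OF 1 2] 3]])
      (simp only: fun_eq_iff add.commute simp_thms)
qed

text \<open>Here \<open>m\<close> is a multiplier with gradient \<open>dm\<close>, \<open>\<Phi>\<close> is the derivative of \<open>Z\<close>, and \<open>dN\<close> is the divergence of \<open>N = g Z\<close>.\<close>

definition rellich_form where
  "rellich_form \<tau> f p Z \<Phi> m dm x =
   (let V = g x *v p x; N = g x *v Z x; q = N \<bullet> Z x; dN = dv x (Z x) + g x \<bullet> \<Phi> x
    in 4 * \<tau> * ((\<Phi> x *v V) \<bullet> V) + 2 * \<tau> * (m x - dN) * (V \<bullet> p x) + 2 * \<tau> * f x * (dm x \<bullet> V)
     + 2 * \<tau>^3 * (dN - m x) * q * (f x)\<^sup>2 + 4 * \<tau>^3 * ((\<Phi> x *v N) \<bullet> N) * (f x)\<^sup>2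
     + 2 * \<tau> * (2 * ((g' x V *v Z x) \<bullet> p x) - (g' x N *v p x) \<bullet> p x)
     + 2 * \<tau>^3 * ((g' x N *v Z x) \<bullet> Z x) * (f x)\<^sup>2 - \<tau>\<^sup>2 * (m x)\<^sup>2 * (f x)\<^sup>2)"

text \<open>The principal part of the conjugated operator; \<open>dv x (p x) + g x \<bullet> H x\<close> is the divergence of \<open>g p\<close>.\<close>

definition conj_op where
  "conj_op \<tau> f p H Z x = dv x (p x) + g x \<bullet> H x - 2 * \<tau> * ((g x *v Z x) \<bullet> p x)
     + \<tau>\<^sup>2 * ((g x *v Z x) \<bullet> Z x) * f x"

text \<open>Write the operator as \<open>S - 2 \<tau> T\<close> with \<open>T = N \<cdot> p\<close> and \<open>S = div V + \<tau>\<^sup>2 (N \<cdot> Z) f\<close>. Discarding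
\<open>(S + \<tau> m f)\<^sup>2 + 4 \<tau>\<^sup>2 T\<^sup>2\<close> from its square leaves \<open>- 4 \<tau> S T - 2 \<tau> m S f - \<tau>\<^sup>2 m\<^sup>2 f\<^sup>2\<close>, in which the second
derivatives of \<open>f\<close> only occur in the products of \<open>div V\<close> with \<open>T\<close> and \<open>f\<close>. Those are divergences up to
first order terms.\<close>

lemma rellich_pointwise:
  assumes H: "transpose (H x) = H x" and \<Phi>: "transpose (\<Phi> x) = \<Phi> x"
  shows "rellich_form \<tau> f p Z \<Phi> m dm x + divm (rellich_field_deriv \<tau> f p H Z \<Phi> m dm x)
    \<le> (conj_op \<tau> f p H Z x)\<^sup>2"
proof -
  define V N q where "V = g x *v p x" "N = g x *v Z x" "q = N \<bullet> Z x"
  define V' N' where "V' h = g' x h *v p x + g x *v (H x *v h)" "N' h = g' x h *v Z x + g x *v (\<Phi> x *v h)" for h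
  define T' E' q' where "T' h = N' h \<bullet> p x + N \<bullet> (H x *v h)" "E' h = V' h \<bullet> p x + V \<bullet> (H x *v h)"
    "q' h = N' h \<bullet> Z x + N \<bullet> (\<Phi> x *v h)" for h
  have l1: "linear (\<lambda>h. g' x h *v w)" for w
    using linear_compose[OF linear_g' bounded_linear.linear[OF bounded_bilinear.bounded_linear_left[OF bounded_bilinear_mv]], of w x]
    by (simp add: o_def)
  have l2: "linear (\<lambda>h. A *v (B *v h))" for A B :: "real^'n^'n"
    using linear_compose[of "(*v) B" "(*v) A"] by (simp add: o_def)
  have l3: "linear (\<lambda>h. l h \<bullet> w)" "linear (\<lambda>h. w \<bullet> l h)" if "linear l" for l :: "real^'n \<Rightarrow> real^'n" and w
    using linear_compose[OF that bounded_linear.linear[OF bounded_linear_inner_left], of w]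
      linear_compose[OF that bounded_linear.linear[OF bounded_linear_inner_right], of w] by (simp_all add: o_def)
  have lin: "linear V'" "linear N'"
    unfolding V'_N'_def[abs_def] by (intro linear_compose_add l1 l2)+
  have lin': "linear T'" "linear E'" "linear q'"
    unfolding T'_E'_q'_def[abs_def] by (intro linear_compose_add l3 lin; simp)+
  have dV: "divm V' = dv x (p x) + g x \<bullet> H x"
    unfolding V'_N'_def divm_add dv_def divm_matrix_product[OF H] ..
  have dN: "divm N' = dv x (Z x) + g x \<bullet> \<Phi> x"
    unfolding V'_N'_def divm_add dv_def divm_matrix_product[OF \<Phi>] ..
  have lin3: "linear (\<lambda>h. q' h * (f x)\<^sup>2 + q * (2 * f x * (p x \<bullet> h)))"
    "linear (\<lambda>h. (dm x \<bullet> h) * f x + m x * (p x \<bullet> h))" "linear (\<lambda>h. 2 * T' h)"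
    using lin'(1,3) unfolding linear_conv_bounded_linear
    by (intro bounded_linear_add bounded_linear_mult_const bounded_linear_const_mult bounded_linear_inner_right; simp)+
  have D: "divm (rellich_field_deriv \<tau> f p H Z \<Phi> m dm x) =
    (- 2 * \<tau>) * ((2 * T' V + 2 * (N \<bullet> p x) * divm V') - (E' N + (V \<bullet> p x) * divm N'))
     - 2 * \<tau>^3 * ((q' N * (f x)\<^sup>2 + q * (2 * f x * (p x \<bullet> N))) + q * (f x)\<^sup>2 * divm N')
     - 2 * \<tau> * (((dm x \<bullet> V) * f x + m x * (p x \<bullet> V)) + m x * f x * divm V')"
  proof -
    have "rellich_field_deriv \<tau> f p H Z \<Phi> m dm x = (\<lambda>h. (- 2 * \<tau>) *\<^sub>R (((2 * T' h) *\<^sub>R V + (2 * (N \<bullet> p x)) *\<^sub>R V' h) - (E' h *\<^sub>R N + (V \<bullet> p x) *\<^sub>R N' h))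
     - (2 * \<tau>^3) *\<^sub>R ((q' h * (f x)\<^sup>2 + q * (2 * f x * (p x \<bullet> h))) *\<^sub>R N + (q * (f x)\<^sup>2) *\<^sub>R N' h)
     - (2 * \<tau>) *\<^sub>R (((dm x \<bullet> h) * f x + m x * (p x \<bullet> h)) *\<^sub>R V + (m x * f x) *\<^sub>R V' h))"
      by (rule ext) (simp only: rellich_field_deriv_def Let_def V_N_q_def V'_N'_def T'_E'_q'_def)
    then show ?thesis
      by (simp only:) (subst divm_diff divm_add divm_scale divm_rank1[OF lin'(2)] divm_rank1[OF lin3(1)] divm_rank1[OF lin3(2)] divm_rank1[OF lin3(3)] | rule refl)+
  qed
  have s1: "(g x *v (\<Phi> x *v V)) \<bullet> p x = (\<Phi> x *v V) \<bullet> V"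
    unfolding V_N_q_def using inner_mv_sym[OF g_sym, of x "\<Phi> x *v (g x *v p x)" "p x"] by (simp add: inner_commute)
  have s2: "N \<bullet> (H x *v V) = V \<bullet> (H x *v N)"
    using inner_mv_sym[OF H, of V N] by (simp add: inner_commute)
  have s3: "(g x *v (H x *v N)) \<bullet> p x = V \<bullet> (H x *v N)"
    unfolding V_N_q_def using inner_mv_sym[OF g_sym, of x "H x *v (g x *v Z x)" "p x"] by (simp add: inner_commute)
  have s4: "(g x *v (\<Phi> x *v N)) \<bullet> Z x = (\<Phi> x *v N) \<bullet> N"
    unfolding V_N_q_def using inner_mv_sym[OF g_sym, of x "\<Phi> x *v (g x *v Z x)" "Z x"] by (simp add: inner_commute)
  have T'V: "T' V = (g' x V *v Z x) \<bullet> p x + (\<Phi> x *v V) \<bullet> V + V \<bullet> (H x *v N)"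
    unfolding T'_E'_q'_def V'_N'_def inner_add_left s1 s2 by simp
  have E'N: "E' N = (g' x N *v p x) \<bullet> p x + 2 * (V \<bullet> (H x *v N))"
    unfolding T'_E'_q'_def V'_N'_def inner_add_left s3 by simp
  have q'N: "q' N = (g' x N *v Z x) \<bullet> Z x + 2 * ((\<Phi> x *v N) \<bullet> N)"
    unfolding T'_E'_q'_def V'_N'_def inner_add_left s4 by (simp add: inner_commute)
  define T E where "T = N \<bullet> p x" "E = V \<bullet> p x"
  have c1: "p x \<bullet> N = T" "p x \<bullet> V = E" by (simp_all add: T_E_def inner_commute)
  define S where "S = divm V' + \<tau>\<^sup>2 * q * f x"
  have conj: "conj_op \<tau> f p H Z x = S - 2 * \<tau> * T"
    unfolding conj_op_def S_def dV V_N_q_def T_E_def by simp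
  have "rellich_form \<tau> f p Z \<Phi> m dm x + divm (rellich_field_deriv \<tau> f p H Z \<Phi> m dm x)
      = - 4 * \<tau> * S * T - 2 * \<tau> * m x * S * f x - \<tau>\<^sup>2 * (m x)\<^sup>2 * (f x)\<^sup>2"
    unfolding D T'V E'N q'N c1 rellich_form_def Let_def V_N_q_def(1,2)[symmetric] V_N_q_def(3)[symmetric] dN[symmetric] T_E_def[symmetric] S_def
    by (simp add: algebra_simps power2_eq_square power3_eq_cube)
  also have "\<dots> \<le> (S - 2 * \<tau> * T)\<^sup>2"
  proof -
    have "(S - 2 * \<tau> * T)\<^sup>2 - (- 4 * \<tau> * S * T - 2 * \<tau> * m x * S * f x - \<tau>\<^sup>2 * (m x)\<^sup>2 * (f x)\<^sup>2)
       = (S + \<tau> * m x * f x)\<^sup>2 + (2 * \<tau> * T)\<^sup>2"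
      by (simp add: algebra_simps power2_eq_square)
    moreover have "0 \<le> (S + \<tau> * m x * f x)\<^sup>2 + (2 * \<tau> * T)\<^sup>2" by simp
    ultimately show ?thesis by linarith
  qed
  finally show ?thesis unfolding conj .
qed

end

section \<open>Positive forms and the quadratic weight\<close>

lemma psd_Cauchy_Schwarz:
  fixes A :: "real^'n::finite^'n"
  assumes sym: "transpose A = A" and psd: "\<And>x. 0 \<le> (A *v x) \<bullet> x"
  shows "((A *v x) \<bullet> y)\<^sup>2 \<le> ((A *v x) \<bullet> x) * ((A *v y) \<bullet> y)"
proof -
  define a b c where "a = (A *v x) \<bullet> x" "b = (A *v x) \<bullet> y" "c = (A *v y) \<bullet> y"
  have q: "0 \<le> a + 2 * t * b + t\<^sup>2 * c" for t
  proof -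
    have "(A *v (x + t *\<^sub>R y)) \<bullet> (x + t *\<^sub>R y) = a + 2 * t * b + t\<^sup>2 * c"
      using inner_mv_sym[OF sym, of y x]
      by (simp add: a_b_c_def matrix_vector_right_distrib matrix_vector_mult_scaleR inner_add algebra_simps power2_eq_square)
    then show ?thesis using psd[of "x + t *\<^sub>R y"] by simp
  qed
  have c0: "c \<ge> 0" and a0: "a \<ge> 0" using psd by (auto simp: a_b_c_def)
  have "b\<^sup>2 \<le> a * c"
  proof (cases "c = 0")
    case True
    have "b = 0"
    proof (rule ccontr)
      assume "b \<noteq> 0"
      then show False using q[of "- (a + 1) / (2 * b)"] True by (simp add: field_simps)
    qed
    then show ?thesis using True by simp
  next
    case False
    then have "0 \<le> (a + 2 * (- b / c) * b + (- b / c)\<^sup>2 * c) * c" using q[of "- b / c"] c0 by simp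
    also have "\<dots> = a * c - b\<^sup>2" using False by (simp add: field_simps power2_eq_square)
    finally show ?thesis by simp
  qed
  then show ?thesis by (simp add: a_b_c_def)
qed

lemma psd_norm_mv_le:
  fixes A :: "real^'n::finite^'n"
  assumes sym: "transpose A = A" and psd: "\<And>x. 0 \<le> (A *v x) \<bullet> x"
    and up: "\<And>x. (A *v x) \<bullet> x \<le> B * (norm x)\<^sup>2"
  shows "(norm (A *v x))\<^sup>2 \<le> B * ((A *v x) \<bullet> x)"
proof (cases "A *v x = 0")
  case False
  let ?y = "A *v x"
  have "((norm ?y)\<^sup>2)\<^sup>2 \<le> ((A *v x) \<bullet> x) * ((A *v ?y) \<bullet> ?y)"
    using psd_Cauchy_Schwarz[OF sym psd, of x ?y] by (simp add: power2_norm_eq_inner)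
  also have "\<dots> \<le> ((A *v x) \<bullet> x) * (B * (norm ?y)\<^sup>2)"
    by (intro mult_left_mono up psd)
  finally have "(norm ?y)\<^sup>2 * (norm ?y)\<^sup>2 \<le> (norm ?y)\<^sup>2 * (B * ((A *v x) \<bullet> x))"
    by (simp add: power2_eq_square mult_ac)
  moreover have "(norm ?y)\<^sup>2 > 0" using False by simp
  ultimately show ?thesis by (meson mult_le_cancel_left_pos)
qed simp

text \<open>In a basis in which \<open>G\<close> is the identity this is \<open>g\<^sup>2 \<le> M g\<close>. The Cauchy-Schwarz inequality for the form \<open>g\<close>,
  applied to \<open>p\<close> and \<open>\<Gamma> g p\<close>, avoids the square root of \<open>G\<close> that such a basis requires.\<close>

lemma inverse_form_le:
  fixes g G \<Gamma> :: "real^'n::finite^'n"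
  assumes sym: "transpose g = g" and psd: "\<And>x. 0 \<le> (g *v x) \<bullet> x"
    and up: "\<And>x. (g *v x) \<bullet> x \<le> M * ((G *v x) \<bullet> x)"
    and inv: "G ** \<Gamma> = mat 1" and pos: "\<And>x. 0 \<le> (\<Gamma> *v x) \<bullet> x" and M: "0 \<le> M"
  shows "(\<Gamma> *v (g *v p)) \<bullet> (g *v p) \<le> M * ((g *v p) \<bullet> p)"
proof -
  define y where "y = \<Gamma> *v (g *v p)"
  define t where "t = (\<Gamma> *v (g *v p)) \<bullet> (g *v p)"
  have Gy: "G *v y = g *v p" unfolding y_def by (metis inv(1) matrix_vector_mul_assoc matrix_vector_mul_lid)
  have "t\<^sup>2 \<le> ((g *v p) \<bullet> p) * ((g *v y) \<bullet> y)"
    using psd_Cauchy_Schwarz[OF sym psd, of p y] by (simp add: t_def y_def inner_commute)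
  also have "\<dots> \<le> ((g *v p) \<bullet> p) * (M * t)"
    using mult_left_mono[OF up[of y] psd[of p]] Gy by (simp add: t_def y_def inner_commute)
  finally have "t * t \<le> t * (M * ((g *v p) \<bullet> p))" by (simp add: power2_eq_square mult_ac)
  moreover have "t \<ge> 0" using pos by (simp add: t_def)
  ultimately show ?thesis using psd[of p] M unfolding t_def[symmetric]
    by (cases "t = 0") auto
qed

text \<open>A sharpening for \<open>m G \<le> g \<le> M G\<close>: in a basis in which \<open>G\<close> is the identity it says
  that \<open>(g - m) (M - g)\<close> is positive.\<close>

lemma inverse_form_le':
  fixes g G \<Gamma> :: "real^'n::finite^'n"
  assumes sym: "transpose g = g" "transpose G = G"
    and lo: "\<And>x. m * ((G *v x) \<bullet> x) \<le> (g *v x) \<bullet> x"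
    and up: "\<And>x. (g *v x) \<bullet> x \<le> M * ((G *v x) \<bullet> x)"
    and inv: "G ** \<Gamma> = mat 1" "\<Gamma> ** G = mat 1" and pos: "\<And>x. 0 \<le> (\<Gamma> *v x) \<bullet> x" and mM: "m \<le> M"
  shows "(\<Gamma> *v (g *v z)) \<bullet> (g *v z) \<le> (m + M) * ((g *v z) \<bullet> z) - m * M * ((G *v z) \<bullet> z)"
proof -
  define R where "R = g - m *\<^sub>R G"
  have Rv: "R *v x = g *v x - m *\<^sub>R (G *v x)" for x
    by (simp add: R_def matrix_vector_mult_diff_rdistrib scaleR_matrix_vector_assoc)
  have "transpose R = R" using sym by (simp add: R_def transpose_def vec_eq_iff)
  then have 1: "(\<Gamma> *v (R *v z)) \<bullet> (R *v z) \<le> (M - m) * ((R *v z) \<bullet> z)"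
    by (rule inverse_form_le[OF _ _ _ inv(1) pos])
      (use lo up mM in \<open>auto simp: Rv inner_diff_left algebra_simps\<close>)
  have GG: "\<Gamma> *v (G *v x) = x" for x by (metis inv(2) matrix_vector_mul_assoc matrix_vector_mul_lid)
  have s\<Gamma>: "transpose \<Gamma> = \<Gamma>"
    by (metis inv matrix_mul_assoc matrix_mul_lid matrix_mul_rid matrix_transpose_mul sym(2) transpose_mat)
  have 2: "(\<Gamma> *v (g *v z)) \<bullet> (G *v z) = (g *v z) \<bullet> z"
    using inner_mv_sym[OF s\<Gamma>, of "g *v z" "G *v z"] GG by (simp add: inner_commute)
  have "(\<Gamma> *v (R *v z)) \<bullet> (R *v z) = (\<Gamma> *v (g *v z)) \<bullet> (g *v z) - 2 * m * ((g *v z) \<bullet> z) + m\<^sup>2 * ((G *v z) \<bullet> z)"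
    unfolding Rv matrix_vector_mult_diff_distrib matrix_vector_mult_scaleR GG inner_diff_left inner_diff_right
      inner_scaleR_left inner_scaleR_right 2
    by (simp add: inner_commute algebra_simps power2_eq_square)
  then show ?thesis using 1 unfolding Rv inner_diff_left inner_scaleR_left
    by (simp add: algebra_simps power2_eq_square)
qed

definition outer :: "real^'n \<Rightarrow> real^'n::finite^'n" where
  "outer z = (\<chi> i j. z $ i * z $ j)"

lemma outer_mv: "outer z *v h = (z \<bullet> h) *\<^sub>R z"
  by (simp add: outer_def matrix_vector_mult_def vec_eq_iff inner_vec_def sum_distrib_right sum_distrib_left mult_ac)

lemma inner_outer: "A \<bullet> outer z = (A *v z) \<bullet> z"
  by (simp add: outer_def matrix_vector_mult_def inner_vec_def sum_distrib_right sum_distrib_left mult_ac)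

lemma transpose_outer: "transpose (outer z) = outer z"
  by (simp add: outer_def transpose_def vec_eq_iff mult.commute)

lemma norm_matrix_le:
  fixes A :: "real^'n::finite^'n" and B :: real
  assumes "\<And>h. norm (A *v h) \<le> B * norm h"
  shows "norm A \<le> real CARD('n) * (real CARD('n) * B)"
proof -
  have c: "\<bar>A $ i $ j\<bar> \<le> B" for i j
  proof -
    have "A $ i $ j = (A *v axis j 1) $ i"
      by (simp add: matrix_vector_mult_def axis_def if_distrib cong: if_cong)
    then show ?thesis using component_le_norm_cart[of "A *v axis j 1" i] assms[of "axis j 1"] by simp
  qed
  have "norm A \<le> (\<Sum>i\<in>UNIV. norm (A $ i))" by (simp add: norm_vec_def L2_set_le_sum)
  also have "\<dots> \<le> (\<Sum>i\<in>UNIV. \<Sum>j\<in>UNIV. \<bar>A $ i $ j\<bar>)" by (intro sum_mono norm_le_l1_cart)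
  also have "\<dots> \<le> (\<Sum>i\<in>(UNIV::'n set). \<Sum>j\<in>(UNIV::'n set). B)" by (intro sum_mono c)
  finally show ?thesis by simp
qed

locale quad_weight =
  fixes \<Gamma> :: "real^'n::finite^'n" and lam :: real
  assumes \<Gamma>_sym: "transpose \<Gamma> = \<Gamma>"
    and lam01: "0 < lam" "lam \<le> 1"
    and \<Gamma>_lower: "lam\<^sup>2 * (norm x)\<^sup>2 \<le> (\<Gamma> *v x) \<bullet> x"
    and \<Gamma>_upper: "(\<Gamma> *v x) \<bullet> x \<le> inverse (lam\<^sup>2) * (norm x)\<^sup>2"
begin

abbreviation \<sigma> where "\<sigma> \<equiv> sigma0 \<Gamma>"

lemma \<Gamma>_psd: "0 \<le> (\<Gamma> *v x) \<bullet> x"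
  using \<Gamma>_lower[of x] lam01 by (meson order_trans zero_le_mult_iff zero_le_power2)

lemma \<sigma>_square: "(\<sigma> x)\<^sup>2 = (\<Gamma> *v x) \<bullet> x"
  by (simp add: sigma0_def \<Gamma>_psd)

lemma \<sigma>_nonneg: "0 \<le> \<sigma> x" by (simp add: sigma0_def \<Gamma>_psd)

lemma norm_le_\<sigma>: "norm x \<le> inverse lam * \<sigma> x"
proof -
  have "(lam * norm x)\<^sup>2 \<le> (\<sigma> x)\<^sup>2" using \<Gamma>_lower by (simp add: \<sigma>_square power_mult_distrib)
  then have "lam * norm x \<le> \<sigma> x" using \<sigma>_nonneg power2_le_imp_le by blast
  then show ?thesis using lam01 by (simp add: field_simps)
qed

lemma \<sigma>_le_norm: "\<sigma> x \<le> inverse lam * norm x"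
proof -
  have "(\<sigma> x)\<^sup>2 \<le> (inverse lam * norm x)\<^sup>2" using \<Gamma>_upper by (simp add: \<sigma>_square power_mult_distrib power_inverse)
  then show ?thesis using lam01 by (meson norm_ge_zero power2_le_imp_le inverse_nonnegative_iff_nonnegative less_imp_le mult_nonneg_nonneg)
qed

lemma \<sigma>_pos: "x \<noteq> 0 \<Longrightarrow> 0 < \<sigma> x"
  using norm_le_\<sigma>[of x] \<sigma>_nonneg[of x] by (cases "\<sigma> x = 0") auto

lemma norm_\<Gamma>_le_\<sigma>: "norm (\<Gamma> *v x) \<le> inverse lam * \<sigma> x"
proof -
  have "(norm (\<Gamma> *v x))\<^sup>2 \<le> (inverse lam * \<sigma> x)\<^sup>2"
    using psd_norm_mv_le[OF \<Gamma>_sym \<Gamma>_psd \<Gamma>_upper, of x] by (simp add: \<sigma>_square power_mult_distrib power_inverse)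
  then show ?thesis using lam01 \<sigma>_nonneg by (meson power2_le_imp_le inverse_nonnegative_iff_nonnegative less_imp_le mult_nonneg_nonneg)
qed

lemma norm_\<Gamma>_mv: "norm (\<Gamma> *v x) \<le> (inverse lam)\<^sup>2 * norm x"
proof -
  have "norm (\<Gamma> *v x) \<le> inverse lam * \<sigma> x" by (rule norm_\<Gamma>_le_\<sigma>)
  also have "\<dots> \<le> inverse lam * (inverse lam * norm x)" using lam01 by (intro mult_left_mono \<sigma>_le_norm) auto
  finally show ?thesis by (simp add: power2_eq_square mult.assoc)
qed

lemma norm_\<Gamma>: "norm \<Gamma> \<le> real CARD('n) * (real CARD('n) * (inverse lam)\<^sup>2)"
  by (rule norm_matrix_le) (rule norm_\<Gamma>_mv)

lemma has_derivative_\<sigma>_powr: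
  assumes "x \<noteq> 0"
  shows "((\<lambda>x. \<sigma> x powr a) has_derivative (\<lambda>h. (a * \<sigma> x powr (a - 2)) * ((\<Gamma> *v x) \<bullet> h))) (at x)"
proof -
  have pos: "(\<Gamma> *v x) \<bullet> x > 0" using \<sigma>_pos[OF assms] \<sigma>_square by (metis zero_less_power2 less_irrefl)
  have q: "((\<lambda>x. (\<Gamma> *v x) \<bullet> x) has_derivative (\<lambda>h. 2 * ((\<Gamma> *v x) \<bullet> h))) (at x)"
  proof -
    have "((\<lambda>x. \<Gamma> *v x) has_derivative (\<lambda>h. \<Gamma> *v h)) (at x)"
      by (rule bounded_linear_imp_has_derivative) simp
    from has_derivative_inner[OF this has_derivative_ident] show ?thesis
      by (rule has_derivative_eq_rhs) (use inner_mv_sym[OF \<Gamma>_sym] in \<open>auto simp: fun_eq_iff inner_commute\<close>)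
  qed
  have "((\<lambda>x. ((\<Gamma> *v x) \<bullet> x) powr (a/2)) has_derivative
     (\<lambda>h. ((a/2) * ((\<Gamma> *v x) \<bullet> x) powr (a/2 - 1)) * (2 * ((\<Gamma> *v x) \<bullet> h)))) (at x)"
  proof -
    have "((\<lambda>t. t powr (a/2)) has_derivative (*) ((a/2) * ((\<Gamma> *v x) \<bullet> x) powr (a/2 - 1))) (at ((\<Gamma> *v x) \<bullet> x))"
      using has_real_derivative_powr[OF pos, of "a/2"] by (simp add: has_field_derivative_def)
    from has_derivative_compose[OF q this] show ?thesis by simp
  qed
  moreover have "\<sigma> y powr c = ((\<Gamma> *v y) \<bullet> y) powr (c / 2)" for y c
    by (simp add: sigma0_def \<Gamma>_psd powr_half_sqrt[symmetric] powr_powr)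
  ultimately show ?thesis by (simp add: diff_divide_distrib mult.assoc)
qed

lemma continuous_on_\<sigma>_powr[continuous_intros]: "continuous_on (- {0}) (\<lambda>x. \<sigma> x powr a)"
  by (intro continuous_at_imp_continuous_on ballI) (use has_derivative_\<sigma>_powr has_derivative_continuous in blast)

end

section \<open>Positivity of the Rellich form for the singular weight\<close>

lemma abs_mult_leI: "\<bar>a\<bar> \<le> A \<Longrightarrow> \<bar>b\<bar> \<le> B \<Longrightarrow> \<bar>a * b\<bar> \<le> A * (B::real)"
  unfolding abs_mult by (rule mult_mono) (auto intro: order_trans[OF abs_ge_zero])
lemma abs_add_leI: "\<bar>a\<bar> \<le> A \<Longrightarrow> \<bar>b\<bar> \<le> B \<Longrightarrow> \<bar>a + b\<bar> \<le> A + (B::real)" by linarith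
lemma abs_diff_leI: "\<bar>a\<bar> \<le> A \<Longrightarrow> \<bar>b\<bar> \<le> B \<Longrightarrow> \<bar>a - b\<bar> \<le> A + (B::real)" by linarith
lemma abs_inner_leI: "norm v \<le> A \<Longrightarrow> norm w \<le> B \<Longrightarrow> \<bar>v \<bullet> w\<bar> \<le> A * B"
  by (rule order_trans[OF Cauchy_Schwarz_ineq2]) (auto intro!: mult_mono intro: order_trans[OF norm_ge_zero])
lemma norm_scaleR_leI: "\<bar>a\<bar> \<le> A \<Longrightarrow> norm v \<le> B \<Longrightarrow> norm (a *\<^sub>R v) \<le> A * B"
  unfolding norm_scaleR by (rule mult_mono) (auto intro: order_trans[OF abs_ge_zero])
lemma norm_add_leI: "norm v \<le> A \<Longrightarrow> norm w \<le> B \<Longrightarrow> norm (v + w) \<le> A + B" by (rule norm_triangle_mono)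
lemma norm_mv_leI: "norm A \<le> a \<Longrightarrow> norm x \<le> b \<Longrightarrow> norm (A *v x) \<le> a * b" for A :: "real^'n::finite^'m::finite"
  by (rule order_trans[OF norm_matrix_vector_mult_le]) (auto intro!: mult_mono intro: order_trans[OF norm_ge_zero])

text \<open>The matrix \<open>G\<close> is compared with \<open>g\<close> on the whole ball \<open>\<sigma> < r\<close>. The constants therefore are slightly worse than those
at the origin, but \<open>gap\<close> survives. A single number \<open>K\<close> dominates all data, so that every constant
below is an explicit function of \<open>K\<close>, \<open>lam\<close>, \<open>\<epsilon>\<close> and \<open>\<beta>\<close> and thus is independent of the coefficients.\<close>

locale carleman_weight = elliptic_C1 g g' lam Lam + quad_weight \<Gamma> lam
  for g :: "real^'n::finite \<Rightarrow> real^'n^'n" and g' :: "real^'n \<Rightarrow> real^'n \<Rightarrow> real^'n^'n"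
    and lam Lam :: real and \<Gamma> :: "real^'n^'n" +
  fixes G :: "real^'n^'n" and \<beta> \<epsilon> m M r K :: real
  assumes G_sym: "transpose G = G" and G_inv: "G ** \<Gamma> = mat 1" "\<Gamma> ** G = mat 1"
    and \<beta>: "0 < \<beta>" and \<epsilon>: "0 < \<epsilon>" and r: "0 < r" "r \<le> 1"
    and g_G: "\<And>x \<xi>. \<sigma> x < r \<Longrightarrow> m * ((G *v \<xi>) \<bullet> \<xi>) \<le> (g x *v \<xi>) \<bullet> \<xi>"
      "\<And>x \<xi>. \<sigma> x < r \<Longrightarrow> (g x *v \<xi>) \<bullet> \<xi> \<le> M * ((G *v \<xi>) \<bullet> \<xi>)"
    and mM: "lam\<^sup>2 / 2 \<le> m" "m \<le> M" "M \<le> 2 * (inverse lam)\<^sup>2"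
    and gap: "2 * \<epsilon> \<le> (\<beta> + 1) * m - M"
    and K: "inverse lam \<le> K" "Lam \<le> K" "real CARD('n) \<le> K" "\<epsilon> \<le> K" "\<beta> + 2 \<le> K" "1 \<le> K"
begin

lemma K0: "0 \<le> K" using K by linarith

lemma norm_g_mv: "norm (g x *v v) \<le> K * norm v"
proof -
  have psd: "0 \<le> (g x *v v) \<bullet> v" for v
    using g_lower[of v x] lam by (meson order_trans mult_nonneg_nonneg zero_le_power2 less_imp_le)
  have "(norm (g x *v v))\<^sup>2 \<le> inverse lam * ((g x *v v) \<bullet> v)"
    by (rule psd_norm_mv_le[OF g_sym psd g_upper])
  also have "\<dots> \<le> inverse lam * (inverse lam * (norm v)\<^sup>2)"
    using lam by (intro mult_left_mono g_upper) auto
  also have "\<dots> = (inverse lam * norm v)\<^sup>2" by (simp add: power_mult_distrib power2_eq_square)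
  finally have "norm (g x *v v) \<le> inverse lam * norm v"
    using lam by (meson power2_le_imp_le inverse_nonnegative_iff_nonnegative less_imp_le mult_nonneg_nonneg norm_ge_zero)
  also have "\<dots> \<le> K * norm v" using K by (intro mult_right_mono) auto
  finally show ?thesis .
qed

lemma norm_g: "norm (g x) \<le> K^3"
proof -
  have "norm (g x) \<le> real CARD('n) * (real CARD('n) * K)"
    by (rule norm_matrix_le) (rule norm_g_mv)
  also have "\<dots> \<le> K * (K * K)" using K K0 by (intro mult_mono) auto
  finally show ?thesis by (simp add: power3_eq_cube)
qed

lemma norm_\<Gamma>_K: "norm \<Gamma> \<le> K^4"
proof -
  have "norm \<Gamma> \<le> real CARD('n) * (real CARD('n) * (inverse lam)\<^sup>2)" by (rule norm_\<Gamma>)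
  also have "\<dots> \<le> K * (K * K\<^sup>2)" using K K0 lam by (intro mult_mono power_mono) auto
  finally show ?thesis by (simp add: power4_eq_xxxx power2_eq_square mult.assoc)
qed

lemma norm_\<Gamma>_mv_K: "norm (\<Gamma> *v v) \<le> K\<^sup>2 * norm v"
proof -
  have "(inverse lam)\<^sup>2 \<le> K\<^sup>2" using K lam by (intro power_mono) auto
  from mult_right_mono[OF this norm_ge_zero[of v]] norm_\<Gamma>_mv[of v] show ?thesis by linarith
qed

text \<open>\<open>Z\<close> and \<open>\<Phi>\<close> are the gradient and the Hessian of \<open>\<sigma> powr (-\<beta>)\<close>. The multiplier \<open>mlt\<close>, with gradient \<open>dmlt\<close>, is
\<open>g(0) \<bullet> \<Phi> + 2 b (M + \<epsilon>)\<close>: it equals the divergence of \<open>g Z\<close>, up to terms that are smaller by a factor \<open>\<sigma>\<close>, plus what is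
needed to make the form in the gradient positive. The coefficients are frozen at the origin since the multiplier
has to be differentiated.\<close>

definition z where "z x = \<Gamma> *v x"
definition b where "b x = \<beta> * \<sigma> x powr (- \<beta> - 2)"
definition Z where "Z x = (- b x) *\<^sub>R z x"
definition \<Phi> where "\<Phi> x = b x *\<^sub>R (((\<beta> + 2) * \<sigma> x powr (- 2)) *\<^sub>R outer (z x) - \<Gamma>)"
definition \<mu> where "\<mu> x = (\<beta> + 2) * \<sigma> x powr (- 2) * ((g 0 *v z x) \<bullet> z x) + (2 * (M + \<epsilon>) - g 0 \<bullet> \<Gamma>)"
definition mlt where "mlt x = b x * \<mu> x"
definition dmlt where "dmlt x = b x *\<^sub>R ((- ((\<beta> + 2) * \<sigma> x powr (- 2) * \<mu> x)) *\<^sub>R z x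
   + (\<beta> + 2) *\<^sub>R ((- 2 * \<sigma> x powr (- 4) * ((g 0 *v z x) \<bullet> z x)) *\<^sub>R z x + (2 * \<sigma> x powr (- 2)) *\<^sub>R (\<Gamma> *v (g 0 *v z x))))"

lemma norm_z: "norm (z x) \<le> K * \<sigma> x"
  unfolding z_def using norm_\<Gamma>_le_\<sigma>[of x] mult_right_mono[OF K(1) \<sigma>_nonneg[of x]] by linarith

lemma G_z: "(G *v z x) \<bullet> z x = (\<sigma> x)\<^sup>2"
proof -
  have "G *v z x = x" unfolding z_def by (metis G_inv(1) matrix_vector_mul_assoc matrix_vector_mul_lid)
  then show ?thesis by (simp add: \<sigma>_square z_def inner_commute)
qed

lemma has_derivative_z: "(z has_derivative (\<lambda>h. \<Gamma> *v h)) (at x)"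
  unfolding z_def[abs_def] by (rule bounded_linear_imp_has_derivative) simp

lemma has_derivative_b:
  assumes "x \<noteq> 0"
  shows "(b has_derivative (\<lambda>h. - b x * ((\<beta> + 2) * \<sigma> x powr (- 2) * (z x \<bullet> h)))) (at x)"
proof -
  have "\<sigma> x powr (- \<beta> - 2 - 2) = \<sigma> x powr (- \<beta> - 2) * \<sigma> x powr (- 2)" by (simp add: powr_add[symmetric])
  then show ?thesis unfolding b_def[abs_def]
    by (intro has_derivative_eq_rhs[OF has_derivative_mult_right[OF has_derivative_\<sigma>_powr[OF assms]]])
      (simp add: fun_eq_iff z_def algebra_simps)
qed

lemma transpose_\<Phi>: "transpose (\<Phi> x) = \<Phi> x"
  using transpose_outer[of "z x"] \<Gamma>_sym by (simp add: \<Phi>_def transpose_def vec_eq_iff)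

lemma \<Phi>_mv: "\<Phi> x *v h = b x *\<^sub>R (((\<beta> + 2) * \<sigma> x powr (- 2) * (z x \<bullet> h)) *\<^sub>R z x - \<Gamma> *v h)"
  unfolding \<Phi>_def by (simp add: scaleR_matrix_vector_assoc[symmetric] matrix_vector_mult_diff_rdistrib outer_mv)

lemma has_derivative_Z:
  assumes "x \<noteq> 0"
  shows "(Z has_derivative (\<lambda>h. \<Phi> x *v h)) (at x)"
  unfolding Z_def[abs_def]
  by (rule has_derivative_eq_rhs[OF has_derivative_scaleR[OF has_derivative_minus[OF has_derivative_b[OF assms]] has_derivative_z]])
    (simp add: fun_eq_iff \<Phi>_mv scaleR_right_diff_distrib)

lemma has_derivative_mlt:
  assumes "x \<noteq> 0"
  shows "(mlt has_derivative (\<lambda>h. dmlt x \<bullet> h)) (at x)"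
proof -
  have gz: "((\<lambda>x. g 0 *v z x) has_derivative (\<lambda>h. g 0 *v (\<Gamma> *v h))) (at x)"
    by (rule bounded_linear.has_derivative[OF _ has_derivative_z]) simp
  have s: "(g 0 *v (\<Gamma> *v h)) \<bullet> z x = (\<Gamma> *v (g 0 *v z x)) \<bullet> h" for h
    using inner_mv_sym[OF g_sym, of 0 "\<Gamma> *v h" "z x"] inner_mv_sym[OF \<Gamma>_sym, of h "g 0 *v z x"]
    by (simp add: inner_commute)
  have s': "(g 0 *v z x) \<bullet> (\<Gamma> *v h) = (\<Gamma> *v (g 0 *v z x)) \<bullet> h" for h
    using inner_mv_sym[OF \<Gamma>_sym, of h "g 0 *v z x"] by (simp add: inner_commute)
  have q: "((\<lambda>x. (g 0 *v z x) \<bullet> z x) has_derivative (\<lambda>h. 2 * ((\<Gamma> *v (g 0 *v z x)) \<bullet> h))) (at x)"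
    by (rule has_derivative_eq_rhs[OF has_derivative_inner[OF gz has_derivative_z]]) (simp add: fun_eq_iff s s')
  have \<mu>: "(\<mu> has_derivative (\<lambda>h. (\<beta> + 2) * (\<sigma> x powr (- 2) * (2 * ((\<Gamma> *v (g 0 *v z x)) \<bullet> h))
      - 2 * \<sigma> x powr (- 4) * ((g 0 *v z x) \<bullet> z x) * (z x \<bullet> h)))) (at x)"
    unfolding \<mu>_def[abs_def] mult.assoc
    by (rule has_derivative_eq_rhs[OF has_derivative_add[OF has_derivative_mult_right[OF has_derivative_mult[OF has_derivative_\<sigma>_powr[OF assms] q]] has_derivative_const]])
      (simp add: fun_eq_iff z_def algebra_simps)
  show ?thesis unfolding mlt_def[abs_def]
    by (rule has_derivative_eq_rhs[OF has_derivative_mult[OF has_derivative_b[OF assms] \<mu>]])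
      (simp add: fun_eq_iff dmlt_def inner_add_left algebra_simps)
qed

lemma b_pos: "x \<noteq> 0 \<Longrightarrow> 0 < b x"
  using \<sigma>_pos[of x] \<beta> by (simp add: b_def)

text \<open>\<open>Cm\<close>, \<open>Cd\<close> and \<open>Ce\<close> enter the bounds for \<open>\<mu>\<close>, the gradient of \<open>mlt\<close>, and the error \<open>e1\<close> made by freezing the coefficients in the
  multiplier. \<open>C4\<close> and \<open>C5\<close> collect the error terms of first and of zero order that are smaller
  than the main terms by a factor \<open>\<sigma>\<close>, and hence are absorbed on a small ball.\<close>

definition Cm where "Cm = K * K^3 + 6 * K\<^sup>2 + K^7"
definition Cd where "Cd = K * Cm * K + K * (2 * K^3 * K + 2 * (K\<^sup>2 * (K * K)))"
definition Ce where "Ce = K * (K * K) + (K * (K * K * K\<^sup>2) + K\<^sup>2 * K^4)"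

definition C4 where "C4 = 2 * (Ce * K\<^sup>2 * K) + 6 * K^3"
definition C5 where "C5 = 2 * (Ce * K\<^sup>2 * K^3) + 2 * K^5"

lemma gz_le: "\<bar>(g y *v z x) \<bullet> z x\<bar> \<le> K^3 * (\<sigma> x)\<^sup>2"
proof -
  have "norm (g y *v z x) \<le> K * (K * \<sigma> x)"
    using norm_g_mv[of y "z x"] mult_left_mono[OF norm_z[of x] K0] by linarith
  from abs_inner_leI[OF this norm_z] show ?thesis by (simp add: power2_eq_square power3_eq_cube mult_ac)
qed

context
  fixes x assumes x: "x \<noteq> 0" "\<sigma> x < r"
begin

lemma s: "0 < \<sigma> x" "\<sigma> x < 1" using \<sigma>_pos x r by auto

lemma w: "\<sigma> x powr (- 2) * (\<sigma> x)\<^sup>2 = 1" "0 < \<sigma> x powr (- 2)" "\<sigma> x powr (- 2) = 1 / (\<sigma> x)\<^sup>2"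
    "\<sigma> x powr (- 4) = 1 / (\<sigma> x)^4"
  using s powr_realpow[of "\<sigma> x" 2] powr_realpow[of "\<sigma> x" 4] by (simp_all add: powr_minus_divide)

lemma abs_\<mu>_le: "\<bar>\<mu> x\<bar> \<le> Cm"
proof -
  have 1: "\<bar>(\<beta> + 2) * (\<sigma> x powr (- 2) * ((g 0 *v z x) \<bullet> z x))\<bar> \<le> K * K^3"
  proof (rule abs_mult_leI)
    show "\<bar>\<beta> + 2\<bar> \<le> K" using K \<beta> by auto
    show "\<bar>\<sigma> x powr (- 2) * ((g 0 *v z x) \<bullet> z x)\<bar> \<le> K^3"
    proof -
      have "\<bar>\<sigma> x powr (- 2) * ((g 0 *v z x) \<bullet> z x)\<bar> \<le> \<sigma> x powr (- 2) * (K^3 * (\<sigma> x)\<^sup>2)"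
        unfolding abs_mult using gz_le[of 0 x] by (intro mult_mono) auto
      then show ?thesis using w(1) by (simp add: mult_ac)
    qed
  qed
  have "\<bar>g 0 \<bullet> \<Gamma>\<bar> \<le> K^3 * K^4" by (rule abs_inner_leI[OF norm_g norm_\<Gamma>_K])
  then have 2: "\<bar>g 0 \<bullet> \<Gamma>\<bar> \<le> K^7" by (simp add: power_add[symmetric])
  have "(inverse lam)\<^sup>2 \<le> K\<^sup>2" using K lam by (intro power_mono) auto
  then have "M \<le> 2 * K\<^sup>2" using mM by linarith
  moreover have "0 \<le> M" using mM by (smt (verit) zero_le_power2 divide_nonneg_pos)
  moreover have "K \<le> K\<^sup>2" using K by (simp add: power2_eq_square)
  ultimately have 3: "\<bar>2 * (M + \<epsilon>)\<bar> \<le> 6 * K\<^sup>2" using \<epsilon> K by simp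
  show ?thesis unfolding \<mu>_def Cm_def using 1 2 3 by (simp only: mult.assoc)
qed

lemma norm_dmlt_le: "norm (dmlt x) \<le> b x * (Cd / \<sigma> x)"
proof -
  have b2: "\<bar>\<beta> + 2\<bar> \<le> K" using K \<beta> by auto
  have Cm0: "0 \<le> Cm" using abs_\<mu>_le by linarith
  have 1: "norm ((- ((\<beta> + 2) * \<sigma> x powr (- 2) * \<mu> x)) *\<^sub>R z x) \<le> K * (1 / (\<sigma> x)\<^sup>2) * Cm * (K * \<sigma> x)"
  proof (rule norm_scaleR_leI[OF _ norm_z])
    have "\<bar>(\<beta> + 2) * \<sigma> x powr (- 2) * \<mu> x\<bar> \<le> K * (1 / (\<sigma> x)\<^sup>2) * Cm"
      by (intro abs_mult_leI b2 abs_\<mu>_le) (simp add: w)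
    then show "\<bar>- ((\<beta> + 2) * \<sigma> x powr (- 2) * \<mu> x)\<bar> \<le> K * (1 / (\<sigma> x)\<^sup>2) * Cm" by simp
  qed
  have 2: "norm ((- 2 * \<sigma> x powr (- 4) * ((g 0 *v z x) \<bullet> z x)) *\<^sub>R z x) \<le> 2 * (1 / (\<sigma> x)^4) * (K^3 * (\<sigma> x)\<^sup>2) * (K * \<sigma> x)"
    by (intro norm_scaleR_leI norm_z abs_mult_leI gz_le) (simp_all add: w)
  have 3: "norm ((2 * \<sigma> x powr (- 2)) *\<^sub>R (\<Gamma> *v (g 0 *v z x))) \<le> 2 * (1 / (\<sigma> x)\<^sup>2) * (K\<^sup>2 * (K * (K * \<sigma> x)))"
  proof (rule norm_scaleR_leI)
    have "norm (\<Gamma> *v (g 0 *v z x)) \<le> K\<^sup>2 * norm (g 0 *v z x)" by (rule norm_\<Gamma>_mv_K)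
    also have "\<dots> \<le> K\<^sup>2 * (K * norm (z x))" by (intro mult_left_mono norm_g_mv) simp
    also have "\<dots> \<le> K\<^sup>2 * (K * (K * \<sigma> x))" using K0 by (intro mult_left_mono norm_z) auto
    finally show "norm (\<Gamma> *v (g 0 *v z x)) \<le> K\<^sup>2 * (K * (K * \<sigma> x))" .
  qed (simp add: w)
  have "norm (dmlt x) \<le> b x * (K * (1 / (\<sigma> x)\<^sup>2) * Cm * (K * \<sigma> x) + K * (2 * (1 / (\<sigma> x)^4) * (K^3 * (\<sigma> x)\<^sup>2) * (K * \<sigma> x) + 2 * (1 / (\<sigma> x)\<^sup>2) * (K\<^sup>2 * (K * (K * \<sigma> x)))))"
    unfolding dmlt_def by (intro norm_scaleR_leI norm_add_leI 1 2 3 b2) (use b_pos[OF x(1)] in simp)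
  also have "\<dots> = b x * (Cd / \<sigma> x)"
    unfolding Cd_def using s(1) by (simp add: field_simps power2_eq_square power3_eq_cube power4_eq_xxxx)
  finally show ?thesis .
qed

definition e1 where "e1 = dv x (Z x) + g x \<bullet> \<Phi> x - mlt x + 2 * b x * (M + \<epsilon>)"

lemma abs_e1_le: "\<bar>e1\<bar> \<le> b x * (\<sigma> x * (Ce * K^2))"
proof -
  have dvs: "dv x (Z x) = - b x * dv x (z x)"
    unfolding dv_def Z_def matrix_vector_mult_scaleR divm_scale ..
  have "\<bar>dv x (z x)\<bar> \<le> real CARD('n) * (Lam * norm (z x))" by (rule abs_dv_le)
  also have "\<dots> \<le> K * (K * (K * \<sigma> x))" using K K0 Lam \<sigma>_nonneg by (intro mult_mono norm_z) auto
  finally have 1: "\<bar>dv x (z x)\<bar> \<le> K * (K * (K * \<sigma> x))" .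
  have nx: "norm x \<le> K * \<sigma> x" using norm_le_\<sigma>[of x] mult_right_mono[OF K(1) \<sigma>_nonneg[of x]] by linarith
  have "norm (g x - g 0) \<le> Lam * norm (x - 0)"
  proof (rule differentiable_bound[where S = UNIV and f' = g'])
    show "onorm (g' y) \<le> Lam" for y by (rule onorm_le) (rule g'_bound)
  qed (use g_deriv in auto)
  also have "\<dots> \<le> K * (K * \<sigma> x)" using nx K Lam by (intro mult_mono) auto
  finally have 2: "norm (g x - g 0) \<le> K * (K * \<sigma> x)" .
  have "norm ((g x - g 0) *v z x) \<le> K * (K * \<sigma> x) * (K * \<sigma> x)" by (rule norm_mv_leI[OF 2 norm_z])
  from abs_inner_leI[OF this norm_z]
  have 3: "\<bar>((g x - g 0) *v z x) \<bullet> z x\<bar> \<le> K * (K * \<sigma> x) * (K * \<sigma> x) * (K * \<sigma> x)" .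
  have 4: "\<bar>(g x - g 0) \<bullet> \<Gamma>\<bar> \<le> K * (K * \<sigma> x) * K^4" by (rule abs_inner_leI[OF 2 norm_\<Gamma>_K])
  have "e1 = b x * (- dv x (z x) + ((\<beta> + 2) * (\<sigma> x powr (- 2) * (((g x - g 0) *v z x) \<bullet> z x)) - (g x - g 0) \<bullet> \<Gamma>))"
    unfolding e1_def dvs \<Phi>_def mlt_def \<mu>_def inner_scaleR_right inner_diff_right inner_outer inner_diff_left matrix_vector_mult_diff_rdistrib
    by (simp add: algebra_simps)
  also have "\<bar>\<dots>\<bar> \<le> b x * (K * (K * (K * \<sigma> x)) + (K * ((1 / (\<sigma> x)\<^sup>2) * (K * (K * \<sigma> x) * (K * \<sigma> x) * (K * \<sigma> x))) + K * (K * \<sigma> x) * K^4))"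
    by (intro abs_mult_leI abs_add_leI abs_diff_leI 3 4) (use 1 w b_pos[OF x(1)] K \<beta> in auto)
  also have "\<dots> = b x * (\<sigma> x * (K^3 + K^5 + K^6))"
    using s(1) by (simp add: field_simps power2_eq_square eval_nat_numeral)
  also have "\<dots> \<le> b x * (\<sigma> x * (Ce * K^2))"
  proof -
    have "K^3 \<le> K^5" "K^5 \<le> K^7" "K^6 \<le> K^8" using K by (intro power_increasing; simp)+
    then have "K^3 + K^5 + K^6 \<le> Ce * K\<^sup>2" unfolding Ce_def by (simp add: algebra_simps eval_nat_numeral)
    then show ?thesis using b_pos[OF x(1)] s by (intro mult_left_mono) auto
  qed
  finally show ?thesis .
qed


lemma g_psd: "0 \<le> (g y *v v) \<bullet> v"
  using g_lower[of v y] lam by (meson order_trans mult_nonneg_nonneg zero_le_power2 less_imp_le)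

lemma m_M_pos: "0 < m" "0 < M"
  using mM lam by (smt (verit) zero_less_power half_gt_zero)+

text \<open>The first part of \<open>\<Phi>\<close> is a nonnegative form, and \<open>\<Gamma>\<close> is at most \<open>M\<close> times the form of \<open>g\<close> on vectors \<open>g v\<close>. The negative term is the loss that the multiplier compensates.\<close>

lemma \<Phi>_gradient_lower: "- b x * (M * ((g x *v v) \<bullet> v)) \<le> (\<Phi> x *v (g x *v v)) \<bullet> (g x *v v)"
proof -
  let ?V = "g x *v v"
  have "(\<Gamma> *v ?V) \<bullet> ?V \<le> M * (?V \<bullet> v)"
    by (rule inverse_form_le[OF g_sym g_psd g_G(2)[OF x(2)] G_inv(1) \<Gamma>_psd]) (use m_M_pos in simp)
  moreover have "0 \<le> (\<beta> + 2) * \<sigma> x powr (- 2) * (z x \<bullet> ?V) * (z x \<bullet> ?V)"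
    using \<beta> by (simp add: mult.assoc)
  ultimately have "- (M * (?V \<bullet> v)) \<le> (\<beta> + 2) * \<sigma> x powr (- 2) * (z x \<bullet> ?V) * (z x \<bullet> ?V) - (\<Gamma> *v ?V) \<bullet> ?V"
    by linarith
  from mult_left_mono[OF this less_imp_le[OF b_pos[OF x(1)]]] show ?thesis
    by (simp add: \<Phi>_mv inner_diff_left)
qed

text \<open>With \<open>t = (g z \<cdot> z) / \<sigma>\<^sup>2\<close>, which lies between \<open>m\<close> and \<open>M\<close>, the claim is a lower bound for
  \<open>(\<beta> + 2) t\<^sup>2 - (m + M) t + m M - (M + \<epsilon>) t\<close>. This polynomial increases for \<open>t \<ge> m\<close>, and at \<open>t = m\<close> its value is
  \<open>m ((\<beta> + 1) m - M - \<epsilon>)\<close>. Here \<open>\<beta> + 1 > M / m\<close> enters.\<close>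

lemma \<Phi>_zero_order_lower:
  defines "q \<equiv> (g x *v Z x) \<bullet> Z x" and "N \<equiv> g x *v Z x"
  shows "b x ^ 3 * (lam\<^sup>2 / 2 * \<epsilon> * (\<sigma> x)\<^sup>2) \<le> (\<Phi> x *v N) \<bullet> N - b x * (M + \<epsilon>) * q"
proof -
  define a where "a = (g x *v z x) \<bullet> z x"
  define t where "t = \<sigma> x powr (- 2) * a"
  have a: "a = t * (\<sigma> x)\<^sup>2" using w(1) by (simp add: t_def)
  have s2: "(\<sigma> x)\<^sup>2 > 0" using s by simp
  have tm: "m \<le> t"
  proof -
    have "m * (\<sigma> x)\<^sup>2 \<le> t * (\<sigma> x)\<^sup>2" using g_G(1)[OF x(2), of "z x"] a G_z by (simp add: a_def)
    then show ?thesis using s2 by (simp only: mult_le_cancel_right_pos)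
  qed
  have N: "N = (- b x) *\<^sub>R (g x *v z x)" by (simp only: N_def Z_def matrix_vector_mult_scaleR)
  have q: "q = (b x)\<^sup>2 * a" 
  proof -
    have "q = N \<bullet> Z x" by (simp only: q_def N_def)
    then show ?thesis unfolding N Z_def by (simp add: a_def power2_eq_square)
  qed
  have gg: "(\<Gamma> *v (g x *v z x)) \<bullet> (g x *v z x) \<le> (m + M) * a - m * M * (\<sigma> x)\<^sup>2"
    using inverse_form_le'[OF g_sym G_sym g_G(1)[OF x(2)] g_G(2)[OF x(2)] G_inv \<Gamma>_psd mM(2), of "z x"]
    by (simp add: a_def G_z)
  have zg: "z x \<bullet> (g x *v z x) = a" by (simp add: a_def inner_commute)
  have "m * \<epsilon> \<le> (\<beta> + 2) * t\<^sup>2 - (m + M) * t + m * M - (M + \<epsilon>) * t"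
  proof -
    have "0 \<le> (\<beta> + 2) * (t + m) - (m + 2 * M + \<epsilon>)"
    proof -
      have "(\<beta> + 2) * (2 * m) \<le> (\<beta> + 2) * (t + m)" using tm \<beta> by (intro mult_left_mono) auto
      moreover have "(\<beta> + 2) * (2 * m) = 2 * ((\<beta> + 1) * m) + 2 * m" by (simp add: algebra_simps)
      ultimately show ?thesis using gap \<epsilon> m_M_pos by linarith
    qed
    then have "0 \<le> (t - m) * ((\<beta> + 2) * (t + m) - (m + 2 * M + \<epsilon>))" using tm by simp
    moreover have "m * \<epsilon> \<le> m * ((\<beta> + 1) * m - M - \<epsilon>)" using gap m_M_pos by (intro mult_left_mono) auto
    moreover have "(\<beta> + 2) * t\<^sup>2 - (m + M) * t + m * M - (M + \<epsilon>) * t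
      = (t - m) * ((\<beta> + 2) * (t + m) - (m + 2 * M + \<epsilon>)) + m * ((\<beta> + 1) * m - M - \<epsilon>)"
      by (simp add: algebra_simps power2_eq_square)
    ultimately show ?thesis by linarith
  qed
  moreover have "lam\<^sup>2 / 2 * \<epsilon> \<le> m * \<epsilon>" using mM \<epsilon> by (intro mult_right_mono) auto
  ultimately have "lam\<^sup>2 / 2 * \<epsilon> * (\<sigma> x)\<^sup>2 \<le> ((\<beta> + 2) * t\<^sup>2 - (m + M) * t + m * M - (M + \<epsilon>) * t) * (\<sigma> x)\<^sup>2"
    by (intro mult_right_mono) auto
  also have "\<dots> = (\<beta> + 2) * (\<sigma> x powr (- 2) * a * a) - ((m + M) * a - m * M * (\<sigma> x)\<^sup>2) - (M + \<epsilon>) * a"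
  proof -
    have ta: "\<sigma> x powr (- 2) * a * a = t * a" by (simp only: t_def)
    show ?thesis unfolding ta unfolding a by (simp add: algebra_simps power2_eq_square)
  qed
  also have "\<dots> \<le> (\<beta> + 2) * (\<sigma> x powr (- 2) * a * a) - (\<Gamma> *v (g x *v z x)) \<bullet> (g x *v z x) - (M + \<epsilon>) * a"
    using gg by linarith
  finally have "b x ^ 3 * (lam\<^sup>2 / 2 * \<epsilon> * (\<sigma> x)\<^sup>2) \<le> b x ^ 3 * \<dots>"
    using b_pos[OF x(1)] by (intro mult_left_mono) auto
  also have "\<dots> = (\<Phi> x *v N) \<bullet> N - b x * (M + \<epsilon>) * q"
    unfolding N q \<Phi>_mv matrix_vector_mult_scaleR inner_scaleR_left inner_scaleR_right inner_diff_left zg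
    by (simp add: zg[unfolded inner_commute[of "z x"]] algebra_simps power2_eq_square power3_eq_cube)
  finally show ?thesis .
qed


text \<open>The two preceding bounds give the positive terms. Everything else either has an additional factor \<open>\<sigma>\<close> or
has a lower power of \<open>\<tau>\<close>.\<close>

lemma rellich_form_lower:
  assumes \<tau>: "0 < \<tau>"
  shows "\<tau> * b x * (4 * \<epsilon> * lam - \<sigma> x * C4) * (norm (p x))\<^sup>2
     + \<tau>^3 * b x ^ 3 * (\<sigma> x)\<^sup>2 * (2 * lam\<^sup>2 * \<epsilon> - \<sigma> x * C5) * (f x)\<^sup>2
     - 2 * \<tau> * (b x * (Cd / \<sigma> x)) * K * \<bar>f x\<bar> * norm (p x) - \<tau>\<^sup>2 * (b x)\<^sup>2 * Cm\<^sup>2 * (f x)\<^sup>2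
     \<le> rellich_form \<tau> f p Z \<Phi> mlt dmlt x"
proof -
  define V N q E where "V = g x *v p x" "N = g x *v Z x" "q = (g x *v Z x) \<bullet> Z x" "E = (g x *v p x) \<bullet> p x"
  have b: "b x > 0" by (rule b_pos[OF x(1)])
  have E: "lam * (norm (p x))\<^sup>2 \<le> E" "0 \<le> E" using g_lower g_psd by (auto simp: V_N_q_E_def)
  have nV: "norm V \<le> K * norm (p x)" unfolding V_N_q_E_def by (rule norm_g_mv)
  have E': "\<bar>E\<bar> \<le> K * norm (p x) * norm (p x)"
    unfolding V_N_q_E_def(4) using abs_inner_leI[OF norm_g_mv order_refl] .
  have nZ: "norm (Z x) \<le> b x * (K * \<sigma> x)" unfolding Z_def using b by (intro norm_scaleR_leI norm_z) auto
  have nN: "norm N \<le> K * (b x * (K * \<sigma> x))" unfolding V_N_q_E_def(2)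
    using norm_g_mv[of x "Z x"] mult_left_mono[OF nZ K0] by linarith
  have q': "\<bar>q\<bar> \<le> K * (b x * (K * \<sigma> x)) * (b x * (K * \<sigma> x))"
    using abs_inner_leI[OF nN nZ] by (simp add: V_N_q_E_def)
  have ng': "norm (g' x v) \<le> K * B" if "norm v \<le> B" for v B
    using g'_bound[of x v] mult_mono[OF K(2) that K0 norm_ge_zero] by linarith
  define R1 where "R1 = 2 * ((g' x V *v Z x) \<bullet> p x) - (g' x N *v p x) \<bullet> p x"
  define R2 where "R2 = (g' x N *v Z x) \<bullet> Z x"
  have R1: "\<bar>R1\<bar> \<le> 2 * (K * (K * norm (p x)) * (b x * (K * \<sigma> x)) * norm (p x)) + K * (K * (b x * (K * \<sigma> x))) * norm (p x) * norm (p x)"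
    unfolding R1_def by (intro abs_diff_leI abs_mult_leI abs_inner_leI norm_mv_leI ng' nV nZ nN order_refl) simp
  have R2: "\<bar>R2\<bar> \<le> K * (K * (b x * (K * \<sigma> x))) * (b x * (K * \<sigma> x)) * (b x * (K * \<sigma> x))"
    unfolding R2_def by (intro abs_inner_leI norm_mv_leI ng' nZ nN)
  have D: "dv x (Z x) + g x \<bullet> \<Phi> x = e1 + mlt x - 2 * b x * (M + \<epsilon>)" by (simp add: e1_def)
  define Y where "Y = (\<Phi> x *v N) \<bullet> N - b x * (M + \<epsilon>) * q"
  have Y: "b x ^ 3 * (lam\<^sup>2 / 2 * \<epsilon> * (\<sigma> x)\<^sup>2) \<le> Y"
    using \<Phi>_zero_order_lower by (simp add: Y_def V_N_q_E_def)
  define W where "W = (\<Phi> x *v V) \<bullet> V + b x * M * E"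
  have W: "0 \<le> W" using \<Phi>_gradient_lower[of "p x"] by (simp add: W_def V_N_q_E_def)
  have fm: "\<bar>f x * (dmlt x \<bullet> V)\<bar> \<le> \<bar>f x\<bar> * (b x * (Cd / \<sigma> x) * (K * norm (p x)))"
    by (intro abs_mult_leI abs_inner_leI norm_dmlt_le nV) simp
  have form: "rellich_form \<tau> f p Z \<Phi> mlt dmlt x =
      4 * \<tau> * W + 4 * \<tau> * (b x * \<epsilon> * E) - 2 * \<tau> * (e1 * E) + 2 * \<tau> * (f x * (dmlt x \<bullet> V))
      + 4 * \<tau>^3 * Y * (f x)\<^sup>2 + 2 * \<tau>^3 * (e1 * q) * (f x)\<^sup>2 + 2 * \<tau> * R1 + 2 * \<tau>^3 * R2 * (f x)\<^sup>2
      - \<tau>\<^sup>2 * (mlt x)\<^sup>2 * (f x)\<^sup>2"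
    unfolding rellich_form_def Let_def D V_N_q_E_def(1,2)[symmetric] R1_def[symmetric] R2_def[symmetric]
      W_def Y_def V_N_q_E_def(4)[folded V_N_q_E_def(1), symmetric] V_N_q_E_def(3)[folded V_N_q_E_def(2), symmetric]
    by (simp add: algebra_simps)
  have t1: "4 * \<tau> * (b x * \<epsilon> * (lam * (norm (p x))\<^sup>2)) \<le> 4 * \<tau> * (b x * \<epsilon> * E)"
    using \<tau> b \<epsilon> E by (intro mult_left_mono) auto
  have t2: "2 * \<tau> * (e1 * E) \<le> 2 * \<tau> * (b x * (\<sigma> x * (Ce * K\<^sup>2)) * (K * norm (p x) * norm (p x)))"
    using abs_mult_leI[OF abs_e1_le E'] \<tau> by (intro mult_left_mono) auto
  have t3: "- (2 * \<tau> * (\<bar>f x\<bar> * (b x * (Cd / \<sigma> x) * (K * norm (p x))))) \<le> 2 * \<tau> * (f x * (dmlt x \<bullet> V))"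
    using mult_left_mono[of "- (\<bar>f x\<bar> * (b x * (Cd / \<sigma> x) * (K * norm (p x))))" "f x * (dmlt x \<bullet> V)" "2 * \<tau>"] fm \<tau> by (simp add: abs_le_iff)
  have t4: "4 * \<tau>^3 * (b x ^ 3 * (lam\<^sup>2 / 2 * \<epsilon> * (\<sigma> x)\<^sup>2)) * (f x)\<^sup>2 \<le> 4 * \<tau>^3 * Y * (f x)\<^sup>2"
    using \<tau> Y by (intro mult_right_mono mult_left_mono) auto
  have t5: "- (2 * \<tau>^3 * (b x * (\<sigma> x * (Ce * K\<^sup>2)) * (K * (b x * (K * \<sigma> x)) * (b x * (K * \<sigma> x)))) * (f x)\<^sup>2) \<le> 2 * \<tau>^3 * (e1 * q) * (f x)\<^sup>2"
  proof -
    have "- (b x * (\<sigma> x * (Ce * K\<^sup>2)) * (K * (b x * (K * \<sigma> x)) * (b x * (K * \<sigma> x)))) \<le> e1 * q"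
      using abs_mult_leI[OF abs_e1_le q'] by (simp add: abs_le_iff)
    then have "2 * \<tau>^3 * (- (b x * (\<sigma> x * (Ce * K\<^sup>2)) * (K * (b x * (K * \<sigma> x)) * (b x * (K * \<sigma> x))))) * (f x)\<^sup>2 \<le> 2 * \<tau>^3 * (e1 * q) * (f x)\<^sup>2"
      using \<tau> by (intro mult_right_mono mult_left_mono) auto
    then show ?thesis by simp
  qed
  have t6: "- (2 * \<tau> * (2 * (K * (K * norm (p x)) * (b x * (K * \<sigma> x)) * norm (p x)) + K * (K * (b x * (K * \<sigma> x))) * norm (p x) * norm (p x))) \<le> 2 * \<tau> * R1"
  proof -
    have "- (2 * (K * (K * norm (p x)) * (b x * (K * \<sigma> x)) * norm (p x)) + K * (K * (b x * (K * \<sigma> x))) * norm (p x) * norm (p x)) \<le> R1" using R1 by linarith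
    from mult_left_mono[OF this, of "2 * \<tau>"] \<tau> show ?thesis by (simp only: mult_minus_right)
  qed
  have t7: "- (2 * \<tau>^3 * (K * (K * (b x * (K * \<sigma> x))) * (b x * (K * \<sigma> x)) * (b x * (K * \<sigma> x))) * (f x)\<^sup>2) \<le> 2 * \<tau>^3 * R2 * (f x)\<^sup>2"
  proof -
    have "2 * \<tau>^3 * (- (K * (K * (b x * (K * \<sigma> x))) * (b x * (K * \<sigma> x)) * (b x * (K * \<sigma> x)))) * (f x)\<^sup>2 \<le> 2 * \<tau>^3 * R2 * (f x)\<^sup>2"
      using R2 \<tau> by (intro mult_right_mono mult_left_mono) auto
    then show ?thesis by simp
  qed
  have t8: "\<tau>\<^sup>2 * (mlt x)\<^sup>2 * (f x)\<^sup>2 \<le> \<tau>\<^sup>2 * ((b x)\<^sup>2 * Cm\<^sup>2) * (f x)\<^sup>2"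
  proof -
    have "\<bar>mlt x\<bar> \<le> b x * Cm" unfolding mlt_def by (intro abs_mult_leI abs_\<mu>_le) (use b in auto)
    then have "(mlt x)\<^sup>2 \<le> (b x * Cm)\<^sup>2" by (metis abs_ge_zero power2_abs power_mono)
    then show ?thesis by (intro mult_right_mono mult_left_mono) (auto simp: power_mult_distrib)
  qed
  have t0: "0 \<le> 4 * \<tau> * W" using W \<tau> by simp
  have "\<tau> * b x * (4 * \<epsilon> * lam - \<sigma> x * C4) * (norm (p x))\<^sup>2
     + \<tau>^3 * b x ^ 3 * (\<sigma> x)\<^sup>2 * (2 * lam\<^sup>2 * \<epsilon> - \<sigma> x * C5) * (f x)\<^sup>2
     - 2 * \<tau> * (b x * (Cd / \<sigma> x)) * K * \<bar>f x\<bar> * norm (p x) - \<tau>\<^sup>2 * (b x)\<^sup>2 * Cm\<^sup>2 * (f x)\<^sup>2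
   = 4 * \<tau> * (b x * \<epsilon> * (lam * (norm (p x))\<^sup>2)) - 2 * \<tau> * (b x * (\<sigma> x * (Ce * K\<^sup>2)) * (K * norm (p x) * norm (p x)))
    - (2 * \<tau> * (\<bar>f x\<bar> * (b x * (Cd / \<sigma> x) * (K * norm (p x)))))
    + 4 * \<tau>^3 * (b x ^ 3 * (lam\<^sup>2 / 2 * \<epsilon> * (\<sigma> x)\<^sup>2)) * (f x)\<^sup>2
    - (2 * \<tau>^3 * (b x * (\<sigma> x * (Ce * K\<^sup>2)) * (K * (b x * (K * \<sigma> x)) * (b x * (K * \<sigma> x)))) * (f x)\<^sup>2)
    - (2 * \<tau> * (2 * (K * (K * norm (p x)) * (b x * (K * \<sigma> x)) * norm (p x)) + K * (K * (b x * (K * \<sigma> x))) * norm (p x) * norm (p x)))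
    - (2 * \<tau>^3 * (K * (K * (b x * (K * \<sigma> x))) * (b x * (K * \<sigma> x)) * (b x * (K * \<sigma> x))) * (f x)\<^sup>2)
    - \<tau>\<^sup>2 * ((b x)\<^sup>2 * Cm\<^sup>2) * (f x)\<^sup>2"
    unfolding C4_def C5_def by (simp add: algebra_simps power2_eq_square power3_eq_cube eval_nat_numeral)
  then show ?thesis unfolding form using t0 t1 t2 t3 t4 t5 t6 t7 t8 by linarith
qed

end

end

section \<open>The weighted estimate for first derivatives\<close>

definition outer2 :: "real^'n \<Rightarrow> real^'n \<Rightarrow> real^'n::finite^'n" where
  "outer2 v w = (\<chi> i j. v $ i * w $ j)"

lemma outer2_mv: "outer2 v w *v h = (w \<bullet> h) *\<^sub>R v"
  by (simp add: outer2_def matrix_vector_mult_def vec_eq_iff inner_vec_def sum_distrib_right sum_distrib_left mult_ac)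

lemma inner_outer2: "A \<bullet> outer2 v w = (A *v w) \<bullet> v"
  by (simp add: outer2_def matrix_vector_mult_def inner_vec_def sum_distrib_right sum_distrib_left mult_ac)

lemma transpose_outer2: "transpose (outer2 v w) = outer2 w v"
  by (simp add: outer2_def transpose_def vec_eq_iff mult.commute)

lemma continuous_on_outer2[continuous_intros]:
  "continuous_on S v \<Longrightarrow> continuous_on S w \<Longrightarrow> continuous_on S (\<lambda>x. outer2 (v x) (w x))"
  unfolding outer2_def by (intro continuous_intros)

lemma outer_eq_outer2: "outer v = outer2 v v"
  by (simp add: outer_def outer2_def)

context carleman_weight
begin

text \<open>\<open>C8\<close> bounds the difference between the conjugated operator \<open>full_conj\<close> and its principal part \<open>conj_op\<close>.\<close>

definition C8 where "C8 = K * K + 2 * K^3 + (3 * K^4 + K^7 + K^5 + K * (K^7 + 2 * K^3))"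
definition c1 where "c1 = lam\<^sup>2 * \<epsilon>"

text \<open>Since \<open>\<tau> b \<sigma>\<^sup>2 \<ge> \<tau> \<beta>\<close>, a lower bound \<open>T\<close> for \<open>\<tau> \<beta>\<close> makes the terms with lower powers of \<open>\<tau>\<close> small
against the main terms. The three conditions are those of the mixed term of \<open>f\<close> and its gradient, of the square
of the multiplier, and of the terms outside the principal part.\<close>

definition admissible_threshold where
  "admissible_threshold T \<longleftrightarrow> 1 \<le> T \<and> 4 * ((Cd * K)\<^sup>2 / (\<epsilon> * lam)) \<le> c1 * T \<and> 4 * Cm\<^sup>2 \<le> c1 * T \<and> 8 * C8\<^sup>2 \<le> c1 * T"

text \<open>\<open>\<zeta>\<close> is the logarithmic gradient of the weight \<open>ew\<close> below, and \<open>D\<zeta>\<close> is its derivative.\<close>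

definition \<zeta> where "\<zeta> \<tau> k x = \<tau> *\<^sub>R Z x + (k * \<sigma> x powr (- 2)) *\<^sub>R z x"
definition D\<zeta> where "D\<zeta> \<tau> k x = \<tau> *\<^sub>R \<Phi> x + k *\<^sub>R (\<sigma> x powr (- 2) *\<^sub>R \<Gamma> - (2 * \<sigma> x powr (- 4)) *\<^sub>R outer (z x))"

text \<open>The operator \<open>e\<^sup>\<chi> L (e\<^sup>-\<^sup>\<chi> f)\<close> for a function \<open>\<chi>\<close> with gradient \<open>\<zeta>\<close>.\<close>

definition full_conj where
  "full_conj \<tau> k f p H x = g x \<bullet> H x - 2 * ((g x *v \<zeta> \<tau> k x) \<bullet> p x)
     + f x * ((g x *v \<zeta> \<tau> k x) \<bullet> \<zeta> \<tau> k x - g x \<bullet> D\<zeta> \<tau> k x)"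

lemma c1_pos: "0 < c1" using lam \<epsilon> by (simp add: c1_def)

lemma has_derivative_\<zeta>:
  assumes "x \<noteq> 0"
  shows "(\<zeta> \<tau> k has_derivative (\<lambda>h. D\<zeta> \<tau> k x *v h)) (at x)"
  unfolding \<zeta>_def[abs_def]
  by (rule has_derivative_eq_rhs[OF has_derivative_add[OF has_derivative_scaleR_right[OF has_derivative_Z[OF assms]]
    has_derivative_scaleR[OF has_derivative_mult_right[OF has_derivative_\<sigma>_powr[OF assms]] has_derivative_z]]])
    (simp add: fun_eq_iff D\<zeta>_def matrix_vector_mult_add_rdistrib matrix_vector_mult_diff_rdistrib scaleR_matrix_vector_assoc[symmetric] outer_mv z_def[symmetric] scaleR_right_diff_distrib mult_ac)

lemma transpose_D\<zeta>: "transpose (D\<zeta> \<tau> k x) = D\<zeta> \<tau> k x"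
  using transpose_\<Phi>[of x] \<Gamma>_sym transpose_outer[of "z x"] by (simp add: D\<zeta>_def transpose_def vec_eq_iff)

lemma continuous_weights[continuous_intros]:
  "continuous_on (- {0}) z" "continuous_on (- {0}) b" "continuous_on (- {0}) Z" "continuous_on (- {0}) \<Phi>"
  "continuous_on (- {0}) \<mu>" "continuous_on (- {0}) mlt" "continuous_on (- {0}) dmlt"
  "continuous_on (- {0}) (\<zeta> \<tau> k)" "continuous_on (- {0}) (D\<zeta> \<tau> k)"
proof -
  show z: "continuous_on (- {0}) z" unfolding z_def[abs_def] by (intro continuous_intros)
  show b: "continuous_on (- {0}) b" unfolding b_def[abs_def] by (intro continuous_intros)
  show Z: "continuous_on (- {0}) Z" unfolding Z_def[abs_def] by (intro continuous_intros z b)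
  show \<Phi>: "continuous_on (- {0}) \<Phi>" unfolding \<Phi>_def[abs_def] outer_eq_outer2 by (intro continuous_intros z b)
  show \<mu>: "continuous_on (- {0}) \<mu>" unfolding \<mu>_def[abs_def] by (intro continuous_intros z b)
  show "continuous_on (- {0}) mlt" unfolding mlt_def[abs_def] by (intro continuous_intros \<mu> b)
  show "continuous_on (- {0}) dmlt" unfolding dmlt_def[abs_def] by (intro continuous_intros \<mu> z b)
  show "continuous_on (- {0}) (\<zeta> \<tau> k)" unfolding \<zeta>_def[abs_def] by (intro continuous_intros Z z)
  show "continuous_on (- {0}) (D\<zeta> \<tau> k)" unfolding D\<zeta>_def[abs_def] outer_eq_outer2 by (intro continuous_intros \<Phi> z)
qed

lemma \<tau>b_ge:
  assumes x: "x \<noteq> 0" "\<sigma> x < r" and \<tau>: "0 < \<tau>"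
  shows "\<tau> * \<beta> \<le> \<tau> * b x * (\<sigma> x)\<^sup>2"
proof -
  have s: "0 < \<sigma> x" "\<sigma> x < 1" by (rule s[OF x])+
  have "1 \<le> \<sigma> x powr (- \<beta>)" using s \<beta> by (simp add: powr_minus one_le_inverse powr_le1)
  moreover have "\<sigma> x powr (- \<beta> - 2) * (\<sigma> x)\<^sup>2 = \<sigma> x powr (- \<beta>)"
  proof -
    have "(\<sigma> x)\<^sup>2 = \<sigma> x powr 2" using s powr_realpow[of "\<sigma> x" 2] by simp
    then show ?thesis by (simp only: powr_add[symmetric]) simp
  qed
  ultimately have "\<beta> \<le> b x * (\<sigma> x)\<^sup>2" using \<beta> by (simp add: b_def mult.assoc)
  then show ?thesis using \<tau> by (simp add: mult.assoc)
qed

text \<open>The mixed term is split by Young's inequality, and \<open>\<tau> b \<sigma>\<^sup>2 \<ge> T\<close> absorbs what it leaves at zero order.\<close>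

lemma rellich_form_positive:
  assumes x: "x \<noteq> 0" "\<sigma> x < r" and \<tau>: "0 < \<tau>" and T: "admissible_threshold T" "T \<le> \<tau> * \<beta>"
    and r4: "r * C4 \<le> \<epsilon> * lam" and r5: "r * C5 \<le> c1 / 2"
  shows "c1 * (\<tau> * b x * (norm (p x))\<^sup>2 + (\<tau> * b x)^3 * (\<sigma> x)\<^sup>2 * (f x)\<^sup>2) \<le> rellich_form \<tau> f p Z \<Phi> mlt dmlt x"
proof -
  define A s P F D where "A = \<tau> * b x" "s = \<sigma> x" "P = norm (p x)" "F = \<bar>f x\<bar>" "D = Cd * K"
  have s: "0 < s" "s < r" using \<sigma>_pos x by (auto simp: A_s_P_F_D_def)
  have A: "0 < A" using b_pos x \<tau> by (simp add: A_s_P_F_D_def)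
  have PF: "0 \<le> P" "0 \<le> F" by (auto simp: A_s_P_F_D_def)
  have As: "T \<le> A * s\<^sup>2" "1 \<le> A * s\<^sup>2" using \<tau>b_ge[OF x \<tau>] T by (auto simp: A_s_P_F_D_def admissible_threshold_def)
  have "T * 1 \<le> (A * s\<^sup>2) * (A * s\<^sup>2)" using As T by (intro mult_mono) (auto simp: admissible_threshold_def)
  then have As2: "T \<le> (A * s\<^sup>2)\<^sup>2" by (simp add: power2_eq_square)
  have el: "0 < \<epsilon> * lam" using \<epsilon> lam by simp
  have C0: "0 \<le> C4" "0 \<le> C5" using K0 by (simp_all add: C4_def C5_def Ce_def)
  have c4: "s * C4 \<le> \<epsilon> * lam" using mult_right_mono[of s r C4] s C0 r4 by linarith
  have c5: "s * C5 \<le> c1 / 2" using mult_right_mono[of s r C5] s C0 r5 by linarith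
  have 1: "A * (3 * \<epsilon> * lam) * P\<^sup>2 \<le> A * (4 * \<epsilon> * lam - s * C4) * P\<^sup>2"
    using A c4 by (intro mult_right_mono mult_left_mono) auto
  have 2: "A^3 * s\<^sup>2 * (3/2 * c1) * F\<^sup>2 \<le> A^3 * s\<^sup>2 * (2 * lam\<^sup>2 * \<epsilon> - s * C5) * F\<^sup>2"
    using A c5 by (intro mult_right_mono mult_left_mono) (auto simp: c1_def mult.commute)
  have 3: "2 * A * (D / s) * F * P \<le> A * (\<epsilon> * lam) * P\<^sup>2 + A^3 * s\<^sup>2 * (c1 / 4) * F\<^sup>2"
  proof -
    define e where "e = sqrt (\<epsilon> * lam)"
    have e: "e > 0" "e\<^sup>2 = \<epsilon> * lam" using el by (simp_all add: e_def)
    have "0 \<le> (e * P - D / s * F / e)\<^sup>2" by simp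
    also have "\<dots> = e\<^sup>2 * P\<^sup>2 + (D\<^sup>2 / e\<^sup>2) / s\<^sup>2 * F\<^sup>2 - 2 * (D / s) * F * P"
      using e(1) s(1) by (simp add: field_simps power2_eq_square)
    also have "\<dots> = \<epsilon> * lam * P\<^sup>2 + (D\<^sup>2 / (\<epsilon> * lam)) / s\<^sup>2 * F\<^sup>2 - 2 * (D / s) * F * P" by (simp only: e(2))
    finally have "2 * (D / s) * F * P \<le> \<epsilon> * lam * P\<^sup>2 + (D\<^sup>2 / (\<epsilon> * lam)) / s\<^sup>2 * F\<^sup>2" by simp
    also have "(D\<^sup>2 / (\<epsilon> * lam)) / s\<^sup>2 \<le> A\<^sup>2 * s\<^sup>2 * (c1 / 4)"
    proof -
      have "4 * (D\<^sup>2 / (\<epsilon> * lam)) \<le> c1 * T" using T by (simp add: admissible_threshold_def A_s_P_F_D_def)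
      also have "\<dots> \<le> c1 * (A * s\<^sup>2)\<^sup>2" using As2 c1_pos by (intro mult_left_mono) auto
      finally have "D\<^sup>2 / (\<epsilon> * lam) \<le> c1 * (A * s\<^sup>2)\<^sup>2 / 4" by linarith
      then have "(D\<^sup>2 / (\<epsilon> * lam)) / s\<^sup>2 \<le> (c1 * (A * s\<^sup>2)\<^sup>2 / 4) / s\<^sup>2" by (rule divide_right_mono) simp
      also have "\<dots> = A\<^sup>2 * s\<^sup>2 * (c1 / 4)" using s by (simp add: field_simps power2_eq_square)
      finally show ?thesis .
    qed
    finally have "2 * (D / s) * F * P \<le> \<epsilon> * lam * P\<^sup>2 + A\<^sup>2 * s\<^sup>2 * (c1 / 4) * F\<^sup>2"
      by (simp add: mult_right_mono)
    from mult_left_mono[OF this less_imp_le[OF A]] show ?thesis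
      by (simp add: algebra_simps power2_eq_square power3_eq_cube)
  qed
  have 4: "A\<^sup>2 * Cm\<^sup>2 * F\<^sup>2 \<le> A^3 * s\<^sup>2 * (c1 / 4) * F\<^sup>2"
  proof -
    have "4 * Cm\<^sup>2 \<le> c1 * (A * s\<^sup>2)" using T mult_left_mono[OF As(1) less_imp_le[OF c1_pos]] unfolding admissible_threshold_def by linarith
    then have "Cm\<^sup>2 \<le> A * s\<^sup>2 * (c1 / 4)" by (simp add: field_simps)
    then have "A\<^sup>2 * Cm\<^sup>2 * F\<^sup>2 \<le> A\<^sup>2 * (A * s\<^sup>2 * (c1 / 4)) * F\<^sup>2" by (intro mult_right_mono mult_left_mono) auto
    then show ?thesis by (simp add: power2_eq_square power3_eq_cube mult_ac)
  qed
  have 5: "A * c1 * P\<^sup>2 \<le> A * (2 * \<epsilon> * lam) * P\<^sup>2"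
  proof -
    have "lam * lam \<le> lam * 1" using lam by (intro mult_left_mono) auto
    then have "c1 \<le> \<epsilon> * lam" using \<epsilon> by (simp add: c1_def power2_eq_square mult.commute)
    also have "\<dots> \<le> 2 * \<epsilon> * lam" using el by simp
    finally show ?thesis using A by (intro mult_right_mono mult_left_mono) auto
  qed
  have "c1 * (A * P\<^sup>2 + A^3 * s\<^sup>2 * F\<^sup>2) \<le> A * (4 * \<epsilon> * lam - s * C4) * P\<^sup>2
      + A^3 * s\<^sup>2 * (2 * lam\<^sup>2 * \<epsilon> - s * C5) * F\<^sup>2 - 2 * A * (D / s) * F * P - A\<^sup>2 * Cm\<^sup>2 * F\<^sup>2"
    using 1 2 3 4 5 by (simp add: algebra_simps)
  also have "\<dots> \<le> rellich_form \<tau> f p Z \<Phi> mlt dmlt x"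
    using rellich_form_lower[OF x \<tau>, of p f] unfolding A_s_P_F_D_def by (simp add: power_mult_distrib mult_ac)
  finally show ?thesis by (simp add: A_s_P_F_D_def)
qed

text \<open>The two operators differ by \<open>P / \<sigma>\<close> and \<open>\<tau> b |f|\<close>, up to a constant, with \<open>P\<close> the length of the gradient. The squares
of these are smaller than the terms of the Rellich form by the factor \<open>\<tau> b \<sigma>\<^sup>2\<close>.\<close>

lemma full_conj_lower:
  assumes x: "x \<noteq> 0" "\<sigma> x < r" and \<tau>: "0 < \<tau>" and T: "admissible_threshold T" "T \<le> \<tau> * \<beta>" and k: "\<bar>k\<bar> \<le> K"
  shows "(conj_op \<tau> f p H Z x)\<^sup>2 - c1 / 2 * (\<tau> * b x * (norm (p x))\<^sup>2 + (\<tau> * b x)^3 * (\<sigma> x)\<^sup>2 * (f x)\<^sup>2)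
     \<le> 2 * (full_conj \<tau> k f p H x)\<^sup>2"
proof -
  define A s P F where "A = \<tau> * b x" "s = \<sigma> x" "P = norm (p x)" "F = \<bar>f x\<bar>"
  have s: "0 < s" "s < 1" using s[OF x] by (auto simp: A_s_P_F_def)
  have A: "0 < A" using b_pos x \<tau> by (simp add: A_s_P_F_def)
  have b: "0 < b x" using b_pos x by simp
  have As: "T \<le> A * s\<^sup>2" "1 \<le> A * s\<^sup>2" using \<tau>b_ge[OF x \<tau>] T by (auto simp: A_s_P_F_def admissible_threshold_def)
  note w = w[OF x, folded A_s_P_F_def(2)]
  have PF: "0 \<le> P" "0 \<le> F" by (auto simp: A_s_P_F_def)
  define gz where "gz = (g x *v z x) \<bullet> z x"
  have gz: "\<bar>gz\<bar> \<le> K^3 * s\<^sup>2" using gz_le[of x x] by (simp add: gz_def A_s_P_F_def)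
  define err where "err = full_conj \<tau> k f p H x - conj_op \<tau> f p H Z x"
  have err: "err = - dv x (p x) - 2 * (k * (s powr (- 2) * ((g x *v z x) \<bullet> p x)))
     + f x * (- (2 * \<tau> * (k * (s powr (- 2) * (b x * gz)))) + k * (k * (s powr (- 4) * gz))
       - (\<tau> * (b x * ((\<beta> + 2) * (s powr (- 2) * gz) - g x \<bullet> \<Gamma>)) + k * (s powr (- 2) * (g x \<bullet> \<Gamma>) - 2 * s powr (- 4) * gz)))"
  proof -
    have "s powr (- 2) * s powr (- 2) = s powr (- 4)" by (simp add: powr_add[symmetric])
    then have w2: "s powr (- 2) * (s powr (- 2) * y) = s powr (- 4) * y" for y by (simp flip: mult.assoc)
    have gsym: "(g x *v Z x) \<bullet> z x = (g x *v z x) \<bullet> Z x" by (rule inner_mv_sym[OF g_sym])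
    note w3 = \<open>s powr (- 2) * s powr (- 2) = s powr (- 4)\<close>
    have \<zeta>\<zeta>: "(g x *v \<zeta> \<tau> k x) \<bullet> \<zeta> \<tau> k x = \<tau>\<^sup>2 * ((g x *v Z x) \<bullet> Z x) + 2 * (\<tau> * (k * (s powr (- 2) * ((g x *v z x) \<bullet> Z x)))) + k * (k * (s powr (- 4) * gz))"
      unfolding \<zeta>_def A_s_P_F_def(2)[symmetric] matrix_vector_right_distrib matrix_vector_mult_scaleR inner_add_left inner_add_right
        inner_scaleR_left inner_scaleR_right gsym gz_def[symmetric]
      by (simp add: algebra_simps power2_eq_square w2 w3)
    have Zz: "(g x *v z x) \<bullet> Z x = - (b x * gz)" by (simp add: Z_def gz_def)
    have \<zeta>p: "(g x *v \<zeta> \<tau> k x) \<bullet> p x = \<tau> * ((g x *v Z x) \<bullet> p x) + k * (s powr (- 2) * ((g x *v z x) \<bullet> p x))"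
      unfolding \<zeta>_def A_s_P_F_def(2)[symmetric] matrix_vector_right_distrib matrix_vector_mult_scaleR inner_add_left inner_scaleR_left by simp
    have gD: "g x \<bullet> D\<zeta> \<tau> k x = \<tau> * (b x * ((\<beta> + 2) * (s powr (- 2) * gz) - g x \<bullet> \<Gamma>)) + k * (s powr (- 2) * (g x \<bullet> \<Gamma>) - 2 * s powr (- 4) * gz)"
      unfolding D\<zeta>_def \<Phi>_def A_s_P_F_def(2)[symmetric] inner_add_right inner_diff_right inner_scaleR_right inner_outer gz_def[symmetric] by simp
    show ?thesis unfolding err_def full_conj_def conj_op_def \<zeta>\<zeta> \<zeta>p gD Zz by (simp add: algebra_simps)
  qed
  have dvp: "\<bar>dv x (p x)\<bar> \<le> K * (K * P)"
    using abs_dv_le[of x "p x"] mult_mono[OF K(3) mult_right_mono[OF K(2), of P]] K0 Lam PF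
    by (auto simp: A_s_P_F_def intro: order_trans)
  have w1: "\<bar>s powr (- 2)\<bar> \<le> 1 / s\<^sup>2" "\<bar>s powr (- 4)\<bar> \<le> 1 / s^4" using w by simp_all
  have gzp: "\<bar>(g x *v z x) \<bullet> p x\<bar> \<le> K * (K * s) * P"
    unfolding A_s_P_F_def(3)
  proof (rule abs_inner_leI[OF _ order_refl])
    show "norm (g x *v z x) \<le> K * (K * s)"
      using norm_g_mv[of x "z x"] mult_left_mono[OF norm_z[of x] K0] by (simp add: A_s_P_F_def)
  qed
  have g\<Gamma>: "\<bar>g x \<bullet> \<Gamma>\<bar> \<le> K^3 * K^4" by (rule abs_inner_leI[OF norm_g norm_\<Gamma>_K])
  have "\<bar>err\<bar> \<le> K * (K * P) + 2 * (K * (1 / s\<^sup>2 * (K * (K * s) * P)))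
     + F * ((2 * \<tau> * (K * (1 / s\<^sup>2 * (b x * (K^3 * s\<^sup>2))))) + K * (K * (1 / s^4 * (K^3 * s\<^sup>2)))
       + (\<tau> * (b x * (K * (1 / s\<^sup>2 * (K^3 * s\<^sup>2)) + K^3 * K^4)) + K * (1 / s\<^sup>2 * (K^3 * K^4) + 2 * (1 / s^4) * (K^3 * s\<^sup>2))))"
  proof -
    have kk: "\<bar>2 * \<tau>\<bar> \<le> 2 * \<tau>" "\<bar>b x\<bar> \<le> b x" "\<bar>\<tau>\<bar> \<le> \<tau>" "\<bar>\<beta> + 2\<bar> \<le> K" "\<bar>2::real\<bar> \<le> 2" "\<bar>f x\<bar> \<le> F"
      using \<tau> b K \<beta> by (auto simp: A_s_P_F_def)
    note i = abs_mult_leI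
    have t2: "\<bar>2 * (k * (s powr (- 2) * ((g x *v z x) \<bullet> p x)))\<bar> \<le> 2 * (K * (1 / s\<^sup>2 * (K * (K * s) * P)))"
      by (rule i[OF kk(5) i[OF k i[OF w1(1) gzp]]])
    have t3: "\<bar>2 * \<tau> * (k * (s powr (- 2) * (b x * gz)))\<bar> \<le> 2 * \<tau> * (K * (1 / s\<^sup>2 * (b x * (K^3 * s\<^sup>2))))"
      by (rule i[OF kk(1) i[OF k i[OF w1(1) i[OF kk(2) gz]]]])
    have t4: "\<bar>k * (k * (s powr (- 4) * gz))\<bar> \<le> K * (K * (1 / s^4 * (K^3 * s\<^sup>2)))"
      by (rule i[OF k i[OF k i[OF w1(2) gz]]])
    have t5: "\<bar>\<tau> * (b x * ((\<beta> + 2) * (s powr (- 2) * gz) - g x \<bullet> \<Gamma>))\<bar> \<le> \<tau> * (b x * (K * (1 / s\<^sup>2 * (K^3 * s\<^sup>2)) + K^3 * K^4))"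
      by (rule i[OF kk(3) i[OF kk(2) abs_diff_leI[OF i[OF kk(4) i[OF w1(1) gz]] g\<Gamma>]]])
    have t6: "\<bar>k * (s powr (- 2) * (g x \<bullet> \<Gamma>) - 2 * s powr (- 4) * gz)\<bar> \<le> K * (1 / s\<^sup>2 * (K^3 * K^4) + 2 * (1 / s^4) * (K^3 * s\<^sup>2))"
      by (rule i[OF k abs_diff_leI[OF i[OF w1(1) g\<Gamma>] i[OF i[OF kk(5) w1(2)] gz]]])
    have "\<bar>- (2 * \<tau> * (k * (s powr (- 2) * (b x * gz))))\<bar> \<le> 2 * \<tau> * (K * (1 / s\<^sup>2 * (b x * (K^3 * s\<^sup>2))))"
      using t3 by (simp only: abs_minus_cancel)
    note t7 = i[OF kk(6) abs_diff_leI[OF abs_add_leI[OF this t4] abs_add_leI[OF t5 t6]]]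
    have "\<bar>- dv x (p x)\<bar> \<le> K * (K * P)" using dvp by (simp only: abs_minus_cancel)
    from abs_add_leI[OF abs_diff_leI[OF this t2] t7] show ?thesis unfolding err by (simp only: mult.assoc)
  qed
  also have "\<dots> = K * K * P + 2 * K^3 * (P / s) + (3 * K^4 + K^7) * (A * F) + (K^5 + K * (K^7 + 2 * K^3)) * (F / s\<^sup>2)"
    using s by (simp add: A_s_P_F_def(1) field_simps power2_eq_square eval_nat_numeral)
  also have "\<dots> \<le> K * K * (P / s) + 2 * K^3 * (P / s) + (3 * K^4 + K^7) * (A * F) + (K^5 + K * (K^7 + 2 * K^3)) * (A * F)"
  proof -
    have "P \<le> P / s" using s PF by (simp add: field_simps mult_left_le)
    moreover have "F / s\<^sup>2 \<le> A * F" using As(2) s PF mult_right_mono[OF As(2) PF(2)] by (simp add: field_simps)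
    ultimately show ?thesis using K0 A by (intro add_mono mult_left_mono) auto
  qed
  also have "\<dots> \<le> C8 * (P / s + A * F)"
    unfolding C8_def using K0 s PF A by (simp add: algebra_simps add_nonneg_nonneg)
  finally have e: "\<bar>err\<bar> \<le> C8 * (P / s + A * F)" .
  have "err\<^sup>2 \<le> (C8 * (P / s + A * F))\<^sup>2" using e by (metis abs_ge_zero power2_abs power_mono)
  also have "\<dots> \<le> 2 * C8\<^sup>2 * ((P / s)\<^sup>2 + (A * F)\<^sup>2)"
  proof -
    have "(P / s + A * F)\<^sup>2 \<le> 2 * ((P / s)\<^sup>2 + (A * F)\<^sup>2)"
      using sum_squares_bound[of "P/s" "A * F"] by (simp add: power2_sum)
    from mult_left_mono[OF this zero_le_power2[of C8]] show ?thesis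
      by (simp only: power_mult_distrib[of C8] mult_ac)
  qed
  also have "\<dots> \<le> c1 / 4 * (A * P\<^sup>2 + A^3 * s\<^sup>2 * F\<^sup>2)"
  proof -
    have C: "2 * C8\<^sup>2 \<le> c1 / 4 * (A * s\<^sup>2)"
      using T mult_left_mono[OF As(1) less_imp_le[OF c1_pos]] unfolding admissible_threshold_def by linarith
    have "2 * C8\<^sup>2 * ((P / s)\<^sup>2 + (A * F)\<^sup>2) \<le> c1 / 4 * (A * s\<^sup>2) * ((P / s)\<^sup>2 + (A * F)\<^sup>2)"
      by (rule mult_right_mono[OF C]) simp
    also have "\<dots> = c1 / 4 * (A * P\<^sup>2 + A^3 * s\<^sup>2 * F\<^sup>2)"
      using s by (simp add: field_simps power2_eq_square power3_eq_cube)
    finally show ?thesis .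
  qed
  finally have E2: "err\<^sup>2 \<le> c1 / 4 * (A * P\<^sup>2 + A^3 * s\<^sup>2 * F\<^sup>2)" .
  have "conj_op \<tau> f p H Z x = full_conj \<tau> k f p H x - err" by (simp add: err_def)
  then have "(conj_op \<tau> f p H Z x)\<^sup>2 \<le> 2 * (full_conj \<tau> k f p H x)\<^sup>2 + 2 * err\<^sup>2"
    using sum_squares_bound[of "full_conj \<tau> k f p H x" "- err"] by (simp add: power2_diff)
  moreover have "A * P\<^sup>2 + A^3 * s\<^sup>2 * F\<^sup>2 = \<tau> * b x * (norm (p x))\<^sup>2 + (\<tau> * b x)^3 * (\<sigma> x)\<^sup>2 * (f x)\<^sup>2"
    by (simp add: A_s_P_F_def)
  ultimately show ?thesis using E2 by simp
qed

end

context carleman_weight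
begin

lemma rellich_integral:
  assumes Q: "compact Q" "Q \<subseteq> - {0}"
    and f: "\<And>x. x \<noteq> 0 \<Longrightarrow> (f has_derivative (\<lambda>h. p x \<bullet> h)) (at x)"
    and p: "\<And>x. x \<noteq> 0 \<Longrightarrow> (p has_derivative (\<lambda>h. H x *v h)) (at x)"
    and H: "continuous_on (- {0}) H" "\<And>x. transpose (H x) = H x"
    and off: "\<And>x. x \<notin> Q \<Longrightarrow> f x = 0 \<and> p x = 0"
  shows "set_integrable lborel Q (rellich_form \<tau> f p Z \<Phi> mlt dmlt)"
    and "set_integrable lborel Q (\<lambda>x. (conj_op \<tau> f p H Z x)\<^sup>2)"
    and "(LINT x:Q|lborel. rellich_form \<tau> f p Z \<Phi> mlt dmlt x) \<le> (LINT x:Q|lborel. (conj_op \<tau> f p H Z x)\<^sup>2)"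
proof -
  have cf: "continuous_on (- {0}) f" using f by (auto intro!: continuous_at_imp_continuous_on dest!: has_derivative_continuous)
  have cp: "continuous_on (- {0}) p" using p by (auto intro!: continuous_at_imp_continuous_on dest!: has_derivative_continuous)
  have cdv: "continuous_on (- {0}) (\<lambda>x. dv x (v x))" if "continuous_on (- {0}) v" for v
    unfolding dv_def by (intro continuous_on_divm continuous_intros that)
  note c = cf cp cdv H(1) continuous_weights continuous_on_g
  have 1: "continuous_on (- {0}) (rellich_form \<tau> f p Z \<Phi> mlt dmlt)"
    unfolding rellich_form_def[abs_def] Let_def by (intro continuous_intros c)
  have 2: "continuous_on (- {0}) (\<lambda>x. (conj_op \<tau> f p H Z x)\<^sup>2)"
    unfolding conj_op_def by (intro continuous_intros c)
  have 3: "continuous_on (- {0}) (\<lambda>x. rellich_field_deriv \<tau> f p H Z \<Phi> mlt dmlt x h)" for h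
    unfolding rellich_field_deriv_def Let_def by (intro continuous_intros c)
  show i1: "set_integrable lborel Q (rellich_form \<tau> f p Z \<Phi> mlt dmlt)"
    by (rule set_integrable_compact[OF Q(1) continuous_on_subset[OF 1 Q(2)]])
  show i2: "set_integrable lborel Q (\<lambda>x. (conj_op \<tau> f p H Z x)\<^sup>2)"
    by (rule set_integrable_compact[OF Q(1) continuous_on_subset[OF 2 Q(2)]])
  have i3: "set_integrable lborel Q (\<lambda>x. divm (rellich_field_deriv \<tau> f p H Z \<Phi> mlt dmlt x))"
    by (rule set_integrable_compact[OF Q(1) continuous_on_subset[OF continuous_on_divm[OF 3] Q(2)]])
  have 0: "(LINT x:Q|lborel. divm (rellich_field_deriv \<tau> f p H Z \<Phi> mlt dmlt x)) = 0"
  proof (rule divergence_integral_zero[OF Q(1) _ Q(2), where X = "rellich_field \<tau> f p Z mlt"])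
    show "open (- {0::real^'n})" by (simp add: open_Compl)
    show "rellich_field \<tau> f p Z mlt x = 0" if "x \<notin> Q" for x
      using off[OF that] by (simp add: rellich_field_def)
    show "(rellich_field \<tau> f p Z mlt has_derivative rellich_field_deriv \<tau> f p H Z \<Phi> mlt dmlt x) (at x)"
      if "x \<in> - {0}" for x
      using that by (intro has_derivative_rellich_field f p has_derivative_Z has_derivative_mlt) auto
  qed (rule 3)
  have "(LINT x:Q|lborel. rellich_form \<tau> f p Z \<Phi> mlt dmlt x)
      = (LINT x:Q|lborel. rellich_form \<tau> f p Z \<Phi> mlt dmlt x + divm (rellich_field_deriv \<tau> f p H Z \<Phi> mlt dmlt x))"
    using set_integral_add(2)[OF i1 i3] 0 by simp
  also have "\<dots> \<le> (LINT x:Q|lborel. (conj_op \<tau> f p H Z x)\<^sup>2)"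
    by (intro set_integral_mono set_integral_add(1) i1 i2 i3 rellich_pointwise H(2) transpose_\<Phi>)
  finally show "(LINT x:Q|lborel. rellich_form \<tau> f p Z \<Phi> mlt dmlt x) \<le> (LINT x:Q|lborel. (conj_op \<tau> f p H Z x)\<^sup>2)" .
qed

text \<open>The square root of the weight. The free exponent \<open>k\<close> becomes half of \<open>s\<close>.\<close>

definition ew where "ew \<tau> k x = \<sigma> x powr k * exp (\<tau> * \<sigma> x powr (- \<beta>))"

lemma has_derivative_ew:
  assumes "x \<noteq> 0"
  shows "(ew \<tau> k has_derivative (\<lambda>h. ew \<tau> k x * (\<zeta> \<tau> k x \<bullet> h))) (at x)"
proof -
  have s: "\<sigma> x > 0" by (rule \<sigma>_pos[OF assms])
  have "((\<lambda>x. \<tau> * \<sigma> x powr (- \<beta>)) has_derivative (\<lambda>h. \<tau> * ((- \<beta> * \<sigma> x powr (- \<beta> - 2)) * (z x \<bullet> h)))) (at x)"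
    using has_derivative_mult_right[OF has_derivative_\<sigma>_powr[OF assms, of "- \<beta>"], of \<tau>] by (simp add: z_def)
  then have e: "((\<lambda>x. exp (\<tau> * \<sigma> x powr (- \<beta>))) has_derivative
     (\<lambda>h. exp (\<tau> * \<sigma> x powr (- \<beta>)) * (\<tau> * (- b x * (z x \<bullet> h))))) (at x)"
    by (rule has_derivative_eq_rhs[OF has_derivative_exp]) (simp add: fun_eq_iff b_def)
  have kk: "\<sigma> x powr (k - 2) = \<sigma> x powr k * \<sigma> x powr (- 2)" by (simp add: powr_add[symmetric])
  show ?thesis unfolding ew_def[abs_def]
    by (rule has_derivative_eq_rhs[OF has_derivative_mult[OF has_derivative_\<sigma>_powr[OF assms] e]])
      (simp add: fun_eq_iff \<zeta>_def Z_def inner_add_left kk z_def[symmetric] algebra_simps)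
qed

lemma continuous_on_ew: "continuous_on (- {0}) (ew \<tau> k)"
  unfolding ew_def[abs_def] by (intro continuous_intros)

lemma norm_\<zeta>_le:
  assumes x: "x \<noteq> 0" "\<sigma> x < r" and \<tau>: "0 < \<tau>" and T: "admissible_threshold T" "T \<le> \<tau> * \<beta>" and k: "\<bar>k\<bar> \<le> K"
  shows "norm (\<zeta> \<tau> k x) \<le> 2 * K\<^sup>2 * (\<tau> * b x * \<sigma> x)"
proof -
  define a s where "a = \<tau> * b x" "s = \<sigma> x"
  have s: "0 < s" "s < 1" using s[OF x] by (auto simp: a_s_def)
  have a: "0 < a" using b_pos x \<tau> by (simp add: a_s_def)
  have as: "1 \<le> a * s\<^sup>2" using \<tau>b_ge[OF x \<tau>] T by (auto simp: a_s_def admissible_threshold_def)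
  have "norm (\<zeta> \<tau> k x) \<le> \<tau> * (b x * (K * s)) + K * (1 / s\<^sup>2) * (K * s)"
    unfolding \<zeta>_def Z_def a_s_def
    by (intro norm_add_leI norm_scaleR_leI abs_mult_leI norm_z k) (use \<tau> b_pos[OF x(1)] w[OF x] in auto)
  also have "\<dots> = K * (a * s) + K\<^sup>2 * (1 / s)" using s by (simp add: a_s_def(1) field_simps power2_eq_square)
  also have "\<dots> \<le> K\<^sup>2 * (a * s) + K\<^sup>2 * (a * s)"
  proof (intro add_mono mult_left_mono mult_right_mono)
    show "1 / s \<le> a * s" using as s by (simp add: field_simps power2_eq_square)
    show "K \<le> K\<^sup>2" using K by (simp add: power2_eq_square)
  qed (use a s in auto)
  finally show ?thesis by (simp add: a_s_def mult_ac)
qed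

text \<open>The positivity of the form is applied to \<open>f = E u\<close>, whose conjugated operator is \<open>E\<close> times the operator applied
  to \<open>u\<close>. Returning from the gradient of \<open>f\<close> to that of \<open>u\<close> costs \<open>|f \<zeta>|\<close>, which the zero order term controls.\<close>

lemma carleman_gradient_estimate:
  assumes T: "admissible_threshold T" "T \<le> \<tau> * \<beta>" and \<tau>: "0 < \<tau>" and k: "\<bar>k\<bar> \<le> K"
    and r4: "r * C4 \<le> \<epsilon> * lam" and r5: "r * C5 \<le> c1 / 2"
    and Q: "compact Q" "Q \<subseteq> {x. \<sigma> x < r} - {0}"
    and u: "\<And>x. (u has_derivative (\<lambda>h. p x \<bullet> h)) (at x)"
    and p: "\<And>x. (p has_derivative (\<lambda>h. H x *v h)) (at x)"
    and H: "continuous_on UNIV H" "\<And>x. transpose (H x) = H x"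
    and off: "\<And>x. x \<notin> Q \<Longrightarrow> u x = 0 \<and> p x = 0"
  shows "(LINT x:Q|lborel. (ew \<tau> k x)\<^sup>2 * (\<tau> * b x * (norm (p x))\<^sup>2 + (\<tau> * b x)^3 * (\<sigma> x)\<^sup>2 * (u x)\<^sup>2))
    \<le> (8 * K^4 + 2) * (4 / c1) * (LINT x:Q|lborel. (ew \<tau> k x)\<^sup>2 * (g x \<bullet> H x)\<^sup>2)"
proof -
  define E where "E = ew \<tau> k"
  define f where "f x = E x * u x" for x
  define q where "q x = E x *\<^sub>R (p x + u x *\<^sub>R \<zeta> \<tau> k x)" for x
  define L where "L x = E x *\<^sub>R (H x + outer2 (\<zeta> \<tau> k x) (p x) + outer2 (p x) (\<zeta> \<tau> k x)
     + u x *\<^sub>R (outer2 (\<zeta> \<tau> k x) (\<zeta> \<tau> k x) + D\<zeta> \<tau> k x))" for x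
  have Q0: "Q \<subseteq> - {0}" using Q by auto
  have dE: "(E has_derivative (\<lambda>h. E x * (\<zeta> \<tau> k x \<bullet> h))) (at x)" if "x \<noteq> 0" for x
    unfolding E_def by (rule has_derivative_ew[OF that])
  have df: "(f has_derivative (\<lambda>h. q x \<bullet> h)) (at x)" if "x \<noteq> 0" for x
    unfolding f_def[abs_def]
    by (rule has_derivative_eq_rhs[OF has_derivative_mult[OF dE[OF that] u]])
      (simp add: fun_eq_iff q_def inner_add_left algebra_simps)
  have dq: "(q has_derivative (\<lambda>h. L x *v h)) (at x)" if "x \<noteq> 0" for x
    unfolding q_def[abs_def]
    by (rule has_derivative_eq_rhs[OF has_derivative_scaleR[OF dE[OF that] has_derivative_add[OF p has_derivative_scaleR[OF u has_derivative_\<zeta>[OF that]]]]])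
      (simp add: fun_eq_iff L_def scaleR_matrix_vector_assoc[symmetric] matrix_vector_mult_add_rdistrib outer2_mv algebra_simps)
  have L_sym: "transpose (L x) = L x" for x
  proof -
    have t: "transpose (A + B) = transpose A + transpose B" "transpose (c *\<^sub>R A) = c *\<^sub>R transpose A" for A B :: "real^'n^'n" and c
      by (simp_all add: transpose_def vec_eq_iff)
    show ?thesis by (simp add: L_def t H(2) transpose_outer2 transpose_D\<zeta> add_ac)
  qed
  have cu: "continuous_on UNIV u" using u by (auto intro!: continuous_at_imp_continuous_on dest!: has_derivative_continuous)
  have cp: "continuous_on UNIV p" using p by (auto intro!: continuous_at_imp_continuous_on dest!: has_derivative_continuous)
  have cE: "continuous_on (- {0}) E" unfolding E_def by (rule continuous_on_ew)
  note cs = continuous_on_subset[OF cu subset_UNIV] continuous_on_subset[OF cp subset_UNIV] continuous_on_subset[OF H(1) subset_UNIV]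
  have cL: "continuous_on (- {0}) L" unfolding L_def[abs_def]
    by (intro continuous_intros cE cs)
  have cf: "continuous_on (- {0}) f" "continuous_on (- {0}) q"
    unfolding f_def[abs_def] q_def[abs_def] by (intro continuous_intros cE cs)+
  have off': "f x = 0 \<and> q x = 0" if "x \<notin> Q" for x using off[OF that] by (simp add: f_def q_def)
  note ri = rellich_integral[OF Q(1) Q0 df dq cL L_sym off', of \<tau>]
  define S where "S x = \<tau> * b x * (norm (q x))\<^sup>2 + (\<tau> * b x)^3 * (\<sigma> x)\<^sup>2 * (f x)\<^sup>2" for x
  have csig: "continuous_on (- {0}) \<sigma>"
    using continuous_on_\<sigma>_powr[of 1] by (rule continuous_on_eq) (use \<sigma>_pos \<sigma>_nonneg in auto)
  have iS: "set_integrable lborel Q S"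
    by (rule set_integrable_compact[OF Q(1) continuous_on_subset[OF _ Q0]])
      (unfold S_def[abs_def], intro continuous_intros cf csig)
  have iR: "set_integrable lborel Q (\<lambda>x. (E x)\<^sup>2 * (g x \<bullet> H x)\<^sup>2)"
    by (rule set_integrable_compact[OF Q(1) continuous_on_subset[OF _ Q0]])
      (intro continuous_intros cE cs continuous_on_g)
  have full: "full_conj \<tau> k f q L x = E x * (g x \<bullet> H x)" for x
  proof -
    have s1: "(g x *v p x) \<bullet> \<zeta> \<tau> k x = (g x *v \<zeta> \<tau> k x) \<bullet> p x" by (rule inner_mv_sym[OF g_sym])
    show ?thesis unfolding full_conj_def f_def q_def L_def inner_scaleR_right inner_add_right inner_outer2 s1
      by (simp add: algebra_simps)
  qed
  have x: "x \<noteq> 0" "\<sigma> x < r" if "x \<in> Q" for x using that Q by auto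
  have A: "(LINT x:Q|lborel. c1 * S x) \<le> (LINT x:Q|lborel. (conj_op \<tau> f q L Z x)\<^sup>2)"
  proof -
    have "(LINT x:Q|lborel. c1 * S x) \<le> (LINT x:Q|lborel. rellich_form \<tau> f q Z \<Phi> mlt dmlt x)"
    proof (rule set_integral_mono)
      show "set_integrable lborel Q (\<lambda>x. c1 * S x)" using iS by simp
      show "c1 * S x \<le> rellich_form \<tau> f q Z \<Phi> mlt dmlt x" if "x \<in> Q" for x
        unfolding S_def by (rule rellich_form_positive[OF x(1)[OF that] x(2)[OF that] \<tau> T r4 r5])
    qed (rule ri(1))
    then show ?thesis using ri(3) by linarith
  qed
  have B: "(LINT x:Q|lborel. (conj_op \<tau> f q L Z x)\<^sup>2 - c1 / 2 * S x) \<le> (LINT x:Q|lborel. 2 * ((E x)\<^sup>2 * (g x \<bullet> H x)\<^sup>2))"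
  proof (rule set_integral_mono)
    show "set_integrable lborel Q (\<lambda>x. (conj_op \<tau> f q L Z x)\<^sup>2 - c1 / 2 * S x)"
      using ri(2) iS by (intro set_integral_diff(1)) auto
    show "set_integrable lborel Q (\<lambda>x. 2 * ((E x)\<^sup>2 * (g x \<bullet> H x)\<^sup>2))" using iR by simp
    show "(conj_op \<tau> f q L Z x)\<^sup>2 - c1 / 2 * S x \<le> 2 * ((E x)\<^sup>2 * (g x \<bullet> H x)\<^sup>2)" if "x \<in> Q" for x
      using full_conj_lower[OF x(1)[OF that] x(2)[OF that] \<tau> T k, of f q L] unfolding full S_def by (simp add: power_mult_distrib)
  qed
  have eqs: "(LINT x:Q|lborel. c1 * S x) = c1 * (LINT x:Q|lborel. S x)"
    "(LINT x:Q|lborel. 2 * ((E x)\<^sup>2 * (g x \<bullet> H x)\<^sup>2)) = 2 * (LINT x:Q|lborel. (E x)\<^sup>2 * (g x \<bullet> H x)\<^sup>2)"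
    "(LINT x:Q|lborel. (conj_op \<tau> f q L Z x)\<^sup>2 - c1 / 2 * S x) = (LINT x:Q|lborel. (conj_op \<tau> f q L Z x)\<^sup>2) - c1 / 2 * (LINT x:Q|lborel. S x)"
    using set_integral_diff(2)[OF ri(2), of "\<lambda>x. c1 / 2 * S x"] iS by simp_all
  have "c1 * (LINT x:Q|lborel. S x) \<le> 4 * (LINT x:Q|lborel. (E x)\<^sup>2 * (g x \<bullet> H x)\<^sup>2)"
    using A B unfolding eqs by linarith
  then have C: "(LINT x:Q|lborel. S x) \<le> (4 / c1) * (LINT x:Q|lborel. (E x)\<^sup>2 * (g x \<bullet> H x)\<^sup>2)"
    using c1_pos by (simp add: field_simps)
  have "(LINT x:Q|lborel. (E x)\<^sup>2 * (\<tau> * b x * (norm (p x))\<^sup>2 + (\<tau> * b x)^3 * (\<sigma> x)\<^sup>2 * (u x)\<^sup>2)) \<le> (LINT x:Q|lborel. (8 * K^4 + 2) * S x)"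
  proof (rule set_integral_mono)
    show "set_integrable lborel Q (\<lambda>x. (E x)\<^sup>2 * (\<tau> * b x * (norm (p x))\<^sup>2 + (\<tau> * b x)^3 * (\<sigma> x)\<^sup>2 * (u x)\<^sup>2))"
      by (rule set_integrable_compact[OF Q(1) continuous_on_subset[OF _ Q0]])
        (intro continuous_intros cE cs csig)
    show "set_integrable lborel Q (\<lambda>x. (8 * K^4 + 2) * S x)" using iS by simp
    fix x assume "x \<in> Q"
    note x = x[OF this]
    define a s where "a = \<tau> * b x" "s = \<sigma> x"
    have s: "0 < s" "s < 1" using s[OF x] by (auto simp: a_s_def)
    have a: "0 < a" using b_pos x \<tau> by (simp add: a_s_def)
    have as: "1 \<le> a * s\<^sup>2" using \<tau>b_ge[OF x \<tau>] T by (auto simp: a_s_def admissible_threshold_def)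
    note z1 = norm_\<zeta>_le[OF x \<tau> T k, folded a_s_def]
    have "E x *\<^sub>R p x = q x - f x *\<^sub>R \<zeta> \<tau> k x" by (simp add: q_def f_def scaleR_right_distrib)
    then have "norm (E x *\<^sub>R p x) \<le> norm (q x) + \<bar>f x\<bar> * norm (\<zeta> \<tau> k x)" by (metis norm_scaleR norm_triangle_ineq4)
    also have "\<dots> \<le> norm (q x) + \<bar>f x\<bar> * (2 * K\<^sup>2 * (a * s))" using z1 by (intro add_left_mono mult_left_mono) auto
    finally have "(norm (E x *\<^sub>R p x))\<^sup>2 \<le> (norm (q x) + \<bar>f x\<bar> * (2 * K\<^sup>2 * (a * s)))\<^sup>2" by (intro power_mono) auto
    also have "\<dots> \<le> 2 * (norm (q x))\<^sup>2 + 2 * (\<bar>f x\<bar> * (2 * K\<^sup>2 * (a * s)))\<^sup>2"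
      using sum_squares_bound[of "norm (q x)" "\<bar>f x\<bar> * (2 * K\<^sup>2 * (a * s))"] unfolding power2_sum by linarith
    also have "\<dots> = 2 * (norm (q x))\<^sup>2 + 8 * K^4 * (a\<^sup>2 * s\<^sup>2 * (f x)\<^sup>2)"
      by (simp add: power_mult_distrib)
    finally have e1: "a * (norm (E x *\<^sub>R p x))\<^sup>2 \<le> a * (2 * (norm (q x))\<^sup>2 + 8 * K^4 * (a\<^sup>2 * s\<^sup>2 * (f x)\<^sup>2))"
      using a by (intro mult_left_mono) auto
    have "(E x)\<^sup>2 * (\<tau> * b x * (norm (p x))\<^sup>2 + (\<tau> * b x)^3 * (\<sigma> x)\<^sup>2 * (u x)\<^sup>2) = a * (norm (E x *\<^sub>R p x))\<^sup>2 + a^3 * s\<^sup>2 * (f x)\<^sup>2"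
      unfolding a_s_def f_def by (simp add: power_mult_distrib algebra_simps)
    also have "\<dots> \<le> 2 * (a * (norm (q x))\<^sup>2) + (8 * K^4 + 1) * (a^3 * s\<^sup>2 * (f x)\<^sup>2)"
      using e1 by (simp add: algebra_simps power2_eq_square power3_eq_cube)
    also have "\<dots> \<le> (8 * K^4 + 2) * (a * (norm (q x))\<^sup>2) + (8 * K^4 + 2) * (a^3 * s\<^sup>2 * (f x)\<^sup>2)"
      using a K0 by (intro add_mono mult_right_mono) auto
    also have "\<dots> = (8 * K^4 + 2) * S x" by (simp add: S_def a_s_def distrib_left)
    finally show "(E x)\<^sup>2 * (\<tau> * b x * (norm (p x))\<^sup>2 + (\<tau> * b x)^3 * (\<sigma> x)\<^sup>2 * (u x)\<^sup>2) \<le> (8 * K^4 + 2) * S x" .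
  qed
  also have "\<dots> = (8 * K^4 + 2) * (LINT x:Q|lborel. S x)" by simp
  also have "\<dots> \<le> (8 * K^4 + 2) * ((4 / c1) * (LINT x:Q|lborel. (E x)\<^sup>2 * (g x \<bullet> H x)\<^sup>2))"
    using C K0 by (intro mult_left_mono) auto
  finally show ?thesis by (simp only: E_def mult.assoc)
qed

end

section \<open>The weighted estimate for second derivatives\<close>

text \<open>\<open>H ** H\<close> is a sum over the columns of \<open>H\<close>, each of which contributes the form of \<open>g\<close> at that column.\<close>

lemma inner_square_ge:
  fixes g H :: "real^'n::finite^'n"
  assumes lo: "\<And>\<xi>. lam * (norm \<xi>)\<^sup>2 \<le> (g *v \<xi>) \<bullet> \<xi>" and H: "transpose H = H"
  shows "lam * (norm H)\<^sup>2 \<le> g \<bullet> (H ** H)"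
proof -
  have Hs: "H $ i $ j = H $ j $ i" for i j using H by (metis transpose_def vec_lambda_beta)
  have "g \<bullet> (H ** H) = (\<Sum>i\<in>UNIV. \<Sum>j\<in>UNIV. \<Sum>k\<in>UNIV. g $ i $ j * (H $ i $ k * H $ k $ j))"
    by (simp add: inner_vec_def matrix_matrix_mult_def sum_distrib_left)
  also have "\<dots> = (\<Sum>i\<in>UNIV. \<Sum>k\<in>UNIV. \<Sum>j\<in>UNIV. g $ i $ j * (H $ i $ k * H $ k $ j))"
    by (intro sum.cong refl sum.swap)
  also have "\<dots> = (\<Sum>k\<in>UNIV. \<Sum>i\<in>UNIV. \<Sum>j\<in>UNIV. g $ i $ j * (H $ k $ i * H $ k $ j))"
    by (subst sum.swap) (simp add: Hs)
  also have "\<dots> = (\<Sum>k\<in>UNIV. (g *v (H $ k)) \<bullet> (H $ k))"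
    by (simp add: inner_vec_def matrix_vector_mult_def sum_distrib_left sum_distrib_right mult_ac)
  also have "\<dots> \<ge> (\<Sum>k\<in>UNIV. lam * (norm (H $ k))\<^sup>2)" by (intro sum_mono lo)
  finally show ?thesis by (simp add: norm_vec_def[of H] L2_set_def sum_nonneg sum_distrib_left)
qed

context elliptic_C1
begin

text \<open>The divergence of this field contains \<open>- W g \<bullet> (H ** H)\<close>, which dominates \<open>|H|\<^sup>2\<close> by ellipticity.\<close>

definition hess_field where
  "hess_field W p H x = W x *\<^sub>R ((g x \<bullet> H x) *\<^sub>R p x - g x *v (H x *v p x))"

definition hess_field_deriv where
  "hess_field_deriv W dW p H D x h =
     W x *\<^sub>R (((g x \<bullet> H x) *\<^sub>R (H x *v h) + (g x \<bullet> D x h + g' x h \<bullet> H x) *\<^sub>R p x)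
       - (g x *v (H x *v (H x *v h)) + g x *v (D x h *v p x) + g' x h *v (H x *v p x)))
     + (dW x \<bullet> h) *\<^sub>R ((g x \<bullet> H x) *\<^sub>R p x - g x *v (H x *v p x))"

lemma has_derivative_hess_field:
  assumes W: "(W has_derivative (\<lambda>h. dW x \<bullet> h)) (at x)"
    and p: "(p has_derivative (\<lambda>h. H x *v h)) (at x)"
    and H: "(H has_derivative D x) (at x)"
  shows "(hess_field W p H has_derivative hess_field_deriv W dW p H D x) (at x)"
  unfolding hess_field_def
  by (rule has_derivative_eq_rhs[OF has_derivative_scaleR[OF W has_derivative_diff[OF
      has_derivative_scaleR[OF has_derivative_inner[OF g_deriv H] p]
      has_derivative_mv[OF g_deriv has_derivative_mv[OF H p]]]]])
    (simp add: fun_eq_iff hess_field_deriv_def matrix_vector_right_distrib add_ac)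

text \<open>The third derivatives cancel since \<open>D x h *v k\<close> is symmetric in \<open>h\<close> and \<open>k\<close>.\<close>

lemma divm_hess_field_deriv:
  assumes H: "transpose (H x) = H x" and D: "\<And>h k. D x h *v k = D x k *v h" "\<And>h. transpose (D x h) = D x h"
    "linear (D x)"
  shows "divm (hess_field_deriv W dW p H D x) =
     W x * ((g x \<bullet> H x) * divm (\<lambda>h. H x *v h) + g' x (p x) \<bullet> H x - g x \<bullet> (H x ** H x) - dv x (H x *v p x))
     + dW x \<bullet> ((g x \<bullet> H x) *\<^sub>R p x - g x *v (H x *v p x))"
proof -
  have lin: "linear (\<lambda>h. g x \<bullet> D x h + g' x h \<bullet> H x)" "linear (\<lambda>h. dW x \<bullet> h)"
    using D(3) linear_g'[of x] by (auto intro!: linearI simp: linear_add linear_cmul inner_add algebra_simps)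
  have HH: "divm (\<lambda>h. g x *v (H x *v (H x *v h))) = g x \<bullet> (H x ** H x)"
    using divm_matrix_product[of "H x ** H x" "g x"] H by (simp add: matrix_transpose_mul matrix_vector_mul_assoc)
  have Dp: "divm (\<lambda>h. g x *v (D x h *v p x)) = g x \<bullet> D x (p x)"
    using divm_matrix_product[OF D(2), of "g x" "p x"] by (simp add: D(1)[of _ "p x"])
  show ?thesis
    unfolding hess_field_deriv_def divm_add divm_diff divm_scale divm_rank1[OF lin(1)] divm_rank1[OF lin(2)] HH Dp dv_def[symmetric]
    by (simp add: algebra_simps)
qed

end

context carleman_weight
begin

definition C9 where "C9 = 2 * K * (1 + 2 * K\<^sup>2 * K + 2 * (K + K\<^sup>2)\<^sup>2 * K)"

text \<open>The divergence of the field integrates to zero. Besides \<open>g \<bullet> (H ** H)\<close> it contains \<open>(g \<bullet> H) tr H\<close> and terms linear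
in \<open>H\<close>, which are absorbed by Young's inequality; the derivative of the weight brings the factor \<open>\<tau> b \<sigma>\<close>.\<close>

lemma hessian_integral:
  assumes T: "admissible_threshold T" "T \<le> \<tau> * \<beta>" and \<tau>: "0 < \<tau>" and k: "\<bar>k\<bar> \<le> K"
    and Q: "compact Q" "Q \<subseteq> {x. \<sigma> x < r} - {0}"
    and p: "\<And>x. (p has_derivative (\<lambda>h. H x *v h)) (at x)"
    and H: "\<And>x. (H has_derivative D x) (at x)" "\<And>x. transpose (H x) = H x"
    and D: "\<And>h. continuous_on UNIV (\<lambda>x. D x h)" "\<And>x h k. D x h *v k = D x k *v h" "\<And>x h. transpose (D x h) = D x h"
    and off: "\<And>x. x \<notin> Q \<Longrightarrow> p x = 0"
  shows "(LINT x:Q|lborel. (ew \<tau> k x)\<^sup>2 * (norm (H x))\<^sup>2)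
    \<le> C9 * (LINT x:Q|lborel. (ew \<tau> k x)\<^sup>2 * ((g x \<bullet> H x)\<^sup>2 + (4 * K\<^sup>2 * (\<tau> * b x * \<sigma> x))\<^sup>2 * (norm (p x))\<^sup>2))"
proof -
  define W where "W x = (ew \<tau> k x)\<^sup>2" for x
  define dW where "dW x = (2 * W x) *\<^sub>R \<zeta> \<tau> k x" for x
  have Q0: "Q \<subseteq> - {0}" using Q by auto
  have W: "(W has_derivative (\<lambda>h. dW x \<bullet> h)) (at x)" if "x \<noteq> 0" for x
    unfolding W_def[abs_def]
    by (rule has_derivative_eq_rhs[OF has_derivative_power[OF has_derivative_ew[OF that]]])
      (simp add: fun_eq_iff dW_def W_def power2_eq_square algebra_simps)
  have cW: "continuous_on (- {0}) W" unfolding W_def[abs_def] by (intro continuous_intros continuous_on_ew)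
  have cdW: "continuous_on (- {0}) dW" unfolding dW_def[abs_def] by (intro continuous_intros cW)
  have cp: "continuous_on S p" for S using p by (meson continuous_at_imp_continuous_on has_derivative_continuous)
  have cH: "continuous_on S H" for S using H(1) by (meson continuous_at_imp_continuous_on has_derivative_continuous)
  have linD: "linear (D x)" for x using H(1) has_derivative_linear by blast
  note c = cW cdW cp cH continuous_on_g continuous_on_subset[OF D(1) subset_UNIV]
  have csig: "continuous_on (- {0}) \<sigma>"
    using continuous_on_\<sigma>_powr[of 1] by (rule continuous_on_eq) (use \<sigma>_pos \<sigma>_nonneg in auto)
  have cX: "continuous_on (- {0}) (\<lambda>x. hess_field_deriv W dW p H D x h)" for h
    unfolding hess_field_deriv_def by (intro continuous_intros c)
  have 0: "(LINT x:Q|lborel. divm (hess_field_deriv W dW p H D x)) = 0"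
  proof (rule divergence_integral_zero[OF Q(1) _ Q0, where X = "hess_field W p H"])
    show "open (- {0::real^'n})" by (simp add: open_Compl)
    show "hess_field W p H x = 0" if "x \<notin> Q" for x using off[OF that] by (simp add: hess_field_def)
    show "(hess_field W p H has_derivative hess_field_deriv W dW p H D x) (at x)" if "x \<in> - {0}" for x
      using that by (intro has_derivative_hess_field W p H) auto
  qed (rule cX)
  have iX: "set_integrable lborel Q (\<lambda>x. divm (hess_field_deriv W dW p H D x))"
    by (rule set_integrable_compact[OF Q(1) continuous_on_subset[OF continuous_on_divm[OF cX] Q0]])
  define R where "R x = (g x \<bullet> H x)\<^sup>2 + (4 * K\<^sup>2 * (\<tau> * b x * \<sigma> x))\<^sup>2 * (norm (p x))\<^sup>2" for x
  define B where "B = 1 + 2 * K\<^sup>2 * K + 2 * (K + K\<^sup>2)\<^sup>2 * K"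
  have iH: "set_integrable lborel Q (\<lambda>x. W x * (norm (H x))\<^sup>2)"
    by (rule set_integrable_compact[OF Q(1) continuous_on_subset[OF _ Q0]]) (intro continuous_intros c)
  have iR: "set_integrable lborel Q (\<lambda>x. W x * R x)"
    by (rule set_integrable_compact[OF Q(1) continuous_on_subset[OF _ Q0]])
      (unfold R_def[abs_def], intro continuous_intros c csig)
  have pt: "lam / 2 * (W x * (norm (H x))\<^sup>2) + divm (hess_field_deriv W dW p H D x) \<le> B * (W x * R x)" if "x \<in> Q" for x
  proof -
    have x: "x \<noteq> 0" "\<sigma> x < r" using that Q by auto
    define a P h \<omega> where "a = \<bar>g x \<bullet> H x\<bar>" "P = norm (p x)" "h = norm (H x)" "\<omega> = 4 * K\<^sup>2 * (\<tau> * b x * \<sigma> x)"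
    have pos: "0 \<le> a" "0 \<le> P" "0 \<le> h" by (auto simp: a_P_h_\<omega>_def)
    have W0: "0 \<le> W x" by (simp add: W_def)
    have \<omega>1: "1 \<le> \<omega>"
    proof -
      have s: "0 < \<sigma> x" "\<sigma> x < 1" by (rule s[OF x])+
      have "1 \<le> \<tau> * b x * (\<sigma> x)\<^sup>2" using \<tau>b_ge[OF x \<tau>] T by (auto simp: admissible_threshold_def)
      also have "\<dots> \<le> \<tau> * b x * \<sigma> x" using s \<tau> b_pos[OF x(1)] by (intro mult_left_mono) (auto simp: power2_eq_square mult_left_le)
      finally have "1 * 1 \<le> K\<^sup>2 * (\<tau> * b x * \<sigma> x)" using K by (intro mult_mono) (auto simp: one_le_power)
      then show ?thesis by (simp add: a_P_h_\<omega>_def)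
    qed
    have gHp: "norm (g x *v (H x *v p x)) \<le> K * (h * P)"
      using norm_g_mv[of x "H x *v p x"] mult_left_mono[OF norm_matrix_vector_mult_le[of "H x" "p x"] K0] by (simp add: a_P_h_\<omega>_def)
    have n\<zeta>: "norm (2 *\<^sub>R \<zeta> \<tau> k x) \<le> \<omega>" using norm_\<zeta>_le[OF x \<tau> T k] by (simp add: a_P_h_\<omega>_def mult_ac)
    have t1: "\<bar>(2 *\<^sub>R \<zeta> \<tau> k x) \<bullet> ((g x \<bullet> H x) *\<^sub>R p x - g x *v (H x *v p x))\<bar> \<le> \<omega> * (a * P + K * (h * P))"
    proof (rule abs_inner_leI[OF n\<zeta>])
      have "norm ((g x \<bullet> H x) *\<^sub>R p x - g x *v (H x *v p x)) \<le> norm ((g x \<bullet> H x) *\<^sub>R p x) + norm (g x *v (H x *v p x))" by (rule norm_triangle_ineq4)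
      then show "norm ((g x \<bullet> H x) *\<^sub>R p x - g x *v (H x *v p x)) \<le> a * P + K * (h * P)" using gHp by (simp add: a_P_h_\<omega>_def)
    qed
    have t2: "\<bar>(g x \<bullet> H x) * divm (\<lambda>h. H x *v h)\<bar> \<le> a * (K * h)"
    proof (rule abs_mult_leI)
      have "\<bar>divm (\<lambda>h. H x *v h)\<bar> \<le> CARD('n) * norm (H x)" by (rule abs_divm_le) (rule norm_matrix_vector_mult_le)
      also have "\<dots> \<le> K * h" using K by (simp add: a_P_h_\<omega>_def mult_right_mono)
      finally show "\<bar>divm (\<lambda>h. H x *v h)\<bar> \<le> K * h" .
    qed (simp add: a_P_h_\<omega>_def)
    have t3: "\<bar>g' x (p x) \<bullet> H x\<bar> \<le> K * P * h"
    proof (rule abs_inner_leI)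
      show "norm (g' x (p x)) \<le> K * P" using g'_bound[of x "p x"] mult_right_mono[OF K(2), of P] pos by (simp add: a_P_h_\<omega>_def)
    qed (simp add: a_P_h_\<omega>_def)
    have t4: "\<bar>dv x (H x *v p x)\<bar> \<le> K * (K * (h * P))"
    proof -
      have "\<bar>dv x (H x *v p x)\<bar> \<le> CARD('n) * (Lam * norm (H x *v p x))" by (rule abs_dv_le)
      also have "\<dots> \<le> K * (K * (h * P))" using K K0 Lam norm_matrix_vector_mult_le[of "H x" "p x"]
        by (intro mult_mono) (auto simp: a_P_h_\<omega>_def)
      finally show ?thesis .
    qed
    have t5: "lam * h\<^sup>2 \<le> g x \<bullet> (H x ** H x)" unfolding a_P_h_\<omega>_def by (rule inner_square_ge[OF g_lower H(2)])
    have "divm (hess_field_deriv W dW p H D x) = W x * ((g x \<bullet> H x) * divm (\<lambda>h. H x *v h) + g' x (p x) \<bullet> H x - g x \<bullet> (H x ** H x) - dv x (H x *v p x)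
       + (2 *\<^sub>R \<zeta> \<tau> k x) \<bullet> ((g x \<bullet> H x) *\<^sub>R p x - g x *v (H x *v p x)))"
      unfolding divm_hess_field_deriv[of H x D, OF H(2) D(2,3) linD] dW_def by (simp add: algebra_simps)
    also have "\<dots> \<le> W x * (a * (K * h) + K * P * h - lam * h\<^sup>2 + K * (K * (h * P)) + \<omega> * (a * P + K * (h * P)))"
      using t1 t2 t3 t4 t5 by (intro mult_left_mono W0) linarith
    also have "\<dots> \<le> W x * (B * R x - lam / 2 * h\<^sup>2)"
    proof (intro mult_left_mono W0)
      have am: "c * h * y \<le> lam / 8 * h\<^sup>2 + 2 * c\<^sup>2 * K * y\<^sup>2" for c y :: real
      proof -
        have "0 \<le> (lam / 4 * h - c * y)\<^sup>2" by simp
        then have "0 \<le> lam\<^sup>2 / 16 * h\<^sup>2 + c\<^sup>2 * y\<^sup>2 - lam / 2 * (c * h * y)"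
          by (simp add: power2_diff power_mult_distrib power_divide mult_ac)
        then have "lam / 2 * (c * h * y) * (2 / lam) \<le> (lam\<^sup>2 / 16 * h\<^sup>2 + c\<^sup>2 * y\<^sup>2) * (2 / lam)"
          using lam by (intro mult_right_mono) auto
        then have "c * h * y \<le> (lam\<^sup>2 / 16 * h\<^sup>2 + c\<^sup>2 * y\<^sup>2) * (2 / lam)" using lam by simp
        also have "\<dots> = lam / 8 * h\<^sup>2 + 2 * c\<^sup>2 * y\<^sup>2 * inverse lam" using lam by (simp add: field_simps power2_eq_square)
        also have "\<dots> \<le> lam / 8 * h\<^sup>2 + 2 * c\<^sup>2 * y\<^sup>2 * K" using K by (intro add_left_mono mult_left_mono) auto
        finally show ?thesis by (simp add: mult_ac)
      qed
      have Rx: "R x = a\<^sup>2 + \<omega>\<^sup>2 * P\<^sup>2"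
        by (simp add: R_def a_P_h_\<omega>_def)
      have "2 * (\<omega> * a * P) \<le> a\<^sup>2 + \<omega>\<^sup>2 * P\<^sup>2" using sum_squares_bound[of a "\<omega> * P"] by (simp add: power_mult_distrib mult_ac)
      moreover have "K * h * a \<le> lam / 8 * h\<^sup>2 + 2 * K\<^sup>2 * K * a\<^sup>2" by (rule am)
      moreover have "(K + K\<^sup>2) * h * P \<le> lam / 8 * h\<^sup>2 + 2 * (K + K\<^sup>2)\<^sup>2 * K * P\<^sup>2" by (rule am)
      moreover have "2 * (K + K\<^sup>2)\<^sup>2 * K * P\<^sup>2 \<le> 2 * (K + K\<^sup>2)\<^sup>2 * K * (\<omega>\<^sup>2 * P\<^sup>2)"
        using \<omega>1 K0 mult_right_mono[of 1 "\<omega>\<^sup>2" "P\<^sup>2"] by (intro mult_left_mono) (auto simp: one_le_power)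
      moreover have "K * h * (\<omega> * P) \<le> lam / 8 * h\<^sup>2 + 2 * K\<^sup>2 * K * (\<omega> * P)\<^sup>2" by (rule am)
      moreover have "0 \<le> (\<omega> * P)\<^sup>2" "0 \<le> a\<^sup>2" by simp_all
      moreover have "2 * (K + K\<^sup>2)\<^sup>2 * K * a\<^sup>2 \<ge> 0" using K0 by simp
      moreover have "lam * h\<^sup>2 / 8 \<ge> 0" using lam by simp
      ultimately show "a * (K * h) + K * P * h - lam * h\<^sup>2 + K * (K * (h * P)) + \<omega> * (a * P + K * (h * P)) \<le> B * R x - lam / 2 * h\<^sup>2"
        unfolding B_def Rx power_mult_distrib
        by (simp only: algebra_simps power2_eq_square)
    qed
    finally show ?thesis by (simp add: a_P_h_\<omega>_def(3) algebra_simps)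
  qed
  have "lam / 2 * (LINT x:Q|lborel. W x * (norm (H x))\<^sup>2)
      = (LINT x:Q|lborel. lam / 2 * (W x * (norm (H x))\<^sup>2) + divm (hess_field_deriv W dW p H D x))"
    using set_integral_add(2)[OF _ iX, of "\<lambda>x. lam / 2 * (W x * (norm (H x))\<^sup>2)"] iH 0 by simp
  also have "\<dots> \<le> (LINT x:Q|lborel. B * (W x * R x))"
  proof (rule set_integral_mono)
    show "set_integrable lborel Q (\<lambda>x. lam / 2 * (W x * (norm (H x))\<^sup>2) + divm (hess_field_deriv W dW p H D x))"
      using iH iX by (intro set_integral_add(1)) auto
    show "set_integrable lborel Q (\<lambda>x. B * (W x * R x))" using iR by simp
  qed (rule pt)
  also have "\<dots> = B * (LINT x:Q|lborel. W x * R x)" by simp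
  finally have "(LINT x:Q|lborel. W x * (norm (H x))\<^sup>2) \<le> 2 * inverse lam * (B * (LINT x:Q|lborel. W x * R x))"
    using lam by (simp add: field_simps)
  also have "\<dots> \<le> 2 * K * (B * (LINT x:Q|lborel. W x * R x))"
  proof -
    have "0 \<le> (LINT x:Q|lborel. W x * R x)" unfolding set_lebesgue_integral_def
      by (rule integral_nonneg_AE) (auto simp: W_def R_def indicator_def)
    moreover have "0 \<le> B" using K0 by (simp add: B_def)
    ultimately show ?thesis using K by (intro mult_right_mono mult_left_mono) auto
  qed
  finally show ?thesis by (simp add: C9_def B_def W_def R_def mult.assoc)
qed

end

section \<open>The Carleman estimate for one operator\<close>

text \<open>The weight of the final estimate; \<open>w0_powr\<close> below relates it to the function \<open>w0\<close>.\<close>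

definition cw :: "real^'n^'n \<Rightarrow> real \<Rightarrow> real \<Rightarrow> real \<Rightarrow> real^'n::finite \<Rightarrow> real" where
  "cw \<Gamma> \<beta> \<tau> s x = sigma0 \<Gamma> x powr s * exp (2 * \<tau> * sigma0 \<Gamma> x powr (- \<beta>))"

text \<open>Derivatives are carried along as functions, so that the estimates apply to any representation of them. The
symmetry conditions state that derivatives commute.\<close>

definition C2_data :: "(real^'n::finite \<Rightarrow> real) \<Rightarrow> (real^'n \<Rightarrow> real^'n) \<Rightarrow> (real^'n \<Rightarrow> real^'n^'n) \<Rightarrow> bool" where
  "C2_data u p H \<longleftrightarrow> (\<forall>x. (u has_derivative (\<lambda>h. p x \<bullet> h)) (at x)) \<and> (\<forall>x. (p has_derivative (\<lambda>h. H x *v h)) (at x)) \<and>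
     continuous_on UNIV H \<and> (\<forall>x. transpose (H x) = H x)"

definition C3_data where
  "C3_data u p H D \<longleftrightarrow> C2_data u p H \<and> (\<forall>x. (H has_derivative D x) (at x)) \<and> (\<forall>h. continuous_on UNIV (\<lambda>x. D x h)) \<and>
     (\<forall>x h k. D x h *v k = D x k *v h) \<and> (\<forall>x h. transpose (D x h) = D x h)"

lemma continuous_on_C2_data:
  assumes "C2_data u p H"
  shows "continuous_on S u" "continuous_on S p" "continuous_on S H"
  using assms unfolding C2_data_def
  by (meson continuous_at_imp_continuous_on has_derivative_continuous)
    (meson assms[unfolded C2_data_def] continuous_at_imp_continuous_on has_derivative_continuous continuous_on_subset subset_UNIV)+

lemma (in quad_weight) continuous_on_cw: "continuous_on (- {0}) (cw \<Gamma> \<beta> \<tau> s)"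
  unfolding cw_def[abs_def] by (intro continuous_intros)

lemma cw_nonneg: "0 \<le> cw \<Gamma> \<beta> \<tau> s x" by (simp add: cw_def)

context carleman_weight
begin

lemma ew_square: "(ew \<tau> k x)\<^sup>2 = cw \<Gamma> \<beta> \<tau> (2 * k) x"
  unfolding ew_def cw_def by (simp add: power2_eq_square powr_add[symmetric] exp_add[symmetric] mult_ac)

lemma cw_add: "cw \<Gamma> \<beta> \<tau> (s + t) x = cw \<Gamma> \<beta> \<tau> s x * \<sigma> x powr t"
  unfolding cw_def by (simp add: powr_add mult_ac)

definition Cgrad where "Cgrad = (8 * K^4 + 2) * (4 / c1) * (1 / min \<beta> (\<beta>^3))"
definition Chess where "Chess = C9 * (1 + 16 * K^4 * \<beta>\<^sup>2 * Cgrad)"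

text \<open>In terms of powers of \<open>\<sigma>\<close>, the factors \<open>b\<close> and \<open>b\<^sup>3 \<sigma>\<^sup>2\<close> lower the exponent by \<open>\<beta> + 2\<close> and \<open>3 \<beta> + 4\<close>.\<close>

lemma gradient_estimate:
  assumes T: "admissible_threshold T" "T \<le> \<tau> * \<beta>" and \<tau>: "0 < \<tau>" and k: "\<bar>s / 2\<bar> \<le> K"
    and r4: "r * C4 \<le> \<epsilon> * lam" and r5: "r * C5 \<le> c1 / 2"
    and Q: "compact Q" "Q \<subseteq> {x. \<sigma> x < r} - {0}"
    and u: "C2_data u p H"
    and off: "\<And>x. x \<notin> Q \<Longrightarrow> u x = 0 \<and> p x = 0"
  shows "(LINT x:Q|lborel. \<tau> * (cw \<Gamma> \<beta> \<tau> (s - \<beta> - 2) x * (norm (p x))\<^sup>2) + \<tau>^3 * (cw \<Gamma> \<beta> \<tau> (s - 3 * \<beta> - 4) x * (u x)\<^sup>2))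
    \<le> Cgrad * (LINT x:Q|lborel. cw \<Gamma> \<beta> \<tau> s x * (g x \<bullet> H x)\<^sup>2)"
proof -
  have Q0: "Q \<subseteq> - {0}" using Q by auto
  note cs = continuous_on_C2_data[OF u]
  note u' = u[unfolded C2_data_def]
  have csig: "continuous_on (- {0}) \<sigma>"
    using continuous_on_\<sigma>_powr[of 1] by (rule continuous_on_eq) (use \<sigma>_pos \<sigma>_nonneg in auto)
  have m0: "0 < min \<beta> (\<beta>^3)" using \<beta> by simp
  have "(LINT x:Q|lborel. \<tau> * (cw \<Gamma> \<beta> \<tau> (s - \<beta> - 2) x * (norm (p x))\<^sup>2) + \<tau>^3 * (cw \<Gamma> \<beta> \<tau> (s - 3 * \<beta> - 4) x * (u x)\<^sup>2))
     \<le> (LINT x:Q|lborel. (1 / min \<beta> (\<beta>^3)) * ((ew \<tau> (s/2) x)\<^sup>2 * (\<tau> * b x * (norm (p x))\<^sup>2 + (\<tau> * b x)^3 * (\<sigma> x)\<^sup>2 * (u x)\<^sup>2)))"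
  proof (rule set_integral_mono)
    show "set_integrable lborel Q (\<lambda>x. \<tau> * (cw \<Gamma> \<beta> \<tau> (s - \<beta> - 2) x * (norm (p x))\<^sup>2) + \<tau>^3 * (cw \<Gamma> \<beta> \<tau> (s - 3 * \<beta> - 4) x * (u x)\<^sup>2))"
      by (rule set_integrable_compact[OF Q(1) continuous_on_subset[OF _ Q0]])
        (intro continuous_intros continuous_on_cw cs)
    show "set_integrable lborel Q (\<lambda>x. (1 / min \<beta> (\<beta>^3)) * ((ew \<tau> (s/2) x)\<^sup>2 * (\<tau> * b x * (norm (p x))\<^sup>2 + (\<tau> * b x)^3 * (\<sigma> x)\<^sup>2 * (u x)\<^sup>2)))"
      by (rule set_integrable_compact[OF Q(1) continuous_on_subset[OF _ Q0]])
        (intro continuous_intros continuous_on_ew cs csig)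
    fix x assume "x \<in> Q"
    then have x: "x \<noteq> 0" "\<sigma> x < r" using Q by auto
    have s: "0 < \<sigma> x" by (rule \<sigma>_pos[OF x(1)])
    have e: "(ew \<tau> (s/2) x)\<^sup>2 = cw \<Gamma> \<beta> \<tau> s x" by (simp add: ew_square)
    have 1: "cw \<Gamma> \<beta> \<tau> s x * b x = \<beta> * cw \<Gamma> \<beta> \<tau> (s - \<beta> - 2) x"
      using cw_add[of \<tau> s "- \<beta> - 2" x] by (simp add: b_def algebra_simps)
    have 2: "cw \<Gamma> \<beta> \<tau> s x * ((b x)^3 * (\<sigma> x)\<^sup>2) = \<beta>^3 * cw \<Gamma> \<beta> \<tau> (s - 3 * \<beta> - 4) x"
    proof -
      have s2: "(\<sigma> x)\<^sup>2 = \<sigma> x powr 2" using s powr_realpow[of "\<sigma> x" 2] by simp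
      have "(b x)^3 * (\<sigma> x)\<^sup>2 = \<beta>^3 * (\<sigma> x powr (- \<beta> - 2) * \<sigma> x powr (- \<beta> - 2) * \<sigma> x powr (- \<beta> - 2) * \<sigma> x powr 2)"
        unfolding b_def s2 power_mult_distrib by (simp add: power3_eq_cube)
      also have "\<dots> = \<beta>^3 * \<sigma> x powr (- 3 * \<beta> - 4)"
      proof -
        have "- \<beta> - 2 + (- \<beta> - 2) + (- \<beta> - 2) + 2 = - 3 * \<beta> - 4" by simp
        then show ?thesis by (simp only: powr_add[symmetric])
      qed
      finally show ?thesis using cw_add[of \<tau> s "- 3 * \<beta> - 4" x] by (simp add: algebra_simps)
    qed
    define A B where "A = \<tau> * (cw \<Gamma> \<beta> \<tau> (s - \<beta> - 2) x * (norm (p x))\<^sup>2)" "B = \<tau>^3 * (cw \<Gamma> \<beta> \<tau> (s - 3 * \<beta> - 4) x * (u x)\<^sup>2)"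
    have AB: "0 \<le> A" "0 \<le> B" using \<tau> by (auto simp: A_B_def cw_nonneg)
    have "(ew \<tau> (s/2) x)\<^sup>2 * (\<tau> * b x * (norm (p x))\<^sup>2 + (\<tau> * b x)^3 * (\<sigma> x)\<^sup>2 * (u x)\<^sup>2)
       = \<tau> * (cw \<Gamma> \<beta> \<tau> s x * b x) * (norm (p x))\<^sup>2 + \<tau>^3 * (cw \<Gamma> \<beta> \<tau> s x * ((b x)^3 * (\<sigma> x)\<^sup>2)) * (u x)\<^sup>2"
      unfolding e by (simp add: algebra_simps power_mult_distrib)
    also have "\<dots> = \<beta> * A + \<beta>^3 * B" unfolding 1 2 A_B_def by (simp add: algebra_simps)
    also have "\<dots> \<ge> min \<beta> (\<beta>^3) * A + min \<beta> (\<beta>^3) * B" using AB by (intro add_mono mult_right_mono) auto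
    finally have "min \<beta> (\<beta>^3) * (A + B) \<le> (ew \<tau> (s/2) x)\<^sup>2 * (\<tau> * b x * (norm (p x))\<^sup>2 + (\<tau> * b x)^3 * (\<sigma> x)\<^sup>2 * (u x)\<^sup>2)"
      by (simp add: distrib_left)
    then show "\<tau> * (cw \<Gamma> \<beta> \<tau> (s - \<beta> - 2) x * (norm (p x))\<^sup>2) + \<tau>^3 * (cw \<Gamma> \<beta> \<tau> (s - 3 * \<beta> - 4) x * (u x)\<^sup>2)
      \<le> (1 / min \<beta> (\<beta>^3)) * ((ew \<tau> (s/2) x)\<^sup>2 * (\<tau> * b x * (norm (p x))\<^sup>2 + (\<tau> * b x)^3 * (\<sigma> x)\<^sup>2 * (u x)\<^sup>2))"
      unfolding A_B_def[symmetric] using m0 by (simp add: field_simps)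
  qed
  also have "\<dots> = (1 / min \<beta> (\<beta>^3)) * (LINT x:Q|lborel. (ew \<tau> (s/2) x)\<^sup>2 * (\<tau> * b x * (norm (p x))\<^sup>2 + (\<tau> * b x)^3 * (\<sigma> x)\<^sup>2 * (u x)\<^sup>2))"
    by (rule set_integral_mult_right)
  also have "\<dots> \<le> (1 / min \<beta> (\<beta>^3)) * ((8 * K^4 + 2) * (4 / c1) * (LINT x:Q|lborel. (ew \<tau> (s/2) x)\<^sup>2 * (g x \<bullet> H x)\<^sup>2))"
    using m0 u' by (intro mult_left_mono carleman_gradient_estimate[OF T \<tau> k r4 r5 Q _ _ _ _ off]) auto
  finally show ?thesis unfolding Cgrad_def by (simp add: ew_square mult_ac)
qed

text \<open>With the exponent \<open>s + \<beta>\<close> for the Hessian, the gradient term of \<open>hessian_integral\<close> has the exponent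
\<open>s - \<beta> - 2\<close> and the factor \<open>\<tau>\<^sup>2\<close>, and thus is \<open>\<tau>\<close> times a term already estimated.\<close>

lemma hessian_estimate:
  assumes T: "admissible_threshold T" "T \<le> \<tau> * \<beta>" and \<tau>: "1 \<le> \<tau>" and k: "\<bar>s / 2\<bar> \<le> K" "\<bar>(s + \<beta>) / 2\<bar> \<le> K"
    and r4: "r * C4 \<le> \<epsilon> * lam" and r5: "r * C5 \<le> c1 / 2"
    and Q: "compact Q" "Q \<subseteq> {x. \<sigma> x < r} - {0}"
    and u: "C3_data u p H D"
    and off: "\<And>x. x \<notin> Q \<Longrightarrow> u x = 0 \<and> p x = 0"
  shows "(LINT x:Q|lborel. cw \<Gamma> \<beta> \<tau> (s + \<beta>) x * (norm (H x))\<^sup>2)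
    \<le> \<tau> * (Chess * (LINT x:Q|lborel. cw \<Gamma> \<beta> \<tau> s x * (g x \<bullet> H x)\<^sup>2))"
proof -
  have u2: "C2_data u p H" using u by (simp add: C3_data_def)
  have Q0: "Q \<subseteq> - {0}" using Q by auto
  have \<tau>0: "0 < \<tau>" using \<tau> by simp
  note cs = continuous_on_C2_data[OF u2]
  have csig: "continuous_on (- {0}) \<sigma>"
    using continuous_on_\<sigma>_powr[of 1] by (rule continuous_on_eq) (use \<sigma>_pos \<sigma>_nonneg in auto)
  define I where "I = (LINT x:Q|lborel. cw \<Gamma> \<beta> \<tau> s x * (g x \<bullet> H x)\<^sup>2)"
  define J where "J = (LINT x:Q|lborel. \<tau> * (cw \<Gamma> \<beta> \<tau> (s - \<beta> - 2) x * (norm (p x))\<^sup>2) + \<tau>^3 * (cw \<Gamma> \<beta> \<tau> (s - 3 * \<beta> - 4) x * (u x)\<^sup>2))"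
  have iI: "set_integrable lborel Q (\<lambda>x. cw \<Gamma> \<beta> \<tau> s x * (g x \<bullet> H x)\<^sup>2)"
    by (rule set_integrable_compact[OF Q(1) continuous_on_subset[OF _ Q0]])
      (intro continuous_intros continuous_on_cw cs continuous_on_g)
  have iJ: "set_integrable lborel Q (\<lambda>x. \<tau> * (cw \<Gamma> \<beta> \<tau> (s - \<beta> - 2) x * (norm (p x))\<^sup>2) + \<tau>^3 * (cw \<Gamma> \<beta> \<tau> (s - 3 * \<beta> - 4) x * (u x)\<^sup>2))"
    by (rule set_integrable_compact[OF Q(1) continuous_on_subset[OF _ Q0]])
      (intro continuous_intros continuous_on_cw cs)
  have J: "J \<le> Cgrad * I" unfolding J_def I_def by (rule gradient_estimate[OF T \<tau>0 k(1) r4 r5 Q u2 off])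
  have h: "2 * ((s + \<beta>) / 2) = s + \<beta>" by simp
  have ee: "(ew \<tau> ((s + \<beta>)/2) x)\<^sup>2 = cw \<Gamma> \<beta> \<tau> (s + \<beta>) x" for x by (simp only: ew_square h)
  have C90: "0 \<le> C9" using K0 by (simp add: C9_def)
  have st1: "(LINT x:Q|lborel. cw \<Gamma> \<beta> \<tau> (s + \<beta>) x * (norm (H x))\<^sup>2)
     \<le> C9 * (LINT x:Q|lborel. (ew \<tau> ((s + \<beta>)/2) x)\<^sup>2 * ((g x \<bullet> H x)\<^sup>2 + (4 * K\<^sup>2 * (\<tau> * b x * \<sigma> x))\<^sup>2 * (norm (p x))\<^sup>2))"
    using hessian_integral[OF T \<tau>0 k(2) Q, of p H D] u off unfolding C3_data_def C2_data_def ee by blast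
  have "(LINT x:Q|lborel. (ew \<tau> ((s + \<beta>)/2) x)\<^sup>2 * ((g x \<bullet> H x)\<^sup>2 + (4 * K\<^sup>2 * (\<tau> * b x * \<sigma> x))\<^sup>2 * (norm (p x))\<^sup>2))
     \<le> (LINT x:Q|lborel. \<tau> * (cw \<Gamma> \<beta> \<tau> s x * (g x \<bullet> H x)\<^sup>2) + (\<tau> * (16 * K^4 * \<beta>\<^sup>2)) * (\<tau> * (cw \<Gamma> \<beta> \<tau> (s - \<beta> - 2) x * (norm (p x))\<^sup>2) + \<tau>^3 * (cw \<Gamma> \<beta> \<tau> (s - 3 * \<beta> - 4) x * (u x)\<^sup>2)))"
  proof (rule set_integral_mono)
    show "set_integrable lborel Q (\<lambda>x. (ew \<tau> ((s + \<beta>)/2) x)\<^sup>2 * ((g x \<bullet> H x)\<^sup>2 + (4 * K\<^sup>2 * (\<tau> * b x * \<sigma> x))\<^sup>2 * (norm (p x))\<^sup>2))"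
      by (rule set_integrable_compact[OF Q(1) continuous_on_subset[OF _ Q0]])
        (intro continuous_intros continuous_on_ew cs csig continuous_on_g)
    show "set_integrable lborel Q (\<lambda>x. \<tau> * (cw \<Gamma> \<beta> \<tau> s x * (g x \<bullet> H x)\<^sup>2) + (\<tau> * (16 * K^4 * \<beta>\<^sup>2)) * (\<tau> * (cw \<Gamma> \<beta> \<tau> (s - \<beta> - 2) x * (norm (p x))\<^sup>2) + \<tau>^3 * (cw \<Gamma> \<beta> \<tau> (s - 3 * \<beta> - 4) x * (u x)\<^sup>2)))"
      by (rule set_integral_add(1); rule set_integrable_mult_right; rule iI iJ)
    fix x assume "x \<in> Q"
    then have x: "x \<noteq> 0" "\<sigma> x < r" using Q by auto
    have s: "0 < \<sigma> x" "\<sigma> x < 1" by (rule s[OF x])+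
    have 1: "cw \<Gamma> \<beta> \<tau> (s + \<beta>) x \<le> \<tau> * cw \<Gamma> \<beta> \<tau> s x"
    proof -
      have "\<sigma> x powr \<beta> \<le> 1" using s \<beta> by (simp add: powr_le1)
      then have "cw \<Gamma> \<beta> \<tau> (s + \<beta>) x \<le> cw \<Gamma> \<beta> \<tau> s x * 1" unfolding cw_add by (intro mult_left_mono cw_nonneg)
      also have "\<dots> \<le> \<tau> * cw \<Gamma> \<beta> \<tau> s x" using mult_right_mono[OF \<tau> cw_nonneg] by simp
      finally show ?thesis .
    qed
    have 2: "cw \<Gamma> \<beta> \<tau> (s + \<beta>) x * (4 * K\<^sup>2 * (\<tau> * b x * \<sigma> x))\<^sup>2 = \<tau> * (16 * K^4 * \<beta>\<^sup>2) * (\<tau> * cw \<Gamma> \<beta> \<tau> (s - \<beta> - 2) x)"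
    proof -
      have s2: "(\<sigma> x)\<^sup>2 = \<sigma> x powr 2" using s powr_realpow[of "\<sigma> x" 2] by simp
      have "cw \<Gamma> \<beta> \<tau> (s + \<beta>) x * ((b x)\<^sup>2 * (\<sigma> x)\<^sup>2) = \<beta>\<^sup>2 * (cw \<Gamma> \<beta> \<tau> (s + \<beta>) x * (\<sigma> x powr (- \<beta> - 2) * \<sigma> x powr (- \<beta> - 2) * \<sigma> x powr 2))"
        unfolding b_def s2 power_mult_distrib by (simp add: power2_eq_square mult_ac)
      also have "\<dots> = \<beta>\<^sup>2 * cw \<Gamma> \<beta> \<tau> (s - \<beta> - 2) x" unfolding powr_add[symmetric] cw_add[symmetric] by (simp add: algebra_simps)
      finally show ?thesis by (simp add: power_mult_distrib algebra_simps power2_eq_square power4_eq_xxxx)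
    qed
    have "(ew \<tau> ((s + \<beta>)/2) x)\<^sup>2 * ((g x \<bullet> H x)\<^sup>2 + (4 * K\<^sup>2 * (\<tau> * b x * \<sigma> x))\<^sup>2 * (norm (p x))\<^sup>2)
       = cw \<Gamma> \<beta> \<tau> (s + \<beta>) x * (g x \<bullet> H x)\<^sup>2 + (cw \<Gamma> \<beta> \<tau> (s + \<beta>) x * (4 * K\<^sup>2 * (\<tau> * b x * \<sigma> x))\<^sup>2) * (norm (p x))\<^sup>2"
      unfolding ee by (simp add: algebra_simps)
    also have "\<dots> \<le> \<tau> * cw \<Gamma> \<beta> \<tau> s x * (g x \<bullet> H x)\<^sup>2 + \<tau> * (16 * K^4 * \<beta>\<^sup>2) * (\<tau> * cw \<Gamma> \<beta> \<tau> (s - \<beta> - 2) x) * (norm (p x))\<^sup>2"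
      unfolding 2 using 1 by (intro add_right_mono mult_right_mono) auto
    also have "\<dots> \<le> \<tau> * (cw \<Gamma> \<beta> \<tau> s x * (g x \<bullet> H x)\<^sup>2) + (\<tau> * (16 * K^4 * \<beta>\<^sup>2)) * (\<tau> * (cw \<Gamma> \<beta> \<tau> (s - \<beta> - 2) x * (norm (p x))\<^sup>2) + \<tau>^3 * (cw \<Gamma> \<beta> \<tau> (s - 3 * \<beta> - 4) x * (u x)\<^sup>2))"
      using \<tau>0 by (simp add: distrib_left mult.assoc cw_nonneg)
    finally show "(ew \<tau> ((s + \<beta>)/2) x)\<^sup>2 * ((g x \<bullet> H x)\<^sup>2 + (4 * K\<^sup>2 * (\<tau> * b x * \<sigma> x))\<^sup>2 * (norm (p x))\<^sup>2) \<le> \<dots>" .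
  qed
  also have "\<dots> = \<tau> * I + \<tau> * (16 * K^4 * \<beta>\<^sup>2) * J"
    unfolding I_def J_def
    by (subst set_integral_add(2)[OF set_integrable_mult_right[OF iI] set_integrable_mult_right[OF iJ]]) (simp only: set_integral_mult_right)
  also have "\<dots> \<le> \<tau> * I + \<tau> * (16 * K^4 * \<beta>\<^sup>2) * (Cgrad * I)"
    using \<tau>0 J by (intro mult_left_mono add_left_mono) auto
  finally have st3: "(LINT x:Q|lborel. (ew \<tau> ((s + \<beta>)/2) x)\<^sup>2 * ((g x \<bullet> H x)\<^sup>2 + (4 * K\<^sup>2 * (\<tau> * b x * \<sigma> x))\<^sup>2 * (norm (p x))\<^sup>2))
    \<le> \<tau> * I + \<tau> * (16 * K^4 * \<beta>\<^sup>2) * (Cgrad * I)" .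
  show ?thesis using order_trans[OF st1 mult_left_mono[OF st3 C90]]
    unfolding I_def[symmetric] Chess_def by (simp add: algebra_simps)
qed

end

definition carleman_bound ::
  "(real^'n::finite \<Rightarrow> real^'n^'n) \<Rightarrow> real^'n^'n \<Rightarrow> real \<Rightarrow> real \<Rightarrow> real \<Rightarrow> real \<Rightarrow> real \<Rightarrow> bool" where
  "carleman_bound g \<Gamma> \<beta> s r C \<tau>0 \<longleftrightarrow> (\<forall>\<tau> Q. \<tau>0 \<le> \<tau> \<longrightarrow> compact Q \<longrightarrow> Q \<subseteq> sigma_ball \<Gamma> r - {0} \<longrightarrow>
    (\<forall>u p H. C2_data u p H \<longrightarrow> (\<forall>x. x \<notin> Q \<longrightarrow> u x = 0 \<and> p x = 0) \<longrightarrow>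
      (LINT x:Q|lborel. \<tau> * (cw \<Gamma> \<beta> \<tau> (s - \<beta> - 2) x * (norm (p x))\<^sup>2) + \<tau>^3 * (cw \<Gamma> \<beta> \<tau> (s - 3 * \<beta> - 4) x * (u x)\<^sup>2))
      \<le> C * (LINT x:Q|lborel. cw \<Gamma> \<beta> \<tau> s x * (g x \<bullet> H x)\<^sup>2)) \<and>
    (\<forall>u p H D. C3_data u p H D \<longrightarrow> (\<forall>x. x \<notin> Q \<longrightarrow> u x = 0 \<and> p x = 0) \<longrightarrow>
      (LINT x:Q|lborel. cw \<Gamma> \<beta> \<tau> (s + \<beta>) x * (norm (H x))\<^sup>2)
      \<le> \<tau> * (C * (LINT x:Q|lborel. cw \<Gamma> \<beta> \<tau> s x * (g x \<bullet> H x)\<^sup>2))))"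

lemma cw_integral_nonneg: "0 \<le> (LINT x:Q|lborel. cw \<Gamma> \<beta> \<tau> s x * (f x)\<^sup>2)"
  unfolding set_lebesgue_integral_def by (rule integral_nonneg_AE) (auto simp: cw_nonneg indicator_def)

text \<open>The constants are chosen before the coefficients. Since \<open>g\<close> is Lipschitz with constant \<open>Lam\<close>, it is compared with \<open>G\<close> on
a small ball nearly as well as at the origin, uniformly in \<open>g\<close>.\<close>

theorem second_order_carleman:
  fixes lam Lam \<beta> \<epsilon> s :: real
  assumes lam: "0 < lam" "lam \<le> 1" and Lam: "0 \<le> Lam" and \<beta>: "0 < \<beta>" and \<epsilon>: "0 < \<epsilon>"
  shows "\<exists>r0 C \<tau>0. 0 < r0 \<and> r0 < 1 \<and> 0 < C \<and> 1 \<le> \<tau>0 \<and>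
    (\<forall>(g :: real^'n::finite \<Rightarrow> real^'n^'n) g' \<Gamma> G m M.
      elliptic_C1 g g' lam Lam \<longrightarrow> quad_weight \<Gamma> lam \<longrightarrow> transpose G = G \<longrightarrow> G ** \<Gamma> = mat 1 \<longrightarrow> \<Gamma> ** G = mat 1 \<longrightarrow>
      (\<forall>\<xi>. m * ((G *v \<xi>) \<bullet> \<xi>) \<le> (g 0 *v \<xi>) \<bullet> \<xi> \<and> (g 0 *v \<xi>) \<bullet> \<xi> \<le> M * ((G *v \<xi>) \<bullet> \<xi>)) \<longrightarrow>
      lam\<^sup>2 \<le> m \<longrightarrow> m \<le> M \<longrightarrow> M \<le> (inverse lam)\<^sup>2 \<longrightarrow> 4 * \<epsilon> \<le> (\<beta> + 1) * m - M \<longrightarrow>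
      carleman_bound g \<Gamma> \<beta> s r0 C \<tau>0)"
proof -
  define K where "K = inverse lam + Lam + CARD('n) + \<epsilon> + (\<beta> + 2) + \<bar>s / 2\<bar> + \<bar>(s + \<beta>) / 2\<bar>"
  have il: "1 \<le> inverse lam" using lam by (simp add: one_le_inverse)
  have K: "inverse lam \<le> K" "Lam \<le> K" "real CARD('n) \<le> K" "\<epsilon> \<le> K" "\<beta> + 2 \<le> K" "1 \<le> K" "\<bar>s / 2\<bar> \<le> K" "\<bar>(s + \<beta>) / 2\<bar> \<le> K"
    using il Lam \<epsilon> \<beta> abs_ge_zero[of "s / 2"] abs_ge_zero[of "(s + \<beta>) / 2"] of_nat_0_le_iff[of "CARD('n)", where 'a = real]
    unfolding K_def by linarith+
  note Ks = K(7,8)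
  define c where "c = lam\<^sup>2 * \<epsilon>"
  have c: "0 < c" using lam \<epsilon> by (simp add: c_def)
  have el: "0 < \<epsilon> * lam" using lam \<epsilon> by simp
  \<comment> \<open>On the ball \<open>\<sigma> < r\<close> the form of \<open>g\<close> differs from that at the origin by at most \<open>\<eta> r\<close> times the form of \<open>G\<close>.\<close>
  define \<eta> where "\<eta> = Lam * (inverse lam)^3"
  have \<eta>: "0 \<le> \<eta>" using Lam lam by (simp add: \<eta>_def)
  define X where "X = 2 + \<bar>carleman_weight.C4 K\<bar> / (\<epsilon> * lam) + \<bar>carleman_weight.C5 K\<bar> * 2 / c + \<eta> * 2 / lam\<^sup>2 + \<eta> * (\<beta> + 2) / (2 * \<epsilon>)"
  have X: "2 \<le> X" "\<bar>carleman_weight.C4 K\<bar> / (\<epsilon> * lam) \<le> X" "\<bar>carleman_weight.C5 K\<bar> * 2 / c \<le> X" "\<eta> * 2 / lam\<^sup>2 \<le> X" "\<eta> * (\<beta> + 2) / (2 * \<epsilon>) \<le> X"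
  proof -
    have n: "0 \<le> \<bar>carleman_weight.C4 K\<bar> / (\<epsilon> * lam)" "0 \<le> \<bar>carleman_weight.C5 K\<bar> * 2 / c" "0 \<le> \<eta> * 2 / lam\<^sup>2" "0 \<le> \<eta> * (\<beta> + 2) / (2 * \<epsilon>)"
      using c el \<eta> \<beta> \<epsilon> by (auto intro!: divide_nonneg_nonneg)
    then show "2 \<le> X" "\<bar>carleman_weight.C4 K\<bar> / (\<epsilon> * lam) \<le> X" "\<bar>carleman_weight.C5 K\<bar> * 2 / c \<le> X" "\<eta> * 2 / lam\<^sup>2 \<le> X" "\<eta> * (\<beta> + 2) / (2 * \<epsilon>) \<le> X"
      unfolding X_def by linarith+
  qed
  define r where "r = 1 / X"
  have r: "0 < r" "r < 1" using X(1) by (auto simp: r_def)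
  have rr: "r * carleman_weight.C4 K \<le> \<epsilon> * lam" "r * carleman_weight.C5 K \<le> c / 2" "\<eta> * r \<le> lam\<^sup>2 / 2" "(\<beta> + 2) * (\<eta> * r) \<le> 2 * \<epsilon>"
  proof -
    have Xp: "0 < X" using X by linarith
    have "\<bar>carleman_weight.C4 K\<bar> \<le> \<epsilon> * lam * X" using X(2) el by (simp add: pos_divide_le_eq mult.commute)
    then have "carleman_weight.C4 K \<le> \<epsilon> * lam * X" by linarith
    then show "r * carleman_weight.C4 K \<le> \<epsilon> * lam" using Xp by (simp add: r_def pos_divide_le_eq)
    have "\<bar>carleman_weight.C5 K\<bar> * 2 \<le> c * X" using X(3) c by (simp add: pos_divide_le_eq mult.commute)
    then have "carleman_weight.C5 K \<le> c / 2 * X" by (simp add: abs_le_iff)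
    then show "r * carleman_weight.C5 K \<le> c / 2" using Xp by (simp add: r_def pos_divide_le_eq)
    have "\<eta> * 2 \<le> lam\<^sup>2 * X" using X(4) lam by (simp add: pos_divide_le_eq mult.commute)
    then show "\<eta> * r \<le> lam\<^sup>2 / 2" using Xp by (simp add: r_def pos_divide_le_eq)
    have "\<eta> * (\<beta> + 2) \<le> 2 * \<epsilon> * X" using X(5) \<epsilon> by (simp add: pos_divide_le_eq mult.commute)
    then show "(\<beta> + 2) * (\<eta> * r) \<le> 2 * \<epsilon>" using Xp by (simp add: r_def pos_divide_le_eq mult.commute)
  qed
  define T where "T = 1 + 4 * ((carleman_weight.Cd K * K)\<^sup>2 / (\<epsilon> * lam)) / c + 4 * (carleman_weight.Cm K)\<^sup>2 / c + 8 * (carleman_weight.C8 K)\<^sup>2 / c"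
  define C where "C = max 1 (max (carleman_weight.Cgrad lam \<beta> \<epsilon> K) (carleman_weight.Chess lam \<beta> \<epsilon> K))"
  define \<tau>0 where "\<tau>0 = max 1 (T / \<beta>)"
  have main: "carleman_bound g \<Gamma> \<beta> s r C \<tau>0"
    if ell: "elliptic_C1 g g' lam Lam" and qw: "quad_weight \<Gamma> lam" and G: "transpose G = G" "G ** \<Gamma> = mat 1" "\<Gamma> ** G = mat 1"
      and gG: "\<And>\<xi>. m * ((G *v \<xi>) \<bullet> \<xi>) \<le> (g 0 *v \<xi>) \<bullet> \<xi>" "\<And>\<xi>. (g 0 *v \<xi>) \<bullet> \<xi> \<le> M * ((G *v \<xi>) \<bullet> \<xi>)"
      and mM: "lam\<^sup>2 \<le> m" "m \<le> M" "M \<le> (inverse lam)\<^sup>2" and gap: "4 * \<epsilon> \<le> (\<beta> + 1) * m - M"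
    for g :: "real^'n \<Rightarrow> real^'n^'n" and g' \<Gamma> G m M
  proof -
    interpret E: elliptic_C1 g g' lam Lam by (rule ell)
    interpret W: quad_weight \<Gamma> lam by (rule qw)
    have G_ge: "(norm \<xi>)\<^sup>2 \<le> (inverse lam)\<^sup>2 * ((G *v \<xi>) \<bullet> \<xi>)" for \<xi>
    proof -
      have "\<Gamma> *v (G *v \<xi>) = \<xi>" by (metis G(3) matrix_vector_mul_assoc matrix_vector_mul_lid)
      then have n: "norm \<xi> \<le> inverse lam * W.\<sigma> (G *v \<xi>)" and q: "(W.\<sigma> (G *v \<xi>))\<^sup>2 = (G *v \<xi>) \<bullet> \<xi>"
        using W.norm_\<Gamma>_le_\<sigma>[of "G *v \<xi>"] W.\<sigma>_square[of "G *v \<xi>"] by (simp_all add: inner_commute)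
      have "(norm \<xi>)\<^sup>2 \<le> (inverse lam * W.\<sigma> (G *v \<xi>))\<^sup>2" using n by (intro power_mono) auto
      then show ?thesis by (simp only: power_mult_distrib q)
    qed
    have dev: "\<bar>(g x *v \<xi>) \<bullet> \<xi> - (g 0 *v \<xi>) \<bullet> \<xi>\<bar> \<le> \<eta> * r * ((G *v \<xi>) \<bullet> \<xi>)" if "W.\<sigma> x < r" for x \<xi>
    proof -
      have "norm (g x - g 0) \<le> Lam * norm (x - 0)"
      proof (rule differentiable_bound[where S = UNIV and f' = g'])
        show "onorm (g' y) \<le> Lam" for y by (rule onorm_le) (rule E.g'_bound)
      qed (use E.g_deriv in auto)
      also have "\<dots> \<le> Lam * (inverse lam * r)"
      proof (rule mult_left_mono[OF _ Lam])
        have "inverse lam * W.\<sigma> x \<le> inverse lam * r" using that lam by (intro mult_left_mono) auto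
        then show "norm (x - 0) \<le> inverse lam * r" using W.norm_le_\<sigma>[of x] by simp
      qed
      finally have n: "norm (g x - g 0) \<le> Lam * (inverse lam * r)" .
      have "\<bar>((g x - g 0) *v \<xi>) \<bullet> \<xi>\<bar> \<le> Lam * (inverse lam * r) * norm \<xi> * norm \<xi>"
        by (intro abs_inner_leI norm_mv_leI n order_refl)
      also have "\<dots> = Lam * (inverse lam * r) * (norm \<xi>)\<^sup>2" by (simp add: power2_eq_square)
      also have "\<dots> \<le> Lam * (inverse lam * r) * ((inverse lam)\<^sup>2 * ((G *v \<xi>) \<bullet> \<xi>))"
        using G_ge Lam lam r by (intro mult_left_mono) auto
      also have "\<dots> = \<eta> * r * ((G *v \<xi>) \<bullet> \<xi>)" by (simp add: \<eta>_def power2_eq_square power3_eq_cube)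
      finally show ?thesis by (simp add: matrix_vector_mult_diff_rdistrib inner_diff_left)
    qed
    define m' M' where "m' = m - \<eta> * r" "M' = M + \<eta> * r"
    have er: "0 \<le> \<eta> * r" using \<eta> r by simp
    interpret carleman_weight g g' lam Lam \<Gamma> G \<beta> \<epsilon> m' M' r K
    proof (unfold_locales)
      fix x \<xi> assume x: "W.\<sigma> x < r"
      show "m' * ((G *v \<xi>) \<bullet> \<xi>) \<le> (g x *v \<xi>) \<bullet> \<xi>"
        using dev[OF x, of \<xi>] gG(1)[of \<xi>] unfolding m'_M'_def left_diff_distrib by linarith
      show "(g x *v \<xi>) \<bullet> \<xi> \<le> M' * ((G *v \<xi>) \<bullet> \<xi>)"
        using dev[OF x, of \<xi>] gG(2)[of \<xi>] unfolding m'_M'_def distrib_right by linarith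
    next
      show "lam\<^sup>2 / 2 \<le> m'" using mM(1) rr(3) unfolding m'_M'_def by (simp add: field_simps)
      show "m' \<le> M'" using mM(2) er unfolding m'_M'_def by linarith
      have "lam\<^sup>2 \<le> 1" using lam by (simp add: power_le_one)
      moreover have "1 \<le> (inverse lam)\<^sup>2" using il by (simp add: one_le_power)
      ultimately show "M' \<le> 2 * (inverse lam)\<^sup>2" using mM(3) rr(3) unfolding m'_M'_def by linarith
      have "(\<beta> + 1) * m' - M' = (\<beta> + 1) * m - M - (\<beta> + 2) * (\<eta> * r)" unfolding m'_M'_def by (simp add: algebra_simps)
      then show "2 * \<epsilon> \<le> (\<beta> + 1) * m' - M'" using gap rr(4) by linarith
    qed (use G \<beta> \<epsilon> r K in auto)
    have cc: "c1 = c" by (simp add: c1_def c_def)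
    have T: "admissible_threshold T"
    proof -
      have n: "0 \<le> 4 * ((Cd * K)\<^sup>2 / (\<epsilon> * lam)) / c" "0 \<le> 4 * Cm\<^sup>2 / c" "0 \<le> 8 * C8\<^sup>2 / c"
        using el c by (auto intro!: divide_nonneg_nonneg)
      have mul: "y \<le> c * T" if "y / c \<le> T" for y using that c by (simp add: pos_divide_le_eq mult.commute)
      show ?thesis unfolding admissible_threshold_def cc
        by (intro conjI mul) (use n in \<open>auto simp: T_def\<close>)
    qed
    have CC: "Cgrad \<le> C" "Chess \<le> C" by (auto simp: C_def)
    show ?thesis unfolding carleman_bound_def
    proof (intro allI impI conjI)
      fix \<tau> Q and u :: "real^'n \<Rightarrow> real" and p H
      assume \<tau>: "\<tau>0 \<le> \<tau>" and Q: "compact Q" "Q \<subseteq> sigma_ball \<Gamma> r - {0}"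
        and u: "C2_data u p H" "\<forall>x. x \<notin> Q \<longrightarrow> u x = 0 \<and> p x = 0"
      have \<tau>': "0 < \<tau>" "T \<le> \<tau> * \<beta>" using \<tau> \<beta> by (auto simp: \<tau>0_def field_simps)
      have Q': "Q \<subseteq> {x. W.\<sigma> x < r} - {0}" using Q(2) by (auto simp: sigma_ball_def)
      show "(LINT x:Q|lborel. \<tau> * (cw \<Gamma> \<beta> \<tau> (s - \<beta> - 2) x * (norm (p x))\<^sup>2) + \<tau>^3 * (cw \<Gamma> \<beta> \<tau> (s - 3 * \<beta> - 4) x * (u x)\<^sup>2))
        \<le> C * (LINT x:Q|lborel. cw \<Gamma> \<beta> \<tau> s x * (g x \<bullet> H x)\<^sup>2)"
        using gradient_estimate[OF T \<tau>'(2,1) Ks(1) rr(1) _ Q(1) Q' u(1)] rr(2) u(2)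
          mult_right_mono[OF CC(1) cw_integral_nonneg[of Q \<Gamma> \<beta> \<tau> s "\<lambda>x. g x \<bullet> H x"]] by (simp add: cc)
    next
      fix \<tau> Q and u :: "real^'n \<Rightarrow> real" and p H D
      assume \<tau>: "\<tau>0 \<le> \<tau>" and Q: "compact Q" "Q \<subseteq> sigma_ball \<Gamma> r - {0}"
        and u: "C3_data u p H D" "\<forall>x. x \<notin> Q \<longrightarrow> u x = 0 \<and> p x = 0"
      have \<tau>': "1 \<le> \<tau>" "T \<le> \<tau> * \<beta>" using \<tau> \<beta> by (auto simp: \<tau>0_def field_simps)
      have Q': "Q \<subseteq> {x. W.\<sigma> x < r} - {0}" using Q(2) by (auto simp: sigma_ball_def)
      have "Chess * (LINT x:Q|lborel. cw \<Gamma> \<beta> \<tau> s x * (g x \<bullet> H x)\<^sup>2) \<le> C * (LINT x:Q|lborel. cw \<Gamma> \<beta> \<tau> s x * (g x \<bullet> H x)\<^sup>2)"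
        by (rule mult_right_mono[OF CC(2) cw_integral_nonneg])
      then have "\<tau> * (Chess * (LINT x:Q|lborel. cw \<Gamma> \<beta> \<tau> s x * (g x \<bullet> H x)\<^sup>2)) \<le> \<tau> * (C * (LINT x:Q|lborel. cw \<Gamma> \<beta> \<tau> s x * (g x \<bullet> H x)\<^sup>2))"
        using \<tau>' by (intro mult_left_mono) auto
      then show "(LINT x:Q|lborel. cw \<Gamma> \<beta> \<tau> (s + \<beta>) x * (norm (H x))\<^sup>2)
        \<le> \<tau> * (C * (LINT x:Q|lborel. cw \<Gamma> \<beta> \<tau> s x * (g x \<bullet> H x)\<^sup>2))"
        using hessian_estimate[OF T \<tau>'(2,1) Ks rr(1) _ Q(1) Q' u(1)] rr(2) u(2) by (simp add: cc)
    qed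
  qed
  have "0 < C" "1 \<le> \<tau>0" by (auto simp: C_def \<tau>0_def)
  with r main show ?thesis
    by (intro exI[of _ r] exI[of _ C] exI[of _ \<tau>0] conjI allI impI) (assumption+, blast)
qed

section \<open>Smooth functions\<close>

lemma has_derivative_vecI:
  fixes f :: "'a::real_normed_vector \<Rightarrow> 'b::euclidean_space^'n::finite"
  assumes "\<And>i. ((\<lambda>x. f x $ i) has_derivative (\<lambda>h. f' h $ i)) (at x)"
  shows "(f has_derivative f') (at x)"
proof (subst has_derivative_componentwise_within, rule ballI)
  fix v :: "'b^'n" assume "v \<in> Basis"
  then obtain i b where v: "v = axis i b" by (auto simp: Basis_vec_def)
  show "((\<lambda>x. f x \<bullet> v) has_derivative (\<lambda>h. f' h \<bullet> v)) (at x)"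
    unfolding v inner_axis by (rule has_derivative_inner_left[OF assms])
qed

definition grad :: "(real^'n::finite \<Rightarrow> real) \<Rightarrow> real^'n \<Rightarrow> real^'n" where
  "grad f x = (\<chi> i. partial_deriv i f x)"

definition hess :: "(real^'n::finite \<Rightarrow> real) \<Rightarrow> real^'n \<Rightarrow> real^'n^'n" where
  "hess f x = (\<chi> i j. iter_partial [i, j] f x)"

definition hess' :: "(real^'n::finite \<Rightarrow> real) \<Rightarrow> real^'n \<Rightarrow> real^'n \<Rightarrow> real^'n^'n" where
  "hess' f x h = (\<chi> i j. \<Sum>k\<in>UNIV. h $ k * iter_partial [k, i, j] f x)"

lemma partial_deriv_has_derivative:
  assumes "(f has_derivative f') (at x)"
  shows "partial_deriv i f x = f' (axis i 1)"
    and "((\<lambda>t. f (x + t *\<^sub>R axis i 1)) has_real_derivative partial_deriv i f x) (at 0)"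
proof -
  have 1: "((\<lambda>t. f (x + t *\<^sub>R axis i 1)) has_derivative (\<lambda>t. f' (t *\<^sub>R axis i 1))) (at 0)"
    by (rule has_derivative_compose[of "\<lambda>t. x + t *\<^sub>R axis i 1"]) (use assms in \<open>auto intro!: derivative_eq_intros\<close>)
  have lin: "linear f'" by (rule has_derivative_linear[OF assms])
  have d: "((\<lambda>t. f (x + t *\<^sub>R axis i 1)) has_real_derivative f' (axis i 1)) (at 0)"
    unfolding has_field_derivative_def
    by (rule has_derivative_eq_rhs[OF 1]) (simp add: fun_eq_iff linear_cmul[OF lin])
  then show "partial_deriv i f x = f' (axis i 1)" unfolding partial_deriv_def by (rule DERIV_imp_deriv)
  with d show "((\<lambda>t. f (x + t *\<^sub>R axis i 1)) has_real_derivative partial_deriv i f x) (at 0)" by simp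
qed

lemma linear_eq_inner:
  fixes l :: "real^'n::finite \<Rightarrow> real"
  assumes "linear l" shows "l h = (\<chi> i. l (axis i 1)) \<bullet> h"
proof -
  have "h = (\<Sum>i\<in>UNIV. h $ i *\<^sub>R axis i 1)" by (simp add: vec_eq_iff axis_def if_distrib cong: if_cong)
  then have "l h = l (\<Sum>i\<in>UNIV. h $ i *\<^sub>R axis i 1)" by simp
  then show ?thesis using assms by (simp add: linear_sum linear_cmul inner_vec_def mult.commute)
qed

lemma has_derivative_grad:
  fixes f :: "real^'n::finite \<Rightarrow> real"
  assumes "f differentiable (at x)"
  shows "(f has_derivative (\<lambda>h. grad f x \<bullet> h)) (at x)"
proof -
  obtain f' where f': "(f has_derivative f') (at x)" using assms by (auto simp: differentiable_def)
  then have "f' h = grad f x \<bullet> h" for h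
    using linear_eq_inner[of f' h] has_derivative_linear[OF f'] partial_deriv_has_derivative(1)[OF f'] by (simp add: grad_def)
  then show ?thesis using f' has_derivative_eq_rhs by blast
qed

lemma iter_partial_append: "iter_partial (is @ js) f = iter_partial is (iter_partial js f)"
  by (induction "is") auto

lemma smooth_iter_partial: "smooth f \<Longrightarrow> smooth (iter_partial is f)"
  by (auto simp: smooth_def iter_partial_append[symmetric])

lemma smooth_partial_deriv: "smooth f \<Longrightarrow> smooth (partial_deriv i f)"
  using smooth_iter_partial[of f "[i]"] by simp

lemma smooth_differentiable: "smooth f \<Longrightarrow> f differentiable (at x)"
  unfolding smooth_def using iter_partial.simps(1) by metis

lemma smooth_has_derivative: "smooth f \<Longrightarrow> (f has_derivative (\<lambda>h. grad f x \<bullet> h)) (at x)"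
  by (rule has_derivative_grad[OF smooth_differentiable])

lemma smooth_continuous_on: "smooth f \<Longrightarrow> continuous_on S f"
  using smooth_has_derivative by (meson continuous_at_imp_continuous_on has_derivative_continuous)

lemma smooth_iter_continuous_on: "smooth f \<Longrightarrow> continuous_on S (iter_partial is f)"
  by (rule smooth_continuous_on[OF smooth_iter_partial])

lemma smooth_line_derivative:
  assumes "smooth f"
  shows "((\<lambda>t. f (y + t *\<^sub>R axis i 1)) has_real_derivative partial_deriv i f (y + t *\<^sub>R axis i 1)) (at t)"
proof -
  have "((\<lambda>s. f ((y + t *\<^sub>R axis i 1) + (s - t) *\<^sub>R axis i 1)) has_real_derivative partial_deriv i f (y + t *\<^sub>R axis i 1)) (at t)"
    using DERIV_shift[of "\<lambda>s. f ((y + t *\<^sub>R axis i 1) + (s - t) *\<^sub>R axis i 1)" _ 0 t]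
      partial_deriv_has_derivative(2)[OF smooth_has_derivative[OF assms], of "y + t *\<^sub>R axis i 1" i] by simp
  then show ?thesis by (simp add: algebra_simps)
qed

text \<open>Schwarz's theorem: both mixed derivatives are limits of the same second difference.\<close>

lemma second_difference:
  assumes f: "smooth f" and h: "0 < h"
  shows "\<exists>y. norm (y - x) \<le> 2 * h \<and>
    f (x + h *\<^sub>R axis i 1 + h *\<^sub>R axis j 1) - f (x + h *\<^sub>R axis i 1) - (f (x + h *\<^sub>R axis j 1) - f x)
      = h * h * partial_deriv j (partial_deriv i f) y"
proof -
  let ?\<phi> = "\<lambda>t. f ((x + h *\<^sub>R axis j 1) + t *\<^sub>R axis i 1) - f (x + t *\<^sub>R axis i 1)"
  have "\<exists>t>0. t < h \<and> ?\<phi> h - ?\<phi> 0 = (h - 0) * (partial_deriv i f ((x + h *\<^sub>R axis j 1) + t *\<^sub>R axis i 1) - partial_deriv i f (x + t *\<^sub>R axis i 1))"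
    by (rule MVT2[OF h]) (rule DERIV_diff[OF smooth_line_derivative[OF f] smooth_line_derivative[OF f]])
  then obtain t where t: "0 < t" "t < h" "?\<phi> h - ?\<phi> 0 = h * (partial_deriv i f ((x + h *\<^sub>R axis j 1) + t *\<^sub>R axis i 1) - partial_deriv i f (x + t *\<^sub>R axis i 1))"
    by auto
  let ?\<psi> = "\<lambda>s. partial_deriv i f ((x + t *\<^sub>R axis i 1) + s *\<^sub>R axis j 1)"
  have "\<exists>s>0. s < h \<and> ?\<psi> h - ?\<psi> 0 = (h - 0) * partial_deriv j (partial_deriv i f) ((x + t *\<^sub>R axis i 1) + s *\<^sub>R axis j 1)"
    by (rule MVT2[OF h]) (rule smooth_line_derivative[OF smooth_partial_deriv[OF f]])
  then obtain s where s: "0 < s" "s < h" "?\<psi> h - ?\<psi> 0 = h * partial_deriv j (partial_deriv i f) ((x + t *\<^sub>R axis i 1) + s *\<^sub>R axis j 1)"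
    by auto
  have "norm ((x + t *\<^sub>R axis i 1) + s *\<^sub>R axis j 1 - x) \<le> 2 * h"
  proof -
    have "norm (t *\<^sub>R axis i (1::real) + s *\<^sub>R axis j 1) \<le> t + s"
      using norm_triangle_ineq[of "t *\<^sub>R axis i (1::real)" "s *\<^sub>R axis j 1"] s t by simp
    then show ?thesis using s t by (simp add: add.assoc)
  qed
  moreover have "?\<phi> h - ?\<phi> 0 = h * (?\<psi> h - ?\<psi> 0)" using t(3) by (simp add: add_ac)
  ultimately show ?thesis using s(3) by (intro exI[of _ "(x + t *\<^sub>R axis i 1) + s *\<^sub>R axis j 1"]) (simp add: add_ac)
qed

lemma partial_deriv_commute:
  assumes f: "smooth f"
  shows "partial_deriv i (partial_deriv j f) x = partial_deriv j (partial_deriv i f) x"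
proof -
  let ?A = "partial_deriv j (partial_deriv i f)" and ?B = "partial_deriv i (partial_deriv j f)"
  have cA: "isCont ?A x" and cB: "isCont ?B x"
    using smooth_continuous_on[OF smooth_partial_deriv[OF smooth_partial_deriv[OF f]], of UNIV]
    by (auto simp: continuous_on_eq_continuous_at)
  have "\<exists>y z. norm (y - x) \<le> 2 * inverse (real (Suc n)) \<and> norm (z - x) \<le> 2 * inverse (real (Suc n)) \<and> ?A y = ?B z" for n
  proof -
    let ?h = "inverse (real (Suc n))"
    have h: "0 < ?h" by simp
    obtain y where y: "norm (y - x) \<le> 2 * ?h" "f (x + ?h *\<^sub>R axis i 1 + ?h *\<^sub>R axis j 1) - f (x + ?h *\<^sub>R axis i 1) - (f (x + ?h *\<^sub>R axis j 1) - f x) = ?h * ?h * ?A y"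
      using second_difference[OF f h] by blast
    obtain z where z: "norm (z - x) \<le> 2 * ?h" "f (x + ?h *\<^sub>R axis j 1 + ?h *\<^sub>R axis i 1) - f (x + ?h *\<^sub>R axis j 1) - (f (x + ?h *\<^sub>R axis i 1) - f x) = ?h * ?h * ?B z"
      using second_difference[OF f h] by blast
    have "?h * ?h * ?A y = ?h * ?h * ?B z" unfolding y(2)[symmetric] z(2)[symmetric] by (simp add: add_ac)
    then have "?A y = ?B z" using h by (metis mult_cancel_left mult_eq_0_iff less_irrefl)
    then show ?thesis using y z by blast
  qed
  then have ex: "\<forall>n. \<exists>p. norm (fst p - x) \<le> 2 * inverse (real (Suc n)) \<and> norm (snd p - x) \<le> 2 * inverse (real (Suc n)) \<and> ?A (fst p) = ?B (snd p)"
    by simp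
  obtain p where p: "\<forall>n. norm (fst (p n) - x) \<le> 2 * inverse (real (Suc n)) \<and> norm (snd (p n) - x) \<le> 2 * inverse (real (Suc n)) \<and> ?A (fst (p n)) = ?B (snd (p n))"
    using choice[OF ex] by (elim exE)
  define y z where "y n = fst (p n)" "z n = snd (p n)" for n
  have yz: "norm (y n - x) \<le> 2 * inverse (real (Suc n))" "norm (z n - x) \<le> 2 * inverse (real (Suc n))" "?A (y n) = ?B (z n)" for n
    using p by (simp_all add: y_z_def)
  have l: "(\<lambda>n. 2 * inverse (real (Suc n))) \<longlonglongrightarrow> 0" using tendsto_mult_right_zero[OF LIMSEQ_inverse_real_of_nat] by blast
  have conv: "w \<longlonglongrightarrow> x" if "\<And>n. norm (w n - x) \<le> 2 * inverse (real (Suc n))" for w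
  proof -
    have "(\<lambda>n. w n - x) \<longlonglongrightarrow> 0"
      by (rule Lim_null_comparison[OF _ l]) (use that in simp)
    then show ?thesis by (rule LIM_zero_cancel)
  qed
  have "y \<longlonglongrightarrow> x" "z \<longlonglongrightarrow> x" using conv yz(1,2) by auto
  then have "(\<lambda>n. ?A (y n)) \<longlonglongrightarrow> ?A x" "(\<lambda>n. ?B (z n)) \<longlonglongrightarrow> ?B x"
    by (auto intro: isCont_tendsto_compose[OF cA] isCont_tendsto_compose[OF cB])
  then show ?thesis using LIMSEQ_unique[of "\<lambda>n. ?A (y n)" "?A x" "?B x"] yz(3) by simp
qed

lemma iter_partial_commute:
  assumes "smooth f"
  shows "iter_partial (i # j # is) f x = iter_partial (j # i # is) f x"
  using partial_deriv_commute[OF smooth_iter_partial[OF assms, of "is"], of i j x] by simp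

lemma iter_partial_commute':
  assumes "smooth f"
  shows "iter_partial [k, i, j] f x = iter_partial [k, j, i] f x"
proof -
  have "partial_deriv i (partial_deriv j f) = partial_deriv j (partial_deriv i f)"
    using partial_deriv_commute[OF assms] by (intro ext)
  then show ?thesis by simp
qed

lemma grad_nth: "grad f x $ i = partial_deriv i f x" by (simp add: grad_def)

lemma smooth_C3_data:
  assumes f: "smooth f"
  shows "C3_data f (grad f) (hess f) (hess' f)"
  unfolding C3_data_def C2_data_def
proof (intro conjI allI)
  fix x h k
  show "(f has_derivative (\<bullet>) (grad f x)) (at x)" by (rule smooth_has_derivative[OF f])
  show "(grad f has_derivative (*v) (hess f x)) (at x)"
  proof (rule has_derivative_vecI)
    fix i
    show "((\<lambda>x. grad f x $ i) has_derivative (\<lambda>h. (hess f x *v h) $ i)) (at x)"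
      unfolding grad_nth
      by (rule has_derivative_eq_rhs[OF smooth_has_derivative[OF smooth_partial_deriv[OF f]]])
        (simp add: fun_eq_iff hess_def grad_def matrix_vector_mult_def inner_vec_def partial_deriv_commute[OF f])
  qed
  show "continuous_on UNIV (hess f)" unfolding hess_def[abs_def]
    by (intro continuous_intros smooth_iter_continuous_on f)
  show "transpose (hess f x) = hess f x"
    using partial_deriv_commute[OF f] by (simp add: transpose_def hess_def vec_eq_iff)
  show "(hess f has_derivative hess' f x) (at x)"
  proof (intro has_derivative_vecI)
    fix i j
    have eq: "hess f x $ i $ j = iter_partial [i, j] f x" for x by (simp add: hess_def)
    show "((\<lambda>x. hess f x $ i $ j) has_derivative (\<lambda>h. hess' f x h $ i $ j)) (at x)"
      unfolding eq
      by (rule has_derivative_eq_rhs[OF smooth_has_derivative[OF smooth_iter_partial[OF f]]])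
        (simp add: fun_eq_iff hess'_def grad_def inner_vec_def mult.commute)
  qed
  show "continuous_on UNIV (\<lambda>x. hess' f x h)" unfolding hess'_def[abs_def]
    by (intro continuous_intros smooth_iter_continuous_on f)
  have sym: "iter_partial [l, i, j] f x = iter_partial [j, i, l] f x" for l i j
    using iter_partial_commute[OF f, of l i "[j]" x] iter_partial_commute'[OF f, of i l j x] iter_partial_commute[OF f, of i j "[l]" x] by simp
  have "(hess' f x h *v k) $ i = (\<Sum>j\<in>UNIV. \<Sum>l\<in>UNIV. h $ l * iter_partial [l, i, j] f x * k $ j)" for h k i
    by (simp add: hess'_def matrix_vector_mult_def sum_distrib_right)
  moreover have "(\<Sum>j\<in>UNIV. \<Sum>l\<in>UNIV. h $ l * iter_partial [l, i, j] f x * k $ j) = (\<Sum>j\<in>UNIV. \<Sum>l\<in>UNIV. k $ l * iter_partial [l, i, j] f x * h $ j)" for i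
    by (subst sum.swap) (intro sum.cong refl, subst sym, simp add: mult_ac)
  ultimately show "hess' f x h *v k = hess' f x k *v h" by (simp add: vec_eq_iff)
  show "transpose (hess' f x h) = hess' f x h"
    using iter_partial_commute'[OF f] by (simp add: transpose_def hess'_def vec_eq_iff)
qed

lemma smoothI:
  assumes "\<And>is x. iter_partial is f differentiable (at x)" shows "smooth f"
  using assms by (simp add: smooth_def)

lemma partial_deriv_linear_combination:
  assumes "\<And>a. a \<in> A \<Longrightarrow> smooth (\<phi> a) \<and> smooth (\<psi> a)" "finite A"
  shows "partial_deriv i (\<lambda>x. \<Sum>a\<in>A. \<phi> a x * \<psi> a x) =
    (\<lambda>x. \<Sum>a\<in>A. partial_deriv i (\<phi> a) x * \<psi> a x + \<phi> a x * partial_deriv i (\<psi> a) x)"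
proof
  fix x
  have "((\<lambda>x. \<Sum>a\<in>A. \<phi> a x * \<psi> a x) has_derivative (\<lambda>h. \<Sum>a\<in>A. \<phi> a x * (grad (\<psi> a) x \<bullet> h) + (grad (\<phi> a) x \<bullet> h) * \<psi> a x)) (at x)"
    using assms(1) by (intro has_derivative_sum has_derivative_mult smooth_has_derivative) auto
  from partial_deriv_has_derivative(1)[OF this, of i]
  show "partial_deriv i (\<lambda>x. \<Sum>a\<in>A. \<phi> a x * \<psi> a x) x = (\<Sum>a\<in>A. partial_deriv i (\<phi> a) x * \<psi> a x + \<phi> a x * partial_deriv i (\<psi> a) x)"
    by (simp add: inner_axis grad_nth add.commute)
qed

text \<open>Partial derivatives map finite sums of products of smooth functions to sums of the same
  kind.\<close>

lemma smooth_sum_list_products: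
  fixes ps :: "((real^'n::finite \<Rightarrow> real) \<times> (real^'n \<Rightarrow> real)) list"
  assumes "\<And>q. q \<in> set ps \<Longrightarrow> smooth (fst q) \<and> smooth (snd q)"
  shows "smooth (\<lambda>x. \<Sum>q\<leftarrow>ps. fst q x * snd q x)"
proof (rule smoothI)
  fix "is" x
  have conv: "(\<lambda>x. \<Sum>q\<leftarrow>ps. fst q x * snd q x) = (\<lambda>x. \<Sum>a<length ps. fst (ps ! a) x * snd (ps ! a) x)" for ps :: "((real^'n \<Rightarrow> real) \<times> (real^'n \<Rightarrow> real)) list"
    by (rule ext) (simp add: sum_list_sum_nth atLeast0LessThan)
  show "iter_partial is (\<lambda>x. \<Sum>q\<leftarrow>ps. fst q x * snd q x) differentiable (at x)"
    using assms
  proof (induction "is" arbitrary: ps rule: rev_induct)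
    case Nil
    have "smooth (fst (ps ! a))" "smooth (snd (ps ! a))" if "a < length ps" for a
      using Nil[OF nth_mem[OF that]] by auto
    then show ?case unfolding conv iter_partial.simps
      by (intro differentiable_sum differentiable_mult smooth_differentiable ballI) simp_all
  next
    case (snoc i "is")
    define qs where "qs = concat (map (\<lambda>(\<phi>, \<psi>). [(partial_deriv i \<phi>, \<psi>), (\<phi>, partial_deriv i \<psi>)]) ps)"
    have "(\<Sum>q\<leftarrow>qs. fst q x * snd q x) = (\<Sum>q\<leftarrow>ps. partial_deriv i (fst q) x * snd q x + fst q x * partial_deriv i (snd q) x)" for x
      unfolding qs_def by (induction ps) (auto simp: case_prod_unfold)
    moreover have "partial_deriv i (\<lambda>x. \<Sum>q\<leftarrow>ps. fst q x * snd q x) x = (\<Sum>q\<leftarrow>ps. partial_deriv i (fst q) x * snd q x + fst q x * partial_deriv i (snd q) x)" for x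
      unfolding conv using partial_deriv_linear_combination[of "{..<length ps}" "\<lambda>a. fst (ps ! a)" "\<lambda>a. snd (ps ! a)" i] snoc.prems
      by (simp add: sum_list_sum_nth atLeast0LessThan)
    ultimately have "partial_deriv i (\<lambda>x. \<Sum>q\<leftarrow>ps. fst q x * snd q x) = (\<lambda>x. \<Sum>q\<leftarrow>qs. fst q x * snd q x)" by auto
    moreover have "smooth (fst q) \<and> smooth (snd q)" if "q \<in> set qs" for q
    proof -
      obtain p where p: "p \<in> set ps" "q = (partial_deriv i (fst p), snd p) \<or> q = (fst p, partial_deriv i (snd p))"
      proof -
        have "set qs = (\<Union>p\<in>set ps. {(partial_deriv i (fst p), snd p), (fst p, partial_deriv i (snd p))})"
          unfolding qs_def by (auto simp: case_prod_unfold)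
        then show thesis using \<open>q \<in> set qs\<close> that by (simp only: UN_iff insert_iff empty_iff) blast
      qed
      then show ?thesis using snoc.prems[OF p(1)] smooth_partial_deriv[of "fst p" i] smooth_partial_deriv[of "snd p" i] by auto
    qed
    ultimately show ?case using snoc.IH[of qs] by (simp add: iter_partial_append)
  qed
qed

lemma smooth_mult: "smooth f \<Longrightarrow> smooth g \<Longrightarrow> smooth (\<lambda>x. f x * g x)"
  using smooth_sum_list_products[of "[(f, g)]"] by simp

lemma partial_deriv_const: "partial_deriv i (\<lambda>x. c) = (\<lambda>x. 0)"
  by (rule ext) (simp add: partial_deriv_def)

lemma smooth_const: "smooth (\<lambda>x. c)"
proof (rule smoothI)
  fix "is" x
  have "\<exists>d. iter_partial is (\<lambda>x. c) = (\<lambda>x. d)" by (induction "is") (auto simp: partial_deriv_const)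
  then show "iter_partial is (\<lambda>x. c) differentiable (at x)" by auto
qed

lemma iter_partial_affine:
  assumes f: "smooth f"
  shows "iter_partial is (\<lambda>y. f (c + a *\<^sub>R y)) = (\<lambda>y. a ^ length is * iter_partial is f (c + a *\<^sub>R y))"
proof (induction "is")
  case (Cons i "is")
  show ?case
  proof
    fix y
    have "((\<lambda>y. c + a *\<^sub>R y) has_derivative (\<lambda>h. a *\<^sub>R h)) (at y)" by (auto intro!: derivative_eq_intros)
    from has_derivative_mult_right[OF has_derivative_compose[OF this smooth_has_derivative[OF smooth_iter_partial[OF f, of "is"]]], of "a ^ length is"]
    have "((\<lambda>y. a ^ length is * iter_partial is f (c + a *\<^sub>R y)) has_derivative (\<lambda>h. a ^ length is * (grad (iter_partial is f) (c + a *\<^sub>R y) \<bullet> (a *\<^sub>R h)))) (at y)" .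
    from partial_deriv_has_derivative(1)[OF this, of i]
    show "iter_partial (i # is) (\<lambda>y. f (c + a *\<^sub>R y)) y = a ^ length (i # is) * iter_partial (i # is) f (c + a *\<^sub>R y)"
      by (simp add: Cons.IH inner_axis grad_nth)
  qed
qed simp

lemma smooth_affine:
  assumes f: "smooth f"
  shows "smooth (\<lambda>y. f (c + a *\<^sub>R y))"
proof (rule smoothI)
  fix "is" x
  have "((\<lambda>y. c + a *\<^sub>R y) has_derivative (\<lambda>h. a *\<^sub>R h)) (at x)" by (auto intro!: derivative_eq_intros)
  note d = has_derivative_mult_right[OF has_derivative_compose[OF this smooth_has_derivative[OF smooth_iter_partial[OF f, of "is"]]], of "a ^ length is"]
  show "iter_partial is (\<lambda>y. f (c + a *\<^sub>R y)) differentiable (at x)"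
    unfolding iter_partial_affine[OF f] differentiable_def by (rule exI) (rule d)
qed

lemma iter_partial_zero_off:
  assumes K: "closed K" and f: "\<And>x. x \<notin> K \<Longrightarrow> f x = 0" and x: "x \<notin> K"
  shows "iter_partial is f x = 0"
  using x
proof (induction "is" arbitrary: x)
  case (Cons i "is")
  have "((iter_partial is f) has_derivative (\<lambda>h. 0)) (at x)"
  proof (rule has_derivative_transform_within_open[of "\<lambda>x. 0" _ _ _ "- K"])
    show "open (- K)" using K by (simp add: open_Compl)
  qed (use Cons in auto)
  from partial_deriv_has_derivative(1)[OF this] show ?case by simp
qed (use f in simp)

section \<open>Mollification\<close>

text \<open>Convolution over a box. It agrees with the convolution over the whole space near points whose
kernel neighbourhood lies in the box, and there is no question of integrability at infinity.\<close>

definition conv :: "real^'n::finite \<Rightarrow> real^'n \<Rightarrow> (real^'n \<Rightarrow> real) \<Rightarrow> (real^'n \<Rightarrow> real) \<Rightarrow> real^'n \<Rightarrow> real" where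
  "conv a b v k x = integral (cbox a b) (\<lambda>y. v y * k (x - y))"

lemma has_derivative_conv:
  assumes v: "continuous_on (cbox a b) v" and k: "smooth k"
  shows "(conv a b v k has_derivative (\<lambda>h. integral (cbox a b) (\<lambda>y. v y * (grad k (x - y) \<bullet> h)))) (at x)"
proof -
  have cg: "continuous_on UNIV (grad k)" unfolding grad_def[abs_def]
    by (intro continuous_intros smooth_continuous_on smooth_partial_deriv k)
  define F where "F x y = v y *\<^sub>R blinfun_inner_right (grad k (x - y))" for x y
  have Fa: "blinfun_apply (F x y) h = v y * (grad k (x - y) \<bullet> h)" for x y h
    by (simp add: F_def blinfun.scaleR_left)
  have cF: "continuous_on (UNIV \<times> cbox a b) (\<lambda>(x, y). F x y)"
    unfolding F_def case_prod_unfold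
    by (intro continuous_intros bounded_linear.continuous_on[OF bounded_linear_blinfun_inner_right]
      continuous_on_compose2[OF v] continuous_on_compose2[OF cg]) auto
  have "((\<lambda>x. integral (cbox a b) (\<lambda>y. v y * k (x - y))) has_derivative blinfun_apply (integral (cbox a b) (F x))) (at x within UNIV)"
  proof (rule leibniz_rule[OF _ _ cF])
    fix x y
    show "((\<lambda>x. v y * k (x - y)) has_derivative blinfun_apply (F x y)) (at x within UNIV)"
    proof -
      have "((\<lambda>x. x - y) has_derivative (\<lambda>h. h)) (at x)" by (auto intro!: derivative_eq_intros)
      from has_derivative_mult_right[OF has_derivative_compose[OF this smooth_has_derivative[OF k]], of "v y"]
      have "((\<lambda>x. v y * k (x - y)) has_derivative (\<lambda>h. v y * (grad k (x - y) \<bullet> h))) (at x)" .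
      moreover have "blinfun_apply (F x y) = (\<lambda>h. v y * (grad k (x - y) \<bullet> h))" by (simp add: fun_eq_iff Fa)
      ultimately show ?thesis by simp
    qed
    show "(\<lambda>y. v y * k (x - y)) integrable_on cbox a b"
      by (intro integrable_continuous continuous_intros v continuous_on_compose2[OF smooth_continuous_on[OF k, of UNIV]]) auto
  qed auto
  moreover have "blinfun_apply (integral (cbox a b) (F x)) = (\<lambda>h. integral (cbox a b) (\<lambda>y. v y * (grad k (x - y) \<bullet> h)))"
  proof
    fix h
    have "F x integrable_on cbox a b"
      by (rule integrable_continuous, rule continuous_on_compose2[OF cF, of _ "\<lambda>y. (x, y)", simplified]) (auto intro!: continuous_intros)
    from integral_linear[OF this blinfun.bounded_linear_left[of h]]
    show "blinfun_apply (integral (cbox a b) (F x)) h = integral (cbox a b) (\<lambda>y. v y * (grad k (x - y) \<bullet> h))"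
      by (simp add: o_def Fa)
  qed
  ultimately show ?thesis unfolding conv_def[abs_def] by simp
qed

lemma partial_deriv_conv:
  assumes v: "continuous_on (cbox a b) v" and k: "smooth k"
  shows "partial_deriv i (conv a b v k) = conv a b v (partial_deriv i k)"
  by (rule ext, subst partial_deriv_has_derivative(1)[OF has_derivative_conv[OF v k]])
    (simp add: conv_def inner_axis grad_nth)

lemma iter_partial_conv:
  assumes v: "continuous_on (cbox a b) v" and k: "smooth k"
  shows "iter_partial is (conv a b v k) = conv a b v (iter_partial is k)"
  by (induction "is") (simp_all add: partial_deriv_conv[OF v smooth_iter_partial[OF k]])

lemma smooth_conv:
  assumes v: "continuous_on (cbox a b) v" and k: "smooth k"
  shows "smooth (conv a b v k)"
proof (rule smoothI)
  fix "is" x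
  show "iter_partial is (conv a b v k) differentiable (at x)"
    unfolding iter_partial_conv[OF v k] differentiable_def
    by (rule exI, rule has_derivative_conv[OF v smooth_iter_partial[OF k]])
qed

definition kernel :: "real \<Rightarrow> (real^'n::finite \<Rightarrow> real) \<Rightarrow> bool" where
  "kernel R \<eta> \<longleftrightarrow> smooth \<eta> \<and> (\<forall>x. 0 \<le> \<eta> x) \<and> (\<forall>x. R < norm x \<longrightarrow> \<eta> x = 0) \<and> (LINT x|lborel. \<eta> x) = 1"

lemma integrable_compact_support:
  fixes f :: "real^'n::finite \<Rightarrow> real"
  assumes "continuous_on UNIV f" "\<And>x. R < norm x \<Longrightarrow> f x = 0"
  shows "integrable lborel f"
proof -
  have "integrable lborel (\<lambda>x. indicator (cball 0 R) x *\<^sub>R f x)"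
    by (rule borel_integrable_compact) (use assms(1) continuous_on_subset in auto)
  moreover have "(\<lambda>x. indicator (cball 0 R) x *\<^sub>R f x) = f"
    using assms(2) by (force simp: fun_eq_iff indicator_def)
  ultimately show ?thesis by simp
qed

lemma lebesgue_integral_eq_lborel:
  fixes f :: "real^'n::finite \<Rightarrow> real"
  shows "continuous_on UNIV f \<Longrightarrow> (LINT x|lebesgue. f x) = (LINT x|lborel. f x)"
  by (rule integral_completion) (simp add: borel_measurable_continuous_onI)

text \<open>No bump function has to be constructed: the square of any nonzero test function, rescaled
  and normalised, is a kernel.\<close>

lemma kernel_exists:
  fixes u :: "real^'n::finite \<Rightarrow> real"
  assumes u: "smooth u" "compact (supp u)" "u x0 \<noteq> 0" and R: "0 < R"
  shows "\<exists>\<eta>::real^'n \<Rightarrow> real. kernel R \<eta>"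
proof -
  obtain B0 where "\<And>x. x \<in> supp u \<Longrightarrow> norm x \<le> B0" using compact_imp_bounded[OF u(2)] by (auto simp: bounded_iff)
  then have B0: "u x = 0" if "B0 < norm x" for x
    using that closure_subset[of "{x. u x \<noteq> 0}"] unfolding supp_def by force
  define B where "B = \<bar>B0\<bar> + 1"
  have B: "0 < B" "\<And>x. B < norm x \<Longrightarrow> u x = 0" using B0 by (auto simp: B_def)
  define f where "f x = (u (0 + (B / R) *\<^sub>R x))\<^sup>2" for x :: "real^'n"
  have sf: "smooth f" unfolding f_def power2_eq_square by (intro smooth_mult smooth_affine u)
  have f0: "f x = 0" if "R < norm x" for x
  proof -
    have "B < norm ((B / R) *\<^sub>R x)" using that B R by (simp add: field_simps)
    then show ?thesis using B(2) by (simp add: f_def)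
  qed
  have cf: "continuous_on UNIV f" by (rule smooth_continuous_on[OF sf])
  have int: "integrable lborel f" by (rule integrable_compact_support[OF cf f0])
  define I where "I = (LINT x|lborel. f x)"
  have fn: "f x \<ge> 0" for x by (simp add: f_def)
  have "I \<noteq> 0"
  proof
    assume "I = 0"
    then have "AE x in lborel. f x = 0" using integral_nonneg_eq_0_iff_AE[OF int] fn by (simp add: I_def)
    then have "{x. f x \<noteq> 0} \<in> null_sets lborel"
      using borel_open[OF open_Collect_neq[OF cf continuous_on_const]] by (subst (asm) AE_iff_null) auto
    then have "negligible {x. f x \<noteq> 0}" unfolding negligible_iff_null_sets by (rule null_sets_completionI)
    moreover have "open {x. f x \<noteq> 0}" using cf by (simp add: open_Collect_neq)
    moreover have "(R / B) *\<^sub>R x0 \<in> {x. f x \<noteq> 0}" using u(3) B R by (simp add: f_def)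
    ultimately show False using open_not_negligible by blast
  qed
  moreover have "I \<ge> 0" unfolding I_def by (rule integral_nonneg_AE) (use fn in auto)
  ultimately have I: "I > 0" by simp
  have "smooth (\<lambda>x. inverse I * f x)" by (intro smooth_mult smooth_const sf)
  then have "kernel R (\<lambda>x. inverse I * f x)"
    using I f0 fn by (auto simp: kernel_def I_def[symmetric])
  then show ?thesis by blast
qed

lemma lborel_distr_reflect: "distr lborel borel (\<lambda>y. x - y) = (lborel :: 'a::euclidean_space measure)"
  by (subst (2) lborel_affine[of "- 1" x]) (simp_all add: density_1)

lemma kernel_shift:
  assumes "kernel R \<eta>"
  shows "integrable lborel (\<lambda>y. \<eta> (x - y))" "(LINT y|lborel. \<eta> (x - y)) = 1" "smooth (\<lambda>y. \<eta> (x - y))"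
    "iter_partial is (\<lambda>y. \<eta> (x - y)) y = (-1) ^ length is * iter_partial is \<eta> (x - y)"
proof -
  have s: "smooth \<eta>" using assms by (simp add: kernel_def)
  show sm: "smooth (\<lambda>y. \<eta> (x - y))" using smooth_affine[OF s, of x "- 1"] by simp
  have c: "continuous_on UNIV (\<lambda>y. \<eta> (x - y))" by (rule smooth_continuous_on[OF sm])
  have "\<eta> (x - y) = 0" if "norm x + R < norm y" for y
  proof -
    have "R < norm (x - y)" using that norm_triangle_ineq2[of y x] by (simp add: norm_minus_commute)
    then show ?thesis using assms by (simp add: kernel_def)
  qed
  then show "integrable lborel (\<lambda>y. \<eta> (x - y))" by (rule integrable_compact_support[OF c])
  have m: "\<eta> \<in> borel_measurable borel" by (rule borel_measurable_continuous_onI[OF smooth_continuous_on[OF s]])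
  have "(LINT y|lborel. \<eta> (x - y)) = (LINT y|distr lborel borel (\<lambda>y. x - y). \<eta> y)"
    using m by (subst integral_distr) auto
  also have "\<dots> = (LINT y|lborel. \<eta> y)" by (simp only: lborel_distr_reflect)
  finally show "(LINT y|lborel. \<eta> (x - y)) = 1" using assms by (simp add: kernel_def)
  show "iter_partial is (\<lambda>y. \<eta> (x - y)) y = (-1) ^ length is * iter_partial is \<eta> (x - y)"
    using iter_partial_affine[OF s, of "is" x "- 1"] by (simp add: fun_eq_iff)
qed

lemma kernel_test_function:
  assumes "kernel R \<eta>"
  shows "(\<lambda>y. \<eta> (x - y)) \<in> test_functions UNIV"
proof -
  have "{y. \<eta> (x - y) \<noteq> 0} \<subseteq> cball x R"
    using assms by (auto simp: kernel_def dist_norm not_less[symmetric])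
  then have "supp (\<lambda>y. \<eta> (x - y)) \<subseteq> cball x R" unfolding supp_def by (rule closure_minimal) simp
  then have "compact (supp (\<lambda>y. \<eta> (x - y)))"
    unfolding supp_def by (meson bounded_cball bounded_subset closed_closure compact_eq_bounded_closed)
  then show ?thesis using kernel_shift(3)[OF assms] by (simp add: test_functions_def)
qed

lemma conv_eq_LINT:
  fixes v k :: "real^'n::finite \<Rightarrow> real"
  assumes v: "continuous_on (cbox a b) v" and k: "smooth k"
  shows "conv a b v k x = (LINT y:cbox a b|lborel. v y * k (x - y))"
    and "set_integrable lborel (cbox a b) (\<lambda>y. v y * k (x - y))"
proof -
  have "continuous_on (cbox a b) (\<lambda>y. v y * k (x - y))"
    by (intro continuous_intros v continuous_on_compose2[OF smooth_continuous_on[OF k, of UNIV]]) auto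
  then show si: "set_integrable lborel (cbox a b) (\<lambda>y. v y * k (x - y))"
    by (intro set_integrable_compact) auto
  show "conv a b v k x = (LINT y:cbox a b|lborel. v y * k (x - y))"
    unfolding conv_def using set_borel_integral_eq_integral(2)[OF si] by simp
qed

lemma conv_near:
  fixes v :: "real^'n::finite \<Rightarrow> real"
  assumes \<eta>: "kernel R \<eta>" and v: "continuous_on (cbox a b) v" and ball: "cball x R \<subseteq> cbox a b"
    and near: "\<And>y. norm (x - y) \<le> R \<Longrightarrow> \<bar>v y - c\<bar> \<le> e"
  shows "\<bar>conv a b v \<eta> x - c\<bar> \<le> e"
proof -
  have s: "smooth \<eta>" using \<eta> by (simp add: kernel_def)
  have z: "\<eta> (x - y) = 0" if "y \<notin> cbox a b" for y
  proof -
    have "y \<notin> cball x R" using that ball by auto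
    then show ?thesis using \<eta> by (simp add: kernel_def dist_norm)
  qed
  have iv: "integrable lborel (\<lambda>y. indicator (cbox a b) y * (v y * \<eta> (x - y)))"
    using conv_eq_LINT(2)[OF v s, of x] by (simp add: set_integrable_def)
  have c: "(LINT y|lborel. c * \<eta> (x - y)) = c" using kernel_shift(2)[OF \<eta>] by simp
  have ic: "integrable lborel (\<lambda>y. c * \<eta> (x - y))" using kernel_shift(1)[OF \<eta>] by simp
  have "conv a b v \<eta> x - c = (LINT y|lborel. indicator (cbox a b) y * (v y * \<eta> (x - y)) - c * \<eta> (x - y))"
    using conv_eq_LINT(1)[OF v s, of x] Bochner_Integration.integral_diff[OF iv ic] c by (simp add: set_lebesgue_integral_def)
  also have "\<bar>\<dots>\<bar> \<le> (LINT y|lborel. \<bar>indicator (cbox a b) y * (v y * \<eta> (x - y)) - c * \<eta> (x - y)\<bar>)"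
    by (rule integral_abs_bound)
  also have "\<dots> \<le> (LINT y|lborel. e * \<eta> (x - y))"
  proof (rule integral_mono)
    show "integrable lborel (\<lambda>y. \<bar>indicator (cbox a b) y * (v y * \<eta> (x - y)) - c * \<eta> (x - y)\<bar>)" using iv ic by simp
    show "integrable lborel (\<lambda>y. e * \<eta> (x - y))" using kernel_shift(1)[OF \<eta>] by simp
    fix y
    show "\<bar>indicator (cbox a b) y * (v y * \<eta> (x - y)) - c * \<eta> (x - y)\<bar> \<le> e * \<eta> (x - y)"
    proof (cases "\<eta> (x - y) = 0")
      case False
      then have "y \<in> cbox a b" using z by blast
      moreover have "norm (x - y) \<le> R" using False \<eta> by (force simp: kernel_def)
      moreover have "0 \<le> \<eta> (x - y)" using \<eta> by (simp add: kernel_def)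
      ultimately show ?thesis using near[of y] by (simp add: left_diff_distrib[symmetric] abs_mult mult_right_mono)
    qed simp
  qed
  also have "\<dots> = e" using kernel_shift(2)[OF \<eta>] by simp
  finally show ?thesis .
qed

text \<open>The derivatives fall on the kernel, which as a function of \<open>y\<close> is a test function, and the definition of a
  weak derivative moves them to \<open>f\<close>. The two signs cancel.\<close>

lemma iter_partial_conv_weak:
  fixes f :: "real^'n::finite \<Rightarrow> real"
  assumes \<eta>: "kernel R \<eta>" and f: "continuous_on UNIV f" and ball: "cball x R \<subseteq> cbox a b"
    and h: "is_weak_partial is f h"
  shows "iter_partial is (conv a b f \<eta>) x = (LINT y|lebesgue. h y * \<eta> (x - y))"
proof -
  have s: "smooth \<eta>" using \<eta> by (simp add: kernel_def)
  have cf: "continuous_on (cbox a b) f" using f continuous_on_subset by blast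
  have z: "iter_partial is \<eta> (x - y) = 0" if "y \<notin> cbox a b" for y
  proof (rule iter_partial_zero_off[where K = "cball 0 R"])
    have "y \<notin> cball x R" using that ball by auto
    then show "x - y \<notin> cball 0 R" by (simp add: dist_norm norm_minus_commute)
  qed (use \<eta> in \<open>auto simp: kernel_def\<close>)
  have "iter_partial is (conv a b f \<eta>) x = (LINT y:cbox a b|lborel. f y * iter_partial is \<eta> (x - y))"
    unfolding iter_partial_conv[OF cf s] by (rule conv_eq_LINT(1)[OF cf smooth_iter_partial[OF s]])
  also have "\<dots> = (LINT y|lborel. f y * iter_partial is \<eta> (x - y))"
    unfolding set_lebesgue_integral_def using z by (intro Bochner_Integration.integral_cong) (auto simp: indicator_def)
  also have "\<dots> = (LINT y|lebesgue. f y * iter_partial is \<eta> (x - y))"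
    by (intro lebesgue_integral_eq_lborel[symmetric] continuous_intros f
        continuous_on_compose2[OF smooth_iter_continuous_on[OF s, of UNIV]]) auto
  also have "\<dots> = (LINT y|lebesgue. (-1) ^ length is * (f y * iter_partial is (\<lambda>y. \<eta> (x - y)) y))"
    unfolding kernel_shift(4)[OF \<eta>] by (simp flip: power_mult_distrib mult.assoc add: mult.commute[of "f _"])
  also have "\<dots> = (-1) ^ length is * (LINT y|lebesgue. f y * iter_partial is (\<lambda>y. \<eta> (x - y)) y)" by simp
  also have "\<dots> = (LINT y|lebesgue. h y * \<eta> (x - y))"
    using h kernel_test_function[OF \<eta>, of x] by (simp add: is_weak_partial_def flip: power_mult_distrib mult.assoc)
  finally show ?thesis .
qed

section \<open>Regularity of the coefficients\<close>

lemma has_derivative_quadratic: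
  fixes f :: "real^'n::finite \<Rightarrow> real"
  assumes q: "\<And>h. norm h \<le> 1 \<Longrightarrow> \<bar>f (x + h) - f x - G \<bullet> h\<bar> \<le> C * (norm h)\<^sup>2" and C: "0 \<le> C"
  shows "(f has_derivative (\<lambda>h. G \<bullet> h)) (at x)"
  unfolding has_derivative_at_alt
proof (intro conjI allI impI)
  show "bounded_linear ((\<bullet>) G)" by (rule bounded_linear_inner_right)
  fix e :: real assume e: "0 < e"
  define d where "d = min 1 (e / (C + 1))"
  have d: "0 < d" using e C by (simp add: d_def)
  have "norm (f y - f x - G \<bullet> (y - x)) \<le> e * norm (y - x)" if "norm (y - x) < d" for y
  proof -
    have "\<bar>f (x + (y - x)) - f x - G \<bullet> (y - x)\<bar> \<le> C * (norm (y - x))\<^sup>2" by (rule q) (use that d_def in auto)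
    also have "\<dots> = (C * norm (y - x)) * norm (y - x)" by (simp add: power2_eq_square)
    also have "\<dots> \<le> e * norm (y - x)"
    proof (rule mult_right_mono)
      have "C * norm (y - x) \<le> C * (e / (C + 1))" using that C d_def by (intro mult_left_mono) auto
      also have "\<dots> \<le> e" using C e by (simp add: field_simps)
      finally show "C * norm (y - x) \<le> e" .
    qed simp
    finally show ?thesis by simp
  qed
  then show "\<exists>d>0. \<forall>y. norm (y - x) < d \<longrightarrow> norm (f y - f x - G \<bullet> (y - x)) \<le> e * norm (y - x)" using d by blast
qed

text \<open>The gradient is even locally Lipschitz: adding the expansions at \<open>x\<close> and \<open>y\<close>, evaluated at the common point \<open>y + h\<close> with
\<open>h\<close> in the direction of \<open>G y - G x\<close> and of length \<open>|y - x|\<close>, bounds \<open>(G y - G x) \<cdot> h\<close> by a multiple of \<open>|y - x|\<^sup>2\<close>.\<close>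

lemma continuous_quadratic:
  fixes f :: "real^'n::finite \<Rightarrow> real"
  assumes q: "\<And>x h. norm h \<le> 1 \<Longrightarrow> \<bar>f (x + h) - f x - G x \<bullet> h\<bar> \<le> C * (norm h)\<^sup>2"
  shows "continuous_on UNIV G"
proof -
  have C: "0 \<le> C"
  proof -
    obtain e :: "real^'n" where "norm e = 1" using vector_choose_size[of 1] by auto
    then show ?thesis using q[of e 0] by (smt (verit) mult_cancel_left2 one_power2)
  qed
  have lip: "norm (G y - G x) \<le> 6 * C * norm (y - x)" if "norm (y - x) \<le> 1 / 2" for x y
  proof (cases "G y = G x \<or> y = x")
    case False
    define d where "d = norm (y - x)"
    define w where "w = G y - G x"
    define h where "h = (d / norm w) *\<^sub>R w"
    have d: "0 < d" "d \<le> 1 / 2" and w: "0 < norm w" using False that by (auto simp: d_def w_def)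
    have nh: "norm h = d" using d w by (simp add: h_def)
    have 1: "\<bar>f (x + (y - x + h)) - f x - G x \<bullet> (y - x + h)\<bar> \<le> C * (norm (y - x + h))\<^sup>2"
      by (rule q) (use norm_triangle_ineq[of "y - x" h] nh d in \<open>simp add: d_def\<close>)
    have sq: "(norm (y - x + h))\<^sup>2 \<le> (2 * d)\<^sup>2"
      using norm_triangle_ineq[of "y - x" h] nh by (intro power_mono) (auto simp: d_def)
    have eq: "x + (y - x + h) = y + h" by simp
    have 1: "\<bar>f (y + h) - f x - G x \<bullet> (y - x + h)\<bar> \<le> C * (2 * d)\<^sup>2"
      using order_trans[OF 1 mult_left_mono[OF sq C]] unfolding eq .
    have 2: "\<bar>f (y + h) - f y - G y \<bullet> h\<bar> \<le> C * d\<^sup>2" using q[of h y] nh d by simp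
    have 3: "\<bar>f (x + (y - x)) - f x - G x \<bullet> (y - x)\<bar> \<le> C * d\<^sup>2" using q[of "y - x" x] that by (simp add: d_def)
    have "w \<bullet> h = (f (y + h) - f x - G x \<bullet> (y - x + h)) - (f (y + h) - f y - G y \<bullet> h) - (f (x + (y - x)) - f x - G x \<bullet> (y - x))"
      by (simp add: w_def inner_add_right inner_diff_right inner_diff_left)
    then have "w \<bullet> h \<le> 6 * C * d\<^sup>2" using 1 2 3 by (simp add: power_mult_distrib)
    moreover have "w \<bullet> h = d * norm w" using w by (simp add: h_def power2_norm_eq_inner[symmetric] power2_eq_square)
    ultimately have "d * norm w \<le> d * (6 * C * d)" by (simp add: power2_eq_square mult_ac)
    then show ?thesis using d by (simp add: w_def d_def mult_le_cancel_left_pos)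
  qed (use C in auto)
  show ?thesis unfolding continuous_on_iff dist_norm
  proof (intro ballI allI impI)
    fix x and e :: real assume e: "0 < e"
    define d where "d = min (1 / 2) (e / (6 * C + 1))"
    have d: "0 < d" using e C by (simp add: d_def)
    have "norm (G y - G x) < e" if "norm (y - x) < d" for y
    proof -
      have "norm (G y - G x) \<le> 6 * C * norm (y - x)" by (rule lip) (use that d_def in auto)
      also have "\<dots> \<le> 6 * C * (e / (6 * C + 1))" using that C d_def by (intro mult_left_mono) auto
      also have "\<dots> < e" using C e by (simp add: field_simps)
      finally show ?thesis .
    qed
    then show "\<exists>d>0. \<forall>y\<in>UNIV. norm (y - x) < d \<longrightarrow> norm (G y - G x) < e" using d by blast
  qed
qed

lemma weak_mean_bound:
  fixes h :: "real^'n::finite \<Rightarrow> real"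
  assumes \<eta>: "kernel R \<eta>" and b: "AE x in lebesgue. \<bar>h x\<bar> \<le> B" and h: "h \<in> borel_measurable lebesgue"
  shows "\<bar>LINT y|lebesgue. h y * \<eta> (x - y)\<bar> \<le> B"
proof -
  have s: "smooth (\<lambda>y. \<eta> (x - y))" by (rule kernel_shift(3)[OF \<eta>])
  have c: "continuous_on UNIV (\<lambda>y. \<eta> (x - y))" by (rule smooth_continuous_on[OF s])
  have m: "(\<lambda>y. \<eta> (x - y)) \<in> borel_measurable lborel" using c by (simp add: borel_measurable_continuous_onI)
  have int: "integrable lebesgue (\<lambda>y. \<eta> (x - y))" using kernel_shift(1)[OF \<eta>, of x] integrable_completion[OF m] by simp
  have one: "(LINT y|lebesgue. \<eta> (x - y)) = 1" using lebesgue_integral_eq_lborel[OF c] kernel_shift(2)[OF \<eta>] by simp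
  have ae: "AE y in lebesgue. norm (h y * \<eta> (x - y)) \<le> B * \<eta> (x - y)"
    using b by eventually_elim (use \<eta> in \<open>auto simp: kernel_def abs_mult intro!: mult_right_mono\<close>)
  have i2: "integrable lebesgue (\<lambda>y. B * \<eta> (x - y))" using int by simp
  have i1: "integrable lebesgue (\<lambda>y. h y * \<eta> (x - y))"
  proof (rule Bochner_Integration.integrable_bound[OF i2])
    show "(\<lambda>y. h y * \<eta> (x - y)) \<in> borel_measurable lebesgue" using h int by (intro borel_measurable_times) auto
    show "AE y in lebesgue. norm (h y * \<eta> (x - y)) \<le> norm (B * \<eta> (x - y))" using ae by eventually_elim simp
  qed
  have "norm (LINT y|lebesgue. h y * \<eta> (x - y)) \<le> (LINT y|lebesgue. norm (h y * \<eta> (x - y)))" by (rule integral_norm_bound)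
  also have "\<dots> \<le> (LINT y|lebesgue. B * \<eta> (x - y))" by (rule integral_mono_AE[OF integrable_norm[OF i1] i2 ae])
  finally have "norm (LINT y|lebesgue. h y * \<eta> (x - y)) \<le> (LINT y|lebesgue. B * \<eta> (x - y))" .
  then show ?thesis using one by simp
qed

text \<open>The mollifications of \<open>f\<close> satisfy a second order Taylor estimate with one constant. Their gradients at \<open>x\<close> are
  bounded by the Lipschitz constant and hence have a limit point, which serves as \<open>G\<close>.\<close>

lemma quadratic_expansion:
  fixes f :: "real^'n::finite \<Rightarrow> real"
  assumes ker: "\<And>R. 0 < R \<Longrightarrow> \<exists>\<eta>::real^'n \<Rightarrow> real. kernel R \<eta>"
    and lip: "\<And>x y. \<bar>f x - f y\<bar> \<le> L * norm (x - y)"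
    and weak: "\<And>k l. \<exists>h. is_weak_partial [k, l] f h \<and> h \<in> borel_measurable lebesgue \<and> (AE x in lebesgue. \<bar>h x\<bar> \<le> B)"
  shows "\<exists>G. \<forall>h. norm h \<le> 1 \<longrightarrow> \<bar>f (x + h) - f x - G \<bullet> h\<bar> \<le> real CARD('n) * (real CARD('n) * B) * (norm h)\<^sup>2"
proof -
  define C where "C = real CARD('n) * (real CARD('n) * B)"
  have "L * norm (axis undefined 1 - (0::real^'n)) \<ge> 0" using lip[of "axis undefined 1" 0] by linarith
  then have L: "0 \<le> L" by simp
  have cf: "continuous_on S f" for S
  proof (rule lipschitz_on_continuous_on[of L])
    show "L-lipschitz_on S f" using lip L by (auto simp: lipschitz_on_def dist_norm)
  qed
  obtain c where ab': "cball x 3 \<subseteq> cbox (- c) c" using bounded_subset_cbox_symmetric[OF bounded_cball] by blast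
  define a b where "a = - c" "b = c"
  have ab: "cball x 3 \<subseteq> cbox a b" using ab' by (simp add: a_b_def)
  define R where "R n = inverse (real (Suc n))" for n
  have R: "0 < R n" "R n \<le> 1" for n by (auto simp: R_def field_simps)
  have Rl: "R \<longlonglongrightarrow> 0" unfolding R_def by (rule LIMSEQ_inverse_real_of_nat)
  define \<eta> where "\<eta> n = (SOME \<eta> :: real^'n \<Rightarrow> real. kernel (R n) \<eta>)" for n
  have \<eta>: "kernel (R n) (\<eta> n)" for n unfolding \<eta>_def by (rule someI_ex[OF ker[OF R(1)[of n]]])
  define F where "F n = conv a b f (\<eta> n)" for n
  have sF: "smooth (F n)" for n unfolding F_def by (rule smooth_conv[OF cf]) (use \<eta> in \<open>auto simp: kernel_def\<close>)
  have sub: "cball y (R n) \<subseteq> cbox a b" if "norm (y - x) \<le> 1" for y n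
  proof (rule order_trans[OF _ ab], rule subsetI)
    fix w assume "w \<in> cball y (R n)"
    then have "norm (w - y) \<le> 1" using R(2)[of n] by (auto simp: dist_norm norm_minus_commute)
    then show "w \<in> cball x 3" using that norm_triangle_ineq[of "w - y" "y - x"] by (simp add: dist_norm norm_minus_commute)
  qed
  have close: "\<bar>F n y - f y\<bar> \<le> L * R n" if "norm (y - x) \<le> 1" for y n
    unfolding F_def
  proof (rule conv_near[OF \<eta> cf sub[OF that]])
    fix w assume "norm (y - w) \<le> R n"
    then have "L * norm (w - y) \<le> L * R n" using L by (intro mult_left_mono) (auto simp: norm_minus_commute)
    then show "\<bar>f w - f y\<bar> \<le> L * R n" using lip[of w y] by linarith
  qed
  have second: "\<bar>iter_partial [k, l] (F n) y\<bar> \<le> B" if "norm (y - x) \<le> 1" for k l n y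
  proof -
    obtain h where h: "is_weak_partial [k, l] f h" "h \<in> borel_measurable lebesgue" "AE x in lebesgue. \<bar>h x\<bar> \<le> B"
      using weak by blast
    show ?thesis unfolding F_def iter_partial_conv_weak[OF \<eta> cf sub[OF that] h(1)] by (rule weak_mean_bound[OF \<eta> h(3,2)])
  qed
  have hess: "norm (hess (F n) y) \<le> C" if "norm (y - x) \<le> 1" for n y
  proof -
    have "norm (hess (F n) y) \<le> (\<Sum>i\<in>UNIV. norm (hess (F n) y $ i))" by (simp add: norm_vec_def L2_set_le_sum)
    also have "\<dots> \<le> (\<Sum>i\<in>UNIV. \<Sum>j\<in>UNIV. \<bar>hess (F n) y $ i $ j\<bar>)" by (intro sum_mono norm_le_l1_cart)
    also have "\<dots> \<le> (\<Sum>i\<in>(UNIV::'n set). \<Sum>j\<in>(UNIV::'n set). B)"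
      by (intro sum_mono) (use second[OF that] in \<open>simp add: hess_def\<close>)
    finally show ?thesis by (simp add: C_def)
  qed
  have C: "0 \<le> C" using order_trans[OF norm_ge_zero hess[of x 0]] by simp
  have C3: "C3_data (F n) (grad (F n)) (hess (F n)) (hess' (F n))" for n by (rule smooth_C3_data[OF sF])
  have taylor: "\<bar>F n (x + h) - F n x - grad (F n) x \<bullet> h\<bar> \<le> C * (norm h)\<^sup>2" if h: "norm h \<le> 1" for n h
  proof -
    have gl: "norm (grad (F n) y - grad (F n) x) \<le> C * norm h" if y: "y \<in> cball x (norm h)" for y
    proof -
      have "norm (grad (F n) y - grad (F n) x) \<le> C * norm (y - x)"
      proof (rule differentiable_bound[where S = "cball x (norm h)" and f' = "\<lambda>y. (*v) (hess (F n) y)"])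
        fix w assume w: "w \<in> cball x (norm h)"
        then have "norm (w - x) \<le> 1" using h by (simp add: dist_norm norm_minus_commute)
        then show "onorm ((*v) (hess (F n) w)) \<le> C"
          by (intro onorm_le order_trans[OF norm_matrix_vector_mult_le] mult_right_mono hess) auto
        show "(grad (F n) has_derivative (*v) (hess (F n) w)) (at w within cball x (norm h))"
          using C3[of n] unfolding C3_data_def C2_data_def by (blast intro: has_derivative_at_withinI)
      qed (use y in auto)
      also have "\<dots> \<le> C * norm h" using y C by (intro mult_left_mono) (auto simp: dist_norm norm_minus_commute)
      finally show ?thesis .
    qed
    have "norm ((F n (x + h) - grad (F n) x \<bullet> (x + h)) - (F n x - grad (F n) x \<bullet> x)) \<le> (C * norm h) * norm (x + h - x)"
    proof (rule differentiable_bound[where S = "cball x (norm h)" and f' = "\<lambda>y w. grad (F n) y \<bullet> w - grad (F n) x \<bullet> w"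
          and f = "\<lambda>y. F n y - grad (F n) x \<bullet> y"])
      fix w assume w: "w \<in> cball x (norm h)"
      show "((\<lambda>y. F n y - grad (F n) x \<bullet> y) has_derivative (\<lambda>v. grad (F n) w \<bullet> v - grad (F n) x \<bullet> v)) (at w within cball x (norm h))"
        by (rule has_derivative_at_withinI, rule has_derivative_diff[OF smooth_has_derivative[OF sF] has_derivative_inner_right[OF has_derivative_ident]])
      show "onorm (\<lambda>v. grad (F n) w \<bullet> v - grad (F n) x \<bullet> v) \<le> C * norm h"
      proof (rule onorm_le)
        fix v
        have "norm (grad (F n) w \<bullet> v - grad (F n) x \<bullet> v) = \<bar>(grad (F n) w - grad (F n) x) \<bullet> v\<bar>" by (simp add: inner_diff_left)
        also have "\<dots> \<le> C * norm h * norm v" by (intro abs_inner_leI gl w order_refl)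
        finally show "norm (grad (F n) w \<bullet> v - grad (F n) x \<bullet> v) \<le> C * norm h * norm v" .
      qed
    qed (auto simp: dist_norm)
    then show ?thesis by (simp add: inner_add_right power2_eq_square algebra_simps)
  qed
  have gb: "norm (grad (F n) x) \<le> real CARD('n) * (3 * L + C)" for n
  proof -
    have "\<bar>grad (F n) x $ i\<bar> \<le> 3 * L + C" for i
    proof -
      have e: "norm (axis i (1::real)) = 1" by simp
      have "\<bar>F n (x + axis i 1) - F n x - grad (F n) x $ i\<bar> \<le> C" using taylor[of "axis i 1" n] by (simp add: inner_axis)
      moreover have "\<bar>F n (x + axis i 1) - f (x + axis i 1)\<bar> \<le> L * R n" "\<bar>F n x - f x\<bar> \<le> L * R n"
        by (rule close; simp)+
      moreover have "\<bar>f (x + axis i 1) - f x\<bar> \<le> L" using lip[of "x + axis i 1" x] by simp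
      moreover have "L * R n \<le> L" using L R(2)[of n] by (simp add: mult_left_le)
      ultimately show ?thesis by linarith
    qed
    then have "(\<Sum>i\<in>UNIV. \<bar>grad (F n) x $ i\<bar>) \<le> real CARD('n) * (3 * L + C)"
      using sum_bounded_above[of UNIV "\<lambda>i. \<bar>grad (F n) x $ i\<bar>" "3 * L + C"] by simp
    then show ?thesis using norm_le_l1_cart[of "grad (F n) x"] by linarith
  qed
  have "seq_compact (cball (0::real^'n) (real CARD('n) * (3 * L + C)))" using compact_cball compact_imp_seq_compact by blast
  then obtain G \<rho> where G: "strict_mono (\<rho>::nat\<Rightarrow>nat)" "((\<lambda>n. grad (F n) x) \<circ> \<rho>) \<longlonglongrightarrow> G"
    using gb unfolding seq_compact_def by (metis mem_cball_0)
  have lim: "(\<lambda>n. F (\<rho> n) y) \<longlonglongrightarrow> f y" if "norm (y - x) \<le> 1" for y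
  proof -
    have "(\<lambda>n. F (\<rho> n) y - f y) \<longlonglongrightarrow> 0"
    proof (rule Lim_null_comparison)
      show "\<forall>\<^sub>F n in sequentially. norm (F (\<rho> n) y - f y) \<le> L * R (\<rho> n)" using close[OF that] by simp
      show "(\<lambda>n. L * R (\<rho> n)) \<longlonglongrightarrow> 0"
        using tendsto_mult_right_zero[OF LIMSEQ_subseq_LIMSEQ[OF Rl G(1)], of L] by (simp add: o_def)
    qed
    then show ?thesis by (rule LIM_zero_cancel)
  qed
  have "\<bar>f (x + h) - f x - G \<bullet> h\<bar> \<le> C * (norm h)\<^sup>2" if h: "norm h \<le> 1" for h
  proof (rule tendsto_upperbound)
    show "(\<lambda>n. \<bar>F (\<rho> n) (x + h) - F (\<rho> n) x - grad (F (\<rho> n)) x \<bullet> h\<bar>) \<longlonglongrightarrow> \<bar>f (x + h) - f x - G \<bullet> h\<bar>"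
      using G(2) by (intro tendsto_intros lim) (use h in \<open>auto simp: o_def\<close>)
  qed (use taylor[OF h] in auto)
  then show ?thesis unfolding C_def by blast
qed

lemma locally_integrable_measurable:
  fixes f :: "real^'n::finite \<Rightarrow> real"
  assumes "locally_integrable f" shows "f \<in> borel_measurable lebesgue"
proof (rule borel_measurable_LIMSEQ_real)
  fix i :: nat
  have "f absolutely_integrable_on cball 0 (real i)" using assms by (simp add: locally_integrable_def)
  then have "integrable lebesgue (\<lambda>x. indicator (cball 0 (real i)) x *\<^sub>R f x)" by (simp add: set_integrable_def)
  then show "(\<lambda>x. indicator (cball 0 (real i)) x * f x) \<in> borel_measurable lebesgue" by (simp add: borel_measurable_integrable)
next
  fix x :: "real^'n"
  obtain N :: nat where N: "norm x \<le> real N" using real_arch_simple by blast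
  have "\<forall>\<^sub>F i in sequentially. indicator (cball 0 (real i)) x * f x = f x"
    unfolding eventually_sequentially
  proof (intro exI[of _ N] allI impI)
    fix i assume "N \<le> i"
    then have "norm x \<le> real i" using N by linarith
    then show "indicator (cball 0 (real i)) x * f x = f x" by (simp add: indicator_def)
  qed
  then show "(\<lambda>i. indicator (cball 0 (real i)) x * f x) \<longlonglongrightarrow> f x" by (rule tendsto_eventually)
qed

lemma esssup_nonneg:
  fixes f :: "real^'n::finite \<Rightarrow> ereal"
  assumes "\<And>x. 0 \<le> f x"
  shows "0 \<le> esssup lebesgue f"
proof (rule ccontr)
  assume "\<not> 0 \<le> esssup lebesgue f"
  then have neg: "esssup lebesgue f < 0" by simp
  have "AE x in (lebesgue :: (real^'n) measure). False"
    using esssup_AE[of f "lebesgue"] by eventually_elim (use assms neg in \<open>meson order_trans not_less\<close>)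
  then have "emeasure lebesgue (UNIV :: (real^'n) set) = 0" by (simp add: AE_iff_measurable[OF _ refl])
  then show False by simp
qed

lemma finite_index_lists: "finite {is :: 'n::finite list. length is = k}"
  using finite_lists_length_eq[of "UNIV :: 'n set" k] by simp

text \<open>Each weak second derivative is bounded by the norm of the weak Hessian, hence by its essential supremum,
and since all of these are nonnegative each is at most their sum.\<close>

lemma admissible_weak:
  fixes g :: "real^'n::finite \<Rightarrow> real^'n^'n"
  assumes adm: "admissible_coeffs lam Lam Lam1 g"
  shows "is_weak_partial [k, l] (\<lambda>x. g x $ i $ j) (weak_partial [k, l] (\<lambda>x. g x $ i $ j))"
    and "weak_partial [k, l] (\<lambda>x. g x $ i $ j) \<in> borel_measurable lebesgue"
    and "AE x in lebesgue. \<bar>weak_partial [k, l] (\<lambda>x. g x $ i $ j) x\<bar> \<le> Lam1"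
proof -
  let ?f = "\<lambda>i j x. g x $ i $ j"
  have "\<exists>h. is_weak_partial [k, l] (?f i j) h" using adm by (simp add: admissible_coeffs_def)
  then show w: "is_weak_partial [k, l] (?f i j) (weak_partial [k, l] (?f i j))"
    unfolding weak_partial_def by (rule someI_ex)
  then show "weak_partial [k, l] (?f i j) \<in> borel_measurable lebesgue"
    by (intro locally_integrable_measurable) (simp add: is_weak_partial_def)
  define E where "E i j = esssup lebesgue (\<lambda>x. ereal (norm_weak_hessian (?f i j) x))" for i j
  have E0: "0 \<le> E i j" for i j unfolding E_def by (rule esssup_nonneg) (simp add: norm_weak_hessian_def sum_nonneg)
  have "E i j \<le> (\<Sum>j\<in>UNIV. E i j)" using sum_mono2[of UNIV "{j}" "E i"] E0 by simp
  also have "\<dots> \<le> (\<Sum>i\<in>UNIV. \<Sum>j\<in>UNIV. E i j)"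
    using sum_mono2[of UNIV "{i}" "\<lambda>i. \<Sum>j\<in>UNIV. E i j"] E0 by (simp add: sum_nonneg)
  also have "\<dots> \<le> ereal Lam1" using adm by (simp add: admissible_coeffs_def E_def)
  finally have E: "E i j \<le> ereal Lam1" .
  have "AE x in lebesgue. ereal (norm_weak_hessian (?f i j) x) \<le> E i j" unfolding E_def by (rule esssup_AE)
  then show "AE x in lebesgue. \<bar>weak_partial [k, l] (?f i j) x\<bar> \<le> Lam1"
  proof eventually_elim
    case (elim x)
    have "(weak_partial [k, l] (?f i j) x)\<^sup>2 \<le> (\<Sum>is | length is = 2. (weak_partial is (?f i j) x)\<^sup>2)"
      by (rule member_le_sum[of "[k, l]"]) (auto simp: finite_index_lists)
    then have "\<bar>weak_partial [k, l] (?f i j) x\<bar> \<le> norm_weak_hessian (?f i j) x"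
      unfolding norm_weak_hessian_def by (rule real_le_rsqrt[of "\<bar>_\<bar>", simplified])
    moreover have "norm_weak_hessian (?f i j) x \<le> Lam1" using order_trans[OF elim E] by simp
    ultimately show ?case by linarith
  qed
qed

lemma admissible_lipschitz:
  fixes g :: "real^'n::finite \<Rightarrow> real^'n^'n"
  assumes adm: "admissible_coeffs lam Lam Lam1 g"
  shows "\<bar>g x $ i $ j - g y $ i $ j\<bar> \<le> Lam * norm (x - y)" "norm (g x - g y) \<le> Lam * norm (x - y)"
proof -
  let ?S = "\<Sum>i\<in>UNIV. \<Sum>j\<in>UNIV. \<bar>g x $ i $ j - g y $ i $ j\<bar>"
  have S: "?S \<le> Lam * norm (x - y)" using adm by (simp add: admissible_coeffs_def)
  have "\<bar>g x $ i $ j - g y $ i $ j\<bar> \<le> (\<Sum>j\<in>UNIV. \<bar>g x $ i $ j - g y $ i $ j\<bar>)"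
    by (rule member_le_sum[of j UNIV "\<lambda>j. \<bar>g x $ i $ j - g y $ i $ j\<bar>"]) auto
  also have "\<dots> \<le> ?S"
    by (rule member_le_sum[of i UNIV "\<lambda>i. \<Sum>j\<in>UNIV. \<bar>g x $ i $ j - g y $ i $ j\<bar>"]) (auto intro: sum_nonneg)
  finally show "\<bar>g x $ i $ j - g y $ i $ j\<bar> \<le> Lam * norm (x - y)" using S by linarith
  have "norm (g x - g y) \<le> (\<Sum>i\<in>UNIV. norm ((g x - g y) $ i))" by (simp add: norm_vec_def L2_set_le_sum)
  also have "\<dots> \<le> (\<Sum>i\<in>UNIV. \<Sum>j\<in>UNIV. \<bar>(g x - g y) $ i $ j\<bar>)" by (intro sum_mono norm_le_l1_cart)
  finally show "norm (g x - g y) \<le> Lam * norm (x - y)" using S by simp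
qed

lemma lipschitz_derivative_bound:
  fixes f :: "'a::real_normed_vector \<Rightarrow> 'b::real_normed_vector"
  assumes f: "(f has_derivative f') (at x)" and lip: "\<And>x y. norm (f x - f y) \<le> L * norm (x - y)"
  shows "norm (f' h) \<le> L * norm h"
proof -
  have lin: "linear f'" by (rule has_derivative_linear[OF f])
  have "norm (f' h) \<le> L * norm h + e" if e: "0 < e" for e
  proof (cases "h = 0")
    case True
    then show ?thesis using e linear_0[OF lin] by simp
  next
    case False
    define e' where "e' = e / norm h"
    have e': "0 < e'" "e' * norm h = e" using e False by (simp_all add: e'_def)
    obtain d where d: "0 < d" "\<And>y. norm (y - x) < d \<Longrightarrow> norm (f y - f x - f' (y - x)) \<le> e' * norm (y - x)"
      using f e'(1) unfolding has_derivative_at_alt by blast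
    define t where "t = d / (2 * norm h)"
    have t: "0 < t" "norm (t *\<^sub>R h) < d" using d(1) False by (simp_all add: t_def)
    have "norm (f (x + t *\<^sub>R h) - f x - f' (t *\<^sub>R h)) \<le> e' * norm (t *\<^sub>R h)" using d(2)[of "x + t *\<^sub>R h"] t(2) by simp
    moreover have "norm (f (x + t *\<^sub>R h) - f x) \<le> L * norm (t *\<^sub>R h)" using lip[of "x + t *\<^sub>R h" x] by simp
    moreover have "norm (f' (t *\<^sub>R h)) \<le> norm (f (x + t *\<^sub>R h) - f x) + norm (f (x + t *\<^sub>R h) - f x - f' (t *\<^sub>R h))"
      using norm_triangle_ineq4[of "f (x + t *\<^sub>R h) - f x" "f (x + t *\<^sub>R h) - f x - f' (t *\<^sub>R h)"] by simp
    ultimately have "t * norm (f' h) \<le> t * (L * norm h + e' * norm h)"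
      using t(1) by (simp add: linear_cmul[OF lin] distrib_left mult.left_commute)
    then show ?thesis using t(1) e'(2) by simp
  qed
  then show ?thesis by (rule field_le_epsilon)
qed

lemma form_eq_sum: "(A *v \<xi>) \<bullet> \<xi> = (\<Sum>i\<in>UNIV. \<Sum>j\<in>UNIV. A $ i $ j * \<xi> $ i * \<xi> $ j)"
  for A :: "real^'n::finite^'n"
  by (simp add: inner_vec_def matrix_vector_mult_def sum_distrib_left sum_distrib_right mult_ac)

text \<open>Every entry of \<open>g\<close> has a quadratic expansion at every point, hence a continuous gradient.\<close>

lemma admissible_C1:
  fixes g :: "real^'n::finite \<Rightarrow> real^'n^'n"
  assumes ker: "\<And>R. 0 < R \<Longrightarrow> \<exists>\<eta>::real^'n \<Rightarrow> real. kernel R \<eta>"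
    and adm: "admissible_coeffs lam Lam Lam1 g" and lam: "0 < lam" "lam \<le> 1" and Lam: "0 < Lam"
  shows "\<exists>g'. elliptic_C1 g g' lam Lam"
proof -
  define C where "C = real CARD('n) * (real CARD('n) * \<bar>Lam1\<bar>)"
  have "\<exists>G. \<forall>h. norm h \<le> 1 \<longrightarrow> \<bar>g (x + h) $ i $ j - g x $ i $ j - G \<bullet> h\<bar> \<le> C * (norm h)\<^sup>2" for i j x
    unfolding C_def
  proof (rule quadratic_expansion[OF ker admissible_lipschitz(1)[OF adm]])
    fix k l
    have "AE x in lebesgue. \<bar>weak_partial [k, l] (\<lambda>x. g x $ i $ j) x\<bar> \<le> \<bar>Lam1\<bar>"
      using admissible_weak(3)[OF adm, of k l i j] by eventually_elim linarith
    then show "\<exists>h. is_weak_partial [k, l] (\<lambda>x. g x $ i $ j) h \<and> h \<in> borel_measurable lebesgue \<and> (AE x in lebesgue. \<bar>h x\<bar> \<le> \<bar>Lam1\<bar>)"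
      using admissible_weak(1,2)[OF adm] by blast
  qed
  then have "\<forall>i j x. \<exists>G. \<forall>h. norm h \<le> 1 \<longrightarrow> \<bar>g (x + h) $ i $ j - g x $ i $ j - G \<bullet> h\<bar> \<le> C * (norm h)\<^sup>2" by blast
  then obtain G where G: "\<And>i j x h. norm h \<le> 1 \<Longrightarrow> \<bar>g (x + h) $ i $ j - g x $ i $ j - G i j x \<bullet> h\<bar> \<le> C * (norm h)\<^sup>2"
    by metis
  have C: "0 \<le> C" by (simp add: C_def)
  define g' where "g' x h = (\<chi> i j. G i j x \<bullet> h)" for x h
  have d: "(g has_derivative g' x) (at x)" for x
  proof (intro has_derivative_vecI)
    fix i j
    show "((\<lambda>x. g x $ i $ j) has_derivative (\<lambda>h. g' x h $ i $ j)) (at x)"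
      using has_derivative_quadratic[of "\<lambda>x. g x $ i $ j" x "G i j x" C, OF G C] by (simp add: g'_def)
  qed
  have cG: "continuous_on UNIV (G i j)" for i j
    by (rule continuous_quadratic[of "\<lambda>x. g x $ i $ j"]) (rule G)
  have "elliptic_C1 g g' lam Lam"
  proof
    show "continuous_on UNIV (\<lambda>x. g' x h)" for h unfolding g'_def by (intro continuous_intros cG)
    show "norm (g' x h) \<le> Lam * norm h" for x h
      by (rule lipschitz_derivative_bound[OF d admissible_lipschitz(2)[OF adm]])
  qed (use adm lam Lam d in \<open>auto simp: admissible_coeffs_def form_eq_sum\<close>)
  then show ?thesis by blast
qed

section \<open>Weak second derivatives of a product\<close>

lemma smooth_compact_mult_test:
  assumes "\<phi> \<in> test_functions UNIV" "smooth \<psi>"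
  shows "(\<lambda>x. \<phi> x * \<psi> x) \<in> test_functions UNIV"
proof -
  have "supp (\<lambda>x. \<phi> x * \<psi> x) \<subseteq> supp \<phi>" unfolding supp_def by (rule closure_mono) auto
  moreover have "closed (supp (\<lambda>x. \<phi> x * \<psi> x))" by (simp add: supp_def)
  ultimately have "compact (supp (\<lambda>x. \<phi> x * \<psi> x))"
    using assms(1) by (simp add: test_functions_def) (metis compact_Int_closed inf.absorb_iff2)
  then show ?thesis using assms by (simp add: test_functions_def smooth_mult)
qed

lemma supp_zero: "x \<notin> supp f \<Longrightarrow> f x = 0"
  unfolding supp_def using closure_subset by force

lemma iter_partial_product2:
  assumes f: "smooth f" and g: "smooth g"
  shows "iter_partial [k, l] (\<lambda>x. f x * g x) x = iter_partial [k, l] f x * g x + partial_deriv l f x * partial_deriv k g x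
    + partial_deriv k f x * partial_deriv l g x + f x * iter_partial [k, l] g x"
proof -
  have pd: "partial_deriv i (\<lambda>x. f x * g x) = (\<lambda>x. partial_deriv i f x * g x + f x * partial_deriv i g x)"
    if "smooth f" "smooth g" for i and f g :: "real^'a \<Rightarrow> real"
    using partial_deriv_linear_combination[of "{()}" "\<lambda>_. f" "\<lambda>_. g" i] that by simp
  have "iter_partial [k, l] (\<lambda>x. f x * g x) x = partial_deriv k (\<lambda>x. partial_deriv l f x * g x + f x * partial_deriv l g x) x"
    using pd[OF f g] by simp
  also have "\<dots> = partial_deriv k (\<lambda>x. partial_deriv l f x * g x) x + partial_deriv k (\<lambda>x. f x * partial_deriv l g x) x"
  proof -
    have s: "smooth (\<lambda>x. partial_deriv l f x * g x)" "smooth (\<lambda>x. f x * partial_deriv l g x)"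
      by (intro smooth_mult smooth_partial_deriv f g)+
    from partial_deriv_has_derivative(1)[OF has_derivative_add[OF smooth_has_derivative[OF s(1)] smooth_has_derivative[OF s(2)]], of k x]
    show ?thesis by (simp add: inner_axis grad_nth)
  qed
  finally show ?thesis by (simp add: pd[OF smooth_partial_deriv[OF f] g] pd[OF f smooth_partial_deriv[OF g]])
qed

lemma locally_integrable_bounded:
  fixes f :: "real^'n::finite \<Rightarrow> real"
  assumes "f \<in> borel_measurable lebesgue" "AE x in lebesgue. \<bar>f x\<bar> \<le> B"
  shows "locally_integrable f"
  unfolding locally_integrable_def
proof (intro allI impI)
  fix K :: "(real^'n) set" assume K: "compact K"
  show "f absolutely_integrable_on K" unfolding set_integrable_def
  proof (rule Bochner_Integration.integrable_bound)
    show "integrable lebesgue (\<lambda>x. indicator K x *\<^sub>R B)"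
    proof -
      have i: "integrable lborel (\<lambda>x. indicator K x *\<^sub>R B)" by (rule borel_integrable_compact[OF K continuous_on_const])
      show ?thesis using i integrable_completion[OF borel_measurable_integrable[OF i]] by simp
    qed
    show "(\<lambda>x. indicator K x *\<^sub>R f x) \<in> borel_measurable lebesgue"
      using K assms(1) by (intro borel_measurable_scaleR borel_measurable_indicator) (auto simp: lmeasurable_compact fmeasurableD)
    show "AE x in lebesgue. norm (indicator K x *\<^sub>R f x) \<le> norm (indicator K x *\<^sub>R B)"
      using assms(2) by eventually_elim (auto simp: indicator_def)
  qed
qed

lemma integrable_bounded_times:
  fixes f \<psi> :: "real^'n::finite \<Rightarrow> real"
  assumes f: "f \<in> borel_measurable lebesgue" "AE x in lebesgue. \<bar>f x\<bar> \<le> B" and \<psi>: "continuous_on UNIV \<psi>" "\<And>x. R < norm x \<Longrightarrow> \<psi> x = 0"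
  shows "integrable lebesgue (\<lambda>x. f x * \<psi> x)"
proof -
  have m: "\<psi> \<in> borel_measurable lborel" using \<psi>(1) by (simp add: borel_measurable_continuous_onI)
  have i: "integrable lebesgue \<psi>" using integrable_compact_support[OF \<psi>] integrable_completion[OF m] by simp
  show ?thesis
  proof (rule Bochner_Integration.integrable_bound)
    show "integrable lebesgue (\<lambda>x. B * \<psi> x)" using i by simp
    show "(\<lambda>x. f x * \<psi> x) \<in> borel_measurable lebesgue" using f(1) i by (intro borel_measurable_times) auto
    show "AE x in lebesgue. norm (f x * \<psi> x) \<le> norm (B * \<psi> x)"
      using f(2) by eventually_elim (auto simp: abs_mult intro!: mult_right_mono)
  qed
qed

lemma locally_integrable_times:
  fixes f \<psi> :: "real^'n::finite \<Rightarrow> real"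
  assumes f: "locally_integrable f" and \<psi>: "continuous_on UNIV \<psi>" "\<And>x. R < norm x \<Longrightarrow> \<psi> x = 0"
  shows "integrable lebesgue (\<lambda>x. f x * \<psi> x)"
proof -
  have "f absolutely_integrable_on cball 0 R" using f by (simp add: locally_integrable_def)
  then have i: "integrable lebesgue (\<lambda>x. indicator (cball 0 R) x *\<^sub>R f x)" by (simp add: set_integrable_def)
  have "compact (\<psi> ` cball 0 R)" using \<psi>(1) by (meson compact_cball compact_continuous_image continuous_on_subset subset_UNIV)
  then obtain B where B: "\<And>x. x \<in> cball 0 R \<Longrightarrow> \<bar>\<psi> x\<bar> \<le> B" by (force dest: compact_imp_bounded simp: bounded_iff)
  have m: "\<psi> \<in> borel_measurable lebesgue" using \<psi>(1)
    by (simp add: borel_measurable_continuous_onI measurable_completion)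
  show ?thesis
  proof (rule Bochner_Integration.integrable_bound)
    show "integrable lebesgue (\<lambda>x. B * norm (indicator (cball 0 R) x *\<^sub>R f x))" using i by (intro integrable_mult_right integrable_norm)
    show "(\<lambda>x. f x * \<psi> x) \<in> borel_measurable lebesgue"
      using locally_integrable_measurable[OF f] m by (rule borel_measurable_times)
    show "AE x in lebesgue. norm (f x * \<psi> x) \<le> norm (B * norm (indicator (cball 0 R) x *\<^sub>R f x))"
    proof (rule AE_I2)
      fix x
      show "norm (f x * \<psi> x) \<le> norm (B * norm (indicator (cball 0 R) x *\<^sub>R f x))"
      proof (cases "x \<in> cball 0 R")
        case True
        then have "\<bar>f x\<bar> * \<bar>\<psi> x\<bar> \<le> \<bar>f x\<bar> * \<bar>B\<bar>" using B[of x] by (intro mult_left_mono) auto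
        then show ?thesis using True by (simp add: abs_mult mult.commute)
      next
        case False
        then show ?thesis using \<psi>(2)[of x] by simp
      qed
    qed
  qed
qed

lemma test_function_bounded_support:
  assumes "\<psi> \<in> test_functions U"
  obtains R where "\<And>x is. R < norm x \<Longrightarrow> iter_partial is \<psi> x = 0"
proof -
  have "compact (supp \<psi>)" using assms by (simp add: test_functions_def)
  then obtain R where R: "\<And>x. x \<in> supp \<psi> \<Longrightarrow> norm x \<le> R" by (force dest: compact_imp_bounded simp: bounded_iff)
  have "iter_partial is \<psi> x = 0" if "R < norm x" for x "is"
    by (rule iter_partial_zero_off[where K = "supp \<psi>"]) (use that R supp_zero in \<open>force simp: supp_def\<close>)+
  then show thesis using that by blast
qed

lemma test_smooth: "\<psi> \<in> test_functions U \<Longrightarrow> smooth \<psi>"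
  by (simp add: test_functions_def)

lemma locally_integrable_test:
  assumes f: "locally_integrable f" and \<psi>: "\<psi> \<in> test_functions U"
  shows "integrable lebesgue (\<lambda>x. f x * iter_partial is \<psi> x)"
proof -
  obtain R where R: "\<And>x is. R < norm x \<Longrightarrow> iter_partial is \<psi> x = 0" using test_function_bounded_support[OF \<psi>] by metis
  show ?thesis by (rule locally_integrable_times[OF f smooth_iter_continuous_on[OF test_smooth[OF \<psi>]] R])
qed

lemma locally_integrable_continuous:
  fixes f :: "real^'n::finite \<Rightarrow> real"
  assumes "continuous_on UNIV f" shows "locally_integrable f"
  unfolding locally_integrable_def set_integrable_def
proof (intro allI impI)
  fix K :: "(real^'n) set" assume K: "compact K"
  have i: "integrable lborel (\<lambda>x. indicator K x *\<^sub>R f x)"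
    by (rule borel_integrable_compact[OF K continuous_on_subset[OF assms]]) simp
  show "integrable lebesgue (\<lambda>x. indicator K x *\<^sub>R f x)"
    using i integrable_completion[OF borel_measurable_integrable[OF i]] by simp
qed

lemma locally_integrable_sum:
  assumes "\<And>a. a \<in> A \<Longrightarrow> locally_integrable (f a)"
  shows "locally_integrable (\<lambda>x. \<Sum>a\<in>A. f a x)"
  using assms unfolding locally_integrable_def set_integrable_def scaleR_sum_right by (auto intro!: Bochner_Integration.integrable_sum)

lemma is_weak_partial_sum:
  fixes f h :: "'a \<Rightarrow> real^'n::finite \<Rightarrow> real"
  assumes w: "\<And>a. a \<in> A \<Longrightarrow> is_weak_partial is (f a) (h a)"
  shows "is_weak_partial is (\<lambda>x. \<Sum>a\<in>A. f a x) (\<lambda>x. \<Sum>a\<in>A. h a x)"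
  unfolding is_weak_partial_def
proof (intro conjI ballI)
  have li: "locally_integrable (f a)" "locally_integrable (h a)" if "a \<in> A" for a
    using w[OF that] by (auto simp: is_weak_partial_def)
  show "locally_integrable (\<lambda>x. \<Sum>a\<in>A. f a x)" "locally_integrable (\<lambda>x. \<Sum>a\<in>A. h a x)"
    using li by (auto intro: locally_integrable_sum)
  fix \<phi> :: "real^'n \<Rightarrow> real" assume \<phi>: "\<phi> \<in> test_functions UNIV"
  have "(LINT x|lebesgue. (\<Sum>a\<in>A. f a x) * iter_partial is \<phi> x) = (\<Sum>a\<in>A. LINT x|lebesgue. f a x * iter_partial is \<phi> x)"
    unfolding sum_distrib_right by (intro Bochner_Integration.integral_sum locally_integrable_test[OF li(1) \<phi>])
  also have "\<dots> = (\<Sum>a\<in>A. (-1) ^ length is * (LINT x|lebesgue. h a x * \<phi> x))"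
    by (intro sum.cong refl) (use w \<phi> in \<open>auto simp: is_weak_partial_def\<close>)
  also have "\<dots> = (-1) ^ length is * (\<Sum>a\<in>A. LINT x|lebesgue. h a x * \<phi> x)" by (simp add: sum_distrib_left)
  also have "(\<Sum>a\<in>A. LINT x|lebesgue. h a x * \<phi> x) = (LINT x|lebesgue. (\<Sum>a\<in>A. h a x) * \<phi> x)"
    unfolding sum_distrib_right
    using locally_integrable_test[OF li(2) \<phi>, of _ "[]"] by (subst Bochner_Integration.integral_sum) auto
  finally show "(LINT x|lebesgue. (\<Sum>a\<in>A. f a x) * iter_partial is \<phi> x) = (-1) ^ length is * (LINT x|lebesgue. (\<Sum>a\<in>A. h a x) * \<phi> x)" .
qed

text \<open>\<open>f a b\<close> is continuously differentiable with compact support, so its derivative has integral zero.\<close>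

lemma integration_by_parts_C1:
  fixes f a b :: "real^'n::finite \<Rightarrow> real"
  assumes f: "\<And>x. (f has_derivative (\<lambda>h. G x \<bullet> h)) (at x)" and G: "continuous_on UNIV G"
    and a: "smooth a" "\<And>x. R < norm x \<Longrightarrow> a x = 0" and b: "smooth b"
  shows "(LINT x|lebesgue. f x * a x * partial_deriv k b x) = - (LINT x|lebesgue. (G x $ k * a x + f x * partial_deriv k a x) * b x)"
proof -
  let ?e = "axis k (1::real)" and ?K = "cball (0::real^'n) R"
  have cf: "continuous_on UNIV f" using f by (meson continuous_at_imp_continuous_on has_derivative_continuous)
  note c = cf G smooth_continuous_on[OF a(1)] smooth_continuous_on[OF b] smooth_continuous_on[OF smooth_partial_deriv[OF a(1)]] smooth_continuous_on[OF smooth_partial_deriv[OF b]]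
  have pa: "partial_deriv k a x = 0" if "R < norm x" for x
    using iter_partial_zero_off[of ?K a x "[k]"] a(2) that by simp
  define F' where "F' x h = f x * a x * (grad b x \<bullet> h) + (f x * (grad a x \<bullet> h) + (G x \<bullet> h) * a x) * b x" for x h
  have "(LINT x:?K|lborel. F' x ?e) = 0"
  proof (rule integral_directional_derivative_zero[OF compact_cball open_UNIV subset_UNIV, where F = "\<lambda>x. f x * a x * b x"])
    show "f x * a x * b x = 0" if "x \<notin> ?K" for x using a(2)[of x] that by simp
    show "((\<lambda>x. f x * a x * b x) has_derivative F' x) (at x)" for x
      unfolding F'_def by (intro has_derivative_mult f smooth_has_derivative a b)
    show "continuous_on UNIV (\<lambda>x. F' x ?e)" unfolding F'_def inner_axis grad_nth by (intro continuous_intros c)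
  qed
  moreover have "(LINT x:?K|lborel. F' x ?e) = (LINT x|lborel. f x * a x * partial_deriv k b x + (G x $ k * a x + f x * partial_deriv k a x) * b x)"
    unfolding set_lebesgue_integral_def
    by (intro Bochner_Integration.integral_cong) (use a(2) pa in \<open>auto simp: F'_def inner_axis grad_nth indicator_def algebra_simps\<close>)
  moreover have "integrable lborel (\<lambda>x. f x * a x * partial_deriv k b x)" "integrable lborel (\<lambda>x. (G x $ k * a x + f x * partial_deriv k a x) * b x)"
    by (rule integrable_compact_support[of _ R]; use a(2) pa in \<open>auto intro!: continuous_intros c\<close>)+
  ultimately have "(LINT x|lborel. f x * a x * partial_deriv k b x) = - (LINT x|lborel. (G x $ k * a x + f x * partial_deriv k a x) * b x)" by simp
  then show ?thesis by (subst (1 2) lebesgue_integral_eq_lborel) (auto intro!: continuous_intros c)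
qed

text \<open>The function \<open>\<phi> \<psi>\<close> is a test function, and the definition of \<open>h\<close>, applied to it, produces the second derivatives of
\<open>\<phi> \<psi>\<close> by Leibniz' rule. The terms in which a derivative of \<open>\<psi>\<close> meets one of \<open>\<phi>\<close> are integrated by parts
with the classical gradient of \<open>f\<close>.\<close>

lemma weak_partial_product:
  fixes f h \<phi> :: "real^'n::finite \<Rightarrow> real"
  assumes w: "is_weak_partial [k, l] f h" and hb: "AE x in lebesgue. \<bar>h x\<bar> \<le> B"
    and f: "\<And>x. (f has_derivative (\<lambda>h. G x \<bullet> h)) (at x)" and G: "continuous_on UNIV G"
    and \<phi>: "\<phi> \<in> test_functions UNIV"
  defines "r \<equiv> \<lambda>x. G x $ k * partial_deriv l \<phi> x + G x $ l * partial_deriv k \<phi> x + f x * iter_partial [k, l] \<phi> x"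
  shows "is_weak_partial [k, l] (\<lambda>x. f x * \<phi> x) (\<lambda>x. h x * \<phi> x + r x)"
    and "\<exists>B. AE x in lebesgue. \<bar>h x * \<phi> x + r x\<bar> \<le> B"
proof -
  have s: "smooth \<phi>" by (rule test_smooth[OF \<phi>])
  obtain R where R: "\<And>x is. R < norm x \<Longrightarrow> iter_partial is \<phi> x = 0" using test_function_bounded_support[OF \<phi>] by metis
  have z: "\<phi> x = 0" "partial_deriv i \<phi> x = 0" if "R < norm x" for x i using R[OF that, of "[]"] R[OF that, of "[i]"] by simp_all
  have cf: "continuous_on UNIV f" using f by (meson continuous_at_imp_continuous_on has_derivative_continuous)
  note c = cf G smooth_continuous_on[OF s] smooth_continuous_on[OF smooth_partial_deriv[OF s]] smooth_iter_continuous_on[OF s]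
  have hl: "locally_integrable h" using w by (simp add: is_weak_partial_def)
  have hm: "h \<in> borel_measurable lebesgue" by (rule locally_integrable_measurable[OF hl])
  have cr: "continuous_on UNIV r" unfolding r_def by (intro continuous_intros c)
  have rz: "r x = 0" if "R < norm x" for x using R[OF that, of "[k, l]"] z[OF that] by (simp add: r_def)
  have bnd: "\<exists>B. \<forall>x. \<bar>q x\<bar> \<le> B" if q: "continuous_on UNIV q" "\<And>x. R < norm x \<Longrightarrow> q x = 0" for q :: "real^'n \<Rightarrow> real"
  proof -
    have "compact (q ` cball 0 R)" using q(1) by (meson compact_cball compact_continuous_image continuous_on_subset subset_UNIV)
    then obtain B where B: "\<And>x. x \<in> cball 0 R \<Longrightarrow> \<bar>q x\<bar> \<le> B" by (force dest: compact_imp_bounded simp: bounded_iff)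
    have "\<bar>q x\<bar> \<le> max B 0" for x using B[of x] q(2)[of x] by (cases "x \<in> cball 0 R") auto
    then show ?thesis by blast
  qed
  obtain B1 where B1: "\<And>x. \<bar>\<phi> x\<bar> \<le> B1" using bnd[of \<phi>] c(3) z(1) by blast
  obtain B2 where B2: "\<And>x. \<bar>r x\<bar> \<le> B2" using bnd[OF cr rz] by blast
  have ae: "AE x in lebesgue. \<bar>h x * \<phi> x + r x\<bar> \<le> B * B1 + B2"
    using hb by eventually_elim (intro abs_add_leI abs_mult_leI B1 B2)
  then show "\<exists>B. AE x in lebesgue. \<bar>h x * \<phi> x + r x\<bar> \<le> B" by blast
  have "(\<lambda>x. h x * \<phi> x + r x) \<in> borel_measurable lebesgue"
    using hm c(3) cr by (intro borel_measurable_add borel_measurable_times) (auto simp: measurable_completion borel_measurable_continuous_onI)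
  then have li: "locally_integrable (\<lambda>x. h x * \<phi> x + r x)" using ae by (rule locally_integrable_bounded)
  show "is_weak_partial [k, l] (\<lambda>x. f x * \<phi> x) (\<lambda>x. h x * \<phi> x + r x)"
    unfolding is_weak_partial_def
  proof (intro conjI ballI li)
    show "locally_integrable (\<lambda>x. f x * \<phi> x)" by (rule locally_integrable_continuous) (intro continuous_intros c)
    fix \<psi> :: "real^'n \<Rightarrow> real" assume \<psi>: "\<psi> \<in> test_functions UNIV"
    have t: "smooth \<psi>" by (rule test_smooth[OF \<psi>])
    note d = smooth_continuous_on[OF t] smooth_continuous_on[OF smooth_partial_deriv[OF t]] smooth_iter_continuous_on[OF t]
    have ci: "integrable lebesgue q" if "continuous_on UNIV q" "\<And>x. R < norm x \<Longrightarrow> q x = 0" for q :: "real^'n \<Rightarrow> real"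
      using locally_integrable_times[OF locally_integrable_continuous[OF continuous_on_const[of _ 1]] that] by simp
    have test: "(\<lambda>x. \<phi> x * \<psi> x) \<in> test_functions UNIV" by (rule smooth_compact_mult_test[OF \<phi> t])
    have i1: "integrable lebesgue (\<lambda>x. f x * iter_partial [k, l] (\<lambda>x. \<phi> x * \<psi> x) x)"
      by (rule locally_integrable_test[OF locally_integrable_continuous[OF cf] test])
    have ibp: "(LINT x|lebesgue. f x * partial_deriv i \<phi> x * partial_deriv j \<psi> x) = - (LINT x|lebesgue. (G x $ j * partial_deriv i \<phi> x + f x * iter_partial [j, i] \<phi> x) * \<psi> x)" for i j
      using integration_by_parts_C1[OF f G smooth_partial_deriv[OF s, of i] z(2) t, where k = j] by simp
    have i2: "integrable lebesgue (\<lambda>x. f x * iter_partial [k, l] \<phi> x * \<psi> x)"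
      and i3: "integrable lebesgue (\<lambda>x. f x * partial_deriv i \<phi> x * partial_deriv j \<psi> x)"
      and i4: "integrable lebesgue (\<lambda>x. (G x $ j * partial_deriv i \<phi> x + f x * iter_partial [j, i] \<phi> x) * \<psi> x)"
      and i5: "integrable lebesgue (\<lambda>x. r x * \<psi> x)" for i j
      by (rule ci; (intro continuous_intros c d cr; fail | simp only: R z rz mult_zero_left mult_zero_right add_0_left))+
    have i6: "integrable lebesgue (\<lambda>x. h x * \<phi> x * \<psi> x)"
      using locally_integrable_test[OF hl test, of "[]"] by (simp add: mult.assoc)
    have "(LINT x|lebesgue. f x * \<phi> x * iter_partial [k, l] \<psi> x) =
      (LINT x|lebesgue. f x * iter_partial [k, l] (\<lambda>x. \<phi> x * \<psi> x) x - f x * iter_partial [k, l] \<phi> x * \<psi> x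
        - f x * partial_deriv l \<phi> x * partial_deriv k \<psi> x - f x * partial_deriv k \<phi> x * partial_deriv l \<psi> x)"
      unfolding iter_partial_product2[OF s t] by (intro Bochner_Integration.integral_cong refl) (simp add: algebra_simps)
    also have "\<dots> = (LINT x|lebesgue. f x * iter_partial [k, l] (\<lambda>x. \<phi> x * \<psi> x) x) - (LINT x|lebesgue. f x * iter_partial [k, l] \<phi> x * \<psi> x)
        - (LINT x|lebesgue. f x * partial_deriv l \<phi> x * partial_deriv k \<psi> x) - (LINT x|lebesgue. f x * partial_deriv k \<phi> x * partial_deriv l \<psi> x)"
      by (subst Bochner_Integration.integral_diff, intro Bochner_Integration.integrable_diff i1 i2 i3, rule i3,
          subst Bochner_Integration.integral_diff, intro Bochner_Integration.integrable_diff i1 i2, rule i3,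
          subst Bochner_Integration.integral_diff[OF i1 i2], rule refl)
    also have "(LINT x|lebesgue. f x * iter_partial [k, l] (\<lambda>x. \<phi> x * \<psi> x) x) = (LINT x|lebesgue. h x * \<phi> x * \<psi> x)"
      using w test by (simp add: is_weak_partial_def mult.assoc)
    also have "(LINT x|lebesgue. h x * \<phi> x * \<psi> x) - (LINT x|lebesgue. f x * iter_partial [k, l] \<phi> x * \<psi> x)
        - (LINT x|lebesgue. f x * partial_deriv l \<phi> x * partial_deriv k \<psi> x) - (LINT x|lebesgue. f x * partial_deriv k \<phi> x * partial_deriv l \<psi> x)
      = (LINT x|lebesgue. h x * \<phi> x * \<psi> x) + (LINT x|lebesgue. r x * \<psi> x)"
    proof -
      have "iter_partial [l, k] \<phi> x = iter_partial [k, l] \<phi> x" for x by (rule iter_partial_commute[OF s])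
      then have "(LINT x|lebesgue. r x * \<psi> x) = (LINT x|lebesgue. ((G x $ k * partial_deriv l \<phi> x + f x * iter_partial [k, l] \<phi> x) * \<psi> x
          + (G x $ l * partial_deriv k \<phi> x + f x * iter_partial [l, k] \<phi> x) * \<psi> x) - f x * iter_partial [k, l] \<phi> x * \<psi> x)"
        by (intro Bochner_Integration.integral_cong refl) (simp add: r_def algebra_simps)
      also have "\<dots> = (LINT x|lebesgue. (G x $ k * partial_deriv l \<phi> x + f x * iter_partial [k, l] \<phi> x) * \<psi> x)
          + (LINT x|lebesgue. (G x $ l * partial_deriv k \<phi> x + f x * iter_partial [l, k] \<phi> x) * \<psi> x) - (LINT x|lebesgue. f x * iter_partial [k, l] \<phi> x * \<psi> x)"
        by (subst Bochner_Integration.integral_diff[OF Bochner_Integration.integrable_add[OF i4 i4] i2], subst Bochner_Integration.integral_add[OF i4 i4], rule refl)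
      finally show ?thesis unfolding ibp by linarith
    qed
    also have "\<dots> = (LINT x|lebesgue. (h x * \<phi> x + r x) * \<psi> x)"
      unfolding Bochner_Integration.integral_add[OF i6 i5, symmetric] by (simp add: distrib_right)
    finally show "(LINT x|lebesgue. f x * \<phi> x * iter_partial [k, l] \<psi> x) = (-1) ^ length [k, l] * (LINT x|lebesgue. (h x * \<phi> x + r x) * \<psi> x)" by simp
  qed
qed

section \<open>Uniqueness of weak derivatives\<close>

lemma conv_one_bounds:
  fixes \<eta> :: "real^'n::finite \<Rightarrow> real"
  assumes \<eta>: "kernel R \<eta>"
  shows "0 \<le> conv a b (\<lambda>_. 1) \<eta> x" "conv a b (\<lambda>_. 1) \<eta> x \<le> 1"
    and "cball x R \<inter> cbox a b = {} \<Longrightarrow> conv a b (\<lambda>_. 1) \<eta> x = 0"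
    and "cball x R \<subseteq> cbox a b \<Longrightarrow> conv a b (\<lambda>_. 1) \<eta> x = 1"
proof -
  have s: "smooth \<eta>" and p: "0 \<le> \<eta> x" for x using \<eta> by (auto simp: kernel_def)
  have c: "conv a b (\<lambda>_. 1) \<eta> x = (LINT y|lborel. indicator (cbox a b) y * \<eta> (x - y))"
    using conv_eq_LINT(1)[OF continuous_on_const s, of a b 1 x] by (simp add: set_lebesgue_integral_def)
  show "0 \<le> conv a b (\<lambda>_. 1) \<eta> x" unfolding c by (rule integral_nonneg_AE) (use p in auto)
  have i: "integrable lborel (\<lambda>y. indicator (cbox a b) y * \<eta> (x - y))"
    using conv_eq_LINT(2)[OF continuous_on_const s, of a b 1 x] by (simp add: set_integrable_def)
  have "conv a b (\<lambda>_. 1) \<eta> x \<le> (LINT y|lborel. \<eta> (x - y))" unfolding c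
    by (rule integral_mono[OF i kernel_shift(1)[OF \<eta>]]) (use p in \<open>auto simp: indicator_def\<close>)
  then show "conv a b (\<lambda>_. 1) \<eta> x \<le> 1" using kernel_shift(2)[OF \<eta>] by simp
  have out: "\<eta> (x - y) = 0" if "y \<notin> cball x R" for y using \<eta> that by (auto simp: kernel_def dist_norm)
  show "conv a b (\<lambda>_. 1) \<eta> x = 0" if d: "cball x R \<inter> cbox a b = {}"
  proof -
    have "indicator (cbox a b) y * \<eta> (x - y) = 0" for y
    proof (cases "y \<in> cbox a b")
      case True
      then have "y \<notin> cball x R" using d by blast
      then show ?thesis using out[of y] by simp
    qed simp
    then have "(\<lambda>y. indicator (cbox a b) y * \<eta> (x - y)) = (\<lambda>_. 0)" by (rule ext)
    then show ?thesis unfolding c by simp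
  qed
  show "conv a b (\<lambda>_. 1) \<eta> x = 1" if d: "cball x R \<subseteq> cbox a b"
    using conv_near[OF \<eta> continuous_on_const d, of 1 1 0] by simp
qed

lemma test_function_conv_one:
  fixes \<eta> :: "real^'n::finite \<Rightarrow> real"
  assumes \<eta>: "kernel R \<eta>" and R: "R \<le> 1" and c: "cbox a b \<subseteq> cball 0 c"
  shows "conv a b (\<lambda>_. 1) \<eta> \<in> test_functions UNIV" "c + 1 < norm x \<Longrightarrow> conv a b (\<lambda>_. 1) \<eta> x = 0"
proof -
  have z: "conv a b (\<lambda>_. 1) \<eta> x = 0" if "c + 1 < norm x" for x
  proof (rule conv_one_bounds(3)[OF \<eta>])
    have "y \<notin> cball x R" if "y \<in> cbox a b" for y
    proof
      assume "y \<in> cball x R"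
      then have "norm (x - y) \<le> 1" using R by (simp add: dist_norm)
      moreover have "norm y \<le> c" using that c by auto
      ultimately show False using norm_triangle_ineq[of "x - y" y] \<open>c + 1 < norm x\<close> by simp
    qed
    then show "cball x R \<inter> cbox a b = {}" by blast
  qed
  then show "c + 1 < norm x \<Longrightarrow> conv a b (\<lambda>_. 1) \<eta> x = 0" .
  have "{x. conv a b (\<lambda>_. 1) \<eta> x \<noteq> 0} \<subseteq> cball 0 (c + 1)" 
  proof (rule subsetI, rule ccontr)
    fix x assume "x \<in> {x. conv a b (\<lambda>_. 1) \<eta> x \<noteq> 0}" "x \<notin> cball 0 (c + 1)"
    then show False using z[of x] by simp
  qed
  then have "supp (conv a b (\<lambda>_. 1) \<eta>) \<subseteq> cball 0 (c + 1)" unfolding supp_def by (rule closure_minimal) simp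
  then have "compact (supp (conv a b (\<lambda>_. 1) \<eta>))"
    unfolding supp_def by (meson bounded_cball bounded_subset closed_closure compact_eq_bounded_closed)
  moreover have "smooth (conv a b (\<lambda>_. 1) \<eta>)" by (rule smooth_conv) (use \<eta> in \<open>auto simp: kernel_def\<close>)
  ultimately show "conv a b (\<lambda>_. 1) \<eta> \<in> test_functions UNIV" by (simp add: test_functions_def)
qed

text \<open>The indicator function of a box is a pointwise limit of its mollifications, almost everywhere and in a bounded way.\<close>

lemma box_integral_zero:
  fixes d :: "real^'n::finite \<Rightarrow> real"
  assumes ker: "\<And>R. 0 < R \<Longrightarrow> \<exists>\<eta>::real^'n \<Rightarrow> real. kernel R \<eta>"
    and d: "locally_integrable d" and test: "\<And>\<psi>. \<psi> \<in> test_functions UNIV \<Longrightarrow> (LINT x|lebesgue. d x * \<psi> x) = 0"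
  shows "(LINT x|lebesgue. indicator (box a b) x * d x) = 0"
proof -
  define R where "R n = inverse (real (Suc n))" for n
  have R: "0 < R n" "R n \<le> 1" for n by (auto simp: R_def field_simps)
  have Rl: "R \<longlonglongrightarrow> 0" unfolding R_def by (rule LIMSEQ_inverse_real_of_nat)
  define \<eta> where "\<eta> n = (SOME \<eta> :: real^'n \<Rightarrow> real. kernel (R n) \<eta>)" for n
  have \<eta>: "kernel (R n) (\<eta> n)" for n unfolding \<eta>_def by (rule someI_ex[OF ker[OF R(1)[of n]]])
  obtain c where c: "cbox a b \<subseteq> cball 0 c" using bounded_cbox[of a b] by (auto simp: bounded_iff subset_eq)
  define \<psi> where "\<psi> n = conv a b (\<lambda>_. 1) (\<eta> n)" for n
  have \<psi>: "\<psi> n \<in> test_functions UNIV" "c + 1 < norm x \<Longrightarrow> \<psi> n x = 0" for n x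
    unfolding \<psi>_def using test_function_conv_one[OF \<eta> R(2) c] by blast+
  have \<psi>b: "0 \<le> \<psi> n x" "\<psi> n x \<le> 1" for n x unfolding \<psi>_def by (rule conv_one_bounds[OF \<eta>])+
  have small: "\<forall>\<^sub>F n in sequentially. R n < e" if "0 < e" for e
    using order_tendstoD(2)[OF Rl that] .
  have inn: "(\<lambda>n. \<psi> n x) \<longlonglongrightarrow> 1" if x: "x \<in> box a b" for x
  proof -
    obtain e where e: "0 < e" "cball x e \<subseteq> box a b" using open_contains_cball[of "box a b"] x by auto
    have "\<forall>\<^sub>F n in sequentially. \<psi> n x = 1" using small[OF e(1)]
    proof eventually_elim
      case (elim n)
      then have "cball x (R n) \<subseteq> cball x e" by (intro subset_cball) simp
      then have "cball x (R n) \<subseteq> cbox a b" using e(2) box_subset_cbox[of a b] by (meson order_trans)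
      then show ?case unfolding \<psi>_def by (rule conv_one_bounds(4)[OF \<eta>])
    qed
    then show ?thesis by (rule tendsto_eventually)
  qed
  have out: "(\<lambda>n. \<psi> n x) \<longlonglongrightarrow> 0" if x: "x \<notin> cbox a b" for x
  proof -
    obtain e where e: "0 < e" "cball x e \<subseteq> - cbox a b" using open_contains_cball[of "- cbox a b"] x by (auto simp: open_Compl closed_cbox)
    have "\<forall>\<^sub>F n in sequentially. \<psi> n x = 0" using small[OF e(1)]
    proof eventually_elim
      case (elim n)
      then have "cball x (R n) \<subseteq> cball x e" by (intro subset_cball) simp
      then have "cball x (R n) \<inter> cbox a b = {}" using e(2) by blast
      then show ?case unfolding \<psi>_def by (rule conv_one_bounds(3)[OF \<eta>])
    qed
    then show ?thesis by (rule tendsto_eventually)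
  qed
  have "d absolutely_integrable_on cball 0 (c + 1)" using d by (simp add: locally_integrable_def)
  then have di: "integrable lebesgue (\<lambda>x. norm (indicator (cball 0 (c + 1)) x *\<^sub>R d x))" by (intro integrable_norm) (simp add: set_integrable_def)
  have dm: "d \<in> borel_measurable lebesgue" by (rule locally_integrable_measurable[OF d])
  have "(\<lambda>n. LINT x|lebesgue. d x * \<psi> n x) \<longlonglongrightarrow> (LINT x|lebesgue. indicator (box a b) x * d x)"
  proof (rule integral_dominated_convergence[OF _ _ di])
    show "(\<lambda>x. indicator (box a b) x * d x) \<in> borel_measurable lebesgue"
      using dm by (intro borel_measurable_times borel_measurable_indicator) (auto simp: lborelD)
    show "(\<lambda>x. d x * \<psi> n x) \<in> borel_measurable lebesgue" for n
      using dm smooth_continuous_on[OF test_smooth[OF \<psi>(1)], of UNIV]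
      by (intro borel_measurable_times) (auto simp: borel_measurable_continuous_onI measurable_completion)
    have "AE x in lebesgue. x \<notin> cbox a b - box a b"
      by (rule AE_not_in) (simp only: negligible_iff_null_sets[symmetric] negligible_frontier_interval)
    then show "AE x in lebesgue. (\<lambda>n. d x * \<psi> n x) \<longlonglongrightarrow> indicator (box a b) x * d x"
    proof eventually_elim
      case (elim x)
      show ?case
      proof (cases "x \<in> box a b")
        case True
        then show ?thesis using tendsto_mult_left[OF inn[OF True], of "d x"] by simp
      next
        case False
        then have "x \<notin> cbox a b" using elim by blast
        from tendsto_mult_left[OF out[OF this], of "d x"] show ?thesis using False by simp
      qed
    qed
    show "AE x in lebesgue. norm (d x * \<psi> n x) \<le> norm (indicator (cball 0 (c + 1)) x *\<^sub>R d x)" for n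
    proof (rule AE_I2)
      fix x
      show "norm (d x * \<psi> n x) \<le> norm (indicator (cball 0 (c + 1)) x *\<^sub>R d x)"
      proof (cases "c + 1 < norm x")
        case False
        then show ?thesis using \<psi>b[of n x] by (simp add: abs_mult mult_left_le)
      qed (use \<psi>(2) in simp)
    qed
  qed
  then have "(\<lambda>n::nat. 0::real) \<longlonglongrightarrow> (LINT x|lebesgue. indicator (box a b) x * d x)" using test[OF \<psi>(1)] by simp
  then show ?thesis using LIMSEQ_unique tendsto_const by blast
qed

text \<open>The positive and the negative part of \<open>d\<close> have the same finite integral over every box. Boxes form an intersection stable
generator of the Borel sets, so that both parts are densities of the same measure.\<close>

lemma AE_zero_of_box_integrals:
  fixes d :: "real^'n::finite \<Rightarrow> real"
  assumes d: "locally_integrable d" and z: "\<And>a b. (LINT x|lebesgue. indicator (box a b) x * d x) = 0"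
  shows "AE x in lebesgue. d x = 0"
proof -
  obtain d' where d': "d' \<in> borel_measurable lborel" "AE x in lborel. d x = d' x"
    using completion_ex_borel_measurable_real[OF locally_integrable_measurable[OF d]] by blast
  have ae: "AE x in lebesgue. d x = d' x" using d'(2) by (rule AE_completion)
  have bi: "integrable lborel (\<lambda>x. indicator (box a b) x * d' x)" and bz: "(LINT x|lborel. indicator (box a b) x * d' x) = 0" for a b
  proof -
    have m: "(\<lambda>x. indicator (box a b) x * d' x) \<in> borel_measurable lborel" using d'(1) by simp
    have "d absolutely_integrable_on cbox a b" using d by (simp add: locally_integrable_def)
    then have "d absolutely_integrable_on box a b"
      by (rule set_integrable_subset) (auto simp: box_subset_cbox)
    then have i: "integrable lebesgue (\<lambda>x. indicator (box a b) x * d x)" by (simp add: set_integrable_def)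
    have "integrable lebesgue (\<lambda>x. indicator (box a b) x * d' x)"
      by (rule integrable_cong_AE_imp[OF i]) (use m ae in \<open>auto simp: measurable_completion\<close>)
    then show "integrable lborel (\<lambda>x. indicator (box a b) x * d' x)" using integrable_completion[OF m] by simp
    have "(LINT x|lborel. indicator (box a b) x * d' x) = (LINT x|lebesgue. indicator (box a b) x * d' x)"
      by (rule integral_completion[OF m, symmetric])
    also have "\<dots> = (LINT x|lebesgue. indicator (box a b) x * d x)"
      by (rule integral_cong_AE) (use m i ae in \<open>auto simp: measurable_completion\<close>)
    finally show "(LINT x|lborel. indicator (box a b) x * d' x) = 0" using z by simp
  qed
  define P N where "P x = ennreal (d' x)" "N x = ennreal (- d' x)" for x
  have mPN: "P \<in> borel_measurable lborel" "N \<in> borel_measurable lborel" using d'(1) by (auto simp: P_N_def[abs_def])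
  have e: "emeasure (density lborel P) (box a b) = emeasure (density lborel N) (box a b)" "emeasure (density lborel P) (box a b) \<noteq> \<infinity>" for a b
  proof -
    let ?f = "\<lambda>x. indicator (box a b) x * d' x"
    have eP: "emeasure (density lborel P) (box a b) = (\<integral>\<^sup>+x. ennreal (?f x) \<partial>lborel)"
      using mPN by (subst emeasure_density) (auto simp: P_N_def indicator_def intro!: nn_integral_cong)
    have eN: "emeasure (density lborel N) (box a b) = (\<integral>\<^sup>+x. ennreal (- ?f x) \<partial>lborel)"
      using mPN by (subst emeasure_density) (auto simp: P_N_def indicator_def intro!: nn_integral_cong)
    have fin: "(\<integral>\<^sup>+x. ennreal (?f x) \<partial>lborel) \<noteq> \<infinity>" "(\<integral>\<^sup>+x. ennreal (- ?f x) \<partial>lborel) \<noteq> \<infinity>"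
      using bi[of a b] by (auto simp: real_integrable_def)
    have "enn2real (\<integral>\<^sup>+x. ennreal (?f x) \<partial>lborel) = enn2real (\<integral>\<^sup>+x. ennreal (- ?f x) \<partial>lborel)"
      using real_lebesgue_integral_def[OF bi[of a b]] bz[of a b] by simp
    moreover have "(\<integral>\<^sup>+x. ennreal (?f x) \<partial>lborel) = ennreal (enn2real (\<integral>\<^sup>+x. ennreal (?f x) \<partial>lborel))"
      "(\<integral>\<^sup>+x. ennreal (- ?f x) \<partial>lborel) = ennreal (enn2real (\<integral>\<^sup>+x. ennreal (- ?f x) \<partial>lborel))"
      using fin by (simp_all add: ennreal_enn2real less_top)
    ultimately show "emeasure (density lborel P) (box a b) = emeasure (density lborel N) (box a b)"
      unfolding eP eN by metis
    show "emeasure (density lborel P) (box a b) \<noteq> \<infinity>" unfolding eP by (rule fin(1))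
  qed
  have "density lborel P = density lborel N"
  proof (rule measure_eqI_generator_eq)
    let ?E = "range (\<lambda>(a, b). box a b::(real^'n) set)"
    show "Int_stable ?E" by (auto simp: Int_stable_def box_Int_box)
    show "?E \<subseteq> Pow UNIV" "sets (density lborel P) = sigma_sets UNIV ?E" "sets (density lborel N) = sigma_sets UNIV ?E"
      by (simp_all add: borel_eq_box)
    let ?A = "\<lambda>n::nat. box (- (real n *\<^sub>R One)) (real n *\<^sub>R One) :: (real^'n) set"
    show "range ?A \<subseteq> ?E" "(\<Union>i. ?A i) = UNIV" unfolding UN_box_eq_UNIV by auto
    show "emeasure (density lborel P) (?A i) \<noteq> \<infinity>" for i using e(2) by auto
    show "emeasure (density lborel P) X = emeasure (density lborel N) X" if "X \<in> ?E" for X using that e(1) by auto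
  qed
  then have "AE x in lborel. P x = N x" by (rule sigma_finite_measure.density_unique[OF sigma_finite_lborel mPN])
  then have "AE x in lborel. d x = 0" using d'(2)
  proof eventually_elim
    case (elim x)
    have "d' x = 0"
    proof (rule ccontr)
      assume "d' x \<noteq> 0"
      then consider "0 < d' x" | "d' x < 0" by linarith
      then show False using elim(1) by cases (auto simp: P_N_def ennreal_neg)
    qed
    then show ?case using elim by simp
  qed
  then show ?thesis by (rule AE_completion)
qed

lemma weak_partial_unique:
  fixes f :: "real^'n::finite \<Rightarrow> real"
  assumes ker: "\<And>R. 0 < R \<Longrightarrow> \<exists>\<eta>::real^'n \<Rightarrow> real. kernel R \<eta>"
    and 1: "is_weak_partial is f h1" and 2: "is_weak_partial is f h2"
  shows "AE x in lebesgue. h1 x = h2 x"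
proof -
  have l: "locally_integrable h1" "locally_integrable h2" using 1 2 by (auto simp: is_weak_partial_def)
  then have ld: "locally_integrable (\<lambda>x. h1 x - h2 x)"
    unfolding locally_integrable_def set_integrable_def scaleR_diff_right by (auto intro!: Bochner_Integration.integrable_diff)
  have "(LINT x|lebesgue. (h1 x - h2 x) * \<psi> x) = 0" if \<psi>: "\<psi> \<in> test_functions UNIV" for \<psi>
  proof -
    have "(LINT x|lebesgue. h1 x * \<psi> x) = (LINT x|lebesgue. h2 x * \<psi> x)"
      using 1 2 \<psi> by (simp add: is_weak_partial_def)
    moreover have "integrable lebesgue (\<lambda>x. h1 x * \<psi> x)" "integrable lebesgue (\<lambda>x. h2 x * \<psi> x)"
      using locally_integrable_test[OF l(1) \<psi>, of "[]"] locally_integrable_test[OF l(2) \<psi>, of "[]"] by simp_all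
    ultimately show ?thesis by (simp add: left_diff_distrib)
  qed
  then have "AE x in lebesgue. h1 x - h2 x = 0"
    by (intro AE_zero_of_box_integrals[OF ld] box_integral_zero[OF ker ld])
  then show ?thesis by eventually_elim simp
qed

section \<open>The estimate for functions with weak second derivatives\<close>

lemma kernel_bounded:
  assumes "kernel R \<eta>" obtains B where "\<And>x. \<eta> x \<le> B" "0 \<le> B"
proof -
  have "compact (\<eta> ` cball 0 R)"
    using assms by (intro compact_continuous_image smooth_continuous_on) (auto simp: kernel_def)
  then obtain B where B: "\<And>x. x \<in> cball 0 R \<Longrightarrow> \<bar>\<eta> x\<bar> \<le> B" by (force dest: compact_imp_bounded simp: bounded_iff)
  have "\<eta> x \<le> max B 0" for x
  proof (cases "x \<in> cball 0 R")
    case True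
    then show ?thesis using B[of x] by auto
  next
    case False
    then have "\<eta> x = 0" using assms by (simp add: kernel_def)
    then show ?thesis by simp
  qed
  then show thesis using that[of "max B 0"] by simp
qed

lemma kernel_shift':
  fixes \<eta> :: "real^'n::finite \<Rightarrow> real"
  assumes "kernel R \<eta>"
  shows "integrable lborel (\<lambda>x. \<eta> (x - y))" "(LINT x|lborel. \<eta> (x - y)) = 1"
proof -
  have m: "\<eta> \<in> borel_measurable borel"
    by (rule borel_measurable_continuous_onI[OF smooth_continuous_on]) (use assms in \<open>simp add: kernel_def\<close>)
  have i: "integrable lborel \<eta>" using kernel_shift(1)[OF assms, of 0]
  proof -
    have c: "continuous_on UNIV \<eta>" by (rule smooth_continuous_on) (use assms in \<open>simp add: kernel_def\<close>)
    show ?thesis by (rule integrable_compact_support[OF c, of R]) (use assms in \<open>simp add: kernel_def\<close>)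
  qed
  then have "integrable (distr lborel borel ((+) (- y))) \<eta>" by (simp add: lborel_distr_plus)
  then show "integrable lborel (\<lambda>x. \<eta> (x - y))" using m by (subst (asm) integrable_distr_eq) auto
  show "(LINT x|lborel. \<eta> (x - y)) = 1" using lborel_integral_shift[OF m, of "- y"] assms by (simp add: kernel_def)
qed

text \<open>Jensen's inequality for the mean with respect to the kernel, followed by an exchange of the integrals. The weight
  varies by a factor of at most two over the support of the kernel, which is the factor in the bound.\<close>

lemma weighted_mean_square:
  fixes \<eta> Q W :: "real^'n::finite \<Rightarrow> real"
  assumes \<eta>: "kernel R \<eta>" and Q: "Q \<in> borel_measurable borel" "\<And>y. \<bar>Q y\<bar> \<le> B" "\<And>y. y \<notin> K \<Longrightarrow> Q y = 0"
    and K: "compact K" "compact K'" "K \<subseteq> K'" and W: "continuous_on K' W" "\<And>x. 0 \<le> W x"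
    and near: "\<And>x y. x \<in> K' \<Longrightarrow> y \<in> K \<Longrightarrow> norm (x - y) \<le> R \<Longrightarrow> W x \<le> 2 * W y"
  shows "set_integrable lborel K' (\<lambda>x. W x * (LINT y|lborel. Q y * \<eta> (x - y))\<^sup>2)"
    and "(LINT x:K'|lborel. W x * (LINT y|lborel. Q y * \<eta> (x - y))\<^sup>2) \<le> 2 * (LINT y:K|lborel. W y * (Q y)\<^sup>2)"
proof -
  have c\<eta>: "continuous_on UNIV \<eta>" by (rule smooth_continuous_on) (use \<eta> in \<open>simp add: kernel_def\<close>)
  have [measurable]: "\<eta> \<in> borel_measurable borel" by (rule borel_measurable_continuous_onI[OF c\<eta>])
  note [measurable] = Q(1)
  have p: "0 \<le> \<eta> x" for x using \<eta> by (simp add: kernel_def)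
  have [measurable]: "K \<in> sets borel" "K' \<in> sets borel" using K by (auto intro: borel_compact)
  have B: "0 \<le> B" using Q(2)[of 0] by linarith
  define V where "V x = indicator K' x * W x" for x
  have [measurable]: "V \<in> borel_measurable borel"
  proof -
    have "(\<lambda>x. indicator K' x *\<^sub>R W x) \<in> borel_measurable borel" by (rule borel_measurable_continuous_on_indicator) (use W in auto)
    then show ?thesis by (simp add: V_def[abs_def])
  qed
  have V0: "0 \<le> V x" for x using W by (simp add: V_def)
  obtain BW where BW: "\<And>x. V x \<le> BW" "0 \<le> BW"
  proof -
    have "compact (W ` K')" using K W(1) by (intro compact_continuous_image)
    then obtain B where B: "\<And>x. x \<in> K' \<Longrightarrow> \<bar>W x\<bar> \<le> B" by (force dest: compact_imp_bounded simp: bounded_iff)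
    have "V x \<le> max B 0" for x using B[of x] by (auto simp: V_def indicator_def)
    then show thesis using that[of "max B 0"] by simp
  qed
  obtain B\<eta> where B\<eta>: "\<And>x. \<eta> x \<le> B\<eta>" "0 \<le> B\<eta>" using kernel_bounded[OF \<eta>] by metis
  have iq: "integrable lborel (\<lambda>y. q y * \<eta> (x - y))" if [measurable]: "q \<in> borel_measurable borel" and q: "\<And>y. \<bar>q y\<bar> \<le> b" for q b x
  proof (rule Bochner_Integration.integrable_bound)
    show "integrable lborel (\<lambda>y. b * \<eta> (x - y))" using kernel_shift(1)[OF \<eta>] by simp
    have "0 \<le> b" using q[of 0] by linarith
    then show "AE y in lborel. norm (q y * \<eta> (x - y)) \<le> norm (b * \<eta> (x - y))"
      using q by (auto simp: abs_mult intro!: mult_right_mono)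
  qed simp
  define A where "A x = (LINT y|lborel. Q y * \<eta> (x - y))" for x
  define D where "D x = (LINT y|lborel. (Q y)\<^sup>2 * \<eta> (x - y))" for x
  have Q2: "\<bar>(Q y)\<^sup>2\<bar> \<le> B\<^sup>2" for y using Q(2)[of y] by (simp add: abs_le_square_iff[symmetric] B)
  have [measurable]: "A \<in> borel_measurable borel" "D \<in> borel_measurable borel"
    unfolding A_def[abs_def] D_def[abs_def] by measurable
  have AD: "(A x)\<^sup>2 \<le> D x" for x
  proof -
    have i1: "integrable lborel (\<lambda>y. (Q y)\<^sup>2 * \<eta> (x - y))" by (rule iq[OF _ Q2]) simp
    have i2: "integrable lborel (\<lambda>y. Q y * \<eta> (x - y))" by (rule iq[OF _ Q(2)]) simp
    have "0 \<le> (LINT y|lborel. (Q y - A x)\<^sup>2 * \<eta> (x - y))" by (rule integral_nonneg_AE) (use p in auto)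
    also have "\<dots> = (LINT y|lborel. (Q y)\<^sup>2 * \<eta> (x - y) - 2 * A x * (Q y * \<eta> (x - y)) + (A x)\<^sup>2 * \<eta> (x - y))"
      by (intro Bochner_Integration.integral_cong refl) (simp add: power2_diff algebra_simps)
    also have "\<dots> = D x - 2 * A x * A x + (A x)\<^sup>2"
      using i1 i2 kernel_shift(1,2)[OF \<eta>, of x] by (simp add: D_def A_def)
    finally show ?thesis by (simp add: power2_eq_square)
  qed
  have Db: "0 \<le> D x" "D x \<le> B\<^sup>2" for x
  proof -
    show "0 \<le> D x" using AD[of x] by (meson order_trans zero_le_power2)
    have "D x \<le> (LINT y|lborel. B\<^sup>2 * \<eta> (x - y))" unfolding D_def
      by (rule integral_mono[OF iq[OF _ Q2]]) (use kernel_shift(1)[OF \<eta>] Q2 p in \<open>auto intro!: mult_right_mono\<close>)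
    then show "D x \<le> B\<^sup>2" using kernel_shift(2)[OF \<eta>] by simp
  qed
  have iK: "integrable lborel (\<lambda>x. indicator K' x *\<^sub>R (BW * B\<^sup>2))" by (rule borel_integrable_compact[OF K(2)]) simp
  have iV: "integrable lborel (\<lambda>x. V x * E x)" if [measurable]: "E \<in> borel_measurable borel" and E: "\<And>x. 0 \<le> E x" "\<And>x. E x \<le> B\<^sup>2" for E
  proof (rule Bochner_Integration.integrable_bound[OF iK])
    have "V x * E x \<le> indicator K' x *\<^sub>R (BW * B\<^sup>2)" for x
    proof (cases "x \<in> K'")
      case True
      then show ?thesis using mult_mono[OF BW(1)[of x] E(2)[of x] BW(2) E(1)[of x]] by simp
    qed (simp add: V_def)
    then show "AE x in lborel. norm (V x * E x) \<le> norm (indicator K' x *\<^sub>R (BW * B\<^sup>2))"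
      using V0 E(1) BW(2) by (auto simp: abs_mult)
  qed simp
  have iA: "integrable lborel (\<lambda>x. V x * (A x)\<^sup>2)" by (rule iV) (use AD Db order_trans in \<open>auto, blast\<close>)
  have iD: "integrable lborel (\<lambda>x. V x * D x)" by (rule iV) (use Db in auto)
  have eV: "indicator K' x *\<^sub>R (W x * (A x)\<^sup>2) = V x * (A x)\<^sup>2" for x by (simp add: V_def)
  show "set_integrable lborel K' (\<lambda>x. W x * (LINT y|lborel. Q y * \<eta> (x - y))\<^sup>2)"
    using iA unfolding set_integrable_def A_def[symmetric] eV .
  have fub: "integrable (lborel \<Otimes>\<^sub>M lborel) (\<lambda>(x, y). V x * ((Q y)\<^sup>2 * \<eta> (x - y)))"
  proof (rule Bochner_Integration.integrable_bound)
    show "integrable (lborel \<Otimes>\<^sub>M lborel) (\<lambda>p. indicator (K' \<times> K) p *\<^sub>R (BW * (B\<^sup>2 * B\<eta>)))"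
      unfolding lborel_prod by (rule borel_integrable_compact[OF compact_Times[OF K(2,1)]]) simp
    show "(\<lambda>(x, y). V x * ((Q y)\<^sup>2 * \<eta> (x - y))) \<in> borel_measurable (lborel \<Otimes>\<^sub>M lborel)" by measurable
    have "V x * ((Q y)\<^sup>2 * \<eta> (x - y)) \<le> indicator (K' \<times> K) (x, y) *\<^sub>R (BW * (B\<^sup>2 * B\<eta>))" for x y
    proof (cases "x \<in> K' \<and> y \<in> K")
      case True
      have qe: "(Q y)\<^sup>2 * \<eta> (x - y) \<le> B\<^sup>2 * B\<eta>" using Q2[of y] B\<eta> p by (intro mult_mono) auto
      have "V x * ((Q y)\<^sup>2 * \<eta> (x - y)) \<le> BW * (B\<^sup>2 * B\<eta>)" using mult_mono[OF BW(1)[of x] qe BW(2)] p by simp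
      then show ?thesis using True by simp
    next
      case False
      then show ?thesis using Q(3)[of y] by (auto simp: V_def indicator_def)
    qed
    then show "AE q in lborel \<Otimes>\<^sub>M lborel. norm (case q of (x, y) \<Rightarrow> V x * ((Q y)\<^sup>2 * \<eta> (x - y))) \<le> norm (indicator (K' \<times> K) q *\<^sub>R (BW * (B\<^sup>2 * B\<eta>)))"
      using V0 p BW(2) B\<eta>(2) by (auto simp: abs_mult)
  qed
  have "(LINT x:K'|lborel. W x * (LINT y|lborel. Q y * \<eta> (x - y))\<^sup>2) = (LINT x|lborel. V x * (A x)\<^sup>2)"
    unfolding set_lebesgue_integral_def A_def[symmetric] eV ..
  also have "\<dots> \<le> (LINT x|lborel. V x * D x)"
    by (rule integral_mono[OF iA iD]) (use AD V0 in \<open>auto intro!: mult_left_mono\<close>)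
  also have "\<dots> = (LINT x|lborel. LINT y|lborel. V x * ((Q y)\<^sup>2 * \<eta> (x - y)))"
    unfolding D_def by (intro Bochner_Integration.integral_cong refl) (simp add: iq[OF _ Q2])
  also have "\<dots> = (LINT y|lborel. LINT x|lborel. V x * ((Q y)\<^sup>2 * \<eta> (x - y)))"
    by (rule lborel_pair.Fubini_integral[OF fub, symmetric])
  also have "\<dots> \<le> (LINT y|lborel. indicator K y *\<^sub>R (2 * (W y * (Q y)\<^sup>2)))"
  proof (rule integral_mono)
    show "integrable lborel (\<lambda>y. LINT x|lborel. V x * ((Q y)\<^sup>2 * \<eta> (x - y)))"
      by (rule lborel_pair.integrable_snd[OF fub])
    show "integrable lborel (\<lambda>y. indicator K y *\<^sub>R (2 * (W y * (Q y)\<^sup>2)))"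
    proof (rule Bochner_Integration.integrable_bound)
      show "integrable lborel (\<lambda>x. 2 * (indicator K' x *\<^sub>R (BW * B\<^sup>2)))" using iK by simp
      have "(\<lambda>y. indicator K y *\<^sub>R W y) \<in> borel_measurable borel"
        by (rule borel_measurable_continuous_on_indicator) (use W K continuous_on_subset in auto)
      then have [measurable]: "(\<lambda>y. indicator K y * W y) \<in> borel_measurable borel" by simp
      have "(\<lambda>y. 2 * ((indicator K y * W y) * (Q y)\<^sup>2)) \<in> borel_measurable lborel" by measurable
      then show "(\<lambda>y. indicator K y *\<^sub>R (2 * (W y * (Q y)\<^sup>2))) \<in> borel_measurable lborel" by (simp add: mult_ac)
      have "indicator K y *\<^sub>R (2 * (W y * (Q y)\<^sup>2)) \<le> 2 * (indicator K' y *\<^sub>R (BW * B\<^sup>2))" for y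
      proof (cases "y \<in> K")
        case True
        then have y: "y \<in> K'" using K by auto
        have "W y * (Q y)\<^sup>2 \<le> BW * B\<^sup>2" using BW(1)[of y] y BW(2) Q2[of y] by (intro mult_mono) (auto simp: V_def)
        then show ?thesis using True y by simp
      qed (use BW B in auto)
      then show "AE y in lborel. norm (indicator K y *\<^sub>R (2 * (W y * (Q y)\<^sup>2))) \<le> norm (2 * (indicator K' y *\<^sub>R (BW * B\<^sup>2)))"
        using W(2) BW(2) by (auto simp: abs_mult indicator_def)
    qed
    fix y
    show "(LINT x|lborel. V x * ((Q y)\<^sup>2 * \<eta> (x - y))) \<le> indicator K y *\<^sub>R (2 * (W y * (Q y)\<^sup>2))"
    proof (cases "y \<in> K")
      case True
      have pt: "V x * \<eta> (x - y) \<le> 2 * W y * \<eta> (x - y)" for x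
      proof (cases "x \<in> K' \<and> norm (x - y) \<le> R")
        case T: True
        then show ?thesis using near[of x y] True p by (intro mult_right_mono) (auto simp: V_def)
      next
        case False
        then have "V x * \<eta> (x - y) = 0" using \<eta> by (auto simp: V_def kernel_def)
        moreover have "0 \<le> 2 * W y * \<eta> (x - y)" using W(2) p by simp
        ultimately show ?thesis by linarith
      qed
      have "(LINT x|lborel. V x * \<eta> (x - y)) \<le> (LINT x|lborel. 2 * W y * \<eta> (x - y))"
      proof (rule integral_mono)
        show i: "integrable lborel (\<lambda>x. 2 * W y * \<eta> (x - y))" using kernel_shift'[OF \<eta>] by simp
        show "integrable lborel (\<lambda>x. V x * \<eta> (x - y))"
          by (rule Bochner_Integration.integrable_bound[OF i]) (use pt V0 p W(2) in \<open>auto simp: abs_mult\<close>)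
      qed (rule pt)
      then have "(LINT x|lborel. V x * \<eta> (x - y)) \<le> 2 * W y" using kernel_shift'[OF \<eta>] by simp
      then have "(Q y)\<^sup>2 * (LINT x|lborel. V x * \<eta> (x - y)) \<le> (Q y)\<^sup>2 * (2 * W y)" by (intro mult_left_mono) auto
      moreover have "(LINT x|lborel. V x * ((Q y)\<^sup>2 * \<eta> (x - y))) = (Q y)\<^sup>2 * (LINT x|lborel. V x * \<eta> (x - y))"
        by (subst integral_mult_right_zero[symmetric]) (intro Bochner_Integration.integral_cong refl, simp add: mult_ac)
      ultimately show ?thesis using True by (simp add: mult_ac)
    qed (use Q(3) in simp)
  qed
  also have "\<dots> = 2 * (LINT y:K|lborel. W y * (Q y)\<^sup>2)"
    unfolding set_lebesgue_integral_def by (subst integral_mult_right_zero[symmetric]) (simp add: mult_ac)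
  finally show "(LINT x:K'|lborel. W x * (LINT y|lborel. Q y * \<eta> (x - y))\<^sup>2) \<le> 2 * (LINT y:K|lborel. W y * (Q y)\<^sup>2)" .
qed

lemma continuous_on_sigma0: "continuous_on S (sigma0 \<Gamma>)"
  unfolding sigma0_def[abs_def] by (intro continuous_intros)

lemma open_sigma_ball: "open (sigma_ball \<Gamma> r)"
  unfolding sigma_ball_def by (intro open_Collect_less continuous_on_sigma0 continuous_intros)

lemma carleman_boundD:
  assumes "carleman_bound g \<Gamma> \<beta> s r C \<tau>0" "\<tau>0 \<le> \<tau>" "compact Q" "Q \<subseteq> sigma_ball \<Gamma> r - {0}" "\<And>x. x \<notin> Q \<Longrightarrow> u x = 0 \<and> p x = 0"
  shows "C2_data u p H \<Longrightarrow> (LINT x:Q|lborel. \<tau> * (cw \<Gamma> \<beta> \<tau> (s - \<beta> - 2) x * (norm (p x))\<^sup>2) + \<tau>^3 * (cw \<Gamma> \<beta> \<tau> (s - 3 * \<beta> - 4) x * (u x)\<^sup>2))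
      \<le> C * (LINT x:Q|lborel. cw \<Gamma> \<beta> \<tau> s x * (g x \<bullet> H x)\<^sup>2)"
    and "C3_data u p H D \<Longrightarrow> (LINT x:Q|lborel. cw \<Gamma> \<beta> \<tau> (s + \<beta>) x * (norm (H x))\<^sup>2)
      \<le> \<tau> * (C * (LINT x:Q|lborel. cw \<Gamma> \<beta> \<tau> s x * (g x \<bullet> H x)\<^sup>2))"
  using assms(1)[unfolded carleman_bound_def, rule_format, OF assms(2-4)] assms(5) by (blast, blast)

lemma C1_weak_partial:
  fixes v :: "real^'n::finite \<Rightarrow> real"
  assumes v: "\<And>x. (v has_derivative (\<lambda>h. q x \<bullet> h)) (at x)" and q: "continuous_on UNIV q"
  shows "is_weak_partial [i] v (\<lambda>x. q x $ i)"
  unfolding is_weak_partial_def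
proof (intro conjI ballI)
  have cv: "continuous_on UNIV v" using v by (meson continuous_at_imp_continuous_on has_derivative_continuous)
  show "locally_integrable v" by (rule locally_integrable_continuous[OF cv])
  have cq: "continuous_on UNIV (\<lambda>x. q x $ i)" by (intro continuous_intros q)
  show lq: "locally_integrable (\<lambda>x. q x $ i)" by (rule locally_integrable_continuous[OF cq])
  fix \<psi> :: "real^'n \<Rightarrow> real" assume \<psi>: "\<psi> \<in> test_functions UNIV"
  obtain R where R: "\<And>x is. R < norm x \<Longrightarrow> iter_partial is \<psi> x = 0" using test_function_bounded_support[OF \<psi>] by metis
  have R0: "\<psi> x = 0" if "R < norm x" for x using R[OF that, of "[]"] by simp
  have "(LINT x|lebesgue. (q x $ i * \<psi> x + v x * partial_deriv i \<psi> x) * 1) = 0"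
    using integration_by_parts_C1[OF v q test_smooth[OF \<psi>] R0 smooth_const[of 1], where k = i]
    by (simp add: partial_deriv_const)
  moreover have "integrable lebesgue (\<lambda>x. q x $ i * \<psi> x)" "integrable lebesgue (\<lambda>x. v x * partial_deriv i \<psi> x)"
    using locally_integrable_test[OF lq \<psi>, of "[]"] locally_integrable_test[OF locally_integrable_continuous[OF cv] \<psi>, of "[i]"] by simp_all
  ultimately show "(LINT x|lebesgue. v x * iter_partial [i] \<psi> x) = (-1) ^ length [i] * (LINT x|lebesgue. q x $ i * \<psi> x)" by simp
qed

lemma compact_bound:
  fixes f :: "'a::topological_space \<Rightarrow> 'b::real_normed_vector"
  assumes "compact K" "continuous_on K f"
  obtains B where "\<And>x. x \<in> K \<Longrightarrow> norm (f x) \<le> B" "0 \<le> B"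
proof -
  obtain B where B: "\<And>x. x \<in> K \<Longrightarrow> norm (f x) \<le> B"
    using compact_imp_bounded[OF compact_continuous_image[OF assms(2,1)]] by (auto simp: bounded_iff)
  have "norm (f x) \<le> max B 0" if "x \<in> K" for x using B[OF that] by simp
  then show thesis using that[of "max B 0"] by simp
qed

lemma global_bound:
  fixes f :: "'a::topological_space \<Rightarrow> 'b::real_normed_vector"
  assumes "compact K" "continuous_on UNIV f" "\<And>x. x \<notin> K \<Longrightarrow> f x = 0"
  obtains B where "\<And>x. norm (f x) \<le> B" "0 \<le> B"
proof -
  obtain B where B: "\<And>x. x \<in> K \<Longrightarrow> norm (f x) \<le> B" "0 \<le> B"
    using compact_bound[OF assms(1) continuous_on_subset[OF assms(2) subset_UNIV]] by metis
  then show thesis using that[of B] assms(3) by (metis norm_zero)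
qed

lemma conv_tendsto:
  fixes v :: "real^'n::finite \<Rightarrow> real"
  assumes \<eta>: "\<And>n. kernel (R n) (\<eta> n)" and R: "R \<longlonglongrightarrow> 0" "\<And>n. R n \<le> 1" and v: "continuous_on UNIV v" and ball: "cball x 1 \<subseteq> cbox a b"
  shows "(\<lambda>n. conv a b v (\<eta> n) x) \<longlonglongrightarrow> v x"
  unfolding LIMSEQ_def dist_real_def
proof (intro allI impI)
  fix e :: real assume e: "0 < e"
  obtain d where d: "0 < d" "\<And>y. dist y x < d \<Longrightarrow> dist (v y) (v x) < e / 2"
    using v e unfolding continuous_on_iff by (metis UNIV_I half_gt_zero)
  obtain N where N: "\<And>n. N \<le> n \<Longrightarrow> R n < d" using order_tendstoD(2)[OF R(1) d(1)] by (auto simp: eventually_sequentially)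
  have "\<bar>conv a b v (\<eta> n) x - v x\<bar> < e" if "N \<le> n" for n
  proof -
    have "cball x (R n) \<subseteq> cbox a b" using subset_cball[OF R(2)[of n], of x] ball by (meson order_trans)
    then have "\<bar>conv a b v (\<eta> n) x - v x\<bar> \<le> e / 2"
    proof (rule conv_near[OF \<eta> continuous_on_subset[OF v subset_UNIV]])
      fix y assume "norm (x - y) \<le> R n"
      then have "dist y x < d" using N[OF that] by (simp add: dist_norm norm_minus_commute)
      then show "\<bar>v y - v x\<bar> \<le> e / 2" using d(2)[of y] by (simp add: dist_real_def)
    qed
    then show ?thesis using e by linarith
  qed
  then show "\<exists>no. \<forall>n\<ge>no. \<bar>conv a b v (\<eta> n) x - v x\<bar> < e" by blast
qed

text \<open>The mollifications \<open>V n\<close> are smooth and satisfy the estimate. Up to an error of the size of the radius \<open>R n\<close>, the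
  operator commutes with the mollification because its coefficients are Lipschitz and the weak derivatives are
  bounded. So the operator applied to \<open>V n\<close> is close to the mean \<open>A n\<close> of \<open>Q = \<Sum> g\<^sup>k\<^sup>l Hw k l\<close>, to which
  \<open>weighted_mean_square\<close> applies. A factor two of the constant is due to that lemma, another one to the
  square of the sum of \<open>A n\<close> and the commutator.\<close>

theorem weak_carleman:
  fixes v :: "real^'n::finite \<Rightarrow> real" and Hw :: "'n \<Rightarrow> 'n \<Rightarrow> real^'n \<Rightarrow> real"
  assumes ker: "\<And>R. 0 < R \<Longrightarrow> \<exists>\<eta>::real^'n \<Rightarrow> real. kernel R \<eta>"
    and ell: "elliptic_C1 g g' lam Lam" and qw: "quad_weight \<Gamma> lam" and cb: "carleman_bound g \<Gamma> \<beta> s r C \<tau>0" and C: "0 \<le> C"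
    and v: "\<And>x. (v has_derivative (\<lambda>h. q x \<bullet> h)) (at x)" and q: "continuous_on UNIV q"
    and off: "\<And>x. x \<notin> K \<Longrightarrow> v x = 0 \<and> q x = 0" and K: "compact K" "K \<subseteq> sigma_ball \<Gamma> r - {0}"
    and weak: "\<And>k l. is_weak_partial [k, l] v (Hw k l)" and HB: "\<And>k l. AE x in lebesgue. \<bar>Hw k l x\<bar> \<le> B"
    and H0: "\<And>k l x. x \<notin> K \<Longrightarrow> Hw k l x = 0" and \<tau>: "\<tau>0 \<le> \<tau>"
  shows "(LINT x:K|lborel. \<tau> * (cw \<Gamma> \<beta> \<tau> (s - \<beta> - 2) x * (norm (q x))\<^sup>2) + \<tau>^3 * (cw \<Gamma> \<beta> \<tau> (s - 3 * \<beta> - 4) x * (v x)\<^sup>2))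
     \<le> 4 * C * (LINT x|lebesgue. cw \<Gamma> \<beta> \<tau> s x * (\<Sum>k\<in>UNIV. \<Sum>l\<in>UNIV. g x $ k $ l * Hw k l x)\<^sup>2)"
proof (cases "K = {}")
  case True
  have "0 \<le> (LINT x|lebesgue. cw \<Gamma> \<beta> \<tau> s x * (\<Sum>k\<in>UNIV. \<Sum>l\<in>UNIV. g x $ k $ l * Hw k l x)\<^sup>2)"
    by (rule integral_nonneg_AE) (simp add: cw_nonneg)
  then show ?thesis using True C by (simp add: set_lebesgue_integral_def)
next
  case False
  interpret E: elliptic_C1 g g' lam Lam by (rule ell)
  interpret W: quad_weight \<Gamma> lam by (rule qw)
  let ?O = "sigma_ball \<Gamma> r - {0}"
  have "open ?O" by (rule open_Diff[OF open_sigma_ball closed_singleton])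
  then obtain e0 where e0: "0 < e0" "(\<Union>x\<in>K. cball x e0) \<subseteq> ?O"
    using compact_subset_open_imp_cball_epsilon_subset[OF K(1) _ K(2)] by blast
  define e where "e = min e0 1"
  have e: "0 < e" "e \<le> 1" using e0 by (auto simp: e_def)
  \<comment> \<open>A compact neighbourhood of \<open>K\<close> that contains the supports of all mollifications.\<close>
  define K' where "K' = {x + y |x y. x \<in> K \<and> y \<in> cball 0 e}"
  have K': "compact K'" unfolding K'_def by (rule compact_sums[OF K(1) compact_cball])
  have K'in: "x \<in> K'" if "y \<in> K" "norm (x - y) \<le> e" for x y
    unfolding K'_def using that by (intro CollectI exI[of _ y] exI[of _ "x - y"]) auto
  have K'O: "K' \<subseteq> ?O"
  proof
    fix w assume "w \<in> K'"
    then obtain x y where "w = x + y" "x \<in> K" "norm y \<le> e" unfolding K'_def by auto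
    then have "x \<in> K" "w \<in> cball x e0" by (auto simp: dist_norm e_def)
    then show "w \<in> ?O" using e0(2) by blast
  qed
  have KK': "K \<subseteq> K'" using K'in e by auto
  have K'0: "K' \<subseteq> - {0}" using K'O by auto
  have K'ne: "K' \<noteq> {}" using KK' False by auto
  obtain c0 where c0: "\<And>x. x \<in> K' \<Longrightarrow> norm x \<le> c0" using compact_imp_bounded[OF K'] by (auto simp: bounded_iff)
  obtain c where c: "cball (0::real^'n) (c0 + 1) \<subseteq> cbox (- c) c" using bounded_subset_cbox_symmetric[OF bounded_cball] by blast
  define a b where "a = - c" "b = c"
  have ball1: "cball x 1 \<subseteq> cbox a b" if "x \<in> K'" for x
  proof -
    have "cball x 1 \<subseteq> cball 0 (c0 + 1)"
    proof
      fix y assume "y \<in> cball x 1"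
      then have "norm (y - x) \<le> 1" by (simp add: dist_norm norm_minus_commute)
      then show "y \<in> cball 0 (c0 + 1)" using norm_triangle_ineq[of "y - x" x] c0[OF that] by simp
    qed
    then show ?thesis using c by (simp add: a_b_def)
  qed
  define R where "R n = e * inverse (real (Suc n))" for n
  have i1: "inverse (real (Suc n)) \<le> 1" for n by (simp add: field_simps)
  have Re: "0 < R n" "R n \<le> e" for n
    using e mult_left_mono[OF i1[of n], of e] by (auto simp: R_def)
  have R: "0 < R n" "R n \<le> e" "R n \<le> 1" for n using Re[of n] e(2) by linarith+
  have Rl: "R \<longlonglongrightarrow> 0" unfolding R_def using tendsto_mult_right_zero[OF LIMSEQ_inverse_real_of_nat] by blast
  define \<eta> where "\<eta> n = (SOME \<eta> :: real^'n \<Rightarrow> real. kernel (R n) \<eta>)" for n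
  have \<eta>: "kernel (R n) (\<eta> n)" for n unfolding \<eta>_def by (rule someI_ex[OF ker[OF R(1)[of n]]])
  have ballR: "cball x (R n) \<subseteq> cbox a b" if "x \<in> K'" for x n
    using ball1[OF that] subset_cball[OF R(3)[of n], of x] by (meson order_trans)
  have cv: "continuous_on UNIV v" using v by (meson continuous_at_imp_continuous_on has_derivative_continuous)
  have cqi: "continuous_on UNIV (\<lambda>x. q x $ i)" for i by (intro continuous_intros q)
  define V where "V n = conv a b v (\<eta> n)" for n
  have sV: "smooth (V n)" for n unfolding V_def by (rule smooth_conv[OF continuous_on_subset[OF cv subset_UNIV]]) (use \<eta> in \<open>simp add: kernel_def\<close>)
  have C2: "C2_data (V n) (grad (V n)) (hess (V n))" for n using smooth_C3_data[OF sV] by (simp add: C3_data_def)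
  have Voff: "V n x = 0" if "x \<notin> K'" for n x
  proof -
    have "v y * \<eta> n (x - y) = 0" for y
    proof (cases "y \<in> K")
      case True
      then have "R n < norm (x - y)" using K'in[OF True, of x] that R(2)[of n] by force
      then show ?thesis using \<eta>[of n] by (simp add: kernel_def)
    qed (use off in simp)
    then have "(\<lambda>y. v y * \<eta> n (x - y)) = (\<lambda>_. 0)" by (rule ext)
    then show ?thesis unfolding V_def conv_def by simp
  qed
  have gVoff: "grad (V n) x = 0" if "x \<notin> K'" for n x
  proof -
    have "iter_partial [i] (V n) x = 0" for i by (rule iter_partial_zero_off[OF compact_imp_closed[OF K'] Voff that])
    then show ?thesis by (simp add: grad_def vec_eq_iff)
  qed
  have gV: "grad (V n) x $ i = conv a b (\<lambda>y. q y $ i) (\<eta> n) x" if "x \<in> K'" for n x i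
  proof -
    have "grad (V n) x $ i = iter_partial [i] (V n) x" by (simp add: grad_def)
    also have "\<dots> = (LINT y|lebesgue. q y $ i * \<eta> n (x - y))"
      unfolding V_def by (rule iter_partial_conv_weak[OF \<eta> cv ballR[OF that] C1_weak_partial[OF v q]])
    also have "\<dots> = iter_partial [] (conv a b (\<lambda>y. q y $ i) (\<eta> n)) x"
    proof (rule iter_partial_conv_weak[OF \<eta> cqi ballR[OF that], symmetric])
      show "is_weak_partial [] (\<lambda>y. q y $ i) (\<lambda>y. q y $ i)"
        using locally_integrable_continuous[OF cqi] by (simp add: is_weak_partial_def)
    qed
    finally show ?thesis by simp
  qed
  have hV: "hess (V n) x $ k $ l = (LINT y|lebesgue. Hw k l y * \<eta> n (x - y))" if "x \<in> K'" for n x k l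
    unfolding hess_def vec_lambda_beta V_def by (rule iter_partial_conv_weak[OF \<eta> cv ballR[OF that] weak])
  \<comment> \<open>The functions and their gradients converge boundedly, so that the left side converges.\<close>
  obtain Bv where Bv: "\<And>x. norm (v x) \<le> Bv" "0 \<le> Bv" using global_bound[OF K(1) cv] off by metis
  obtain Bq where Bq: "\<And>x. norm (q x) \<le> Bq" "0 \<le> Bq" using global_bound[OF K(1) q] off by metis
  have Vb: "\<bar>V n x\<bar> \<le> Bv" if "x \<in> K'" for n x
    using conv_near[OF \<eta> continuous_on_subset[OF cv subset_UNIV] ballR[OF that, of n], of 0 Bv] Bv by (simp add: V_def)
  have gVb: "norm (grad (V n) x) \<le> real CARD('n) * Bq" if "x \<in> K'" for n x
  proof -
    have "\<bar>grad (V n) x $ i\<bar> \<le> Bq" for i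
    proof -
      have "\<bar>q y $ i\<bar> \<le> Bq" for y using component_le_norm_cart[of "q y" i] Bq(1)[of y] by linarith
      then show ?thesis unfolding gV[OF that]
        using conv_near[OF \<eta> continuous_on_subset[OF cqi subset_UNIV] ballR[OF that, of n], of i 0 Bq] by simp
    qed
    then have "(\<Sum>i\<in>UNIV. \<bar>grad (V n) x $ i\<bar>) \<le> real CARD('n) * Bq"
      using sum_bounded_above[of UNIV "\<lambda>i. \<bar>grad (V n) x $ i\<bar>" Bq] by simp
    then show ?thesis using norm_le_l1_cart[of "grad (V n) x"] by linarith
  qed
  have Vl: "(\<lambda>n. V n x) \<longlonglongrightarrow> v x" if "x \<in> K'" for x unfolding V_def by (rule conv_tendsto[OF \<eta> Rl R(3) cv ball1[OF that]])
  have gVl: "(\<lambda>n. grad (V n) x) \<longlonglongrightarrow> q x" if "x \<in> K'" for x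
    by (rule vec_tendstoI) (unfold gV[OF that], rule conv_tendsto[OF \<eta> Rl R(3) cqi ball1[OF that]])
  define S where "S p u x = \<tau> * (cw \<Gamma> \<beta> \<tau> (s - \<beta> - 2) x * (norm (p x))\<^sup>2) + \<tau>^3 * (cw \<Gamma> \<beta> \<tau> (s - 3 * \<beta> - 4) x * (u x)\<^sup>2)"
    for p :: "real^'n \<Rightarrow> real^'n" and u :: "real^'n \<Rightarrow> real" and x
  have cS: "continuous_on K' (S p u)" if "continuous_on UNIV p" "continuous_on UNIV u" for p u
    unfolding S_def[abs_def]
    by (intro continuous_intros continuous_on_subset[OF W.continuous_on_cw K'0] continuous_on_subset[OF that(1) subset_UNIV] continuous_on_subset[OF that(2) subset_UNIV])
  define Dm where "Dm x = \<bar>\<tau>\<bar> * (cw \<Gamma> \<beta> \<tau> (s - \<beta> - 2) x * (real CARD('n) * Bq)\<^sup>2) + \<bar>\<tau>\<bar>^3 * (cw \<Gamma> \<beta> \<tau> (s - 3 * \<beta> - 4) x * Bv\<^sup>2)" for x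
  have lim: "(\<lambda>n. LINT x:K'|lborel. S (grad (V n)) (V n) x) \<longlonglongrightarrow> (LINT x:K'|lborel. S q v x)"
    unfolding set_lebesgue_integral_def
  proof (rule integral_dominated_convergence)
    show "(\<lambda>x. indicat_real K' x *\<^sub>R S q v x) \<in> borel_measurable lborel"
      using borel_integrable_compact[OF K' cS[OF q cv]] by (rule borel_measurable_integrable)
    show "(\<lambda>x. indicat_real K' x *\<^sub>R S (grad (V n)) (V n) x) \<in> borel_measurable lborel" for n
      using borel_integrable_compact[OF K' cS[OF continuous_on_C2_data(2,1)[OF C2]]] by (rule borel_measurable_integrable)
    show "integrable lborel (\<lambda>x. indicat_real K' x *\<^sub>R Dm x)"
      by (rule borel_integrable_compact[OF K'])
        (unfold Dm_def[abs_def], intro continuous_intros continuous_on_subset[OF W.continuous_on_cw K'0])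
    show "AE x in lborel. (\<lambda>n. indicat_real K' x *\<^sub>R S (grad (V n)) (V n) x) \<longlonglongrightarrow> indicat_real K' x *\<^sub>R S q v x"
    proof (rule AE_I2)
      fix x
      show "(\<lambda>n. indicat_real K' x *\<^sub>R S (grad (V n)) (V n) x) \<longlonglongrightarrow> indicat_real K' x *\<^sub>R S q v x"
        by (cases "x \<in> K'") (auto simp: S_def intro!: tendsto_intros Vl gVl)
    qed
    show "AE x in lborel. norm (indicat_real K' x *\<^sub>R S (grad (V n)) (V n) x) \<le> indicat_real K' x *\<^sub>R Dm x" for n
    proof (rule AE_I2)
      fix x
      show "norm (indicat_real K' x *\<^sub>R S (grad (V n)) (V n) x) \<le> indicat_real K' x *\<^sub>R Dm x"
      proof (cases "x \<in> K'")
        case True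
        have "(norm (grad (V n) x))\<^sup>2 \<le> (real CARD('n) * Bq)\<^sup>2" by (intro power_mono gVb True) simp
        moreover have "(V n x)\<^sup>2 \<le> Bv\<^sup>2" using Vb[OF True, of n] Bv(2) by (simp add: abs_le_square_iff[symmetric])
        ultimately have "\<bar>S (grad (V n)) (V n) x\<bar> \<le> Dm x" unfolding S_def Dm_def
          by (intro abs_add_leI abs_mult_leI) (auto simp: cw_nonneg power_abs[symmetric] abs_mult intro!: mult_left_mono)
        then show ?thesis using True by simp
      qed simp
    qed
  qed
  have SK: "(LINT x:K'|lborel. S q v x) = (LINT x:K|lborel. S q v x)"
    unfolding set_lebesgue_integral_def
    by (intro Bochner_Integration.integral_cong refl) (use off KK' in \<open>auto simp: indicator_def S_def\<close>)
  \<comment> \<open>The minimum of the weight on \<open>K'\<close> serves as the tolerance in its uniform continuity.\<close>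
  define Wt where "Wt = cw \<Gamma> \<beta> \<tau> s"
  have cWt: "continuous_on K' Wt" unfolding Wt_def by (rule continuous_on_subset[OF W.continuous_on_cw K'0])
  have Wtp: "0 < Wt x" if "x \<noteq> 0" for x using W.\<sigma>_pos[OF that] by (simp add: Wt_def cw_def)
  obtain x1 where x1: "x1 \<in> K'" "\<And>x. x \<in> K' \<Longrightarrow> Wt x1 \<le> Wt x" using continuous_attains_inf[OF K' K'ne cWt] by blast
  have "x1 \<noteq> 0" using x1(1) K'0 by auto
  then have w1: "0 < Wt x1" by (rule Wtp)
  obtain d where d: "0 < d" "\<And>x y. x \<in> K' \<Longrightarrow> y \<in> K' \<Longrightarrow> dist x y < d \<Longrightarrow> dist (Wt x) (Wt y) < Wt x1"
    using compact_uniformly_continuous[OF cWt K'] w1 unfolding uniformly_continuous_on_def by metis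
  have near: "Wt x \<le> 2 * Wt y" if "x \<in> K'" "y \<in> K" "norm (x - y) < d" for x y
  proof -
    have y: "y \<in> K'" using that KK' by auto
    have "dist (Wt x) (Wt y) < Wt x1" using d(2)[OF that(1) y] that by (simp add: dist_norm)
    then show ?thesis using x1(2)[OF y] by (simp add: dist_real_def)
  qed
  define Q0 where "Q0 x = (\<Sum>k\<in>UNIV. \<Sum>l\<in>UNIV. g x $ k $ l * Hw k l x)" for x
  have Hm: "Hw k l \<in> borel_measurable lebesgue" for k l
    using weak[of k l] locally_integrable_measurable by (auto simp: is_weak_partial_def)
  have gm: "(\<lambda>x. g x $ k $ l) \<in> borel_measurable lebesgue" for k l
  proof -
    have "continuous_on UNIV (\<lambda>x. g x $ k $ l)" by (intro continuous_intros E.continuous_on_g)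
    then show ?thesis by (simp add: borel_measurable_continuous_onI measurable_completion)
  qed
  have Qm: "Q0 \<in> borel_measurable lebesgue" unfolding Q0_def[abs_def] by (intro borel_measurable_sum borel_measurable_times gm Hm)
  obtain Bg where Bg: "\<And>x. x \<in> K \<Longrightarrow> norm (g x) \<le> Bg" "0 \<le> Bg" using compact_bound[OF K(1) E.continuous_on_g] by metis
  have allH: "AE x in lebesgue. \<forall>k l. \<bar>Hw k l x\<bar> \<le> B" using HB by (simp add: AE_all_countable)
  have comp: "\<bar>A $ k $ l\<bar> \<le> norm A" for A :: "real^'n^'n" and k l
    using component_le_norm_cart[of "A $ k" l] Finite_Cartesian_Product.norm_nth_le[of A k] by linarith
  define N where "N = real CARD('n)"
  have dbl: "\<bar>\<Sum>k\<in>UNIV. \<Sum>l\<in>UNIV. (A $ k $ l) * h k l\<bar> \<le> N * (N * (m * B))" if "norm A \<le> m" "\<And>k l. \<bar>h k l\<bar> \<le> B"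
    for A :: "real^'n^'n" and h :: "'n \<Rightarrow> 'n \<Rightarrow> real" and m
  proof -
    have "\<bar>\<Sum>k\<in>UNIV. \<Sum>l\<in>UNIV. (A $ k $ l) * h k l\<bar> \<le> (\<Sum>k\<in>UNIV. \<Sum>l\<in>UNIV. \<bar>(A $ k $ l) * h k l\<bar>)"
      by (rule order_trans[OF sum_abs sum_mono[OF sum_abs]])
    also have "\<dots> \<le> (\<Sum>k\<in>(UNIV::'n set). \<Sum>l\<in>(UNIV::'n set). m * B)"
      by (intro sum_mono abs_mult_leI order_trans[OF comp that(1)] that(2))
    finally show ?thesis by (simp add: N_def)
  qed
  define BQ where "BQ = N * (N * (Bg * B))"
  have Q0b: "AE x in lebesgue. \<bar>Q0 x\<bar> \<le> \<bar>BQ\<bar>" using allH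
  proof eventually_elim
    case (elim x)
    show ?case
    proof (cases "x \<in> K")
      case True
      then show ?thesis using dbl[of "g x" Bg "\<lambda>k l. Hw k l x"] Bg elim by (simp add: Q0_def BQ_def)
    qed (use H0 in \<open>simp add: Q0_def\<close>)
  qed
  obtain Q1 where Q1: "Q1 \<in> borel_measurable lborel" "AE x in lborel. Q0 x = Q1 x" using completion_ex_borel_measurable_real[OF Qm] by blast
  \<comment> \<open>A Borel representative that is bounded and vanishes off \<open>K\<close> everywhere, not only almost everywhere.\<close>
  define Q where "Q x = indicator K x * max (- \<bar>BQ\<bar>) (min \<bar>BQ\<bar> (Q1 x))" for x
  have Kb: "K \<in> sets borel" using K by (simp add: borel_compact)
  have Qb: "Q \<in> borel_measurable borel" unfolding Q_def[abs_def] using Q1(1) Kb by simp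
  have Q_le: "\<bar>Q x\<bar> \<le> \<bar>BQ\<bar>" for x by (auto simp: Q_def indicator_def)
  have Q_off: "Q x = 0" if "x \<notin> K" for x using that by (simp add: Q_def)
  have QQ: "AE x in lebesgue. Q0 x = Q x" using AE_completion[OF Q1(2)] Q0b
  proof eventually_elim
    case (elim x)
    show ?case by (cases "x \<in> K") (use elim H0 in \<open>auto simp: Q_def Q0_def\<close>)
  qed
  have Qleb: "Q \<in> borel_measurable lebesgue" using Qb by (simp add: measurable_completion)
  define A where "A n x = (LINT y|lborel. Q y * \<eta> n (x - y))" for n x
  define \<kappa> where "\<kappa> = N * (N * (Lam * \<bar>B\<bar>))"
  have op: "\<bar>g x \<bullet> hess (V n) x - A n x\<bar> \<le> \<kappa> * R n" if x: "x \<in> K'" for n x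
  proof -
    have c\<eta>: "continuous_on UNIV (\<lambda>y. \<eta> n (x - y))" by (rule smooth_continuous_on[OF kernel_shift(3)[OF \<eta>]])
    have z\<eta>: "\<eta> n (x - y) = 0" if "norm x + R n < norm y" for y
    proof -
      have "R n < norm (x - y)" using that norm_triangle_ineq2[of y x] by (simp add: norm_minus_commute)
      then show ?thesis using \<eta>[of n] by (simp add: kernel_def)
    qed
    have iH: "integrable lebesgue (\<lambda>y. Hw k l y * \<eta> n (x - y))" for k l by (rule integrable_bounded_times[OF Hm HB c\<eta> z\<eta>])
    have iQ: "integrable lebesgue (\<lambda>y. Q y * \<eta> n (x - y))" by (rule integrable_bounded_times[OF Qleb AE_I2[OF Q_le] c\<eta> z\<eta>])
    have mQ: "(\<lambda>y. Q y * \<eta> n (x - y)) \<in> borel_measurable lborel"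
      by (intro borel_measurable_times) (use Qb borel_measurable_continuous_onI[OF c\<eta>] in simp_all)
    have AL: "A n x = (LINT y|lebesgue. Q y * \<eta> n (x - y))" unfolding A_def by (rule integral_completion[OF mQ, symmetric])
    have "g x \<bullet> hess (V n) x = (\<Sum>k\<in>UNIV. \<Sum>l\<in>UNIV. g x $ k $ l * (LINT y|lebesgue. Hw k l y * \<eta> n (x - y)))"
      by (simp add: inner_vec_def hV[OF x])
    also have "\<dots> = (LINT y|lebesgue. (\<Sum>k\<in>UNIV. \<Sum>l\<in>UNIV. g x $ k $ l * (Hw k l y * \<eta> n (x - y))))"
      using iH by (simp add: Bochner_Integration.integral_sum)
    finally have e1: "g x \<bullet> hess (V n) x = (LINT y|lebesgue. (\<Sum>k\<in>UNIV. \<Sum>l\<in>UNIV. g x $ k $ l * (Hw k l y * \<eta> n (x - y))))" .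
    have iS: "integrable lebesgue (\<lambda>y. \<Sum>k\<in>UNIV. \<Sum>l\<in>UNIV. g x $ k $ l * (Hw k l y * \<eta> n (x - y)))"
      using iH by (intro Bochner_Integration.integrable_sum integrable_mult_right) 
    define dif where "dif y = (\<Sum>k\<in>UNIV. \<Sum>l\<in>UNIV. g x $ k $ l * (Hw k l y * \<eta> n (x - y))) - Q y * \<eta> n (x - y)" for y
    have idif: "integrable lebesgue dif" unfolding dif_def[abs_def] by (intro Bochner_Integration.integrable_diff iS iQ)
    have ib: "integrable lebesgue (\<lambda>y. (\<kappa> * R n) * \<eta> n (x - y))"
      using locally_integrable_times[OF locally_integrable_continuous[OF continuous_on_const[of _ "\<kappa> * R n"]] c\<eta> z\<eta>] by simp
    have ae: "AE y in lebesgue. norm (dif y) \<le> (\<kappa> * R n) * \<eta> n (x - y)" using allH QQ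
    proof eventually_elim
      case (elim y)
      have eq: "dif y = (\<Sum>k\<in>UNIV. \<Sum>l\<in>UNIV. (g x - g y) $ k $ l * Hw k l y) * \<eta> n (x - y)"
        unfolding dif_def elim(2)[symmetric] Q0_def by (simp add: sum_distrib_right sum_subtractf[symmetric] left_diff_distrib mult.assoc)
      show ?case
      proof (cases "norm (x - y) \<le> R n")
        case True
        have "norm (g x - g y) \<le> Lam * norm (x - y)"
        proof (rule differentiable_bound[where S = UNIV and f' = g'])
          show "onorm (g' y) \<le> Lam" for y by (rule onorm_le) (rule E.g'_bound)
        qed (use E.g_deriv in auto)
        also have "\<dots> \<le> Lam * R n" using True E.Lam by (intro mult_left_mono) auto
        finally have n: "norm (g x - g y) \<le> Lam * R n" .
        have Hb: "\<bar>Hw k l y\<bar> \<le> B" for k l using elim(1) by blast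
        have "0 \<le> B" using Hb[of undefined undefined] by linarith
        then have "\<bar>\<Sum>k\<in>UNIV. \<Sum>l\<in>UNIV. (g x - g y) $ k $ l * Hw k l y\<bar> \<le> \<kappa> * R n"
          using dbl[OF n, of "\<lambda>k l. Hw k l y", OF Hb] by (simp add: \<kappa>_def mult_ac)
        then show ?thesis unfolding eq using \<eta>[of n] by (auto simp: abs_mult kernel_def intro!: mult_right_mono)
      next
        case False
        then have "\<eta> n (x - y) = 0" using \<eta>[of n] by (simp add: kernel_def)
        then show ?thesis by (simp add: eq)
      qed
    qed
    have "g x \<bullet> hess (V n) x - A n x = (LINT y|lebesgue. dif y)"
      unfolding e1 AL dif_def by (rule Bochner_Integration.integral_diff[OF iS iQ, symmetric])
    also have "\<bar>\<dots>\<bar> \<le> (LINT y|lebesgue. norm (dif y))" using integral_norm_bound[of lebesgue dif] by simp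
    also have "\<dots> \<le> (LINT y|lebesgue. (\<kappa> * R n) * \<eta> n (x - y))" by (rule integral_mono_AE[OF integrable_norm[OF idif] ib ae])
    also have "\<dots> = \<kappa> * R n" using lebesgue_integral_eq_lborel[OF c\<eta>] kernel_shift(2)[OF \<eta>[of n], of x] by simp
    finally show ?thesis .
  qed
  define I where "I = (LINT x:K|lborel. Wt x * (Q x)\<^sup>2)"
  define IW where "IW = (LINT x:K'|lborel. Wt x)"
  have iW: "set_integrable lborel K' Wt" by (rule set_integrable_compact[OF K' cWt])
  have ev: "\<forall>\<^sub>F n in sequentially. (LINT x:K'|lborel. S (grad (V n)) (V n) x) \<le> C * (4 * I + 2 * (\<kappa> * R n)\<^sup>2 * IW)"
    using order_tendstoD(2)[OF Rl d(1)]
  proof eventually_elim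
    case (elim n)
    have W0: "0 \<le> Wt x" for x by (simp add: Wt_def cw_nonneg)
    have n: "Wt x \<le> 2 * Wt y" if "x \<in> K'" "y \<in> K" "norm (x - y) \<le> R n" for x y using near[OF that(1,2)] that elim by simp
    have wms: "set_integrable lborel K' (\<lambda>x. Wt x * (A n x)\<^sup>2)" "(LINT x:K'|lborel. Wt x * (A n x)\<^sup>2) \<le> 2 * I"
      unfolding A_def I_def
      by (rule weighted_mean_square[OF \<eta>[of n] Qb]; (rule Q_le Q_off K(1) K' KK' cWt W0 n; assumption?))+
    have "(LINT x:K'|lborel. S (grad (V n)) (V n) x) \<le> C * (LINT x:K'|lborel. Wt x * (g x \<bullet> hess (V n) x)\<^sup>2)"
      unfolding S_def Wt_def by (rule carleman_boundD(1)[OF cb \<tau> K' K'O conjI[OF Voff gVoff] C2])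
    also have "\<dots> \<le> C * (LINT x:K'|lborel. 2 * (Wt x * (A n x)\<^sup>2) + 2 * (\<kappa> * R n)\<^sup>2 * Wt x)"
    proof (intro mult_left_mono C set_integral_mono)
      have cg: "continuous_on K' g" by (rule E.continuous_on_g)
      have ch: "continuous_on K' (hess (V n))" by (rule continuous_on_C2_data(3)[OF C2])
      show "set_integrable lborel K' (\<lambda>x. Wt x * (g x \<bullet> hess (V n) x)\<^sup>2)"
        by (rule set_integrable_compact[OF K']) (intro continuous_intros cWt cg ch)
      show "set_integrable lborel K' (\<lambda>x. 2 * (Wt x * (A n x)\<^sup>2) + 2 * (\<kappa> * R n)\<^sup>2 * Wt x)"
        by (intro set_integral_add(1) set_integrable_mult_right wms(1) iW)
      fix x assume x: "x \<in> K'"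
      have "(g x \<bullet> hess (V n) x)\<^sup>2 \<le> 2 * (A n x)\<^sup>2 + 2 * (g x \<bullet> hess (V n) x - A n x)\<^sup>2"
        using sum_squares_bound[of "A n x" "g x \<bullet> hess (V n) x - A n x"] power2_sum[of "A n x" "g x \<bullet> hess (V n) x - A n x"] by simp
      also have "(g x \<bullet> hess (V n) x - A n x)\<^sup>2 \<le> (\<kappa> * R n)\<^sup>2" using op[OF x, of n] by (metis abs_ge_zero power2_abs power_mono)
      finally have "(g x \<bullet> hess (V n) x)\<^sup>2 \<le> 2 * (A n x)\<^sup>2 + 2 * (\<kappa> * R n)\<^sup>2" by simp
      from mult_left_mono[OF this W0[of x]]
      show "Wt x * (g x \<bullet> hess (V n) x)\<^sup>2 \<le> 2 * (Wt x * (A n x)\<^sup>2) + 2 * (\<kappa> * R n)\<^sup>2 * Wt x" by (simp add: algebra_simps)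
    qed
    also have "(LINT x:K'|lborel. 2 * (Wt x * (A n x)\<^sup>2) + 2 * (\<kappa> * R n)\<^sup>2 * Wt x) = 2 * (LINT x:K'|lborel. Wt x * (A n x)\<^sup>2) + 2 * (\<kappa> * R n)\<^sup>2 * IW"
      unfolding IW_def by (subst set_integral_add(2)[OF set_integrable_mult_right[OF wms(1)] set_integrable_mult_right[OF iW]]) (simp_all only: set_integral_mult_right)
    also have "C * (2 * (LINT x:K'|lborel. Wt x * (A n x)\<^sup>2) + 2 * (\<kappa> * R n)\<^sup>2 * IW) \<le> C * (4 * I + 2 * (\<kappa> * R n)\<^sup>2 * IW)"
      using wms(2) C by (intro mult_left_mono) auto
    finally show ?case .
  qed
  have "(\<lambda>n. C * (4 * I + 2 * (\<kappa> * R n)\<^sup>2 * IW)) \<longlonglongrightarrow> C * (4 * I + 2 * (\<kappa> * 0)\<^sup>2 * IW)"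
    by (intro tendsto_intros Rl)
  then have lim2: "(\<lambda>n. C * (4 * I + 2 * (\<kappa> * R n)\<^sup>2 * IW)) \<longlonglongrightarrow> 4 * C * I" by (simp add: mult_ac)
  have main: "(LINT x:K|lborel. S q v x) \<le> 4 * C * I"
    using tendsto_le[OF sequentially_bot lim2 lim ev] unfolding SK .
  have mI: "(\<lambda>x. (indicator K x * Wt x) * (Q x)\<^sup>2) \<in> borel_measurable lborel"
  proof -
    have "(\<lambda>x. indicator K x *\<^sub>R Wt x) \<in> borel_measurable borel"
      by (rule borel_measurable_continuous_on_indicator[OF Kb continuous_on_subset[OF cWt KK']])
    then show ?thesis using borel_measurable_times[OF _ borel_measurable_power[OF Qb]] by simp
  qed
  have "I = (LINT x|lborel. (indicator K x * Wt x) * (Q x)\<^sup>2)" by (simp add: I_def set_lebesgue_integral_def mult_ac)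
  also have "\<dots> = (LINT x|lebesgue. (indicator K x * Wt x) * (Q x)\<^sup>2)" by (rule integral_completion[OF mI, symmetric])
  also have "\<dots> = (LINT x|lebesgue. Wt x * (Q0 x)\<^sup>2)"
  proof (rule integral_cong_AE)
    show m1: "(\<lambda>x. (indicator K x * Wt x) * (Q x)\<^sup>2) \<in> borel_measurable lebesgue" by (rule measurable_completion[OF mI])
    have ae: "AE x in lebesgue. (indicator K x * Wt x) * (Q x)\<^sup>2 = Wt x * (Q0 x)\<^sup>2" using QQ
    proof eventually_elim
      case (elim x)
      then show ?case using Q_off[of x] by (cases "x \<in> K") auto
    qed
    then show "AE x in lebesgue. (indicator K x * Wt x) * (Q x)\<^sup>2 = Wt x * (Q0 x)\<^sup>2" .
    have eq: "(indicator K x * Wt x) * (Q0 x)\<^sup>2 = Wt x * (Q0 x)\<^sup>2" for x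
      using H0[of x] by (cases "x \<in> K") (auto simp: Q0_def)
    have "(\<lambda>x. indicator K x *\<^sub>R Wt x) \<in> borel_measurable borel"
      by (rule borel_measurable_continuous_on_indicator[OF Kb continuous_on_subset[OF cWt KK']])
    then have "(\<lambda>x. indicator K x * Wt x) \<in> borel_measurable lebesgue" by (simp add: measurable_completion)
    then have "(\<lambda>x. (indicator K x * Wt x) * (Q0 x)\<^sup>2) \<in> borel_measurable lebesgue"
      by (rule borel_measurable_times[OF _ borel_measurable_power[OF Qm]])
    then show "(\<lambda>x. Wt x * (Q0 x)\<^sup>2) \<in> borel_measurable lebesgue" by (simp only: eq)
  qed
  finally show ?thesis using main by (simp only: S_def Q0_def Wt_def)
qed

section \<open>The matrix of the weight\<close>

lemma form_add_scaleR: "((A + s *\<^sub>R B) *v x) \<bullet> x = (A *v x) \<bullet> x + s * ((B *v x) \<bullet> x)"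
  for A B :: "real^'n::finite^'n"
  by (simp add: matrix_vector_mult_add_rdistrib scaleR_matrix_vector_assoc[symmetric] inner_add_left)

lemma transpose_scaleR: "transpose (s *\<^sub>R A) = s *\<^sub>R transpose A" for A :: "real^'n::finite^'n"
  by (simp add: transpose_def vec_eq_iff)

lemma transpose_add: "transpose (A + B) = transpose A + transpose B" for A :: "real^'n::finite^'n"
  by (simp add: transpose_def vec_eq_iff)

text \<open>The eigenvalue is the minimum of the form on the unit sphere; at a minimum point the form
  with that eigenvalue subtracted, which is nonnegative, vanishes.\<close>

lemma symmetric_least_eigenvalue:
  fixes A :: "real^'n::finite^'n"
  assumes sym: "transpose A = A"
  obtains l where "l \<in> eigenvalues A" "\<And>x. l * (norm x)\<^sup>2 \<le> (A *v x) \<bullet> x"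
proof -
  have ne: "sphere (0::real^'n) 1 \<noteq> {}" by (simp add: sphere_eq_empty)
  have cont: "continuous_on (sphere 0 1) (\<lambda>x. (A *v x) \<bullet> x)" by (intro continuous_intros)
  obtain v where v: "norm v = 1" "\<And>y. norm y = 1 \<Longrightarrow> (A *v v) \<bullet> v \<le> (A *v y) \<bullet> y"
    using continuous_attains_inf[OF compact_sphere ne cont] by (auto simp: dist_norm)
  define l where "l = (A *v v) \<bullet> v"
  have low: "l * (norm x)\<^sup>2 \<le> (A *v x) \<bullet> x" for x
  proof (cases "x = 0")
    case False
    have "l \<le> (A *v (inverse (norm x) *\<^sub>R x)) \<bullet> (inverse (norm x) *\<^sub>R x)"
      unfolding l_def by (rule v(2)) (use False in simp)
    also have "\<dots> = ((A *v x) \<bullet> x) / (norm x)\<^sup>2"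
      by (simp add: matrix_vector_mult_scaleR power2_eq_square divide_inverse mult_ac)
    finally show ?thesis using False by (simp add: field_simps)
  qed simp
  define P where "P = A + (-l) *\<^sub>R mat 1"
  have P: "(P *v x) \<bullet> x = (A *v x) \<bullet> x - l * (norm x)\<^sup>2" for x
    unfolding P_def form_add_scaleR by (simp add: power2_norm_eq_inner)
  have "transpose P = P" by (simp only: P_def transpose_add transpose_scaleR transpose_mat sym)
  then have "((P *v v) \<bullet> (P *v v))\<^sup>2 \<le> ((P *v v) \<bullet> v) * ((P *v (P *v v)) \<bullet> (P *v v))"
    by (rule psd_Cauchy_Schwarz) (use low P in simp)
  also have "(P *v v) \<bullet> v = 0" unfolding P by (simp add: l_def v)
  finally have "P *v v = 0" by simp
  moreover have "P *v v = A *v v - l *\<^sub>R v"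
    unfolding P_def matrix_vector_mult_add_rdistrib scaleR_matrix_vector_assoc[symmetric] by simp
  ultimately have "A *v v = l *\<^sub>R v" by simp
  moreover have "v \<noteq> 0" using v(1) by auto
  ultimately show thesis using that low unfolding eigenvalues_def by blast
qed

text \<open>Eigenvectors of distinct eigenvalues are orthogonal, hence independent.\<close>

lemma finite_eigenvalues:
  fixes A :: "real^'n::finite^'n"
  assumes sym: "transpose A = A"
  shows "finite (eigenvalues A)"
proof -
  define f where "f l = (SOME v. v \<noteq> 0 \<and> A *v v = l *\<^sub>R v)" for l
  have f: "f l \<noteq> 0" "A *v f l = l *\<^sub>R f l" if "l \<in> eigenvalues A" for l
    using someI_ex[of "\<lambda>v. v \<noteq> 0 \<and> A *v v = l *\<^sub>R v"] that unfolding f_def eigenvalues_def by auto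
  have orth: "f l \<bullet> f m = 0" if "l \<in> eigenvalues A" "m \<in> eigenvalues A" "l \<noteq> m" for l m
  proof -
    have "l * (f l \<bullet> f m) = (A *v f l) \<bullet> f m" by (simp add: f(2)[OF that(1)])
    also have "\<dots> = f l \<bullet> (A *v f m)" by (metis dot_lmul_matrix sym vector_transpose_matrix)
    also have "\<dots> = m * (f l \<bullet> f m)" by (simp add: f(2)[OF that(2)])
    finally show ?thesis using that(3) by simp
  qed
  have "pairwise orthogonal (f ` eigenvalues A)" using orth by (auto simp: pairwise_def orthogonal_def)
  then have "independent (f ` eigenvalues A)" using f by (intro pairwise_orthogonal_independent) force+
  then have "finite (f ` eigenvalues A)" by (rule independent_imp_finite)
  moreover have "inj_on f (eigenvalues A)"
  proof (rule inj_onI, rule ccontr)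
    fix l m assume "l \<in> eigenvalues A" "m \<in> eigenvalues A" "f l = f m" "l \<noteq> m"
    then show False using orth[of l m] f(1)[of m] by simp
  qed
  ultimately show ?thesis by (rule finite_imageD)
qed

lemma symmetric_form_bounds:
  fixes A :: "real^'n::finite^'n"
  assumes sym: "transpose A = A"
  shows "Min (eigenvalues A) \<in> eigenvalues A" "Max (eigenvalues A) \<in> eigenvalues A"
    and "Min (eigenvalues A) * (norm x)\<^sup>2 \<le> (A *v x) \<bullet> x" "(A *v x) \<bullet> x \<le> Max (eigenvalues A) * (norm x)\<^sup>2"
proof -
  note fin = finite_eigenvalues[OF sym]
  obtain l where l: "l \<in> eigenvalues A" "\<And>x. l * (norm x)\<^sup>2 \<le> (A *v x) \<bullet> x"
    using symmetric_least_eigenvalue[OF sym] by metis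
  have mA: "(- A) *v x = - (A *v x)" for x
    using scaleR_matrix_vector_assoc[of "-1" A x] by simp
  have "transpose (- A) = - A" using transpose_scaleR[of "-1" A] sym by simp
  then obtain m where m: "m \<in> eigenvalues (- A)" "\<And>x. m * (norm x)\<^sup>2 \<le> ((- A) *v x) \<bullet> x"
    using symmetric_least_eigenvalue by metis
  have m': "- m \<in> eigenvalues A" using m(1) unfolding eigenvalues_def mA by (auto simp: minus_equation_iff[of _ "_ *\<^sub>R _"]) 
  show "Min (eigenvalues A) \<in> eigenvalues A" "Max (eigenvalues A) \<in> eigenvalues A"
    using Min_in[OF fin] Max_in[OF fin] l(1) by auto
  have "Min (eigenvalues A) * (norm x)\<^sup>2 \<le> l * (norm x)\<^sup>2" by (intro mult_right_mono Min_le fin l) simp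
  then show "Min (eigenvalues A) * (norm x)\<^sup>2 \<le> (A *v x) \<bullet> x" using l(2)[of x] by linarith
  have "(- m) * (norm x)\<^sup>2 \<le> Max (eigenvalues A) * (norm x)\<^sup>2" by (intro mult_right_mono Max_ge fin m') simp
  then show "(A *v x) \<bullet> x \<le> Max (eigenvalues A) * (norm x)\<^sup>2" using m(2)[of x] by (simp add: mA)
qed

lemma eigenvalue_bounds:
  fixes A :: "real^'n::finite^'n"
  assumes low: "\<And>x. a * (norm x)\<^sup>2 \<le> (A *v x) \<bullet> x" and up: "\<And>x. (A *v x) \<bullet> x \<le> b * (norm x)\<^sup>2"
    and l: "l \<in> eigenvalues A"
  shows "a \<le> l" "l \<le> b"
proof -
  obtain v where v: "v \<noteq> 0" "A *v v = l *\<^sub>R v" using l by (auto simp: eigenvalues_def)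
  then have "(A *v v) \<bullet> v = l * (norm v)\<^sup>2" by (simp add: power2_norm_eq_inner)
  then show "a \<le> l" "l \<le> b" using low[of v] up[of v] v(1) by (simp_all add: mult_le_cancel_right)
qed

text \<open>Here \<open>a\<close> and \<open>b\<close> are values of two forms with \<open>d a \<le> b \<le> e a\<close>. The mean \<open>(a + s b) / (1 + s)\<close> lies
  between \<open>(1 + s d) / (1 + s)\<close> and \<open>(1 + s e) / (1 + s)\<close> times \<open>a\<close>, and similarly for \<open>b\<close>. The two ratios of these
  bounds are \<open>(1 + s e) / (1 + s d)\<close> and \<open>(e / d) (1 + s d) / (1 + s e)\<close>. They agree, with the common value
  \<open>sqrt (e / d)\<close>, for \<open>s = 1 / sqrt (d e)\<close>.\<close>

lemma pinching_constants:
  fixes a1 b1 a2 b2 lam :: real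
  assumes lam: "0 < lam" "lam \<le> 1" and b: "lam \<le> a1" "a1 \<le> b1" "b1 \<le> inverse lam" "lam \<le> a2" "a2 \<le> b2" "b2 \<le> inverse lam"
  defines "\<kappa> \<equiv> sqrt ((b2 * b1) / (a2 * a1))"
  obtains s m1 m2 where "0 < s" "lam\<^sup>2 \<le> m1" "lam\<^sup>2 \<le> m2" "\<kappa> * m1 \<le> (inverse lam)\<^sup>2" "\<kappa> * m2 \<le> (inverse lam)\<^sup>2" "1 \<le> \<kappa>"
    and "\<And>a b. (a2 / b1) * a \<le> b \<Longrightarrow> b \<le> (b2 / a1) * a \<Longrightarrow>
      m1 * ((a + s * b) / (1 + s)) \<le> a \<and> a \<le> (\<kappa> * m1) * ((a + s * b) / (1 + s)) \<and>
      m2 * ((a + s * b) / (1 + s)) \<le> b \<and> b \<le> (\<kappa> * m2) * ((a + s * b) / (1 + s))"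
proof -
  define d e where "d = a2 / b1" and "e = b2 / a1"
  have p: "0 < a1" "0 < b1" "0 < a2" "0 < b2" using lam b by linarith+
  have de: "0 < d" "0 < e" using p by (auto simp: d_def e_def)
  have "a1 * a2 \<le> b1 * b2" by (rule mult_mono) (use b p in auto)
  then have dle: "d \<le> e" using p by (simp add: d_def e_def field_simps)
  have k: "\<kappa> = sqrt (e / d)" using p by (simp add: \<kappa>_def d_def e_def field_simps)
  have k1: "1 \<le> \<kappa>" unfolding k using dle de by (simp add: field_simps)
  define s where "s = 1 / sqrt (d * e)"
  have s: "0 < s" using de by (simp add: s_def)
  have se: "s * e = \<kappa>" unfolding s_def k using de by (simp add: real_sqrt_mult real_sqrt_divide field_simps)
  have sd: "s * d * \<kappa> = 1" unfolding s_def k using de by (simp add: real_sqrt_mult real_sqrt_divide field_simps)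
  define x where "x = s * d"
  have x: "0 < x" "x * \<kappa> = 1" using s de sd by (auto simp: x_def)
  have il: "0 < inverse lam" "lam * inverse lam = 1" "1 \<le> inverse lam" using lam by (auto simp: field_simps)
  have h: "lam\<^sup>2 * t \<le> c" if "t \<le> inverse lam" "lam \<le> c" for t c
  proof -
    have "lam\<^sup>2 * t \<le> lam\<^sup>2 * inverse lam" by (intro mult_left_mono that) simp
    also have "\<dots> = lam" using lam by (simp add: power2_eq_square)
    finally show ?thesis using that by linarith
  qed
  have d1: "lam\<^sup>2 \<le> d" using h[OF b(3,4)] p by (simp add: d_def pos_le_divide_eq)
  have e1: "lam\<^sup>2 * e \<le> 1" using h[OF b(6,1)] p by (simp add: e_def pos_divide_le_eq)
  have l2: "0 < lam\<^sup>2" "lam\<^sup>2 \<le> 1" using lam by (auto simp: power_le_one)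
  have kx1: "\<kappa> * (1 + x) = 1 + \<kappa>" using x(2) by (simp add: algebra_simps)
  have kk: "e = \<kappa> * (\<kappa> * d)"
  proof -
    have "\<kappa> * \<kappa> = e / d" unfolding k using de by (simp add: real_sqrt_mult_self)
    then show ?thesis using de by (simp add: mult.assoc[symmetric])
  qed
  define m1 m2 where "m1 = (1 + s) / (1 + \<kappa>)" and "m2 = d * ((1 + s) / (1 + x))"
  have M1: "\<kappa> * m1 = (1 + s) / (1 + x)" unfolding m1_def kx1[symmetric] using k1 by simp
  have M2: "\<kappa> * m2 = e * ((1 + s) / (1 + \<kappa>))"
    unfolding m2_def kx1[symmetric] unfolding kk using k1 by simp
  show thesis
  proof (rule that[OF s _ _ _ _ k1])
    have "lam\<^sup>2 * (1 + \<kappa>) = lam\<^sup>2 + s * (lam\<^sup>2 * e)" unfolding se[symmetric] by (simp add: algebra_simps)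
    also have "\<dots> \<le> 1 + s * 1" by (intro add_mono mult_left_mono l2 e1) (use s in auto)
    finally show "lam\<^sup>2 \<le> m1" unfolding m1_def using k1 by (simp add: field_simps)
    have "lam\<^sup>2 * (1 + x) \<le> d + s * (lam\<^sup>2 * d)" using d1 by (simp add: x_def algebra_simps)
    also have "\<dots> \<le> d + s * (1 * d)" by (intro add_mono mult_left_mono mult_right_mono l2 order_refl) (use s de in auto)
    finally show "lam\<^sup>2 \<le> m2" unfolding m2_def using x(1) by (simp add: field_simps)
    have "lam\<^sup>2 * (1 + s) = lam\<^sup>2 + s * lam\<^sup>2" by (simp add: algebra_simps)
    also have "\<dots> \<le> 1 + s * d" by (intro add_mono mult_left_mono l2 d1) (use s in auto)
    finally have "lam\<^sup>2 * (1 + s) \<le> 1 + x" by (simp add: x_def)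
    then have "lam\<^sup>2 * ((1 + s) / (1 + x)) \<le> 1" using x(1) by (simp add: field_simps)
    then show "\<kappa> * m1 \<le> (inverse lam)\<^sup>2" unfolding M1 using l2 by (simp add: field_simps power_inverse)
    have "lam\<^sup>2 * e * (1 + s) = lam\<^sup>2 * e + lam\<^sup>2 * (s * e)" by (simp add: algebra_simps)
    also have "\<dots> \<le> 1 + 1 * \<kappa>" unfolding se by (intro add_mono mult_right_mono l2 e1) (use k1 in auto)
    finally have "lam\<^sup>2 * (e * ((1 + s) / (1 + \<kappa>))) \<le> 1" using k1 by (simp add: field_simps)
    then show "\<kappa> * m2 \<le> (inverse lam)\<^sup>2" unfolding M2 using l2 by (simp add: field_simps power_inverse)
    fix a b assume ab: "(a2 / b1) * a \<le> b" "b \<le> (b2 / a1) * a"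
    then have da: "d * a \<le> b" and eb: "b \<le> e * a" by (auto simp: d_def e_def)
    have s1: "0 < 1 + s" using s by simp
    have c: "((1 + s) / t) * (y / (1 + s)) = y / t" for t y :: real using s1 by simp
    have k2: "0 < 1 + \<kappa>" "0 < 1 + x" using k1 x by auto
    have "s * b \<le> s * (e * a)" using eb s by (intro mult_left_mono) auto
    then have sb: "s * b \<le> \<kappa> * a" by (simp add: se[symmetric] mult.assoc)
    have "s * (d * a) \<le> s * b" using da s by (intro mult_left_mono) auto
    then have sb': "x * a \<le> s * b" by (simp add: x_def mult.assoc)
    have "d * (a + s * b) \<le> b * (1 + x)" using da by (simp add: x_def algebra_simps)
    moreover have "b * (1 + \<kappa>) \<le> e * (a + s * b)" using eb by (simp add: se[symmetric] algebra_simps)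
    ultimately show "m1 * ((a + s * b) / (1 + s)) \<le> a \<and> a \<le> (\<kappa> * m1) * ((a + s * b) / (1 + s)) \<and>
      m2 * ((a + s * b) / (1 + s)) \<le> b \<and> b \<le> (\<kappa> * m2) * ((a + s * b) / (1 + s))"
      unfolding M1 M2 unfolding m1_def m2_def mult.assoc c using sb sb' k2
      by (simp add: pos_divide_le_eq pos_le_divide_eq algebra_simps)
  qed
qed

text \<open>The matrix \<open>G\<close> is the inverse of \<open>\<Gamma>\<close>; it is comparable with \<open>A\<close> and with \<open>B\<close>, each time with the same quotient \<open>\<kappa>\<close> of the upper
and the lower constant.\<close>

definition weight_matrix :: "real \<Rightarrow> real \<Rightarrow> real^'n::finite^'n \<Rightarrow> real^'n^'n \<Rightarrow> real^'n^'n \<Rightarrow> bool" where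
  "weight_matrix lam \<kappa> A B \<Gamma> \<longleftrightarrow> quad_weight \<Gamma> lam \<and> 1 \<le> \<kappa> \<and>
    (\<exists>G m1 m2. transpose G = G \<and> G ** \<Gamma> = mat 1 \<and> \<Gamma> ** G = mat 1 \<and>
      lam\<^sup>2 \<le> m1 \<and> lam\<^sup>2 \<le> m2 \<and> \<kappa> * m1 \<le> (inverse lam)\<^sup>2 \<and> \<kappa> * m2 \<le> (inverse lam)\<^sup>2 \<and>
      (\<forall>x. m1 * ((G *v x) \<bullet> x) \<le> (A *v x) \<bullet> x \<and> (A *v x) \<bullet> x \<le> (\<kappa> * m1) * ((G *v x) \<bullet> x)) \<and>
      (\<forall>x. m2 * ((G *v x) \<bullet> x) \<le> (B *v x) \<bullet> x \<and> (B *v x) \<bullet> x \<le> (\<kappa> * m2) * ((G *v x) \<bullet> x)))"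

text \<open>With the extreme eigenvalues, \<open>d = \<mu>\<^sub>* / \<nu>\<^sup>*\<close> and \<open>d' = \<mu>\<^sup>* / \<nu>\<^sub>*\<close> satisfy \<open>d A \<le> B \<le> d' A\<close>, and \<open>sqrt (d' / d)\<close> is the threshold
plus one.\<close>

theorem weight_matrix_exists:
  fixes A B :: "real^'n::finite^'n"
  assumes lam: "0 < lam" "lam \<le> 1" and sym: "transpose A = A" "transpose B = B"
    and A: "\<And>x. lam * (norm x)\<^sup>2 \<le> (A *v x) \<bullet> x" "\<And>x. (A *v x) \<bullet> x \<le> inverse lam * (norm x)\<^sup>2"
    and B: "\<And>x. lam * (norm x)\<^sup>2 \<le> (B *v x) \<bullet> x" "\<And>x. (B *v x) \<bullet> x \<le> inverse lam * (norm x)\<^sup>2"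
  shows "\<exists>\<Gamma>. weight_matrix lam (beta_threshold A B + 1) A B \<Gamma>"
proof -
  define a1 b1 a2 b2 where ab: "a1 = Min (eigenvalues A)" "b1 = Max (eigenvalues A)" "a2 = Min (eigenvalues B)" "b2 = Max (eigenvalues B)"
  note FA = symmetric_form_bounds[OF sym(1)] and FB = symmetric_form_bounds[OF sym(2)]
  have b: "lam \<le> a1" "a1 \<le> b1" "b1 \<le> inverse lam" "lam \<le> a2" "a2 \<le> b2" "b2 \<le> inverse lam"
    unfolding ab using eigenvalue_bounds[OF A] eigenvalue_bounds[OF B] FA(1,2) FB(1,2)
      Min_le[OF finite_eigenvalues[OF sym(1)] FA(2)] Min_le[OF finite_eigenvalues[OF sym(2)] FB(2)] by auto
  define \<kappa> where "\<kappa> = beta_threshold A B + 1"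
  have k: "\<kappa> = sqrt ((b2 * b1) / (a2 * a1))" by (simp add: \<kappa>_def beta_threshold_def ab)
  obtain s m1 m2 where s: "0 < s" and m: "lam\<^sup>2 \<le> m1" "lam\<^sup>2 \<le> m2" "\<kappa> * m1 \<le> (inverse lam)\<^sup>2" "\<kappa> * m2 \<le> (inverse lam)\<^sup>2" "1 \<le> \<kappa>"
    and pin: "\<And>a b. (a2 / b1) * a \<le> b \<Longrightarrow> b \<le> (b2 / a1) * a \<Longrightarrow>
      m1 * ((a + s * b) / (1 + s)) \<le> a \<and> a \<le> (\<kappa> * m1) * ((a + s * b) / (1 + s)) \<and>
      m2 * ((a + s * b) / (1 + s)) \<le> b \<and> b \<le> (\<kappa> * m2) * ((a + s * b) / (1 + s))"
    using pinching_constants[OF lam b] unfolding k[symmetric] by metis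
  have p: "0 < a1" "0 < b1" "0 < a2" "0 < b2" using lam b by linarith+
  define G where "G = inverse (1 + s) *\<^sub>R (A + s *\<^sub>R B)"
  have G: "(G *v x) \<bullet> x = ((A *v x) \<bullet> x + s * ((B *v x) \<bullet> x)) / (1 + s)" for x
    unfolding G_def by (simp add: scaleR_matrix_vector_assoc[symmetric] form_add_scaleR divide_inverse mult.commute)
  have Gs: "transpose G = G" by (simp add: G_def transpose_scaleR transpose_add sym)
  have G1: "lam * (norm x)\<^sup>2 \<le> (G *v x) \<bullet> x" for x
  proof -
    have "lam * (norm x)\<^sup>2 + s * (lam * (norm x)\<^sup>2) \<le> (A *v x) \<bullet> x + s * ((B *v x) \<bullet> x)"
      by (intro add_mono mult_left_mono A B) (use s in auto)
    then show ?thesis unfolding G using s by (simp add: field_simps)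
  qed
  have G2: "(G *v x) \<bullet> x \<le> inverse lam * (norm x)\<^sup>2" for x
  proof -
    have "(A *v x) \<bullet> x + s * ((B *v x) \<bullet> x) \<le> inverse lam * (norm x)\<^sup>2 + s * (inverse lam * (norm x)\<^sup>2)"
      by (intro add_mono mult_left_mono A B) (use s in auto)
    also have "\<dots> = (inverse lam * (norm x)\<^sup>2) * (1 + s)" by (simp add: algebra_simps)
    finally show ?thesis unfolding G using s by (simp add: pos_divide_le_eq)
  qed
  have "x = 0" if "G *v x = 0" for x using G1[of x] that lam by (simp add: mult_le_0_iff)
  then obtain \<Gamma> where \<Gamma>G: "\<Gamma> ** G = mat 1" using matrix_left_invertible_ker[of G] by blast
  then have G\<Gamma>: "G ** \<Gamma> = mat 1" by (rule matrix_left_right_inverse1)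
  have \<Gamma>s: "transpose \<Gamma> = \<Gamma>"
  proof -
    have "transpose \<Gamma> = transpose \<Gamma> ** (G ** \<Gamma>)" by (simp add: G\<Gamma>)
    also have "\<dots> = transpose (G ** \<Gamma>) ** \<Gamma>" by (simp only: matrix_mul_assoc matrix_transpose_mul Gs)
    finally show ?thesis by (simp add: G\<Gamma>)
  qed
  have "quad_weight \<Gamma> lam"
  proof
    fix x :: "real^'n"
    define y where "y = \<Gamma> *v x"
    have x: "G *v y = x" by (simp add: y_def matrix_vector_mul_assoc G\<Gamma>)
    have q: "(\<Gamma> *v x) \<bullet> x = (G *v y) \<bullet> y" using x by (simp add: y_def inner_commute)
    have G0: "0 \<le> (G *v z) \<bullet> z" for z using G1[of z] lam by (smt (verit) mult_nonneg_nonneg zero_le_power2)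
    have "(norm x)\<^sup>2 \<le> inverse lam * ((\<Gamma> *v x) \<bullet> x)"
      using psd_norm_mv_le[OF Gs G0 G2, of y] unfolding x q .
    then have "lam * (norm x)\<^sup>2 \<le> (\<Gamma> *v x) \<bullet> x" using lam by (simp add: field_simps)
    moreover have "lam\<^sup>2 * (norm x)\<^sup>2 \<le> lam * (norm x)\<^sup>2"
      using lam by (intro mult_right_mono) (auto simp: power2_eq_square mult_left_le)
    ultimately show "lam\<^sup>2 * (norm x)\<^sup>2 \<le> (\<Gamma> *v x) \<bullet> x" by linarith
    have "lam * (norm y)\<^sup>2 \<le> x \<bullet> y" using G1[of y] by (simp add: x)
    also have "\<dots> \<le> norm x * norm y" by (rule norm_cauchy_schwarz)
    finally have "lam * norm y \<le> norm x" by (cases "norm y = 0") (auto simp: power2_eq_square)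
    then have "lam * norm y * norm x \<le> norm x * norm x" by (intro mult_right_mono) auto
    then have "norm y * norm x \<le> inverse lam * (norm x)\<^sup>2" using lam by (simp add: field_simps power2_eq_square)
    also have "\<dots> \<le> inverse (lam\<^sup>2) * (norm x)\<^sup>2"
      using lam by (intro mult_right_mono le_imp_inverse_le) (auto simp: power2_eq_square mult_left_le)
    finally show "(\<Gamma> *v x) \<bullet> x \<le> inverse (lam\<^sup>2) * (norm x)\<^sup>2"
      using norm_cauchy_schwarz[of y x] by (simp add: y_def)
  qed (use \<Gamma>s lam in auto)
  have pinx: "m1 * ((G *v x) \<bullet> x) \<le> (A *v x) \<bullet> x \<and> (A *v x) \<bullet> x \<le> (\<kappa> * m1) * ((G *v x) \<bullet> x) \<and>
      m2 * ((G *v x) \<bullet> x) \<le> (B *v x) \<bullet> x \<and> (B *v x) \<bullet> x \<le> (\<kappa> * m2) * ((G *v x) \<bullet> x)" for x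
    unfolding G
  proof (rule pin)
    have "(a2 / b1) * ((A *v x) \<bullet> x) \<le> (a2 / b1) * (b1 * (norm x)\<^sup>2)"
      using FA(4)[of x] p by (intro mult_left_mono) (auto simp: ab)
    also have "\<dots> \<le> (B *v x) \<bullet> x" using FB(3)[of x] p by (simp add: ab)
    finally show "(a2 / b1) * ((A *v x) \<bullet> x) \<le> (B *v x) \<bullet> x" .
    have "(B *v x) \<bullet> x \<le> (b2 / a1) * (a1 * (norm x)\<^sup>2)" using FB(4)[of x] p by (simp add: ab)
    also have "\<dots> \<le> (b2 / a1) * ((A *v x) \<bullet> x)"
      using FA(3)[of x] p by (intro mult_left_mono) (auto simp: ab)
    finally show "(B *v x) \<bullet> x \<le> (b2 / a1) * ((A *v x) \<bullet> x)" .
  qed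
  show ?thesis
    unfolding weight_matrix_def \<kappa>_def[symmetric]
    by (intro exI[of _ \<Gamma>] exI[of _ G] exI[of _ m1] exI[of _ m2] conjI \<open>quad_weight \<Gamma> lam\<close> Gs G\<Gamma> \<Gamma>G m) (use pinx in blast)+
qed

section \<open>The inner operator and its derivatives\<close>

lemma sum_lists_snoc:
  "(\<Sum>is | length is = Suc k. f is) = (\<Sum>i\<in>UNIV. \<Sum>is | length is = k. f (is @ [i]))"
  for f :: "'n::finite list \<Rightarrow> real"
proof -
  have eq: "{is :: 'n list. length is = Suc k} = (\<lambda>(i, is). is @ [i]) ` (UNIV \<times> {is. length is = k})"
  proof (intro set_eqI iffI)
    fix js :: "'n list" assume "js \<in> {is. length is = Suc k}"
    then have "js = (\<lambda>(i, is). is @ [i]) (last js, butlast js)" "(last js, butlast js) \<in> UNIV \<times> {is. length is = k}"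
      by (auto simp: length_Suc_conv)
    then show "js \<in> (\<lambda>(i, is). is @ [i]) ` (UNIV \<times> {is. length is = k})" by (rule image_eqI)
  qed auto
  have "(\<Sum>is | length is = Suc k. f is) = (\<Sum>(i, is)\<in>UNIV \<times> {is. length is = k}. f (is @ [i]))"
    unfolding eq by (subst sum.reindex) (auto simp: inj_on_def case_prod_unfold)
  then show ?thesis by (simp add: sum.cartesian_product)
qed

lemma norm_nabla_0: "(norm_nabla 0 u x)\<^sup>2 = (u x)\<^sup>2"
  by (simp add: norm_nabla_def)

lemma norm_nabla_Suc: "(norm_nabla (Suc k) u x)\<^sup>2 = (\<Sum>i\<in>UNIV. (norm_nabla k (partial_deriv i u) x)\<^sup>2)"
  unfolding norm_nabla_def by (simp add: sum_lists_snoc iter_partial_append sum_nonneg)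

lemma norm_vec_square: "(norm v)\<^sup>2 = (\<Sum>i\<in>UNIV. (norm (v $ i))\<^sup>2)" for v :: "'a::real_normed_vector^'n::finite"
  by (simp add: norm_vec_def L2_set_def sum_nonneg)

lemma norm_nabla_1: "(norm_nabla (Suc 0) u x)\<^sup>2 = (norm (grad u x))\<^sup>2"
  by (simp add: norm_nabla_Suc norm_nabla_0 norm_vec_square grad_def)

lemma norm_nabla_2: "(norm_nabla (Suc (Suc 0)) u x)\<^sup>2 = (norm (hess u x))\<^sup>2"
proof -
  have "(norm_nabla (Suc (Suc 0)) u x)\<^sup>2 = (\<Sum>j\<in>UNIV. \<Sum>i\<in>UNIV. (iter_partial [i, j] u x)\<^sup>2)"
    by (simp add: norm_nabla_Suc norm_nabla_0)
  also have "\<dots> = (\<Sum>i\<in>UNIV. \<Sum>j\<in>UNIV. (iter_partial [i, j] u x)\<^sup>2)" by (rule sum.swap)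
  finally show ?thesis by (simp add: norm_vec_square hess_def)
qed

lemma norm_nabla_3: "(norm_nabla (Suc (Suc (Suc 0))) u x)\<^sup>2 = (\<Sum>k\<in>UNIV. (norm (hess (partial_deriv k u) x))\<^sup>2)"
  by (simp add: norm_nabla_Suc[of "Suc (Suc 0)"] norm_nabla_2)

lemma hess_partial_deriv:
  assumes "smooth u"
  shows "hess (partial_deriv k u) x = hess' u x (axis k 1)"
proof -
  have "iter_partial [i, j] (partial_deriv k u) x = iter_partial [k, i, j] u x" for i j
  proof -
    have "(\<lambda>x. iter_partial [j, k] u x) = iter_partial [k, j] u" by (rule ext) (rule iter_partial_commute[OF assms])
    then have "iter_partial [i, j] (partial_deriv k u) x = partial_deriv i (iter_partial [k, j] u) x" by simp
    then show ?thesis using iter_partial_commute[OF assms, of i k "[j]" x] by simp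
  qed
  then show ?thesis by (simp add: hess_def hess'_def vec_eq_iff axis_def if_distrib[of "\<lambda>a. a * _"] cong: if_cong)
qed

lemma inner_op_eq: "inner_op g u x = g x \<bullet> hess u x"
  by (simp add: inner_op_def hess_def inner_vec_def)

context elliptic_C1
begin

text \<open>By Schwarz' theorem the derivative of the Hessian in a coordinate direction is the Hessian of that derivative.\<close>

definition inner_op_grad :: "(real^'n \<Rightarrow> real) \<Rightarrow> real^'n \<Rightarrow> real^'n" where
  "inner_op_grad u x = (\<chi> k. g' x (axis k 1) \<bullet> hess u x + g x \<bullet> hess (partial_deriv k u) x)"

lemma inner_op_has_derivative:
  assumes u: "smooth u"
  shows "(inner_op g u has_derivative (\<lambda>h. inner_op_grad u x \<bullet> h)) (at x)"
proof -
  have H: "(hess u has_derivative hess' u x) (at x)" using smooth_C3_data[OF u] by (simp add: C3_data_def)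
  have d: "((\<lambda>x. g x \<bullet> hess u x) has_derivative (\<lambda>h. g x \<bullet> hess' u x h + g' x h \<bullet> hess u x)) (at x)"
    by (rule has_derivative_inner[OF g_deriv H])
  have "g x \<bullet> hess' u x h + g' x h \<bullet> hess u x = inner_op_grad u x \<bullet> h" for h
  proof -
    have "linear (\<lambda>h. g x \<bullet> hess' u x h + g' x h \<bullet> hess u x)" by (rule has_derivative_linear[OF d])
    from linear_eq_inner[OF this, of h] show ?thesis
      by (simp add: inner_op_grad_def hess_partial_deriv[OF u] add.commute)
  qed
  with d show ?thesis unfolding inner_op_eq[abs_def] by simp
qed

lemma continuous_on_hess: "smooth u \<Longrightarrow> continuous_on S (hess u)"
  using smooth_C3_data continuous_on_C2_data(3) unfolding C3_data_def by blast

lemma continuous_on_inner_op_grad: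
  assumes u: "smooth u"
  shows "continuous_on S (inner_op_grad u)"
  unfolding inner_op_grad_def[abs_def]
  by (intro continuous_on_vec_lambda continuous_intros continuous_on_hess[OF u] continuous_on_hess[OF smooth_partial_deriv[OF u]] continuous_on_g)

text \<open>Every summand of the operator is a coefficient, which has bounded weak second derivatives, times a test function.
  Therefore the rule for products applies, and its result vanishes where the test function does.\<close>

lemma inner_op_weak_hessian:
  assumes adm: "admissible_coeffs lam Lam Lam1 g" and u: "u \<in> test_functions U"
  shows "\<exists>Hw B. \<forall>k l. is_weak_partial [k, l] (inner_op g u) (Hw k l) \<and> (AE x in lebesgue. \<bar>Hw k l x\<bar> \<le> B) \<and>
    (\<forall>x. x \<notin> supp u \<longrightarrow> Hw k l x = 0)"
proof -
  have su: "smooth u" by (rule test_smooth[OF u])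
  have u0: "iter_partial is u x = 0" if "x \<notin> supp u" for "is" x
    by (rule iter_partial_zero_off[of "supp u"]) (use that in \<open>auto simp: supp_def intro!: supp_zero[unfolded supp_def]\<close>)
  define \<phi> where "\<phi> a = iter_partial [fst a, snd a] u" for a :: "'n \<times> 'n"
  define f where "f a x = g x $ fst a $ snd a" for a :: "'n \<times> 'n" and x
  define G where "G a x = (\<chi> k. g' x (axis k 1) $ fst a $ snd a)" for a :: "'n \<times> 'n" and x
  define h where "h a k l = weak_partial [k, l] (f a)" for a :: "'n \<times> 'n" and k l
  have "{x. \<phi> a x \<noteq> 0} \<subseteq> supp u" for a unfolding \<phi>_def using u0 by blast
  then have sub: "supp (\<phi> a) \<subseteq> supp u" for a
    unfolding supp_def[of "\<phi> a"] by (rule closure_minimal) (simp add: supp_def)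
  have \<phi>: "\<phi> a \<in> test_functions UNIV" for a
  proof -
    have "compact (supp u)" using u by (simp add: test_functions_def)
    then have "compact (supp (\<phi> a))" using sub[of a] by (metis closed_closure compact_Int_closed inf.absorb2 supp_def)
    then show ?thesis using smooth_iter_partial[OF su] by (simp add: test_functions_def \<phi>_def del: iter_partial.simps)
  qed
  have fd: "(f a has_derivative (\<lambda>h. G a x \<bullet> h)) (at x)" for a x
  proof -
    have d: "((\<lambda>x. g x $ fst a $ snd a) has_derivative (\<lambda>h. g' x h $ fst a $ snd a)) (at x)"
      by (intro bounded_linear.has_derivative[OF bounded_linear_vec_nth] g_deriv)
    have "g' x h $ fst a $ snd a = G a x \<bullet> h" for h
      using linear_eq_inner[OF has_derivative_linear[OF d], of h] by (simp add: G_def)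
    with d show ?thesis unfolding f_def[abs_def] by simp
  qed
  have cG: "continuous_on UNIV (G a)" for a unfolding G_def[abs_def] by (intro continuous_on_vec_lambda continuous_intros)
  have w: "is_weak_partial [k, l] (f a) (h a k l)" "AE x in lebesgue. \<bar>h a k l x\<bar> \<le> Lam1" for a k l
    unfolding h_def f_def[abs_def] using admissible_weak(1,3)[OF adm, of k l "fst a" "snd a"] by auto
  define P where "P a k l x = h a k l x * \<phi> a x + (G a x $ k * partial_deriv l (\<phi> a) x + G a x $ l * partial_deriv k (\<phi> a) x + f a x * iter_partial [k, l] (\<phi> a) x)" for a k l x
  have P: "is_weak_partial [k, l] (\<lambda>x. f a x * \<phi> a x) (P a k l)" "\<exists>B. AE x in lebesgue. \<bar>P a k l x\<bar> \<le> B" for a k l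
    using weak_partial_product[OF w(1) w(2) fd cG \<phi>, where k = k and l = l] unfolding P_def[abs_def] by blast+
  obtain B where B: "AE x in lebesgue. \<bar>P a k l x\<bar> \<le> B a k l" for a k l using P(2) by metis
  define B' where "B' = (\<Sum>k\<in>UNIV. \<Sum>l\<in>UNIV. \<Sum>a\<in>UNIV. \<bar>B a k l\<bar>)"
  define Hw where "Hw k l x = (\<Sum>a\<in>UNIV. P a k l x)" for k l x
  have v: "inner_op g u = (\<lambda>x. \<Sum>a\<in>UNIV. f a x * \<phi> a x)"
    unfolding f_def \<phi>_def inner_op_def[abs_def] by (simp add: sum.cartesian_product UNIV_Times_UNIV[symmetric] case_prod_unfold del: UNIV_Times_UNIV)
  have "is_weak_partial [k, l] (inner_op g u) (Hw k l)" for k l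
    unfolding v Hw_def[abs_def] by (rule is_weak_partial_sum[OF P(1)])
  moreover have "AE x in lebesgue. \<bar>Hw k l x\<bar> \<le> B'" for k l
  proof -
    have "AE x in lebesgue. \<forall>a\<in>UNIV. \<bar>P a k l x\<bar> \<le> B a k l" by (rule AE_finite_allI) (use B in auto)
    then show ?thesis
    proof eventually_elim
      case (elim x)
      have "\<bar>Hw k l x\<bar> \<le> (\<Sum>a\<in>UNIV. \<bar>P a k l x\<bar>)" unfolding Hw_def by (rule sum_abs)
      also have "\<dots> \<le> (\<Sum>a\<in>UNIV. \<bar>B a k l\<bar>)" by (rule sum_mono) (meson elim UNIV_I abs_ge_self order_trans)
      also have "\<dots> \<le> (\<Sum>l\<in>UNIV. \<Sum>a\<in>UNIV. \<bar>B a k l\<bar>)"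
        by (rule member_le_sum[of l UNIV "\<lambda>l. \<Sum>a\<in>UNIV. \<bar>B a k l\<bar>"]) (auto intro: sum_nonneg)
      also have "\<dots> \<le> B'" unfolding B'_def
        by (rule member_le_sum[of k UNIV "\<lambda>k. \<Sum>l\<in>UNIV. \<Sum>a\<in>UNIV. \<bar>B a k l\<bar>"]) (auto intro!: sum_nonneg)
      finally show ?case .
    qed
  qed
  moreover have "Hw k l x = 0" if "x \<notin> supp u" for k l x
  proof -
    have "iter_partial is (\<phi> a) x = 0" for a "is" unfolding \<phi>_def iter_partial_append[symmetric] by (rule u0[OF that])
    from this[of "[]"] this[of "[k]"] this[of "[l]"] this[of "[k, l]"] show ?thesis by (simp add: Hw_def P_def)
  qed
  ultimately show ?thesis by blast
qed

end

text \<open>The outer operator contains the weak derivatives that Hilbert's choice picks. Uniqueness replaces them by the ones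
constructed above.\<close>

lemma product_op_weak:
  fixes u :: "real^'n::finite \<Rightarrow> real"
  assumes ker: "\<And>R. 0 < R \<Longrightarrow> \<exists>\<eta>::real^'n \<Rightarrow> real. kernel R \<eta>"
    and w: "\<And>k l. is_weak_partial [k, l] (inner_op g1 u) (Hw k l)"
  shows "AE x in lebesgue. product_op g1 g2 u x = (\<Sum>k\<in>UNIV. \<Sum>l\<in>UNIV. g2 x $ k $ l * Hw k l x)"
proof -
  have "AE x in lebesgue. weak_partial [k, l] (inner_op g1 u) x = Hw k l x" for k l
  proof (rule weak_partial_unique[OF ker _ w])
    show "is_weak_partial [k, l] (inner_op g1 u) (weak_partial [k, l] (inner_op g1 u))"
      unfolding weak_partial_def by (rule someI[of "is_weak_partial [k, l] (inner_op g1 u)", OF w])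
  qed
  then have "AE x in lebesgue. \<forall>k\<in>UNIV. \<forall>l\<in>UNIV. weak_partial [k, l] (inner_op g1 u) x = Hw k l x"
    by (intro AE_finite_allI) auto
  then show ?thesis by eventually_elim (simp add: product_op_def outer_op_def)
qed

lemma lebesgue_integral_on_compact:
  fixes F :: "real^'n::finite \<Rightarrow> real"
  assumes K: "compact K" and F: "continuous_on K F" and off: "\<And>x. x \<notin> K \<Longrightarrow> F x = 0"
  shows "(LINT x|lebesgue. F x) = (LINT x:K|lborel. F x)"
proof -
  have F': "F = (\<lambda>x. indicator K x *\<^sub>R F x)" 
  proof
    show "F x = indicator K x *\<^sub>R F x" for x using off[of x] by (cases "x \<in> K") auto
  qed
  have "(\<lambda>x. indicator K x *\<^sub>R F x) \<in> borel_measurable borel"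
    by (rule borel_measurable_continuous_on_indicator[OF _ F]) (use K in \<open>simp add: borel_compact\<close>)
  then have "(LINT x|lebesgue. indicator K x *\<^sub>R F x) = (LINT x|lborel. indicator K x *\<^sub>R F x)"
    by (intro integral_completion) simp
  then show ?thesis unfolding set_lebesgue_integral_def using F' by simp
qed

lemma w0_powr: "sigma0 \<Gamma> x powr s * w0 \<Gamma> \<beta> x powr (- 2 * \<tau>) = cw \<Gamma> \<beta> \<tau> s x"
  by (simp add: cw_def w0_def powr_def mult_ac)

section \<open>The estimate for the product\<close>

lemma carleman_bound_mono:
  assumes "carleman_bound g \<Gamma> \<beta> s r C \<tau>0" "r' \<le> r" "\<tau>0 \<le> \<tau>0'"
  shows "carleman_bound g \<Gamma> \<beta> s r' C \<tau>0'"
proof -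
  have sub: "Q \<subseteq> sigma_ball \<Gamma> r - {0}" if "Q \<subseteq> sigma_ball \<Gamma> r' - {0}" for Q
    using that assms(2) by (force simp: sigma_ball_def)
  have D1: "(LINT x:Q|lborel. \<tau> * (cw \<Gamma> \<beta> \<tau> (s - \<beta> - 2) x * (norm (p x))\<^sup>2) + \<tau>^3 * (cw \<Gamma> \<beta> \<tau> (s - 3 * \<beta> - 4) x * (u x)\<^sup>2))
      \<le> C * (LINT x:Q|lborel. cw \<Gamma> \<beta> \<tau> s x * (g x \<bullet> H x)\<^sup>2)"
    and D2: "C3_data u p H D \<Longrightarrow> (LINT x:Q|lborel. cw \<Gamma> \<beta> \<tau> (s + \<beta>) x * (norm (H x))\<^sup>2)
      \<le> \<tau> * (C * (LINT x:Q|lborel. cw \<Gamma> \<beta> \<tau> s x * (g x \<bullet> H x)\<^sup>2))"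
    if "\<tau>0' \<le> \<tau>" "compact Q" "Q \<subseteq> sigma_ball \<Gamma> r' - {0}" "C2_data u p H" "\<forall>x. x \<notin> Q \<longrightarrow> u x = 0 \<and> p x = 0" for \<tau> Q u p H D
    by (rule carleman_boundD[OF assms(1) order_trans[OF assms(3) that(1)] that(2) sub[OF that(3)] that(5)[rule_format]]; (rule that(4) | assumption))+
  show ?thesis unfolding carleman_bound_def by (intro allI impI conjI D1 D2; (assumption | simp add: C3_data_def))
qed

text \<open>In the proof \<open>X\<close> and \<open>Y\<close> are the weighted integrals of \<open>v\<^sup>2\<close> and \<open>|\<nabla>v|\<^sup>2\<close> with the exponents \<open>2 \<beta> + 2\<close> and \<open>4 \<beta> + 4\<close>, and \<open>A0\<close>
to \<open>A3\<close> are those of the derivatives of \<open>u\<close>. The estimates \<open>E1\<close> and \<open>E2\<close> are multiplied by \<open>\<tau>\<^sup>3\<close> and \<open>\<tau>\<^sup>2\<close>, such that all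
terms are bounded by \<open>\<tau>\<^sup>3 X + \<tau> Y\<close>, which \<open>E5\<close> controls. In \<open>E3\<close>, the commutator comes with the weight of exponent \<open>4 \<beta> + 4\<close>,
which is below that of exponent \<open>3 \<beta> + 2\<close> in \<open>A2\<close> because \<open>\<sigma>\<^sub>0 < 1\<close>.\<close>

theorem product_carleman:
  fixes u :: "real^'n::finite \<Rightarrow> real" and g1 g2 :: "real^'n \<Rightarrow> real^'n^'n"
  assumes ker: "\<And>R. 0 < R \<Longrightarrow> \<exists>\<eta>::real^'n \<Rightarrow> real. kernel R \<eta>"
    and ell: "elliptic_C1 g1 g1' lam Lam" "elliptic_C1 g2 g2' lam Lam" and adm: "admissible_coeffs lam Lam Lam1 g1"
    and qw: "quad_weight \<Gamma> lam" and \<beta>: "0 < \<beta>" and r: "r \<le> 1"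
    and cb: "carleman_bound g1 \<Gamma> \<beta> (2 * \<beta> + 2) r C1 \<tau>0" "carleman_bound g1 \<Gamma> \<beta> (4 * \<beta> + 4) r C2 \<tau>0"
      "carleman_bound g2 \<Gamma> \<beta> (5 * \<beta> + 6) r C3 \<tau>0"
    and C: "0 < C1" "0 < C2" "0 < C3" and \<tau>: "1 \<le> \<tau>0" "\<tau>0 \<le> \<tau>"
    and u: "u \<in> test_functions (sigma_ball \<Gamma> r - {0})"
  shows "(\<Sum>k = 0..3. \<tau> ^ (6 - 2 * k) *
      (LINT x|lebesgue. cw \<Gamma> \<beta> \<tau> (- \<beta> - 2 + real k * (2 * \<beta> + 2)) x * (norm_nabla k u x)\<^sup>2))
    \<le> ((2 * C1 + 2 * C2 + 2 * real CARD('n) * Lam\<^sup>2 * C1 * C2) * (4 * C3)) *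
      (LINT x|lebesgue. cw \<Gamma> \<beta> \<tau> (5 * \<beta> + 6) x * \<bar>product_op g1 g2 u x\<bar>\<^sup>2)"
proof -
  interpret E: elliptic_C1 g1 g1' lam Lam by (rule ell)
  interpret W: quad_weight \<Gamma> lam by (rule qw)
  define K where "K = supp u"
  have K: "compact K" "K \<subseteq> sigma_ball \<Gamma> r - {0}" using u by (auto simp: K_def test_functions_def)
  have K0: "K \<subseteq> - {0}" using K by auto
  have su: "smooth u" by (rule test_smooth[OF u])
  have suk: "smooth (partial_deriv k u)" for k by (rule smooth_partial_deriv[OF su])
  have off: "iter_partial is u x = 0" if "x \<notin> K" for "is" x
    by (rule iter_partial_zero_off[of K]) (use that supp_zero compact_imp_closed[OF K(1)] in \<open>auto simp: K_def\<close>)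
  have noff: "norm_nabla k u x = 0" if "x \<notin> K" for k x by (simp add: norm_nabla_def off[OF that])
  have hoff: "hess u x = 0" "grad u x = 0" if "x \<notin> K" for x
    using off[OF that, of "[_, _]"] off[OF that, of "[_]"] by (simp_all add: hess_def grad_def vec_eq_iff)
  have hoffk: "hess (partial_deriv k u) x = 0" "grad (partial_deriv k u) x = 0" "partial_deriv k u x = 0" if "x \<notin> K" for x k
    using off[OF that, of "[_, _, k]"] off[OF that, of "[_, k]"] off[OF that, of "[k]"] by (simp_all add: hess_def grad_def vec_eq_iff)
  have \<tau>1: "1 \<le> \<tau>" using \<tau> by linarith
  let ?W = "cw \<Gamma> \<beta> \<tau>"
  define J where "J F = (LINT x:K|lborel. F x)" for F :: "real^'n \<Rightarrow> real"
  have si: "set_integrable lborel K F" if "continuous_on K F" for F :: "real^'n \<Rightarrow> real"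
    by (rule set_integrable_compact[OF K(1) that])
  have Jadd: "J (\<lambda>x. F x + G x) = J F + J G" if "continuous_on K F" "continuous_on K G" for F G
    unfolding J_def by (rule set_integral_add(2)[OF si si]) (use that in auto)
  have Jmul: "J (\<lambda>x. c * F x) = c * J F" for c F unfolding J_def by simp
  have Jlin: "J (\<lambda>x. a * F x + b * G x) = a * J F + b * J G" if "continuous_on K F" "continuous_on K G" for a b F G
  proof -
    have "continuous_on K (\<lambda>x. a * F x)" "continuous_on K (\<lambda>x. b * G x)"
      by (intro continuous_on_mult continuous_on_const that)+
    then show ?thesis by (simp only: Jadd Jmul)
  qed
  have Jsum: "J (\<lambda>x. \<Sum>k\<in>UNIV. F k x) = (\<Sum>k\<in>(UNIV::'n set). J (F k))" if "\<And>k. continuous_on K (F k)" for F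
  proof -
    have "(\<Sum>k\<in>UNIV. indicat_real K x *\<^sub>R F k x) = indicat_real K x *\<^sub>R (\<Sum>k\<in>UNIV. F k x)" for x
      by (simp add: sum_distrib_left)
    moreover have "integrable lborel (\<lambda>x. indicat_real K x *\<^sub>R F k x)" for k
      using si[OF that] by (simp add: set_integrable_def)
    ultimately show ?thesis
      unfolding J_def set_lebesgue_integral_def by (simp add: Bochner_Integration.integral_sum[symmetric])
  qed
  have Jmono: "J F \<le> J G" if "continuous_on K F" "continuous_on K G" "\<And>x. x \<in> K \<Longrightarrow> F x \<le> G x" for F G
    unfolding J_def by (rule set_integral_mono[OF si si]) (use that in auto)
  have cW: "continuous_on K (?W s)" for s by (rule continuous_on_subset[OF W.continuous_on_cw K0])
  have cu: "continuous_on K u" and cgu: "continuous_on K (grad u)" and chu: "continuous_on K (hess u)"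
    using smooth_C3_data[OF su] continuous_on_C2_data unfolding C3_data_def by blast+
  have chk: "continuous_on K (hess (partial_deriv k u))" for k
    using smooth_C3_data[OF suk] continuous_on_C2_data unfolding C3_data_def by blast
  define v q where "v = inner_op g1 u" and "q = E.inner_op_grad u"
  have v: "(v has_derivative (\<lambda>h. q x \<bullet> h)) (at x)" for x unfolding v_def q_def by (rule E.inner_op_has_derivative[OF su])
  have cq: "continuous_on S q" for S unfolding q_def by (rule E.continuous_on_inner_op_grad[OF su])
  have cv: "continuous_on K v" using v by (meson continuous_at_imp_continuous_on has_derivative_continuous)
  have voff: "v x = 0 \<and> q x = 0" if "x \<notin> K" for x
  proof -
    have "q x $ k = 0" for k
      unfolding q_def E.inner_op_grad_def vec_lambda_beta hoff(1)[OF that] hoffk(1)[OF that] by simp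
    then have "q x = 0" by (simp add: vec_eq_iff)
    then show ?thesis unfolding v_def inner_op_eq hoff(1)[OF that] by simp
  qed
  obtain Hw B where H: "\<forall>k l. is_weak_partial [k, l] v (Hw k l) \<and> (AE x in lebesgue. \<bar>Hw k l x\<bar> \<le> B) \<and> (\<forall>x. x \<notin> K \<longrightarrow> Hw k l x = 0)"
    using E.inner_op_weak_hessian[OF adm u] unfolding v_def K_def by (elim exE)
  then have Hw: "is_weak_partial [k, l] v (Hw k l)" "AE x in lebesgue. \<bar>Hw k l x\<bar> \<le> B" "x \<notin> K \<Longrightarrow> Hw k l x = 0" for k l x
    by blast+
  define X Y Z where "X = J (\<lambda>x. ?W (2 * \<beta> + 2) x * (v x)\<^sup>2)" and "Y = J (\<lambda>x. ?W (4 * \<beta> + 4) x * (norm (q x))\<^sup>2)"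
    and "Z = (LINT x|lebesgue. ?W (5 * \<beta> + 6) x * \<bar>product_op g1 g2 u x\<bar>\<^sup>2)"
  define A0 A1 A2 A3 where "A0 = J (\<lambda>x. ?W (- \<beta> - 2) x * (u x)\<^sup>2)" and "A1 = J (\<lambda>x. ?W \<beta> x * (norm (grad u x))\<^sup>2)"
    and "A2 = J (\<lambda>x. ?W (3 * \<beta> + 2) x * (norm (hess u x))\<^sup>2)"
    and "A3 = (\<Sum>k\<in>UNIV. J (\<lambda>x. ?W (5 * \<beta> + 4) x * (norm (hess (partial_deriv k u) x))\<^sup>2))"
  have c2: "C2_data u (grad u) (hess u)" and c3: "C3_data u (grad u) (hess u) (hess' u)"
    using smooth_C3_data[OF su] by (auto simp: C3_data_def)
  have u0: "u x = 0 \<and> grad u x = 0" if "x \<notin> K" for x using off[OF that, of "[]"] hoff[OF that] by simp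
  have X0: "0 \<le> X" and Y0: "0 \<le> Y" and A20: "0 \<le> A2" unfolding X_def Y_def A2_def J_def by (rule cw_integral_nonneg)+
  have E1: "\<tau> * A1 + \<tau>^3 * A0 \<le> C1 * X"
  proof -
    have e: "2 * \<beta> + 2 - \<beta> - 2 = \<beta>" "2 * \<beta> + 2 - 3 * \<beta> - 4 = - \<beta> - 2" by simp_all
    have "J (\<lambda>x. \<tau> * (?W \<beta> x * (norm (grad u x))\<^sup>2) + \<tau>^3 * (?W (- \<beta> - 2) x * (u x)\<^sup>2)) \<le> C1 * X"
      using carleman_boundD(1)[OF cb(1) \<tau>(2) K u0 c2] unfolding e J_def X_def v_def inner_op_eq .
    also have "J (\<lambda>x. \<tau> * (?W \<beta> x * (norm (grad u x))\<^sup>2) + \<tau>^3 * (?W (- \<beta> - 2) x * (u x)\<^sup>2)) = \<tau> * A1 + \<tau>^3 * A0"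
      unfolding A0_def A1_def by (rule Jlin) (intro continuous_intros cW cu cgu)+
    finally show ?thesis .
  qed
  have E2: "A2 \<le> \<tau> * (C1 * X)"
  proof -
    have e: "2 * \<beta> + 2 + \<beta> = 3 * \<beta> + 2" by simp
    show ?thesis using carleman_boundD(2)[OF cb(1) \<tau>(2) K u0 c3] unfolding e J_def X_def A2_def v_def inner_op_eq .
  qed
  \<comment> \<open>The inner operator applied to a first derivative differs from the derivative of \<open>v\<close> by a term with the
    derivatives of the coefficients and the Hessian of \<open>u\<close>.\<close>
  have E3: "J (\<lambda>x. ?W (5 * \<beta> + 4) x * (norm (hess (partial_deriv k u) x))\<^sup>2)
      \<le> \<tau> * (C2 * (2 * J (\<lambda>x. ?W (4 * \<beta> + 4) x * (q x $ k)\<^sup>2) + 2 * Lam\<^sup>2 * A2))" for k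
  proof -
    have e: "4 * \<beta> + 4 + \<beta> = 5 * \<beta> + 4" by simp
    have c3k: "C3_data (partial_deriv k u) (grad (partial_deriv k u)) (hess (partial_deriv k u)) (hess' (partial_deriv k u))"
      by (rule smooth_C3_data[OF suk])
    have uk0: "partial_deriv k u x = 0 \<and> grad (partial_deriv k u) x = 0" if "x \<notin> K" for x using hoffk[OF that] by simp
    have cL: "continuous_on K (\<lambda>x. ?W (4 * \<beta> + 4) x * (g1 x \<bullet> hess (partial_deriv k u) x)\<^sup>2)"
      by (intro continuous_intros cW E.continuous_on_g chk)
    have cR: "continuous_on K (\<lambda>x. ?W (4 * \<beta> + 4) x * (q x $ k)\<^sup>2)" "continuous_on K (\<lambda>x. ?W (3 * \<beta> + 2) x * (norm (hess u x))\<^sup>2)"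
      by (intro continuous_intros cW cq chu)+
    have "J (\<lambda>x. ?W (4 * \<beta> + 4) x * (g1 x \<bullet> hess (partial_deriv k u) x)\<^sup>2)
      \<le> J (\<lambda>x. 2 * (?W (4 * \<beta> + 4) x * (q x $ k)\<^sup>2) + (2 * Lam\<^sup>2) * (?W (3 * \<beta> + 2) x * (norm (hess u x))\<^sup>2))"
    proof (rule Jmono[OF cL])
      show "continuous_on K (\<lambda>x. 2 * (?W (4 * \<beta> + 4) x * (q x $ k)\<^sup>2) + (2 * Lam\<^sup>2) * (?W (3 * \<beta> + 2) x * (norm (hess u x))\<^sup>2))"
        by (intro continuous_on_add continuous_on_mult continuous_on_const cR)
      fix x assume x: "x \<in> K"
      then have x0: "x \<noteq> 0" and sx: "sigma0 \<Gamma> x < 1" using K(2) r by (auto simp: sigma_ball_def)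
      have "?W (4 * \<beta> + 4) x \<le> ?W (3 * \<beta> + 2) x"
        unfolding cw_def using \<beta> sx W.\<sigma>_pos[OF x0] by (intro mult_right_mono powr_mono') auto
      then have w: "?W (4 * \<beta> + 4) x * (norm (hess u x))\<^sup>2 \<le> ?W (3 * \<beta> + 2) x * (norm (hess u x))\<^sup>2" by (rule mult_right_mono) simp
      define t where "t = g1' x (axis k 1) \<bullet> hess u x"
      have "\<bar>t\<bar> \<le> norm (g1' x (axis k 1)) * norm (hess u x)" unfolding t_def by (rule Cauchy_Schwarz_ineq2)
      also have "\<dots> \<le> Lam * norm (hess u x)" using E.g'_bound[of x "axis k 1"] by (intro mult_right_mono) auto
      finally have "t\<^sup>2 \<le> (Lam * norm (hess u x))\<^sup>2" by (metis abs_ge_zero power2_abs power_mono)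
      moreover have "g1 x \<bullet> hess (partial_deriv k u) x = q x $ k - t" by (simp add: q_def E.inner_op_grad_def t_def)
      moreover have "(q x $ k - t)\<^sup>2 \<le> 2 * (q x $ k)\<^sup>2 + 2 * t\<^sup>2"
        using zero_le_power2[of "q x $ k + t"] by (simp add: power2_sum power2_diff)
      ultimately have "(g1 x \<bullet> hess (partial_deriv k u) x)\<^sup>2 \<le> 2 * (q x $ k)\<^sup>2 + (2 * Lam\<^sup>2) * (norm (hess u x))\<^sup>2"
        by (simp add: power_mult_distrib)
      from mult_left_mono[OF this cw_nonneg[of \<Gamma> \<beta> \<tau> "4 * \<beta> + 4" x]] mult_left_mono[OF w, of "2 * Lam\<^sup>2"]
      show "?W (4 * \<beta> + 4) x * (g1 x \<bullet> hess (partial_deriv k u) x)\<^sup>2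
        \<le> 2 * (?W (4 * \<beta> + 4) x * (q x $ k)\<^sup>2) + (2 * Lam\<^sup>2) * (?W (3 * \<beta> + 2) x * (norm (hess u x))\<^sup>2)"
        by (simp add: algebra_simps)
    qed
    also have "\<dots> = 2 * J (\<lambda>x. ?W (4 * \<beta> + 4) x * (q x $ k)\<^sup>2) + 2 * Lam\<^sup>2 * A2"
      unfolding A2_def by (rule Jlin[OF cR])
    finally have m: "J (\<lambda>x. ?W (4 * \<beta> + 4) x * (g1 x \<bullet> hess (partial_deriv k u) x)\<^sup>2)
      \<le> 2 * J (\<lambda>x. ?W (4 * \<beta> + 4) x * (q x $ k)\<^sup>2) + 2 * Lam\<^sup>2 * A2" .
    have "J (\<lambda>x. ?W (5 * \<beta> + 4) x * (norm (hess (partial_deriv k u) x))\<^sup>2)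
        \<le> \<tau> * (C2 * J (\<lambda>x. ?W (4 * \<beta> + 4) x * (g1 x \<bullet> hess (partial_deriv k u) x)\<^sup>2))"
      using carleman_boundD(2)[OF cb(2) \<tau>(2) K uk0 c3k] unfolding e J_def .
    also have "\<dots> \<le> \<tau> * (C2 * (2 * J (\<lambda>x. ?W (4 * \<beta> + 4) x * (q x $ k)\<^sup>2) + 2 * Lam\<^sup>2 * A2))"
      using m C \<tau>1 by (intro mult_left_mono) auto
    finally show ?thesis .
  qed
  have E4: "A3 \<le> 2 * C2 * (\<tau> * Y) + 2 * real CARD('n) * Lam\<^sup>2 * C2 * (\<tau> * A2)"
  proof -
    have "A3 \<le> (\<Sum>k\<in>(UNIV::'n set). \<tau> * (C2 * (2 * J (\<lambda>x. ?W (4 * \<beta> + 4) x * (q x $ k)\<^sup>2) + 2 * Lam\<^sup>2 * A2)))"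
      unfolding A3_def by (intro sum_mono E3)
    also have "\<dots> = \<tau> * C2 * (2 * (\<Sum>k\<in>(UNIV::'n set). J (\<lambda>x. ?W (4 * \<beta> + 4) x * (q x $ k)\<^sup>2)) + real CARD('n) * (2 * Lam\<^sup>2 * A2))"
      by (simp add: sum_distrib_left[symmetric] sum.distrib mult.assoc)
    also have "(\<Sum>k\<in>(UNIV::'n set). J (\<lambda>x. ?W (4 * \<beta> + 4) x * (q x $ k)\<^sup>2)) = Y"
    proof -
      have "(\<Sum>k\<in>(UNIV::'n set). J (\<lambda>x. ?W (4 * \<beta> + 4) x * (q x $ k)\<^sup>2)) = J (\<lambda>x. \<Sum>k\<in>UNIV. ?W (4 * \<beta> + 4) x * (q x $ k)\<^sup>2)"
        by (rule Jsum[symmetric]) (intro continuous_intros cW cq)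
      then show ?thesis unfolding Y_def norm_vec_square by (simp add: sum_distrib_left)
    qed
    finally show ?thesis by (simp add: algebra_simps)
  qed
  have E5: "\<tau> * Y + \<tau>^3 * X \<le> 4 * C3 * Z"
  proof -
    have e: "5 * \<beta> + 6 - \<beta> - 2 = 4 * \<beta> + 4" "5 * \<beta> + 6 - 3 * \<beta> - 4 = 2 * \<beta> + 2" by simp_all
    have "\<tau> * Y + \<tau>^3 * X = J (\<lambda>x. \<tau> * (?W (4 * \<beta> + 4) x * (norm (q x))\<^sup>2) + \<tau>^3 * (?W (2 * \<beta> + 2) x * (v x)\<^sup>2))"
      unfolding X_def Y_def by (rule Jlin[symmetric]) (intro continuous_intros cW cq cv)+
    also have "\<dots> \<le> 4 * C3 * (LINT x|lebesgue. ?W (5 * \<beta> + 6) x * (\<Sum>k\<in>UNIV. \<Sum>l\<in>UNIV. g2 x $ k $ l * Hw k l x)\<^sup>2)"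
      using weak_carleman[OF ker ell(2) qw cb(3) less_imp_le[OF C(3)] v cq voff K Hw \<tau>(2)] unfolding e J_def .
    also have "(LINT x|lebesgue. ?W (5 * \<beta> + 6) x * (\<Sum>k\<in>UNIV. \<Sum>l\<in>UNIV. g2 x $ k $ l * Hw k l x)\<^sup>2) = Z"
    proof -
      have Hm: "Hw k l \<in> borel_measurable lebesgue" for k l
        using Hw(1)[of k l] locally_integrable_measurable by (auto simp: is_weak_partial_def)
      have gm: "(\<lambda>x. g2 x $ k $ l) \<in> borel_measurable lebesgue" for k l
      proof -
        have "continuous_on UNIV (\<lambda>x. g2 x $ k $ l)" by (intro continuous_intros elliptic_C1.continuous_on_g[OF ell(2)])
        then show ?thesis by (intro measurable_completion) (simp add: borel_measurable_continuous_onI)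
      qed
      have Wm: "(\<lambda>x. ?W (5 * \<beta> + 6) x) \<in> borel_measurable lebesgue"
      proof -
        have "continuous_on UNIV (sigma0 \<Gamma>)" by (rule continuous_on_sigma0)
        then have "sigma0 \<Gamma> \<in> borel_measurable borel" by (rule borel_measurable_continuous_onI)
        then show ?thesis unfolding cw_def by (intro measurable_completion) simp
      qed
      define S where "S x = (\<Sum>k\<in>UNIV. \<Sum>l\<in>UNIV. g2 x $ k $ l * Hw k l x)" for x
      have Sm: "S \<in> borel_measurable lebesgue" unfolding S_def[abs_def] by (intro borel_measurable_sum borel_measurable_times gm Hm)
      have ae: "AE x in lebesgue. product_op g1 g2 u x = S x"
        unfolding S_def by (rule product_op_weak[OF ker Hw(1)[unfolded v_def]])
      have ae': "AE x in lebesgue. S x = product_op g1 g2 u x" using ae by eventually_elim simp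
      have Pm: "product_op g1 g2 u \<in> borel_measurable lebesgue" by (rule borel_measurable_AE[OF Sm ae'])
      show ?thesis unfolding Z_def S_def[symmetric] power2_abs
      proof (rule integral_cong_AE)
        show "(\<lambda>x. ?W (5 * \<beta> + 6) x * (S x)\<^sup>2) \<in> borel_measurable lebesgue"
          by (rule borel_measurable_times[OF Wm borel_measurable_power[OF Sm]])
        show "(\<lambda>x. ?W (5 * \<beta> + 6) x * (product_op g1 g2 u x)\<^sup>2) \<in> borel_measurable lebesgue"
          by (rule borel_measurable_times[OF Wm borel_measurable_power[OF Pm]])
        show "AE x in lebesgue. ?W (5 * \<beta> + 6) x * (S x)\<^sup>2 = ?W (5 * \<beta> + 6) x * (product_op g1 g2 u x)\<^sup>2"
          using ae by eventually_elim simp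
      qed
    qed
    finally show ?thesis .
  qed
  have L: "(LINT x|lebesgue. ?W s x * (norm_nabla k u x)\<^sup>2) = J (\<lambda>x. ?W s x * (norm_nabla k u x)\<^sup>2)"
    if "continuous_on K (\<lambda>x. (norm_nabla k u x)\<^sup>2)" for s k
    unfolding J_def by (rule lebesgue_integral_on_compact[OF K(1)]) (use noff in \<open>auto intro!: continuous_on_mult cW that\<close>)
  have L0: "(LINT x|lebesgue. ?W (- \<beta> - 2) x * (norm_nabla 0 u x)\<^sup>2) = A0"
    by (subst L) (simp_all add: norm_nabla_0 A0_def, intro continuous_intros cu)
  have L1: "(LINT x|lebesgue. ?W \<beta> x * (norm_nabla (Suc 0) u x)\<^sup>2) = A1"
    by (subst L) (simp_all add: norm_nabla_1 A1_def, intro continuous_intros cgu)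
  have L2: "(LINT x|lebesgue. ?W (3 * \<beta> + 2) x * (norm_nabla (Suc (Suc 0)) u x)\<^sup>2) = A2"
    by (subst L) (simp_all add: norm_nabla_2 A2_def, intro continuous_intros chu)
  have L3: "(LINT x|lebesgue. ?W (5 * \<beta> + 4) x * (norm_nabla (Suc (Suc (Suc 0))) u x)\<^sup>2) = A3"
  proof (subst L)
    show "continuous_on K (\<lambda>x. (norm_nabla (Suc (Suc (Suc 0))) u x)\<^sup>2)" unfolding norm_nabla_3 by (intro continuous_intros chk)
    show "J (\<lambda>x. ?W (5 * \<beta> + 4) x * (norm_nabla (Suc (Suc (Suc 0))) u x)\<^sup>2) = A3"
      unfolding norm_nabla_3 sum_distrib_left A3_def by (rule Jsum) (intro continuous_intros cW chk)
  qed
  have ex: "- \<beta> - 2 + real 0 * (2 * \<beta> + 2) = - \<beta> - 2" "- \<beta> - 2 + real (Suc 0) * (2 * \<beta> + 2) = \<beta>"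
    "- \<beta> - 2 + real (Suc (Suc 0)) * (2 * \<beta> + 2) = 3 * \<beta> + 2" "- \<beta> - 2 + real (Suc (Suc (Suc 0))) * (2 * \<beta> + 2) = 5 * \<beta> + 4"
    by (simp_all add: algebra_simps)
  have s3: "{0..3} = {0, Suc 0, Suc (Suc 0), Suc (Suc (Suc 0))}" by auto
  have "(\<Sum>k = 0..3. \<tau> ^ (6 - 2 * k) * (LINT x|lebesgue. ?W (- \<beta> - 2 + real k * (2 * \<beta> + 2)) x * (norm_nabla k u x)\<^sup>2))
    = \<tau>^6 * A0 + \<tau>^4 * A1 + \<tau>^2 * A2 + A3"
    unfolding s3 by (simp add: ex L0 L1 L2 L3 del: of_nat_Suc)
  also have "\<tau>^6 * A0 + \<tau>^4 * A1 = \<tau>^3 * (\<tau> * A1 + \<tau>^3 * A0)" by (simp add: eval_nat_numeral algebra_simps)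
  also have "\<tau>^3 * (\<tau> * A1 + \<tau>^3 * A0) + \<tau>^2 * A2 + A3 \<le> (2 * C1 + 2 * C2 + 2 * real CARD('n) * Lam\<^sup>2 * C1 * C2) * (\<tau> * Y + \<tau>^3 * X)"
  proof -
    have 1: "\<tau>^3 * (\<tau> * A1 + \<tau>^3 * A0) \<le> C1 * (\<tau>^3 * X)"
      using mult_left_mono[OF E1, of "\<tau>^3"] \<tau>1 by (simp add: mult_ac)
    have 2: "\<tau>^2 * A2 \<le> C1 * (\<tau>^3 * X)"
      using mult_left_mono[OF E2, of "\<tau>^2"] by (simp add: power2_eq_square power3_eq_cube mult_ac)
    have "\<tau> * A2 \<le> \<tau>^2 * A2" using \<tau>1 A20 by (intro mult_right_mono) (auto simp: power2_eq_square)
    then have 3: "\<tau> * A2 \<le> C1 * (\<tau>^3 * X)" using 2 by linarith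
    define N where "N = 2 * real CARD('n) * Lam\<^sup>2"
    have N: "0 \<le> N" by (simp add: N_def)
    have 4: "A3 \<le> 2 * C2 * (\<tau> * Y) + N * C2 * (C1 * (\<tau>^3 * X))"
      using E4 mult_left_mono[OF 3, of "N * C2"] N C unfolding N_def[symmetric] by simp
    define X' Y' where "X' = \<tau>^3 * X" and "Y' = \<tau> * Y"
    have p: "0 \<le> X'" "0 \<le> Y'" using X0 Y0 \<tau>1 by (auto simp: X'_def Y'_def)
    have "0 \<le> C1 * Y'" "0 \<le> C2 * X'" "0 \<le> N * C1 * C2 * Y'" using C N p by auto
    then show ?thesis using 1 2 4 unfolding N_def[symmetric] X'_def[symmetric] Y'_def[symmetric] by (simp add: algebra_simps)
  qed
  also have "\<dots> \<le> (2 * C1 + 2 * C2 + 2 * real CARD('n) * Lam\<^sup>2 * C1 * C2) * (4 * C3 * Z)"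
    using E5 C by (intro mult_left_mono) auto
  finally show ?thesis by (simp add: Z_def mult.assoc)
qed

definition product_bound ::
  "(real^'n::finite \<Rightarrow> real^'n^'n) \<Rightarrow> (real^'n \<Rightarrow> real^'n^'n) \<Rightarrow> real^'n^'n \<Rightarrow> real \<Rightarrow> real \<Rightarrow> real \<Rightarrow> real \<Rightarrow> bool" where
  "product_bound g1 g2 \<Gamma> \<beta> r C \<tau>0 \<longleftrightarrow> (\<forall>u \<in> test_functions (sigma_ball \<Gamma> r - {0}). \<forall>\<tau> \<ge> \<tau>0.
      (\<Sum>k = 0..3. \<tau> ^ (6 - 2 * k) *
        (LINT x|lebesgue. cw \<Gamma> \<beta> \<tau> (- \<beta> - 2 + real k * (2 * \<beta> + 2)) x * (norm_nabla k u x)\<^sup>2))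
      \<le> C * (LINT x|lebesgue. cw \<Gamma> \<beta> \<tau> (5 * \<beta> + 6) x * \<bar>product_op g1 g2 u x\<bar>\<^sup>2))"

text \<open>The mollifiers in the proof are made from a test function that does not vanish identically. If there
  were none, the estimate would be void.\<close>

lemma product_bound_no_kernel:
  fixes g1 g2 :: "real^'n::finite \<Rightarrow> real^'n^'n"
  assumes no: "\<not> (\<exists>\<eta>::real^'n \<Rightarrow> real. kernel R \<eta>)" and R: "0 < R" and C: "0 < C"
  shows "product_bound g1 g2 \<Gamma> \<beta> r C \<tau>0"
  unfolding product_bound_def
proof (intro allI impI ballI)
  fix \<tau> u assume u: "u \<in> test_functions (sigma_ball \<Gamma> r - {0})"
  have "u x = 0" for x
  proof (rule ccontr)
    assume "u x \<noteq> 0"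
    with kernel_exists[of u x R] u R no show False by (auto simp: test_functions_def)
  qed
  then have "iter_partial is u x = 0" for "is" x by (intro iter_partial_zero_off[of "{}"]) auto
  then have n0: "norm_nabla k u x = 0" for k x by (simp add: norm_nabla_def)
  have "0 \<le> (LINT x|lebesgue. cw \<Gamma> \<beta> \<tau> (5 * \<beta> + 6) x * \<bar>product_op g1 g2 u x\<bar>\<^sup>2)"
    by (rule integral_nonneg_AE) (simp add: cw_nonneg)
  then have "0 \<le> C * (LINT x|lebesgue. cw \<Gamma> \<beta> \<tau> (5 * \<beta> + 6) x * \<bar>product_op g1 g2 u x\<bar>\<^sup>2)" using C by simp
  then show "(\<Sum>k = 0..3. \<tau> ^ (6 - 2 * k) *
      (LINT x|lebesgue. cw \<Gamma> \<beta> \<tau> (- \<beta> - 2 + real k * (2 * \<beta> + 2)) x * (norm_nabla k u x)\<^sup>2))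
    \<le> C * (LINT x|lebesgue. cw \<Gamma> \<beta> \<tau> (5 * \<beta> + 6) x * \<bar>product_op g1 g2 u x\<bar>\<^sup>2)" by (simp add: n0)
qed

text \<open>As \<open>lam\<^sup>2 \<le> m\<close> and \<open>M = \<kappa> m\<close>, the quantity \<open>(\<beta> + 1) m - M\<close> is at least \<open>lam\<^sup>2 \<delta>\<close>. Hence one value of \<open>\<epsilon>\<close>, and with it one
triple of constants, serves all coefficients.\<close>

theorem uniform_product_carleman:
  fixes lam Lam \<beta> \<delta> :: real
  assumes lam: "0 < lam" "lam \<le> 1" and Lam: "0 < Lam" and \<beta>: "0 < \<beta>" and \<delta>: "0 < \<delta>"
  shows "\<exists>r C \<tau>0. 0 < r \<and> r < 1 \<and> 0 < C \<and> 0 < \<tau>0 \<and>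
    (\<forall>(g1 :: real^'n::finite \<Rightarrow> real^'n^'n) g2 \<Gamma> \<kappa> Lam1.
      admissible_coeffs lam Lam Lam1 g1 \<longrightarrow> admissible_coeffs lam Lam Lam1 g2 \<longrightarrow> weight_matrix lam \<kappa> (g1 0) (g2 0) \<Gamma> \<longrightarrow>
      \<delta> \<le> \<beta> + 1 - \<kappa> \<longrightarrow> product_bound g1 g2 \<Gamma> \<beta> r C \<tau>0)"
proof -
  define \<epsilon> where "\<epsilon> = lam\<^sup>2 * \<delta> / 4"
  have \<epsilon>: "0 < \<epsilon>" using lam \<delta> by (simp add: \<epsilon>_def)
  define one where "one s r C \<tau>0 \<longleftrightarrow>
    (\<forall>(g :: real^'n \<Rightarrow> real^'n^'n) g' \<Gamma> G m M.
      elliptic_C1 g g' lam Lam \<longrightarrow> quad_weight \<Gamma> lam \<longrightarrow> transpose G = G \<longrightarrow> G ** \<Gamma> = mat 1 \<longrightarrow> \<Gamma> ** G = mat 1 \<longrightarrow>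
      (\<forall>\<xi>. m * ((G *v \<xi>) \<bullet> \<xi>) \<le> (g 0 *v \<xi>) \<bullet> \<xi> \<and> (g 0 *v \<xi>) \<bullet> \<xi> \<le> M * ((G *v \<xi>) \<bullet> \<xi>)) \<longrightarrow>
      lam\<^sup>2 \<le> m \<longrightarrow> m \<le> M \<longrightarrow> M \<le> (inverse lam)\<^sup>2 \<longrightarrow> 4 * \<epsilon> \<le> (\<beta> + 1) * m - M \<longrightarrow>
      carleman_bound g \<Gamma> \<beta> s r C \<tau>0)" for s r C \<tau>0
  have ex: "\<exists>r C \<tau>0. 0 < r \<and> r < 1 \<and> 0 < C \<and> 1 \<le> \<tau>0 \<and> one s r C \<tau>0" for s
    unfolding one_def by (rule second_order_carleman[OF lam less_imp_le[OF Lam] \<beta> \<epsilon>])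
  obtain ra Ca ta where a: "0 < ra" "ra < 1" "0 < Ca" "1 \<le> ta" "one (2 * \<beta> + 2) ra Ca ta" using ex by blast
  obtain rb Cb tb where b: "0 < rb" "rb < 1" "0 < Cb" "1 \<le> tb" "one (4 * \<beta> + 4) rb Cb tb" using ex by blast
  obtain rc Cc tc where c: "0 < rc" "rc < 1" "0 < Cc" "1 \<le> tc" "one (5 * \<beta> + 6) rc Cc tc" using ex by blast
  note C = a(3) b(3) c(3)
  define r \<tau>0 where "r = min ra (min rb rc)" and "\<tau>0 = max ta (max tb tc)"
  have r: "0 < r" "r < 1" "r \<le> ra" "r \<le> rb" "r \<le> rc" using a(1,2) b(1) c(1) by (auto simp: r_def)
  have \<tau>0: "1 \<le> \<tau>0" "ta \<le> \<tau>0" "tb \<le> \<tau>0" "tc \<le> \<tau>0" using a(4) by (auto simp: \<tau>0_def)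
  define C' where "C' = (2 * Ca + 2 * Cb + 2 * real CARD('n) * Lam\<^sup>2 * Ca * Cb) * (4 * Cc)"
  have C': "0 < C'" unfolding C'_def by (intro mult_pos_pos add_pos_nonneg) (use C in auto)
  have main: "product_bound g1 g2 \<Gamma> \<beta> r C' \<tau>0"
    if adm: "admissible_coeffs lam Lam Lam1 g1" "admissible_coeffs lam Lam Lam1 g2" and wm: "weight_matrix lam \<kappa> (g1 0) (g2 0) \<Gamma>"
      and d: "\<delta> \<le> \<beta> + 1 - \<kappa>" and ker: "\<And>R. 0 < R \<Longrightarrow> \<exists>\<eta>::real^'n \<Rightarrow> real. kernel R \<eta>"
    for g1 g2 :: "real^'n \<Rightarrow> real^'n^'n" and \<Gamma> \<kappa> Lam1
  proof -
    obtain g1' where e1: "elliptic_C1 g1 g1' lam Lam" using admissible_C1[OF ker adm(1) lam Lam] by blast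
    obtain g2' where e2: "elliptic_C1 g2 g2' lam Lam" using admissible_C1[OF ker adm(2) lam Lam] by blast
    have qw: "quad_weight \<Gamma> lam" and \<kappa>: "1 \<le> \<kappa>" using wm by (simp_all add: weight_matrix_def)
    obtain G m1 m2 where G: "transpose G = G" "G ** \<Gamma> = mat 1" "\<Gamma> ** G = mat 1"
      and m: "lam\<^sup>2 \<le> m1" "lam\<^sup>2 \<le> m2" and M: "\<kappa> * m1 \<le> (inverse lam)\<^sup>2" "\<kappa> * m2 \<le> (inverse lam)\<^sup>2"
      and p1: "\<forall>x. m1 * ((G *v x) \<bullet> x) \<le> (g1 0 *v x) \<bullet> x \<and> (g1 0 *v x) \<bullet> x \<le> (\<kappa> * m1) * ((G *v x) \<bullet> x)"
      and p2: "\<forall>x. m2 * ((G *v x) \<bullet> x) \<le> (g2 0 *v x) \<bullet> x \<and> (g2 0 *v x) \<bullet> x \<le> (\<kappa> * m2) * ((G *v x) \<bullet> x)"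
      using wm unfolding weight_matrix_def by (elim conjE exE)
    have gap: "4 * \<epsilon> \<le> (\<beta> + 1) * m - \<kappa> * m" if "lam\<^sup>2 \<le> m" for m
    proof -
      have "0 \<le> m" using that zero_le_power2[of lam] by linarith
      then have "lam\<^sup>2 * \<delta> \<le> m * (\<beta> + 1 - \<kappa>)" by (intro mult_mono that d) (use \<delta> in auto)
      then show ?thesis by (simp add: \<epsilon>_def algebra_simps)
    qed
    have le: "m \<le> \<kappa> * m" if "lam\<^sup>2 \<le> m" for m
      using mult_right_mono[OF \<kappa>, of m] order_trans[OF zero_le_power2 that] by simp
    have D: "carleman_bound g \<Gamma> \<beta> s r' C \<tau>'"
      if o: "one s r' C \<tau>'" and e: "elliptic_C1 g g' lam Lam" and m: "lam\<^sup>2 \<le> m" and M: "\<kappa> * m \<le> (inverse lam)\<^sup>2"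
        and p: "\<forall>\<xi>. m * ((G *v \<xi>) \<bullet> \<xi>) \<le> (g 0 *v \<xi>) \<bullet> \<xi> \<and> (g 0 *v \<xi>) \<bullet> \<xi> \<le> (\<kappa> * m) * ((G *v \<xi>) \<bullet> \<xi>)" for g g' s r' C \<tau>' m
      by (rule o[unfolded one_def, rule_format, OF e qw G p[rule_format] m le[OF m] M gap[OF m]])
    have c1: "carleman_bound g1 \<Gamma> \<beta> (2 * \<beta> + 2) r Ca \<tau>0"
      by (rule carleman_bound_mono[OF D[OF a(5) e1 m(1) M(1) p1] r(3) \<tau>0(2)])
    have c2: "carleman_bound g1 \<Gamma> \<beta> (4 * \<beta> + 4) r Cb \<tau>0"
      by (rule carleman_bound_mono[OF D[OF b(5) e1 m(1) M(1) p1] r(4) \<tau>0(3)])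
    have c3: "carleman_bound g2 \<Gamma> \<beta> (5 * \<beta> + 6) r Cc \<tau>0"
      by (rule carleman_bound_mono[OF D[OF c(5) e2 m(2) M(2) p2] r(5) \<tau>0(4)])
    show ?thesis
      unfolding product_bound_def C'_def
      by (intro allI impI ballI) (rule product_carleman[OF ker e1 e2 adm(1) qw \<beta> less_imp_le[OF r(2)] c1 c2 c3 C \<tau>0(1)])
  qed
  have "product_bound g1 g2 \<Gamma> \<beta> r C' \<tau>0"
    if "admissible_coeffs lam Lam Lam1 g1" "admissible_coeffs lam Lam Lam1 g2" "weight_matrix lam \<kappa> (g1 0) (g2 0) \<Gamma>" "\<delta> \<le> \<beta> + 1 - \<kappa>"
    for g1 g2 :: "real^'n \<Rightarrow> real^'n^'n" and \<Gamma> \<kappa> Lam1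
  proof (cases "\<forall>R>0. \<exists>\<eta>::real^'n \<Rightarrow> real. kernel R \<eta>")
    case True
    then show ?thesis using main[OF that] by blast
  next
    case False
    then show ?thesis using product_bound_no_kernel[OF _ _ C'] by blast
  qed
  moreover have "0 < \<tau>0" using \<tau>0(1) by linarith
  ultimately show ?thesis using r(1,2) C' by (intro exI[of _ r] exI[of _ C'] exI[of _ \<tau>0] conjI allI impI) blast+
qed

theorem theorem5p2:
  fixes lam Lam Lam1 :: real
  assumes "2 \<le> CARD('n::finite)"
    and "0 < lam" "lam \<le> 1" "0 < Lam" "0 < Lam1"
  shows "\<exists>(r1 :: real \<Rightarrow> real \<Rightarrow> real) (C :: real \<Rightarrow> real \<Rightarrow> real) (taubar :: real \<Rightarrow> real \<Rightarrow> real).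
    (\<forall>\<beta> \<delta>. 0 < r1 \<beta> \<delta> \<and> r1 \<beta> \<delta> < 1 \<and> 0 < C \<beta> \<delta> \<and> 0 < taubar \<beta> \<delta>) \<and>
    (\<forall>g1 g2 :: real^'n \<Rightarrow> real^'n^'n.
      admissible_coeffs lam Lam Lam1 g1 \<and> admissible_coeffs lam Lam Lam1 g2 \<longrightarrow>
      (\<exists>\<Gamma> :: real^'n^'n.
        transpose \<Gamma> = \<Gamma> \<and>
        (\<forall>x. lam\<^sup>2 * (norm x)\<^sup>2 \<le> (\<Gamma> *v x) \<bullet> x \<and>
             (\<Gamma> *v x) \<bullet> x \<le> inverse (lam\<^sup>2) * (norm x)\<^sup>2) \<and>
        (\<forall>\<beta> \<delta>. \<beta> > beta_threshold (g1 0) (g2 0) \<and>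
                0 < \<delta> \<and> \<delta> \<le> \<beta> - beta_threshold (g1 0) (g2 0) \<longrightarrow>
          (\<forall>u \<in> test_functions (sigma_ball \<Gamma> (r1 \<beta> \<delta>) - {0}). \<forall>\<tau> \<ge> taubar \<beta> \<delta>.
            (\<Sum>k = 0..3. \<tau> ^ (6 - 2 * k) *
               (LINT x|lebesgue. sigma0 \<Gamma> x powr (- \<beta> - 2 + real k * (2 * \<beta> + 2)) *
                  w0 \<Gamma> \<beta> x powr (- 2 * \<tau>) * (norm_nabla k u x)\<^sup>2))
            \<le> C \<beta> \<delta> *
               (LINT x|lebesgue. sigma0 \<Gamma> x powr (5 * \<beta> + 6) *
                  w0 \<Gamma> \<beta> x powr (- 2 * \<tau>) * \<bar>product_op g1 g2 u x\<bar>\<^sup>2)))))"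
proof -
  define est where "est \<beta> \<delta> r C t \<longleftrightarrow> (\<forall>(g1 :: real^'n \<Rightarrow> real^'n^'n) g2 \<Gamma> \<kappa>.
      admissible_coeffs lam Lam Lam1 g1 \<longrightarrow> admissible_coeffs lam Lam Lam1 g2 \<longrightarrow> weight_matrix lam \<kappa> (g1 0) (g2 0) \<Gamma> \<longrightarrow>
      \<delta> \<le> \<beta> + 1 - \<kappa> \<longrightarrow> product_bound g1 g2 \<Gamma> \<beta> r C t)" for \<beta> \<delta> r C t
  have "\<exists>r C t. 0 < r \<and> r < 1 \<and> 0 < C \<and> 0 < t \<and> (0 < \<beta> \<and> 0 < \<delta> \<longrightarrow> est \<beta> \<delta> r C t)" for \<beta> \<delta> :: real
  proof (cases "0 < \<beta> \<and> 0 < \<delta>")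
    case True
    then show ?thesis
      using uniform_product_carleman[OF assms(2-4), of \<beta> \<delta>, where 'n = 'n] unfolding est_def by blast
  next
    case False
    \<comment> \<open>Such \<open>\<beta>\<close> and \<open>\<delta>\<close> do not occur in the estimate, and any constants will do.\<close>
    have "0 < (1/2::real) \<and> (1/2::real) < 1 \<and> 0 < (1::real)" by simp
    with False show ?thesis by blast
  qed
  then obtain r1 C t where rCt: "0 < r1 \<beta> \<delta> \<and> r1 \<beta> \<delta> < 1 \<and> 0 < C \<beta> \<delta> \<and> 0 < t \<beta> \<delta> \<and>
      (0 < \<beta> \<and> 0 < \<delta> \<longrightarrow> est \<beta> \<delta> (r1 \<beta> \<delta>) (C \<beta> \<delta>) (t \<beta> \<delta>))" for \<beta> \<delta>
    by metis
  have main: "\<exists>\<Gamma>. transpose \<Gamma> = \<Gamma> \<and>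
        (\<forall>x. lam\<^sup>2 * (norm x)\<^sup>2 \<le> (\<Gamma> *v x) \<bullet> x \<and> (\<Gamma> *v x) \<bullet> x \<le> inverse (lam\<^sup>2) * (norm x)\<^sup>2) \<and>
        (\<forall>\<beta> \<delta>. \<beta> > beta_threshold (g1 0) (g2 0) \<and> 0 < \<delta> \<and> \<delta> \<le> \<beta> - beta_threshold (g1 0) (g2 0) \<longrightarrow>
          product_bound g1 g2 \<Gamma> \<beta> (r1 \<beta> \<delta>) (C \<beta> \<delta>) (t \<beta> \<delta>))"
    if adm: "admissible_coeffs lam Lam Lam1 g1" "admissible_coeffs lam Lam Lam1 g2" for g1 g2 :: "real^'n \<Rightarrow> real^'n^'n"
  proof -
    have "\<exists>\<Gamma>. weight_matrix lam (beta_threshold (g1 0) (g2 0) + 1) (g1 0) (g2 0) \<Gamma>"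
      by (rule weight_matrix_exists[OF assms(2,3)]) (use adm in \<open>simp_all add: admissible_coeffs_def form_eq_sum\<close>)
    then obtain \<Gamma> where wm: "weight_matrix lam (beta_threshold (g1 0) (g2 0) + 1) (g1 0) (g2 0) \<Gamma>" by blast
    then interpret W: quad_weight \<Gamma> lam by (simp add: weight_matrix_def)
    have "product_bound g1 g2 \<Gamma> \<beta> (r1 \<beta> \<delta>) (C \<beta> \<delta>) (t \<beta> \<delta>)"
      if "0 < \<delta>" "\<delta> \<le> \<beta> - beta_threshold (g1 0) (g2 0)" for \<beta> \<delta>
    proof -
      \<comment> \<open>The threshold is nonnegative, as \<open>1 \<le> \<kappa>\<close> in \<open>weight_matrix\<close>.\<close>
      have "0 < \<beta>" using wm that by (simp add: weight_matrix_def)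
      then have "est \<beta> \<delta> (r1 \<beta> \<delta>) (C \<beta> \<delta>) (t \<beta> \<delta>)" using rCt[of \<beta> \<delta>] that by blast
      from this[unfolded est_def, rule_format, OF adm wm] that show ?thesis by simp
    qed
    then show ?thesis using W.\<Gamma>_sym W.\<Gamma>_lower W.\<Gamma>_upper by blast
  qed
  show ?thesis
    unfolding w0_powr
  proof (rule exI[of _ r1], rule exI[of _ C], rule exI[of _ t], rule conjI)
    show "\<forall>\<beta> \<delta>. 0 < r1 \<beta> \<delta> \<and> r1 \<beta> \<delta> < 1 \<and> 0 < C \<beta> \<delta> \<and> 0 < t \<beta> \<delta>" using rCt by blast
  qed (intro allI impI, rule main[unfolded product_bound_def], simp_all)
qed

end
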